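(* Let $V$ be a vertex operator algebra such that its category $\mathcal{C}$ of modules has a natural vertex tensor category structure (in the sense described in the context). Assume in addition that: $V$ is simple; every $V$-module is completely reducible; for any irreducible $V$-module $W$ the weights of elements of $W$ are nonnegative real numbers, and $W_{(0)}\neq 0$ if and only if $W$ is equivalent to $V$ viewed as a $V$-module; and $\dim V_{(0)}=1$. Then the following two notions are equivalent: (1) An extension $V_e\supset V$ such that $\dim (V_e)_{(0)}=1$, that is, a vertex operator algebra $V_e$ such that $V$ is a (vertex operator) subalgebra of $V_e$ and $\dim (V_e)_{(0)}=1$. (2) A haploid $\mathcal{C}$-algebra $V_e$ with $\theta_{V_e}=1_{V_e}$.
   Context: **Vertex operator algebras and modules.** All vertex operator algebras and modules are over $\mathbb{C}$. A vertex operator algebra $V=\bigoplus_{n\in\mathbb{Z}}V_{(n)}$ has vertex operator map $Y$, vacuum $\mathbf{1}$, conformal element $\omega$, Virasoro operators $L(n)$, arbitrary central charge in $\mathbb{C}$; it is graded by $L(0)$-eigenvalues (weights), with $\dim V_{(n)}<\infty$ and $V_{(n)}=0$ for $n$ sufficiently negative. A $V$-module $W=\bigoplus_{n\in\mathbb{C}}W_{(n)}$ is graded by $L(0)$-eigenvalues in $\mathbb{C}$, with $\dim W_{(n)}<\infty$ and $W_{(n)}=0$ when the real part of $n$ is sufficiently negative. A vertex operator subalgebra has the same vacuum and the same conformal element. $V$ is simple if it is irreducible as a module for itself. $\overline{W}=\prod_n W_{(n)}$ is the formal completion, $\pi_n$ the projection to the weight-$n$ subspace, $\overline{f}$ the natural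 extension of a module map $f$ to completions, and $W'=\bigoplus_n W_{(n)}^*$ the contragredient module. **Intertwining operators and $P(z)$-tensor products.** An intertwining operator $\mathcal{Y}(\cdot,x)$ of type $\binom{W_3}{W_1\,W_2}$ is a linear map $w_1\otimes w_2\mapsto \mathcal{Y}(w_1,x)w_2=\sum_{n\in\mathbb{C}}(w_1)_n w_2\,x^{-n-1}$ with coefficients in $W_3$ satisfying lower truncation, the Jacobi identity and the $L(-1)$-derivative property. For $z\in\mathbb{C}\setminus\{0\}$, $\mathcal{Y}(w_1,z)w_2\in\overline{W_3}$ is obtained by substituting $x^n=e^{n\log z}$ with $0\le\arg z<2\pi$; such a map $w_1\otimes w_2\mapsto\mathcal{Y}(w_1,z)w_2$ is called a $P(z)$-intertwining map. More generally $\mathcal{Y}(w_1,e^{l})w_2$ means substituting $x^n=e^{nl}$. The $P(z)$-tensor product of $W_1,W_2$ is a $V$-module $W_1\boxtimes_{P(z)}W_2$ with a $P(z)$-intertwining map $(w_1,w_2)\mapsto w_1\boxtimes_{P(z)}w_2\in\overline{W_1\boxtimes_{P(z)}W_2}$ which is universal: for each $P(z)$-intertwining map $I$ of type $\binom{W_3}{W_1\,W_2}$ there is a unique module map $\eta\colon W_1\boxtimes_{P(z)}W_2\to W_3$ with $\overline{\eta}(w_1\boxtimes_{P(z)}w_2)=I(w_1\otimes w_2)$. Write $\boxtimes=\boxtimes_{P(1)}$. **Natural vertex tensor category structure.** That the module category $\mathcal{C}$ of $V$ has a natural vertex tensor category structure means that it carries the Huang–Lepowsky vertex tensor category structure, comprising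 the following. - $P(z)$-tensor products exist for all $V$-modules and all $z\in\mathbb{C}\setminus\{0\}$, and the homogeneous components of the elements $w_1\boxtimes_{P(z)}w_2$ span $W_1\boxtimes_{P(z)}W_2$. - Products $\mathcal{Y}_1(w_1,z_1)\mathcal{Y}_2(w_2,z_2)w_3=\sum_n\mathcal{Y}_1(w_1,z_1)\pi_n(\mathcal{Y}_2(w_2,z_2)w_3)$ of intertwining operators converge weakly absolutely (i.e. absolutely after pairing with elements of the contragredient module) when $|z_1|>|z_2|>0$, and iterates $\mathcal{Y}^1(\mathcal{Y}^2(w_1,z_1-z_2)w_2,z_2)w_3$ do so when $|z_2|>|z_1-z_2|>0$, the sums lying in the completions of the target modules. In particular the triple elements $w_1\boxtimes_{P(z_1)}(w_2\boxtimes_{P(z_2)}w_3)$ and $(w_1\boxtimes_{P(z_1-z_2)}w_2)\boxtimes_{P(z_2)}w_3$ are defined in the respective regions; their homogeneous components span the corresponding triple tensor product modules. The analogous statements hold for four or more elements in suitable regions. - For $|z_1|>|z_2|>|z_1-z_2|>0$ there are natural associativity isomorphisms $\mathcal{A}^{P(z_1-z_2),P(z_2)}_{P(z_1),P(z_2)}\colon W_1\boxtimes_{P(z_1)}(W_2\boxtimes_{P(z_2)}W_3)\to(W_1\boxtimes_{P(z_1-z_2)}W_2)\boxtimes_{P(z_2)}W_3$ whose extensions to the completions send $w_1\boxtimes_{P(z_1)}(w_2\boxtimes_{P(z_2)}w_3)$ to $(w_1\boxtimes_{P(z_1-z_2)}w_2)\boxtimes_{P(z_2)}w_3$. - For a path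 $\gamma$ in $\mathbb{C}\setminus\{0\}$ from $z_1$ to $z_2$ there is a parallel transport isomorphism $\mathcal{T}_\gamma\colon W_1\boxtimes_{P(z_1)}W_2\to W_1\boxtimes_{P(z_2)}W_2$ with $\overline{\mathcal{T}}_\gamma(w_1\boxtimes_{P(z_1)}w_2)=\mathcal{Y}(w_1,e^{l(z_1)})w_2$, where $\mathcal{Y}$ is the intertwining operator corresponding to $\boxtimes_{P(z_2)}$ and $l(z_1)$ is the value of the logarithm of $z_1$ determined by $\log z_2$ ($0\le\arg z_2<2\pi$) and $\gamma$. **Resulting braided tensor category structure on $\mathcal{C}$.** The tensor product is $\boxtimes=\boxtimes_{P(1)}$ and the unit object $\mathbf{1}_{\mathcal{C}}$ is $V$. The unit isomorphisms $l_W\colon V\boxtimes W\to W$, $r_W\colon W\boxtimes V\to W$ satisfy $l_W(\mathbf{1}\boxtimes w)=w$ and $\overline{r_W}(w\boxtimes\mathbf{1})=e^{L(-1)}w$. The braiding $\mathcal{R}_{W_1W_2}\colon W_1\boxtimes W_2\to W_2\boxtimes W_1$ satisfies $\overline{\mathcal{R}}_{W_1W_2}(w_1\boxtimes w_2)=e^{L(-1)}\overline{\mathcal{T}}_{\gamma_1^-}(w_2\boxtimes_{P(-1)}w_1)$, with $\gamma_1^-$ a path from $-1$ to $1$ in the closed upper half plane with $0$ deleted. The associativity isomorphism $\mathcal{A}\colon W_1\boxtimes(W_2\boxtimes W_3)\to(W_1\boxtimes W_2)\boxtimes W_3$ is $\mathcal{T}_{\gamma_3}\circ(\mathcal{T}_{\gamma_4}\boxtimes_{P(z_2)}1_{W_3})\circ\mathcal{A}^{P(z_1-z_2),P(z_2)}_{P(z_1),P(z_2)}\circ(1_{W_1}\boxtimes_{P(z_1)}\mathcal{T}_{\gamma_2})\circ\mathcal{T}_{\gamma_1}$,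 for real $z_1>z_2>z_1-z_2>0$ and paths in the real line with $0$ deleted: $\gamma_1,\gamma_2$ from $1$ to $z_1,z_2$ and $\gamma_3,\gamma_4$ from $z_2,z_1-z_2$ to $1$. The twist is $\theta_W=e^{2\pi iL(0)}$ on each module $W$. **$\mathcal{C}$-algebras.** A commutative associative algebra in a braided tensor category $\mathcal{C}$ ($\mathcal{C}$-algebra) is an object $A$ with a morphism $\mu\colon A\otimes A\to A$ and an injective morphism $\iota_A\colon\mathbf{1}_{\mathcal{C}}\hookrightarrow A$ such that $\mu\circ(\mu\otimes1_A)\circ\mathcal{A}=\mu\circ(1_A\otimes\mu)$, $\mu\circ\mathcal{R}=\mu$, and $\mu\circ(\iota_A\otimes1_A)\circ l_A^{-1}=1_A$. It is haploid if $\dim\operatorname{Hom}_{\mathcal{C}}(\mathbf{1}_{\mathcal{C}},A)=1$. For the module category above, $\otimes$ is $\boxtimes$. *)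

theory Defs
  imports "HOL-Analysis.Analysis" "HOL-Library.Function_Algebras" "HOL-Library.Groups_Big_Fun"
begin

section \<open>Complex vector spaces\<close>

class complex_vector = ab_group_add +
  fixes scaleC :: "complex \<Rightarrow> 'a \<Rightarrow> 'a"  (infixr \<open>*\<^sub>C\<close> 75)
  assumes scaleC_add_right: "c *\<^sub>C (x + y) = c *\<^sub>C x + c *\<^sub>C y"
    and scaleC_add_left: "(c + d) *\<^sub>C x = c *\<^sub>C x + d *\<^sub>C x"
    and scaleC_scaleC: "c *\<^sub>C (d *\<^sub>C x) = (c * d) *\<^sub>C x"
    and scaleC_one: "1 *\<^sub>C x = x"

global_interpretation cvs: vector_space "scaleC :: complex \<Rightarrow> 'a \<Rightarrow> 'a::complex_vector"
  by unfold_locales (simp_all add: scaleC_add_right scaleC_add_left scaleC_scaleC scaleC_one)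

instantiation complex :: complex_vector
begin
definition scaleC_complex :: "complex \<Rightarrow> complex \<Rightarrow> complex" where
  "scaleC_complex c x = c * x"
instance
  by standard (simp_all add: scaleC_complex_def algebra_simps)
end

instantiation "fun" :: (type, complex_vector) complex_vector
begin
definition scaleC_fun :: "complex \<Rightarrow> ('a \<Rightarrow> 'b) \<Rightarrow> 'a \<Rightarrow> 'b" where
  "scaleC_fun c f = (\<lambda>x. c *\<^sub>C f x)"
instance
  by standard
    (simp_all add: scaleC_fun_def fun_eq_iff scaleC_add_right scaleC_add_left scaleC_scaleC scaleC_one)
end

text \<open>
  All algebras and modules are carried by subspaces of one ambient complex vector space, the
  type \<open>'u\<close>. A module whose homogeneous subspaces \<open>W_(n)\<close>, \<open>n\<close> complex, are
  finite-dimensional has dimension at most that of the continuum. If \<open>'u\<close> has at least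
  that dimension, every module (and every vertex operator algebra) is isomorphic to one carried
  by a subspace of \<open>'u\<close>.
\<close>

definition universe :: "'u::complex_vector itself \<Rightarrow> bool" where
  "universe _ \<longleftrightarrow> (\<exists>b :: complex \<Rightarrow> 'u. inj b \<and> cvs.independent (range b))"

definition clinear_on :: "'a::complex_vector set \<Rightarrow> ('a \<Rightarrow> 'b::complex_vector) \<Rightarrow> bool" where
  "clinear_on A f \<longleftrightarrow>
     (\<forall>x\<in>A. \<forall>y\<in>A. f (x + y) = f x + f y) \<and> (\<forall>c. \<forall>x\<in>A. f (c *\<^sub>C x) = c *\<^sub>C f x)"

definition cbilinear_on ::
  "'a::complex_vector set \<Rightarrow> 'b::complex_vector set \<Rightarrow> ('a \<Rightarrow> 'b \<Rightarrow> 'c::complex_vector) \<Rightarrow> bool" where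
  "cbilinear_on A B f \<longleftrightarrow>
     (\<forall>y\<in>B. clinear_on A (\<lambda>x. f x y)) \<and> (\<forall>x\<in>A. clinear_on B (f x))"

definition finite_dimensional :: "'a::complex_vector set \<Rightarrow> bool" where
  "finite_dimensional U \<longleftrightarrow> (\<exists>B. finite B \<and> U \<subseteq> cvs.span B)"


section \<open>Vertex operator algebras and modules\<close>

text \<open>\<open>vY V u n v\<close> is \<open>u_n v\<close>, the coefficient of \<open>x^(-n-1)\<close> in \<open>Y(u,x)v\<close>;
  likewise \<open>mact W v n w\<close> is \<open>v_n w\<close>.\<close>

record 'u voa =
  vcar :: "'u set"
  vY :: "'u \<Rightarrow> int \<Rightarrow> 'u \<Rightarrow> 'u"
  vac :: 'u
  omega :: 'u

record 'u vmod =
  mcar :: "'u set"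
  mact :: "'u \<Rightarrow> int \<Rightarrow> 'u \<Rightarrow> 'u"

definition adj :: "'u voa \<Rightarrow> 'u vmod" where
  "adj V = \<lparr>mcar = vcar V, mact = vY V\<rparr>"

definition Lop :: "'u voa \<Rightarrow> 'u vmod \<Rightarrow> int \<Rightarrow> 'u \<Rightarrow> 'u" where
  "Lop V W n = mact W (omega V) (n + 1)"

definition wspace :: "'u::complex_vector voa \<Rightarrow> 'u vmod \<Rightarrow> complex \<Rightarrow> 'u set" where
  "wspace V W n = {w \<in> mcar W. Lop V W 0 w = n *\<^sub>C w}"

text \<open>
  The Jacobi identity
  \<open>x0^(-1) \<delta>((x1-x2)/x0) Y3(u,x1) Y(w1,x2) w2 - x0^(-1) \<delta>((x2-x1)/(-x0)) Y(w1,x2) Y2(u,x1) w2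
    = x2^(-1) \<delta>((x1-x0)/x2) Y(Y1(u,x0) w1, x2) w2\<close>,
  as the family of its coefficients of \<open>x0^(-l-1) x1^(-m-1) x2^(-n-1)\<close>.
  The index type \<open>'i\<close> of the modes of \<open>Y\<close> is \<open>int\<close> for vertex operators and
  \<open>complex\<close> for intertwining operators. The sums are finite by lower truncation.
\<close>

definition jacobi ::
  "'u::complex_vector voa \<Rightarrow> 'u vmod \<Rightarrow> 'u vmod \<Rightarrow> 'u vmod \<Rightarrow> ('u \<Rightarrow> 'i::ring_1 \<Rightarrow> 'u \<Rightarrow> 'u) \<Rightarrow> bool" where
  "jacobi V W1 W2 W3 Y \<longleftrightarrow>
     (\<forall>u\<in>vcar V. \<forall>w1\<in>mcar W1. \<forall>w2\<in>mcar W2. \<forall>(l::int) (m::int) (n::'i).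
        Sum_any (\<lambda>i::nat. (of_int m gchoose i) *\<^sub>C
            Y (mact W1 u (l + int i) w1) (of_int m + n - of_nat i) w2)
      = Sum_any (\<lambda>i::nat. ((-1) ^ i * (of_int l gchoose i)) *\<^sub>C
            mact W3 u (m + l - int i) (Y w1 (n + of_nat i) w2))
      - Sum_any (\<lambda>i::nat. ((-1) powi l * (-1) ^ i * (of_int l gchoose i)) *\<^sub>C
            Y w1 (n + of_int l - of_nat i) (mact W2 u (m + int i) w2)))"

text \<open>The last condition only normalises the action outside the carriers, so that
  equality of records is equality of structures.\<close>

definition vertex_action :: "'u::complex_vector voa \<Rightarrow> 'u vmod \<Rightarrow> bool" where
  "vertex_action V W \<longleftrightarrow>
     cvs.subspace (mcar W) \<and>
     (\<forall>n. cbilinear_on (vcar V) (mcar W) (\<lambda>v w. mact W v n w)) \<and>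
     (\<forall>v\<in>vcar V. \<forall>n. \<forall>w\<in>mcar W. mact W v n w \<in> mcar W) \<and>
     (\<forall>v\<in>vcar V. \<forall>w\<in>mcar W. \<exists>N. \<forall>n\<ge>N. mact W v n w = 0) \<and>
     (\<forall>w\<in>mcar W. \<forall>n. mact W (vac V) n w = (if n = -1 then w else 0)) \<and>
     jacobi V (adj V) W W (mact W) \<and>
     (\<forall>v\<in>vcar V. \<forall>n. \<forall>w\<in>mcar W.
        mact W (Lop V (adj V) (-1) v) n w = - (of_int n *\<^sub>C mact W v (n - 1) w)) \<and>
     (\<forall>v n w. v \<notin> vcar V \<or> w \<notin> mcar W \<longrightarrow> mact W v n w = 0)"

definition is_voa :: "'u::complex_vector voa \<Rightarrow> bool" where
  "is_voa V \<longleftrightarrow>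
     vac V \<in> vcar V \<and> omega V \<in> vcar V \<and>
     vertex_action V (adj V) \<and>
     (\<forall>v\<in>vcar V. vY V v (-1) (vac V) = v \<and> (\<forall>n\<ge>0. vY V v n (vac V) = 0)) \<and>
     (\<exists>c::complex. \<forall>m n. \<forall>v\<in>vcar V.
        Lop V (adj V) m (Lop V (adj V) n v) - Lop V (adj V) n (Lop V (adj V) m v)
        = of_int (m - n) *\<^sub>C Lop V (adj V) (m + n) v
          + (if m + n = 0 then (of_int (m ^ 3 - m) / 12 * c) *\<^sub>C v else 0)) \<and>
     cvs.span (\<Union>n::int. wspace V (adj V) (of_int n)) = vcar V \<and>
     (\<forall>n::int. finite_dimensional (wspace V (adj V) (of_int n))) \<and>
     (\<exists>N::int. \<forall>n<N. wspace V (adj V) (of_int n) = {0})"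

definition is_module :: "'u::complex_vector voa \<Rightarrow> 'u vmod \<Rightarrow> bool" where
  "is_module V W \<longleftrightarrow>
     vertex_action V W \<and>
     cvs.span (\<Union>n. wspace V W n) = mcar W \<and>
     (\<forall>n. finite_dimensional (wspace V W n)) \<and>
     (\<exists>N::real. \<forall>n. Re n < N \<longrightarrow> wspace V W n = {0})"

text \<open>Module maps are set to \<open>0\<close> outside the carrier of their source.\<close>

definition Hom :: "'u::complex_vector voa \<Rightarrow> 'u vmod \<Rightarrow> 'u vmod \<Rightarrow> ('u \<Rightarrow> 'u) set" where
  "Hom V W1 W2 = {f. clinear_on (mcar W1) f \<and> f ` mcar W1 \<subseteq> mcar W2 \<and>
     (\<forall>v\<in>vcar V. \<forall>n. \<forall>w\<in>mcar W1. f (mact W1 v n w) = mact W2 v n (f w)) \<and>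
     (\<forall>w. w \<notin> mcar W1 \<longrightarrow> f w = 0)}"

definition Iso :: "'u::complex_vector voa \<Rightarrow> 'u vmod \<Rightarrow> 'u vmod \<Rightarrow> ('u \<Rightarrow> 'u) set" where
  "Iso V W1 W2 = {f \<in> Hom V W1 W2. bij_betw f (mcar W1) (mcar W2)}"

definition idm :: "'u::complex_vector vmod \<Rightarrow> 'u \<Rightarrow> 'u" where
  "idm W = (\<lambda>w. if w \<in> mcar W then w else 0)"

definition submodule :: "'u::complex_vector voa \<Rightarrow> 'u vmod \<Rightarrow> 'u set \<Rightarrow> bool" where
  "submodule V W U \<longleftrightarrow> cvs.subspace U \<and> U \<subseteq> mcar W \<and>
     (\<forall>v\<in>vcar V. \<forall>n. \<forall>w\<in>U. mact W v n w \<in> U)"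

definition irreducible_module :: "'u::complex_vector voa \<Rightarrow> 'u vmod \<Rightarrow> bool" where
  "irreducible_module V W \<longleftrightarrow>
     mcar W \<noteq> {0} \<and> (\<forall>U. submodule V W U \<longrightarrow> U = {0} \<or> U = mcar W)"

definition simple_voa :: "'u::complex_vector voa \<Rightarrow> bool" where
  "simple_voa V \<longleftrightarrow> irreducible_module V (adj V)"

definition completely_reducible :: "'u::complex_vector voa \<Rightarrow> 'u vmod \<Rightarrow> bool" where
  "completely_reducible V W \<longleftrightarrow>
     (\<exists>S. (\<forall>U\<in>S. submodule V W U \<and> irreducible_module V (W\<lparr>mcar := U\<rparr>)) \<and>
          cvs.span (\<Union>S) = mcar W \<and>
          (\<forall>U\<in>S. U \<inter> cvs.span (\<Union>(S - {U})) = {0}))"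


section \<open>Formal completions\<close>

text \<open>The projection \<open>\<pi>_n\<close> reads off the component of weight \<open>n\<close> in the unique
  decomposition into finitely many homogeneous elements.\<close>

definition wproj :: "'u::complex_vector voa \<Rightarrow> 'u vmod \<Rightarrow> complex \<Rightarrow> 'u \<Rightarrow> 'u" where
  "wproj V W n w =
     (THE f. (\<forall>k. f k \<in> wspace V W k) \<and> finite {k. f k \<noteq> 0} \<and> Sum_any f = w) n"

definition formal_completion :: "'u::complex_vector voa \<Rightarrow> 'u vmod \<Rightarrow> (complex \<Rightarrow> 'u) set" where
  "formal_completion V W = {f. \<forall>n. f n \<in> wspace V W n}"

definition emb :: "'u::complex_vector voa \<Rightarrow> 'u vmod \<Rightarrow> 'u \<Rightarrow> complex \<Rightarrow> 'u" where
  "emb V W w = (\<lambda>n. wproj V W n w)"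

definition cext :: "('u \<Rightarrow> 'u) \<Rightarrow> (complex \<Rightarrow> 'u) \<Rightarrow> complex \<Rightarrow> 'u" where
  "cext f g = (\<lambda>n. f (g n))"

definition contragredient :: "'u::complex_vector voa \<Rightarrow> 'u vmod \<Rightarrow> ('u \<Rightarrow> complex) set" where
  "contragredient V W =
     {p. clinear_on (mcar W) p \<and> finite {n. \<exists>w\<in>wspace V W n. p w \<noteq> 0}}"

definition pairing :: "('u \<Rightarrow> complex) \<Rightarrow> (complex \<Rightarrow> 'u) \<Rightarrow> complex" where
  "pairing p f = Sum_any (\<lambda>n. p (f n))"

definition has_weak_sum ::
  "'u::complex_vector voa \<Rightarrow> 'u vmod \<Rightarrow> ('s \<Rightarrow> complex \<Rightarrow> 'u) \<Rightarrow> 's set \<Rightarrow> (complex \<Rightarrow> 'u) \<Rightarrow> bool" where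
  "has_weak_sum V W F S f \<longleftrightarrow> f \<in> formal_completion V W \<and>
     (\<forall>p\<in>contragredient V W. (\<lambda>s. norm (pairing p (F s))) summable_on S \<and>
        ((\<lambda>s. pairing p (F s)) has_sum pairing p f) S)"

definition exp_Lm1 :: "'u::complex_vector voa \<Rightarrow> 'u vmod \<Rightarrow> (complex \<Rightarrow> 'u) \<Rightarrow> complex \<Rightarrow> 'u" where
  "exp_Lm1 V W f =
     (\<lambda>n. Sum_any (\<lambda>k::nat. (1 / fact k) *\<^sub>C (Lop V W (-1) ^^ k) (f (n - of_nat k))))"


section \<open>Intertwining operators and \<open>P(z)\<close>-intertwining maps\<close>

definition intertwining_operator ::
  "'u::complex_vector voa \<Rightarrow> 'u vmod \<Rightarrow> 'u vmod \<Rightarrow> 'u vmod \<Rightarrow> ('u \<Rightarrow> complex \<Rightarrow> 'u \<Rightarrow> 'u) \<Rightarrow> bool" where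
  "intertwining_operator V W1 W2 W3 Y \<longleftrightarrow>
     (\<forall>n. cbilinear_on (mcar W1) (mcar W2) (\<lambda>w1 w2. Y w1 n w2)) \<and>
     (\<forall>w1\<in>mcar W1. \<forall>n. \<forall>w2\<in>mcar W2. Y w1 n w2 \<in> mcar W3) \<and>
     (\<forall>w1\<in>mcar W1. \<forall>w2\<in>mcar W2. \<exists>N::real. \<forall>n. Re n \<ge> N \<longrightarrow> Y w1 n w2 = 0) \<and>
     jacobi V W1 W2 W3 Y \<and>
     (\<forall>w1\<in>mcar W1. \<forall>n. \<forall>w2\<in>mcar W2.
        Y (Lop V W1 (-1) w1) n w2 = - (n *\<^sub>C Y w1 (n - 1) w2))"

text \<open>The branch \<open>0 \<le> arg z < 2 \<pi>\<close> of the logarithm, unlike \<open>Ln\<close>.\<close>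

definition logz :: "complex \<Rightarrow> complex" where
  "logz z = Complex (ln (cmod z)) (Arg2pi z)"

text \<open>\<open>Y(w1, e^l) w2\<close>. Each weight component is a finite sum.\<close>

definition subst_at ::
  "'u::complex_vector voa \<Rightarrow> 'u vmod \<Rightarrow> ('u \<Rightarrow> complex \<Rightarrow> 'u \<Rightarrow> 'u) \<Rightarrow> complex \<Rightarrow> 'u \<Rightarrow> 'u \<Rightarrow> complex \<Rightarrow> 'u" where
  "subst_at V W3 Y l w1 w2 =
     (\<lambda>m. Sum_any (\<lambda>n. exp ((- n - 1) * l) *\<^sub>C wproj V W3 m (Y w1 n w2)))"

definition intertwining_map ::
  "'u::complex_vector voa \<Rightarrow> complex \<Rightarrow> 'u vmod \<Rightarrow> 'u vmod \<Rightarrow> 'u vmod \<Rightarrow> ('u \<Rightarrow> 'u \<Rightarrow> complex \<Rightarrow> 'u) \<Rightarrow> bool" where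
  "intertwining_map V z W1 W2 W3 I \<longleftrightarrow>
     (\<exists>Y. intertwining_operator V W1 W2 W3 Y \<and>
        (\<forall>w1\<in>mcar W1. \<forall>w2\<in>mcar W2. I w1 w2 = subst_at V W3 Y (logz z) w1 w2))"

definition tensor_product ::
  "'u::complex_vector voa \<Rightarrow> complex \<Rightarrow> 'u vmod \<Rightarrow> 'u vmod \<Rightarrow> 'u vmod \<Rightarrow> ('u \<Rightarrow> 'u \<Rightarrow> complex \<Rightarrow> 'u) \<Rightarrow> bool" where
  "tensor_product V z W1 W2 T t \<longleftrightarrow>
     is_module V T \<and> intertwining_map V z W1 W2 T t \<and>
     (\<forall>W3 I. is_module V W3 \<and> intertwining_map V z W1 W2 W3 I \<longrightarrow>
        (\<exists>!\<eta>. \<eta> \<in> Hom V T W3 \<and>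
           (\<forall>w1\<in>mcar W1. \<forall>w2\<in>mcar W2. cext \<eta> (t w1 w2) = I w1 w2)))"


section \<open>Products and iterates of intertwining operators\<close>

text \<open>
  An arbitrary composition of intertwining maps is a binary tree. A node holds the target module,
  a \<open>P(z)\<close>-intertwining map into it, \<open>z\<close>, and the trees of the two arguments.
  For instance, \<open>Node W I1 z1 (Leaf W1 w1) (Node M I2 z2 (Leaf W2 w2) (Leaf W3 w3))\<close> is the
  product \<open>Y1(w1,z1) Y2(w2,z2) w3\<close>, and
  \<open>Node W I1 z2 (Node M I2 (z1 - z2) (Leaf W1 w1) (Leaf W2 w2)) (Leaf W3 w3)\<close> is the
  iterate \<open>Y1(Y2(w1,z1-z2) w2,z2) w3\<close>.
\<close>

datatype 'u tree =
    Leaf "'u vmod" 'u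
  | Node "'u vmod" "'u \<Rightarrow> 'u \<Rightarrow> complex \<Rightarrow> 'u" complex "'u tree" "'u tree"

fun tree_mod :: "'u tree \<Rightarrow> 'u vmod" where
  "tree_mod (Leaf W w) = W"
| "tree_mod (Node W I z l r) = W"

fun tree_wf :: "'u::complex_vector voa \<Rightarrow> 'u tree \<Rightarrow> bool" where
  "tree_wf V (Leaf W w) \<longleftrightarrow> is_module V W \<and> w \<in> mcar W"
| "tree_wf V (Node W I z l r) \<longleftrightarrow> is_module V W \<and> tree_wf V l \<and> tree_wf V r \<and>
     intertwining_map V z (tree_mod l) (tree_mod r) W I"

text \<open>
  Insertion points are measured from the rightmost leaf of a tree; all of them lie within
  \<open>tree_radius\<close> of it, even after rotating every subtree about its own centre. The region of
  convergence asks the discs of the two subtrees of every node to be disjoint. For products it is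
  \<open>|z1| > \<dots> > |zn| > 0\<close>, for the iterate above it is \<open>|z2| > |z1 - z2| > 0\<close>, and
  for \<open>(w1 w2)(w3 w4)\<close> it is \<open>|z2 - z4| > |z1 - z2| + |z3 - z4|\<close>, where the last
  insertion point is \<open>z4\<close>.
\<close>

fun tree_radius :: "'u tree \<Rightarrow> real" where
  "tree_radius (Leaf W w) = 0"
| "tree_radius (Node W I z l r) = cmod z + tree_radius l"

fun in_region :: "'u tree \<Rightarrow> bool" where
  "in_region (Leaf W w) \<longleftrightarrow> True"
| "in_region (Node W I z l r) \<longleftrightarrow> in_region l \<and> in_region r \<and>
     z \<noteq> 0 \<and> cmod z > tree_radius l + tree_radius r"

text \<open>
  The terms of the (multiple) series denoted by a tree are indexed by labellings of its inner
  nodes by weights: the label \<open>n\<close> of a node means that \<open>\<pi>_n\<close> is applied to the output of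
  that node. At the root, no projection is applied.
\<close>

datatype labelling = NoLabel | Label complex labelling labelling

fun labellings :: "'u tree \<Rightarrow> labelling set" where
  "labellings (Leaf W w) = {NoLabel}"
| "labellings (Node W I z l r) =
     {Label n a b | n a b. a \<in> labellings l \<and> b \<in> labellings r}"

fun tree_term :: "'u::complex_vector tree \<Rightarrow> labelling \<Rightarrow> 'u" where
  "tree_term (Leaf W w) a = w"
| "tree_term (Node W I z l r) (Label n a b) = I (tree_term l a) (tree_term r b) n"
| "tree_term (Node W I z l r) NoLabel = 0"

fun has_tree_value :: "'u::complex_vector voa \<Rightarrow> 'u tree \<Rightarrow> (complex \<Rightarrow> 'u) \<Rightarrow> bool" where
  "has_tree_value V (Leaf W w) f \<longleftrightarrow> f = emb V W w"
| "has_tree_value V (Node W I z l r) f \<longleftrightarrow>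
     has_weak_sum V W (\<lambda>(a, b). I (tree_term l a) (tree_term r b))
       (labellings l \<times> labellings r) f"

definition tree_value :: "'u::complex_vector voa \<Rightarrow> 'u tree \<Rightarrow> complex \<Rightarrow> 'u" where
  "tree_value V t = (THE f. has_tree_value V t f)"


section \<open>Vertex tensor category structure\<close>

text \<open>
  \<open>tprod D z W1 W2\<close> is the \<open>P(z)\<close>-tensor product module, \<open>telem D z W1 W2 w1 w2\<close> the
  \<open>P(z)\<close>-tensor product of elements, \<open>tassoc D z1 z2 W1 W2 W3\<close> the associativity isomorphism
  and \<open>ttrans D \<gamma> W1 W2\<close> the parallel transport isomorphism along \<open>\<gamma>\<close>.
\<close>

record 'u vertex_tensor =
  tprod :: "complex \<Rightarrow> 'u vmod \<Rightarrow> 'u vmod \<Rightarrow> 'u vmod"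
  telem :: "complex \<Rightarrow> 'u vmod \<Rightarrow> 'u vmod \<Rightarrow> 'u \<Rightarrow> 'u \<Rightarrow> complex \<Rightarrow> 'u"
  tassoc :: "complex \<Rightarrow> complex \<Rightarrow> 'u vmod \<Rightarrow> 'u vmod \<Rightarrow> 'u vmod \<Rightarrow> 'u \<Rightarrow> 'u"
  ttrans :: "(real \<Rightarrow> complex) \<Rightarrow> 'u vmod \<Rightarrow> 'u vmod \<Rightarrow> 'u \<Rightarrow> 'u"

definition tmap ::
  "'u::complex_vector voa \<Rightarrow> 'u vertex_tensor \<Rightarrow> complex \<Rightarrow> 'u vmod \<Rightarrow> 'u vmod \<Rightarrow> 'u vmod \<Rightarrow> 'u vmod \<Rightarrow>
   ('u \<Rightarrow> 'u) \<Rightarrow> ('u \<Rightarrow> 'u) \<Rightarrow> 'u \<Rightarrow> 'u" where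
  "tmap V D z W1 W2 U1 U2 f g =
     (THE h. h \<in> Hom V (tprod D z W1 W2) (tprod D z U1 U2) \<and>
        (\<forall>w1\<in>mcar W1. \<forall>w2\<in>mcar W2.
           cext h (telem D z W1 W2 w1 w2) = telem D z U1 U2 (f w1) (g w2)))"

text \<open>Trees all of whose intertwining maps are the universal ones.\<close>

datatype 'u ttree = TLeaf "'u vmod" 'u | TNode complex "'u ttree" "'u ttree"

fun ttree_mod :: "'u vertex_tensor \<Rightarrow> 'u ttree \<Rightarrow> 'u vmod" where
  "ttree_mod D (TLeaf W w) = W"
| "ttree_mod D (TNode z l r) = tprod D z (ttree_mod D l) (ttree_mod D r)"

fun tensor_tree :: "'u vertex_tensor \<Rightarrow> 'u ttree \<Rightarrow> 'u tree" where
  "tensor_tree D (TLeaf W w) = Leaf W w"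
| "tensor_tree D (TNode z l r) =
     Node (ttree_mod D (TNode z l r)) (telem D z (ttree_mod D l) (ttree_mod D r)) z
       (tensor_tree D l) (tensor_tree D r)"

fun shape :: "'u::zero ttree \<Rightarrow> 'u ttree" where
  "shape (TLeaf W w) = TLeaf W 0"
| "shape (TNode z l r) = TNode z (shape l) (shape r)"

definition tensor_products_exist :: "'u::complex_vector voa \<Rightarrow> 'u vertex_tensor \<Rightarrow> bool" where
  "tensor_products_exist V D \<longleftrightarrow>
     (\<forall>z W1 W2. z \<noteq> 0 \<and> is_module V W1 \<and> is_module V W2 \<longrightarrow>
        tensor_product V z W1 W2 (tprod D z W1 W2) (telem D z W1 W2) \<and>
        cvs.span {telem D z W1 W2 w1 w2 n | w1 w2 n. w1 \<in> mcar W1 \<and> w2 \<in> mcar W2}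
          = mcar (tprod D z W1 W2))"

definition convergence :: "'u::complex_vector voa \<Rightarrow> bool" where
  "convergence V \<longleftrightarrow>
     (\<forall>t. tree_wf V t \<and> in_region t \<longrightarrow> (\<exists>f. has_tree_value V t f))"

definition components_span :: "'u::complex_vector voa \<Rightarrow> 'u vertex_tensor \<Rightarrow> bool" where
  "components_span V D \<longleftrightarrow>
     (\<forall>t. tree_wf V (tensor_tree D t) \<and> in_region (tensor_tree D t) \<longrightarrow>
        cvs.span {tree_value V (tensor_tree D s) n | s n.
                    shape s = shape t \<and> tree_wf V (tensor_tree D s)}
          = mcar (ttree_mod D t))"

definition associativity :: "'u::complex_vector voa \<Rightarrow> 'u vertex_tensor \<Rightarrow> bool" where
  "associativity V D \<longleftrightarrow>
     (\<forall>z1 z2 W1 W2 W3.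
        cmod z1 > cmod z2 \<and> cmod z2 > cmod (z1 - z2) \<and> cmod (z1 - z2) > 0 \<and>
        is_module V W1 \<and> is_module V W2 \<and> is_module V W3 \<longrightarrow>
        tassoc D z1 z2 W1 W2 W3 \<in> Iso V
          (tprod D z1 W1 (tprod D z2 W2 W3)) (tprod D z2 (tprod D (z1 - z2) W1 W2) W3) \<and>
        (\<forall>w1\<in>mcar W1. \<forall>w2\<in>mcar W2. \<forall>w3\<in>mcar W3.
           cext (tassoc D z1 z2 W1 W2 W3)
             (tree_value V (tensor_tree D
               (TNode z1 (TLeaf W1 w1) (TNode z2 (TLeaf W2 w2) (TLeaf W3 w3)))))
           = tree_value V (tensor_tree D
               (TNode z2 (TNode (z1 - z2) (TLeaf W1 w1) (TLeaf W2 w2)) (TLeaf W3 w3)))) \<and>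
        (\<forall>U1 U2 U3 f1 f2 f3.
           is_module V U1 \<and> is_module V U2 \<and> is_module V U3 \<and>
           f1 \<in> Hom V W1 U1 \<and> f2 \<in> Hom V W2 U2 \<and> f3 \<in> Hom V W3 U3 \<longrightarrow>
           tassoc D z1 z2 U1 U2 U3 \<circ>
             tmap V D z1 W1 (tprod D z2 W2 W3) U1 (tprod D z2 U2 U3)
               f1 (tmap V D z2 W2 W3 U2 U3 f2 f3)
           = tmap V D z2 (tprod D (z1 - z2) W1 W2) W3 (tprod D (z1 - z2) U1 U2) U3
               (tmap V D (z1 - z2) W1 W2 U1 U2 f1 f2) f3 \<circ>
             tassoc D z1 z2 W1 W2 W3))"

text \<open>The value \<open>l(\<gamma> 0)\<close> of the logarithm obtained by continuing \<open>log (\<gamma> 1)\<close>,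
  \<open>0 \<le> arg < 2 \<pi>\<close>, backwards along \<open>\<gamma>\<close>.\<close>

definition start_log :: "(real \<Rightarrow> complex) \<Rightarrow> complex \<Rightarrow> bool" where
  "start_log \<gamma> l \<longleftrightarrow>
     (\<exists>h. continuous_on {0..1} h \<and> (\<forall>t\<in>{0..1}. exp (h t) = \<gamma> t) \<and>
          h 1 = logz (\<gamma> 1) \<and> h 0 = l)"

definition parallel_transport :: "'u::complex_vector voa \<Rightarrow> 'u vertex_tensor \<Rightarrow> bool" where
  "parallel_transport V D \<longleftrightarrow>
     (\<forall>\<gamma> W1 W2. path \<gamma> \<and> 0 \<notin> path_image \<gamma> \<and> is_module V W1 \<and> is_module V W2 \<longrightarrow>
        ttrans D \<gamma> W1 W2 \<in> Iso V (tprod D (pathstart \<gamma>) W1 W2) (tprod D (pathfinish \<gamma>) W1 W2) \<and>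
        (\<forall>l Y. start_log \<gamma> l \<and>
           intertwining_operator V W1 W2 (tprod D (pathfinish \<gamma>) W1 W2) Y \<and>
           (\<forall>w1\<in>mcar W1. \<forall>w2\<in>mcar W2.
              subst_at V (tprod D (pathfinish \<gamma>) W1 W2) Y (logz (pathfinish \<gamma>)) w1 w2
              = telem D (pathfinish \<gamma>) W1 W2 w1 w2) \<longrightarrow>
           (\<forall>w1\<in>mcar W1. \<forall>w2\<in>mcar W2.
              cext (ttrans D \<gamma> W1 W2) (telem D (pathstart \<gamma>) W1 W2 w1 w2)
              = subst_at V (tprod D (pathfinish \<gamma>) W1 W2) Y l w1 w2)))"

definition vertex_tensor_category :: "'u::complex_vector voa \<Rightarrow> 'u vertex_tensor \<Rightarrow> bool" where
  "vertex_tensor_category V D \<longleftrightarrow>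
     tensor_products_exist V D \<and> convergence V \<and> components_span V D \<and>
     associativity V D \<and> parallel_transport V D"


section \<open>The braided tensor category\<close>

definition left_unit :: "'u::complex_vector voa \<Rightarrow> 'u vertex_tensor \<Rightarrow> 'u vmod \<Rightarrow> 'u \<Rightarrow> 'u" where
  "left_unit V D W =
     (THE f. f \<in> Iso V (tprod D 1 (adj V) W) W \<and>
        (\<forall>w\<in>mcar W. cext f (telem D 1 (adj V) W (vac V) w) = emb V W w))"

definition braiding :: "'u::complex_vector voa \<Rightarrow> 'u vertex_tensor \<Rightarrow> 'u vmod \<Rightarrow> 'u vmod \<Rightarrow> 'u \<Rightarrow> 'u" where
  "braiding V D W1 W2 =
     (THE f. f \<in> Hom V (tprod D 1 W1 W2) (tprod D 1 W2 W1) \<and>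
        (\<forall>w1\<in>mcar W1. \<forall>w2\<in>mcar W2.
           cext f (telem D 1 W1 W2 w1 w2)
           = exp_Lm1 V (tprod D 1 W2 W1)
               (cext (ttrans D (\<lambda>t. cis (pi * (1 - t))) W2 W1) (telem D (-1) W2 W1 w2 w1))))"

text \<open>The associativity isomorphism does not depend on the choice of the real numbers
  \<open>z1 > z2 > z1 - z2 > 0\<close>.\<close>

definition assoc_iso ::
  "'u::complex_vector voa \<Rightarrow> 'u vertex_tensor \<Rightarrow> real \<Rightarrow> real \<Rightarrow> 'u vmod \<Rightarrow> 'u vmod \<Rightarrow> 'u vmod \<Rightarrow> 'u \<Rightarrow> 'u" where
  "assoc_iso V D z1 z2 W1 W2 W3 =
     (let a = complex_of_real z1; b = complex_of_real z2 in
      ttrans D (linepath b 1) (tprod D 1 W1 W2) W3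
      \<circ> tmap V D b (tprod D (a - b) W1 W2) W3 (tprod D 1 W1 W2) W3
          (ttrans D (linepath (a - b) 1) W1 W2) (idm W3)
      \<circ> tassoc D a b W1 W2 W3
      \<circ> tmap V D a W1 (tprod D 1 W2 W3) W1 (tprod D b W2 W3)
          (idm W1) (ttrans D (linepath 1 b) W2 W3)
      \<circ> ttrans D (linepath 1 a) W1 (tprod D 1 W2 W3))"

definition twist :: "'u::complex_vector voa \<Rightarrow> 'u vmod \<Rightarrow> 'u \<Rightarrow> 'u" where
  "twist V W w = Sum_any (\<lambda>n. exp (2 * pi * \<i> * n) *\<^sub>C wproj V W n w)"

record 'u C_alg =
  aobj :: "'u vmod"
  amult :: "'u \<Rightarrow> 'u"
  aunit :: "'u \<Rightarrow> 'u"

definition C_algebra ::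
  "'u::complex_vector voa \<Rightarrow> 'u vertex_tensor \<Rightarrow> real \<Rightarrow> real \<Rightarrow> 'u C_alg \<Rightarrow> bool" where
  "C_algebra V D z1 z2 X \<longleftrightarrow>
     (let A = aobj X; \<mu> = amult X; \<iota> = aunit X; AA = tprod D 1 A A in
      is_module V A \<and>
      \<mu> \<in> Hom V AA A \<and>
      \<iota> \<in> Hom V (adj V) A \<and> inj_on \<iota> (vcar V) \<and>
      (\<forall>x\<in>mcar (tprod D 1 A AA).
         \<mu> (tmap V D 1 AA A A A \<mu> (idm A) (assoc_iso V D z1 z2 A A A x))
         = \<mu> (tmap V D 1 A AA A A (idm A) \<mu> x)) \<and>
      (\<forall>x\<in>mcar AA. \<mu> (braiding V D A A x) = \<mu> x) \<and>
      (\<forall>a\<in>mcar A.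
         \<mu> (tmap V D 1 (adj V) A A A \<iota> (idm A)
              (inv_into (mcar (tprod D 1 (adj V) A)) (left_unit V D A) a)) = a))"

definition haploid :: "'u::complex_vector voa \<Rightarrow> 'u C_alg \<Rightarrow> bool" where
  "haploid V X \<longleftrightarrow> cvs.dim (Hom V (adj V) (aobj X)) = 1"


section \<open>Extensions\<close>

text \<open>An extension of \<open>V\<close> is a vertex operator algebra \<open>E\<close> in which \<open>V\<close> is identified by
  \<open>i\<close> with a vertex operator subalgebra; \<open>i\<close> is the inclusion if \<open>V\<close> is literally a subset.\<close>

definition is_extension :: "'u::complex_vector voa \<Rightarrow> 'u voa \<Rightarrow> ('u \<Rightarrow> 'u) \<Rightarrow> bool" where
  "is_extension V E i \<longleftrightarrow>
     is_voa E \<and> clinear_on (vcar V) i \<and> inj_on i (vcar V) \<and> i ` vcar V \<subseteq> vcar E \<and>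
     (\<forall>v. v \<notin> vcar V \<longrightarrow> i v = 0) \<and>
     i (vac V) = vac E \<and> i (omega V) = omega E \<and>
     (\<forall>u\<in>vcar V. \<forall>v\<in>vcar V. \<forall>n. i (vY V u n v) = vY E (i u) n (i v))"

definition restrict_module :: "'u::complex_vector voa \<Rightarrow> 'u voa \<Rightarrow> ('u \<Rightarrow> 'u) \<Rightarrow> 'u vmod" where
  "restrict_module V E i =
     \<lparr>mcar = vcar E, mact = (\<lambda>v n w. if v \<in> vcar V then vY E (i v) n w else 0)\<rparr>"

text \<open>The \<open>C\<close>-algebra of an extension: \<open>E\<close> as a \<open>V\<close>-module, the multiplication \<open>\<mu>\<close> whose
  extension to the completion sends \<open>u \<boxtimes> v\<close> to \<open>Y(u,1)v\<close>, and the inclusion of \<open>V\<close>.\<close>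

definition algebra_of_extension ::
  "'u::complex_vector voa \<Rightarrow> 'u vertex_tensor \<Rightarrow> 'u voa \<times> ('u \<Rightarrow> 'u) \<Rightarrow> 'u C_alg" where
  "algebra_of_extension V D = (\<lambda>(E, i).
     let M = restrict_module V E i in
     \<lparr>aobj = M,
      amult = (THE \<mu>. \<mu> \<in> Hom V (tprod D 1 M M) M \<and>
        (\<forall>u\<in>vcar E. \<forall>v\<in>vcar E.
           cext \<mu> (telem D 1 M M u v) = (\<lambda>m. Sum_any (\<lambda>n::int. wproj V M m (vY E u n v))))),
      aunit = i\<rparr>)"

end

theory Submission
  imports Defs "HOL-Complex_Analysis.Complex_Analysis"
begin

text \<open>Let \<open>E\<close> be an extension. Restricted to \<open>V\<close> it is a \<open>V\<close>-module, and its vertex operator is an intertwining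
  operator of type \<open>(E; E E)\<close>, which by universality is the same thing as a module map \<open>\<mu> : E \<boxtimes> E \<rightarrow> E\<close>.
  Under this dictionary the axioms correspond one by one: \<open>\<mu> \<circ> \<R> = \<mu>\<close> is skew-symmetry of the vertex operator
  (\<open>eta_braiding\<close>), the unit axiom is \<open>1_(-1) a = a\<close> (\<open>unit_axiom\<close>), and associativity of \<open>\<mu>\<close> says that at one pair of
  points \<open>z1 > z2 > z1 - z2 > 0\<close> products and iterates agree as elements of the completion,
  \<open>Y(u, z1) Y(v, z2) w = Y(Y(u, z1 - z2) v, z2) w\<close> (\<open>associativity_axiom_iff\<close>). The twist is trivial exactly when all
  weights are integers, and then only integral modes of the multiplication survive.

  The analytic core is the equivalence of this single equation (together with skew-symmetry) with the Jacobi identity.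
  Everything is homogeneous, so after pairing with a functional a matrix coefficient depends only on \<open>t = z1 / z2\<close>. It has
  the three expansions
  \<open>A(t) = \<Sum> a_m t^(-m-1)\<close> for \<open>|t| > 1\<close>, \<open>B(t) = \<Sum> b_m (t - 1)^(-m-1)\<close> for \<open>0 < |t - 1| < 1\<close> and
  \<open>C(t) = \<Sum> c_m t^(-m-1)\<close> for \<open>0 < |t| < 1\<close>, from \<open>Y(u) Y(v)\<close>, from the iterate and from \<open>Y(v) Y(u)\<close>. The Jacobi identity says
  that for all integers \<open>l\<close>, \<open>m\<close> the residues of \<open>t^m (t - 1)^l\<close> times these expansions, at infinity, at \<open>1\<close> and at \<open>0\<close>,
  add up. It holds once the three expansions come from one meromorphic function on the sphere with poles in \<open>{0, 1, \<infinity>}\<close>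
  (\<open>residue_three_points\<close>, \<open>jacobi_of_continuation\<close>), and conversely it forces \<open>A = B\<close> on the common domain
  (\<open>associativity_of_jacobi\<close>).

  Three points need an argument in the direction from algebras to extensions. Agreement at one point \<open>t\<close> suffices: replacing
  \<open>u\<close> by \<open>L(-1)^n u\<close> differentiates both sides, so all Taylor coefficients agree (\<open>associativity_propagates\<close>).
  Skew-symmetry turns \<open>A = B\<close> for the pair \<open>(v, u)\<close> into \<open>B = C\<close> for the pair \<open>(u, v)\<close> (\<open>skew_symmetric_continuation\<close>).
  Finally \<open>A\<close>, \<open>B\<close>, \<open>C\<close> are defined on \<open>|t| > 1\<close> and two discs, which do not cover a neighbourhood of the unit circle; the gap
  is closed by moving the third point. By skew-symmetry \<open>e^(-d L(-1)) w = Y(w, -d) 1\<close>, and convergence of the fourfold product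
  \<open>Y(u, t - d) Y(v, 1 - d) Y(w, -d) 1\<close> for \<open>d = 2/5\<close> extends \<open>A\<close> to \<open>|t - 2/5| > 3/5\<close> (\<open>translated_lconv\<close>,
  \<open>three_point_jacobi\<close>), and this region together with the two discs covers the plane.

  The two remaining conditions match as follows. A module map \<open>V \<rightarrow> E\<close> is determined by the image of the vacuum, a vector of
  weight \<open>0\<close>, so \<open>dim E_(0) = 1\<close> makes \<open>E\<close> haploid. Conversely, a haploid algebra decomposes into irreducible submodules, only copies of \<open>V\<close>
  contribute to weight \<open>0\<close>, and haploidity makes all of them contribute the line of the unit
  (\<open>weight_zero_spanned_by_unit\<close>). The conformal vector of \<open>E\<close> is the image of that of \<open>V\<close>; its Virasoro relations hold on
  every \<open>V\<close>-module (\<open>virasoro_module\<close>).\<close>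

section \<open>Laurent series with finite principal part\<close>

lemma has_sum_Sum_any:
  fixes f :: "'a \<Rightarrow> 'b::{comm_monoid_add, topological_space}"
  assumes "finite {i. f i \<noteq> 0}"
  shows "(f has_sum Sum_any f) UNIV"
  by (rule has_sum_finite_neutralI[of "{i. f i \<noteq> 0}"]) (use assms in \<open>auto simp: Sum_any.expand_set\<close>)

definition lsum :: "(int \<Rightarrow> complex) \<Rightarrow> complex \<Rightarrow> complex" where
  "lsum g x = (\<Sum>\<^sub>\<infinity>k. g k * x powi k)"

text \<open>Coefficients are indexed by the integers and vanish far to the left; \<open>\<rho>\<close> is a lower bound for the outer radius of
  convergence.\<close>

definition lconv :: "(int \<Rightarrow> complex) \<Rightarrow> real \<Rightarrow> bool" where
  "lconv g \<rho> \<longleftrightarrow> (\<exists>k0. \<forall>k<k0. g k = 0) \<and>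
     (\<forall>x. 0 < norm x \<and> norm x < \<rho> \<longrightarrow> (\<lambda>k. g k * x powi k) summable_on UNIV)"

lemma lconv_has_sum:
  assumes "lconv g \<rho>" "0 < norm x" "norm x < \<rho>"
  shows "((\<lambda>k. g k * x powi k) has_sum lsum g x) UNIV"
  using assms unfolding lconv_def lsum_def by auto

lemma laurent_has_sum_nat_iff:
  fixes g :: "int \<Rightarrow> complex"
  assumes "\<And>k. k < k0 \<Longrightarrow> g k = 0" "x \<noteq> 0"
  shows "((\<lambda>k. g k * x powi k) has_sum S) UNIV \<longleftrightarrow>
         ((\<lambda>n::nat. g (k0 + int n) * x ^ n) has_sum (S / x powi k0)) UNIV"
proof -
  have im: "range (\<lambda>n. k0 + int n) = {k0..}"
  proof safe
    fix k assume "k0 \<le> k"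
    then show "k \<in> range (\<lambda>n. k0 + int n)" by (intro image_eqI[of _ _ "nat (k - k0)"]) auto
  qed auto
  have "((\<lambda>k. g k * x powi k) has_sum S) UNIV \<longleftrightarrow> ((\<lambda>k. g k * x powi k) has_sum S) {k0..}"
    by (rule has_sum_cong_neutral) (use assms(1) in auto)
  also have "\<dots> \<longleftrightarrow> ((\<lambda>k. g k * x powi k) has_sum S) (range (\<lambda>n. k0 + int n))"
    by (simp add: im)
  also have "\<dots> \<longleftrightarrow> (((\<lambda>k. g k * x powi k) \<circ> (\<lambda>n. k0 + int n)) has_sum S) UNIV"
    by (rule has_sum_reindex) (auto simp: inj_on_def)
  also have "((\<lambda>k. g k * x powi k) \<circ> (\<lambda>n. k0 + int n)) =
      (\<lambda>n. x powi k0 * (g (k0 + int n) * x ^ n))"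
    using assms(2) by (auto simp: fun_eq_iff power_int_add)
  also have "(\<dots> has_sum S) UNIV \<longleftrightarrow> ((\<lambda>n. g (k0 + int n) * x ^ n) has_sum (S / x powi k0)) UNIV"
  proof
    assume "((\<lambda>n. x powi k0 * (g (k0 + int n) * x ^ n)) has_sum S) UNIV"
    from has_sum_cmult_right[OF this, of "1 / x powi k0"]
    show "((\<lambda>n. g (k0 + int n) * x ^ n) has_sum (S / x powi k0)) UNIV"
      using assms(2) by simp
  next
    assume "((\<lambda>n. g (k0 + int n) * x ^ n) has_sum (S / x powi k0)) UNIV"
    from has_sum_cmult_right[OF this, of "x powi k0"]
    show "((\<lambda>n. x powi k0 * (g (k0 + int n) * x ^ n)) has_sum S) UNIV"
      using assms(2) by simp
  qed
  finally show ?thesis .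
qed

lemma lconv_powser:
  assumes "lconv g \<rho>" "\<And>k. k < k0 \<Longrightarrow> g k = 0" "norm x < \<rho>"
  shows "summable (\<lambda>n. norm (g (k0 + int n) * x ^ n))"
proof (cases "x = 0")
  case True
  then have "norm (g (k0 + int n) * x ^ n) = 0" if "n \<notin> {0}" for n using that by simp
  then show ?thesis by (intro summable_finite[of "{0}"]) auto
next
  case False
  have "((\<lambda>k. g k * x powi k) has_sum lsum g x) UNIV"
    by (rule lconv_has_sum[OF assms(1)]) (use False assms(3) in auto)
  then have "((\<lambda>n::nat. g (k0 + int n) * x ^ n) has_sum (lsum g x / x powi k0)) UNIV"
    using laurent_has_sum_nat_iff[of k0 g x] assms(2) False by blast
  then have "(\<lambda>n::nat. g (k0 + int n) * x ^ n) summable_on UNIV" by (auto simp: summable_on_def)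
  then have "(\<lambda>n::nat. norm (g (k0 + int n) * x ^ n)) summable_on UNIV"
    by (simp only: summable_on_iff_abs_summable_on_complex)
  then show ?thesis by (rule summable_on_imp_summable)
qed

lemma lsum_powser:
  assumes "lconv g \<rho>" "\<And>k. k < k0 \<Longrightarrow> g k = 0" "norm x < \<rho>" "x \<noteq> 0"
  shows "lsum g x = x powi k0 * suminf (\<lambda>n. g (k0 + int n) * x ^ n)"
proof -
  have "((\<lambda>k. g k * x powi k) has_sum lsum g x) UNIV"
    by (rule lconv_has_sum[OF assms(1)]) (use assms in auto)
  then have "((\<lambda>n::nat. g (k0 + int n) * x ^ n) has_sum (lsum g x / x powi k0)) UNIV"
    using laurent_has_sum_nat_iff[of k0 g x] assms(2,4) by blast
  then have "(\<lambda>n::nat. g (k0 + int n) * x ^ n) sums (lsum g x / x powi k0)"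
    by (rule has_sum_imp_sums)
  then have "suminf (\<lambda>n. g (k0 + int n) * x ^ n) = lsum g x / x powi k0" by (rule sums_unique[symmetric])
  then show ?thesis using assms(4) by simp
qed

lemma lsum_powserI:
  fixes g :: "int \<Rightarrow> complex"
  assumes "\<And>k. k < k0 \<Longrightarrow> g k = 0" "x \<noteq> 0" "summable (\<lambda>n. norm (g (k0 + int n) * x ^ n))"
  shows "((\<lambda>k. g k * x powi k) has_sum (x powi k0 * suminf (\<lambda>n. g (k0 + int n) * x ^ n))) UNIV"
proof -
  have "(\<lambda>n. g (k0 + int n) * x ^ n) sums suminf (\<lambda>n. g (k0 + int n) * x ^ n)"
    by (rule summable_sums[OF summable_norm_cancel[OF assms(3)]])
  then have "((\<lambda>n. g (k0 + int n) * x ^ n) has_sum suminf (\<lambda>n. g (k0 + int n) * x ^ n)) UNIV"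
    by (rule norm_summable_imp_has_sum[OF assms(3)])
  moreover have "x powi k0 * suminf (\<lambda>n. g (k0 + int n) * x ^ n) / x powi k0 = suminf (\<lambda>n. g (k0 + int n) * x ^ n)"
    using assms(2) by simp
  ultimately show ?thesis
    using laurent_has_sum_nat_iff[of k0 g x "x powi k0 * suminf (\<lambda>n. g (k0 + int n) * x ^ n)", OF assms(1,2)]
    by (simp only:)
qed

text \<open>Splitting off any number of leading terms leaves a power of \<open>x\<close> times a function that is holomorphic at the
  origin. The value of this function at the origin is the next coefficient, which is how residues are read off below.\<close>

lemma lsum_split:
  assumes "lconv g \<rho>" "\<And>k. k < - int N \<Longrightarrow> g k = 0" "\<rho> > 0"
  obtains r where "r holomorphic_on ball 0 \<rho>" "r 0 = g (int q - int N)"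
    "\<And>x. 0 < norm x \<Longrightarrow> norm x < \<rho> \<Longrightarrow>
       lsum g x = (\<Sum>n<q. g (int n - int N) * x powi (int n - int N)) + x powi (int q - int N) * r x"
proof
  let ?c = "\<lambda>n. g (int q - int N + int n)"
  define r where "r = (\<lambda>x. suminf (\<lambda>n. ?c n * x ^ n))"
  have sm: "summable (\<lambda>n. g (- int N + int n) * x ^ n)" if "norm x < \<rho>" for x
    by (rule summable_norm_cancel[OF lconv_powser[OF assms(1,2) that]])
  have sm2: "summable (\<lambda>n. ?c n * x ^ n)" if "norm x < \<rho>" for x
  proof (cases "x = 0")
    case True then show ?thesis by (intro summable_finite[of "{0}"]) auto
  next
    case False
    have "summable (\<lambda>n. g (- int N + int (n + q)) * x ^ (n + q))"
      using sm[OF that] by (rule summable_ignore_initial_segment)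
    then have "summable (\<lambda>n. g (- int N + int (n + q)) * x ^ (n + q) * (1 / x ^ q))"
      by (rule summable_mult2)
    then show ?thesis using False by (simp add: power_add algebra_simps)
  qed
  show "r holomorphic_on ball 0 \<rho>"
  proof (rule holomorphic_onI)
    fix x :: complex assume "x \<in> ball 0 \<rho>"
    then have "norm x < \<rho>" by simp
    from termdiffs_strong'[of \<rho> ?c x, OF sm2 this]
    show "r field_differentiable at x within ball 0 \<rho>"
      unfolding r_def field_differentiable_def by (blast intro: has_field_derivative_at_within)
  qed
  show "r 0 = g (int q - int N)" unfolding r_def by (subst powser_zero) simp
  fix x :: complex assume x: "0 < norm x" "norm x < \<rho>"
  then have x0: "x \<noteq> 0" by auto
  have "lsum g x = x powi (- int N) * suminf (\<lambda>n. g (- int N + int n) * x ^ n)"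
    by (rule lsum_powser[OF assms(1,2) x(2) x0])
  also have "suminf (\<lambda>n. g (- int N + int n) * x ^ n) =
     suminf (\<lambda>n. g (- int N + int (n + q)) * x ^ (n + q)) + (\<Sum>n<q. g (- int N + int n) * x ^ n)"
    by (rule suminf_split_initial_segment[OF sm[OF x(2)]])
  also have "suminf (\<lambda>n. g (- int N + int (n + q)) * x ^ (n + q)) = suminf (\<lambda>n. x ^ q * (?c n * x ^ n))"
    by (simp add: power_add algebra_simps)
  also have "\<dots> = x ^ q * r x" unfolding r_def by (rule suminf_mult[OF sm2[OF x(2)]])
  also have "x powi - int N * (x ^ q * r x + (\<Sum>n<q. g (- int N + int n) * x ^ n)) =
    (\<Sum>n<q. g (int n - int N) * x powi (int n - int N)) + x powi (int q - int N) * r x"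
    using x0 by (simp add: algebra_simps sum_distrib_left power_int_diff power_int_minus divide_inverse)
  finally show "lsum g x = (\<Sum>n<q. g (int n - int N) * x powi (int n - int N)) + x powi (int q - int N) * r x" .
qed

lemma lsum_has_derivative:
  assumes "lconv g \<rho>" "0 < norm x" "norm x < \<rho>"
  shows "lconv (\<lambda>k. of_int (k + 1) * g (k + 1)) \<rho>"
    and "(lsum g has_field_derivative lsum (\<lambda>k. of_int (k + 1) * g (k + 1)) x) (at x)"
proof -
  obtain k0 where k0: "\<And>k. k < k0 \<Longrightarrow> g k = 0" using assms(1) unfolding lconv_def by blast
  let ?g' = "\<lambda>k. of_int (k + 1) * g (k + 1)"
  let ?c = "\<lambda>n. g (k0 + int n)"
  have g'0: "\<And>k. k < k0 - 1 \<Longrightarrow> ?g' k = 0" using k0 by auto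
  have sm: "summable (\<lambda>n. ?c n * y ^ n)" if "norm y < \<rho>" for y
    by (rule summable_norm_cancel[OF lconv_powser[OF assms(1) k0 that]])
  have diffs_sm: "summable (\<lambda>n. diffs ?c n * y ^ n)" if "norm y < \<rho>" for y
    by (rule termdiff_converges[of y \<rho> ?c, OF that sm])
  have sn: "summable (\<lambda>n. of_nat n * ?c n * y ^ n)" if "norm y < \<rho>" for y
  proof (subst summable_Suc_iff[symmetric])
    have "summable (\<lambda>n. y * (diffs ?c n * y ^ n))" by (rule summable_mult[OF diffs_sm[OF that]])
    then show "summable (\<lambda>n. of_nat (Suc n) * ?c (Suc n) * y ^ Suc n)"
      by (simp add: diffs_def algebra_simps)
  qed
  have g': "?g' (k0 - 1 + int n) * y ^ n = of_int k0 * (?c n * y ^ n) + of_nat n * ?c n * y ^ n" for n y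
    by (simp add: algebra_simps)
  have nsm': "summable (\<lambda>n. ?g' (k0 - 1 + int n) * y ^ n)" if "norm y < \<rho>" for y
    unfolding g' by (intro summable_add summable_mult sm sn that)
  have abs: "summable (\<lambda>n. norm (?g' (k0 - 1 + int n) * y ^ n))" if "norm y < \<rho>" for y
  proof -
    define z where "z = (of_real ((norm y + \<rho>) / 2) :: complex)"
    have "norm z = \<bar>(norm y + \<rho>) / 2\<bar>" unfolding z_def by (rule norm_of_real)
    then have "norm z < \<rho>" "norm y < norm z" using that norm_ge_zero[of y] by auto
    then show ?thesis using powser_insidea[OF nsm'] by blast
  qed
  show lc: "lconv ?g' \<rho>"
    unfolding lconv_def
  proof (intro conjI allI impI)
    show "\<exists>k0. \<forall>k<k0. ?g' k = 0" using g'0 by blast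
    fix y :: complex assume y: "0 < norm y \<and> norm y < \<rho>"
    then show "(\<lambda>k. ?g' k * y powi k) summable_on UNIV"
      using lsum_powserI[of "k0 - 1" ?g' y, OF g'0] abs[of y] by (auto simp: summable_on_def)
  qed
  have x0: "x \<noteq> 0" using assms by auto
  let ?G = "\<lambda>y. suminf (\<lambda>n. ?c n * y ^ n)"
  have dG: "(?G has_field_derivative suminf (\<lambda>n. diffs ?c n * x ^ n)) (at x)"
    by (rule termdiffs_strong'[of \<rho>, OF sm assms(3)])
  have "((\<lambda>y. y powi k0 * ?G y) has_field_derivative
     (of_int k0 * x powi (k0 - 1) * ?G x + x powi k0 * suminf (\<lambda>n. diffs ?c n * x ^ n))) (at x)"
  proof -
    have "((\<lambda>y. y powi k0) has_field_derivative of_int k0 * x powi (k0 - 1)) (at x)"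
      using x0 by (auto intro!: derivative_eq_intros)
    from DERIV_mult[OF this dG] show ?thesis by (simp add: algebra_simps)
  qed
  moreover have "of_int k0 * x powi (k0 - 1) * ?G x + x powi k0 * suminf (\<lambda>n. diffs ?c n * x ^ n) = lsum ?g' x"
  proof -
    have "x * suminf (\<lambda>n. diffs ?c n * x ^ n) = suminf (\<lambda>n. x * (diffs ?c n * x ^ n))"
      by (rule suminf_mult[symmetric, OF diffs_sm[OF assms(3)]])
    also have "\<dots> = suminf (\<lambda>n. of_nat (Suc n) * ?c (Suc n) * x ^ Suc n)"
      by (simp add: diffs_def algebra_simps)
    also have "\<dots> = suminf (\<lambda>n. of_nat n * ?c n * x ^ n)"
      using suminf_split_head[OF sn[OF assms(3)]] by simp
    finally have e: "x * suminf (\<lambda>n. diffs ?c n * x ^ n) = suminf (\<lambda>n. of_nat n * ?c n * x ^ n)" .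
    have "lsum ?g' x = x powi (k0 - 1) * suminf (\<lambda>n. ?g' (k0 - 1 + int n) * x ^ n)"
      by (rule lsum_powser[OF lc g'0 assms(3) x0])
    also have "suminf (\<lambda>n. ?g' (k0 - 1 + int n) * x ^ n) = suminf (\<lambda>n. of_int k0 * (?c n * x ^ n)) + suminf (\<lambda>n. of_nat n * ?c n * x ^ n)"
      unfolding g' by (rule suminf_add[symmetric, OF summable_mult[OF sm[OF assms(3)]] sn[OF assms(3)]])
    also have "suminf (\<lambda>n. of_int k0 * (?c n * x ^ n)) = of_int k0 * ?G x"
      by (rule suminf_mult[OF sm[OF assms(3)]])
    also have "suminf (\<lambda>n. of_nat n * ?c n * x ^ n) = x * suminf (\<lambda>n. diffs ?c n * x ^ n)" by (simp add: e)
    also have "x powi (k0 - 1) * (of_int k0 * ?G x + x * suminf (\<lambda>n. diffs ?c n * x ^ n)) =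
       of_int k0 * x powi (k0 - 1) * ?G x + (x powi (k0 - 1) * x) * suminf (\<lambda>n. diffs ?c n * x ^ n)"
      by (simp add: algebra_simps)
    also have "x powi (k0 - 1) * x = x powi k0"
      using x0 by (simp add: power_int_diff)
    finally show ?thesis by simp
  qed
  ultimately have d: "((\<lambda>y. y powi k0 * ?G y) has_field_derivative lsum ?g' x) (at x)" by simp
  show "(lsum g has_field_derivative lsum ?g' x) (at x)"
  proof (rule has_field_derivative_transform_within_open[OF d])
    show "open (ball 0 \<rho> - {0::complex})" by auto
    show "x \<in> ball 0 \<rho> - {0}" using assms by auto
    fix y :: complex assume "y \<in> ball 0 \<rho> - {0}"
    then show "y powi k0 * ?G y = lsum g y" using lsum_powser[OF assms(1) k0, where x = y] by auto
  qed
qed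

lemma lsum_holomorphic:
  assumes "lconv g \<rho>"
  shows "lsum g holomorphic_on (ball 0 \<rho> - {0})"
proof (rule holomorphic_onI)
  fix x :: complex assume "x \<in> ball 0 \<rho> - {0}"
  then have "0 < norm x" "norm x < \<rho>" by auto
  from lsum_has_derivative(2)[OF assms this]
  show "lsum g field_differentiable at x within (ball 0 \<rho> - {0})"
    unfolding field_differentiable_def by (blast intro: has_field_derivative_at_within)
qed

lemma lsum_shift:
  assumes "lconv g \<rho>"
  shows "lconv (\<lambda>k. g (k + d)) \<rho>"
    and "x \<noteq> 0 \<Longrightarrow> lsum (\<lambda>k. g (k + d)) x = x powi (- d) * lsum g x"
proof -
  have e: "(\<lambda>k. g (k + d) * x powi k) = (\<lambda>k. x powi (- d) * (g (k + d) * x powi (k + d)))"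
    if "x \<noteq> 0" for x
  proof
    fix k
    have "x powi (- d) * x powi (k + d) = x powi k"
      using power_int_add[of x "- d" "k + d"] that by simp
    then show "g (k + d) * x powi k = x powi (- d) * (g (k + d) * x powi (k + d))"
      by (simp add: mult.left_commute)
  qed
  have bij: "bij_betw (\<lambda>k. k + d) UNIV UNIV"
    by (rule bij_betwI[of _ _ _ "\<lambda>k. k - d"]) auto
  show "lconv (\<lambda>k. g (k + d)) \<rho>"
    unfolding lconv_def
  proof (intro conjI allI impI)
    obtain k0 where k0: "\<And>k. k < k0 \<Longrightarrow> g k = 0" using assms(1) unfolding lconv_def by blast
    then show "\<exists>k0. \<forall>k<k0. g (k + d) = 0" by (intro exI[of _ "k0 - d"]) auto
    fix x :: complex assume x: "0 < norm x \<and> norm x < \<rho>"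
    then have "(\<lambda>k. g k * x powi k) summable_on UNIV" using assms unfolding lconv_def by auto
    then have "(\<lambda>k. g (k + d) * x powi (k + d)) summable_on UNIV"
      using summable_on_reindex_bij_betw[OF bij, of "\<lambda>k. g k * x powi k"] by simp
    then show "(\<lambda>k. g (k + d) * x powi k) summable_on UNIV"
      using e[of x] x by (auto intro!: summable_on_cmult_right)
  qed
  assume x: "x \<noteq> 0"
  have "lsum (\<lambda>k. g (k + d)) x = (\<Sum>\<^sub>\<infinity>k. x powi (- d) * (g (k + d) * x powi (k + d)))"
    unfolding lsum_def e[OF x] ..
  also have "\<dots> = x powi (- d) * (\<Sum>\<^sub>\<infinity>k. (g (k + d) * x powi (k + d)))"
    by (rule infsum_cmult_right')
  also have "(\<Sum>\<^sub>\<infinity>k. (g (k + d) * x powi (k + d))) = lsum g x"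
    unfolding lsum_def by (rule infsum_reindex_bij_betw[OF bij, of "\<lambda>k. g k * x powi k"])
  finally show "lsum (\<lambda>k. g (k + d)) x = x powi (- d) * lsum g x" .
qed

section \<open>Binomial resummation and translation\<close>

lemma binomial_series_abs_summable:
  fixes z :: complex
  assumes "norm z < 1"
  shows "summable (\<lambda>n. norm ((a gchoose n) * z ^ n))"
proof -
  define w where "w = (of_real ((norm z + 1) / 2) :: complex)"
  have "norm w = \<bar>(norm z + 1) / 2\<bar>" unfolding w_def by (rule norm_of_real)
  then have "norm w < 1" "norm z < norm w" using assms norm_ge_zero[of z] by auto
  then show ?thesis
    using powser_insidea[of "\<lambda>n. a gchoose n" w z] gen_binomial_complex[of w a] by (auto dest: sums_summable)
qed

lemma binomial_series_has_sum:
  fixes z :: complex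
  assumes "norm z < 1"
  shows "((\<lambda>i. (of_int e gchoose i) * z ^ i) has_sum (1 + z) powi e) UNIV"
proof -
  have "1 + z \<noteq> 0" using assms by (metis add_eq_0_iff norm_minus_cancel norm_one less_irrefl)
  then have "(1 + z) powr of_int e = (1 + z) powi e" by (simp add: complex_powr_of_int)
  then have "(\<lambda>i. (of_int e gchoose i) * z ^ i) sums (1 + z) powi e"
    using gen_binomial_complex[OF assms, of "of_int e"] by simp
  then show ?thesis
    by (rule norm_summable_imp_has_sum[OF binomial_series_abs_summable[OF assms]])
qed

text \<open>The coefficients of \<open>\<Sum> g_k x^k (1 + c x)^(E k)\<close>, re-expanded in powers of \<open>x\<close>. Constant \<open>E\<close> multiplies a
  series by a power of \<open>1 + c x\<close>, and \<open>E k = e - k\<close> substitutes \<open>x / (1 + c x)\<close> for \<open>x\<close>.\<close>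

definition resum :: "(int \<Rightarrow> int) \<Rightarrow> complex \<Rightarrow> (int \<Rightarrow> complex) \<Rightarrow> int \<Rightarrow> complex" where
  "resum E c g n = Sum_any (\<lambda>i::nat. (of_int (E (n - int i)) gchoose i) * c ^ i * g (n - int i))"

lemma resum_finite:
  assumes "\<And>k. k < k0 \<Longrightarrow> g k = (0::complex)"
  shows "finite {i::nat. F i * g (n - int i) \<noteq> 0}"
proof (rule finite_subset)
  show "{i::nat. F i * g (n - int i) \<noteq> 0} \<subseteq> {..nat (n - k0)}"
  proof
    fix i assume "i \<in> {i::nat. F i * g (n - int i) \<noteq> 0}"
    then have "g (n - int i) \<noteq> 0" by auto
    then have "\<not> n - int i < k0" using assms by blast
    then show "i \<in> {..nat (n - k0)}" by auto
  qed
qed simp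

lemma resum_bdd:
  assumes "\<And>k. k < k0 \<Longrightarrow> g k = 0" "n < k0"
  shows "resum E c g n = 0"
proof -
  have "(\<lambda>i::nat. (of_int (E (n - int i)) gchoose i) * c ^ i * g (n - int i)) = (\<lambda>i. 0)"
    using assms by (auto simp: fun_eq_iff)
  then show ?thesis unfolding resum_def by (simp only: Sum_any.neutral)
qed

lemma resum_has_sum:
  assumes g: "\<And>k. k < k0 \<Longrightarrow> g k = 0" and x: "x \<noteq> 0" and cx: "norm (c * x) < 1"
    and sm: "(\<lambda>(k, i::nat). g k * x powi k * ((of_int (E k) gchoose i) * (c * x) ^ i)) summable_on (UNIV \<times> UNIV)"
  shows "((\<lambda>n. resum E c g n * x powi n) has_sum (\<Sum>\<^sub>\<infinity>k. g k * x powi k * (1 + c * x) powi (E k))) UNIV"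
proof -
  let ?F = "\<lambda>(k, i::nat). g k * x powi k * ((of_int (E k) gchoose i) * (c * x) ^ i)"
  obtain S where S: "(?F has_sum S) (UNIV \<times> UNIV)" using sm unfolding summable_on_def by blast
  have 1: "((\<lambda>k. g k * x powi k * (1 + c * x) powi (E k)) has_sum S) UNIV"
    by (rule has_sum_SigmaD[OF S])
      (use has_sum_cmult_right[OF binomial_series_has_sum[OF cx]] in \<open>simp\<close>)
  have "((\<lambda>(n, i). ?F (n - int i, i)) has_sum S) (UNIV \<times> UNIV)"
  proof -
    have "((\<lambda>p. ?F ((\<lambda>(n, i). (n - int i, i)) p)) has_sum S) (UNIV \<times> UNIV) \<longleftrightarrow> (?F has_sum S) (UNIV \<times> UNIV)"
      by (rule has_sum_reindex_bij_betw, rule bij_betwI[of _ _ _ "\<lambda>(k, i). (k + int i, i)"]) auto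
    moreover have "(\<lambda>p. ?F ((\<lambda>(n, i). (n - int i, i)) p)) = (\<lambda>(n, i). ?F (n - int i, i))" by auto
    ultimately show ?thesis using S by simp
  qed
  then have 2: "((\<lambda>n. resum E c g n * x powi n) has_sum S) UNIV"
  proof (rule has_sum_SigmaD)
    fix n :: int
    let ?h = "\<lambda>i::nat. (of_int (E (n - int i)) gchoose i) * c ^ i * g (n - int i)"
    have "(?h has_sum resum E c g n) UNIV"
      unfolding resum_def by (rule has_sum_Sum_any, rule resum_finite[OF g])
    from has_sum_cmult_left[OF this, of "x powi n"]
    have "((\<lambda>i. ?h i * x powi n) has_sum resum E c g n * x powi n) UNIV" .
    moreover have "(\<lambda>i. ?h i * x powi n) = (\<lambda>i. (\<lambda>(n, i). ?F (n - int i, i)) (n, i))"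
    proof
      fix i
      have "x powi (n - int i) * x ^ i = x powi n"
        using power_int_add[of x "n - int i" "int i"] x by simp
      then have "?h i * x powi n = ?h i * (x powi (n - int i) * x ^ i)" by simp
      then show "?h i * x powi n = (\<lambda>(n, i). ?F (n - int i, i)) (n, i)"
        by (simp add: power_mult_distrib mult_ac)
    qed
    ultimately show "((\<lambda>i. (\<lambda>(n, i). ?F (n - int i, i)) (n, i)) has_sum resum E c g n * x powi n) UNIV" by simp
  qed
  from 1 have "S = (\<Sum>\<^sub>\<infinity>k. g k * x powi k * (1 + c * x) powi (E k))" by (simp add: infsumI)
  with 2 show ?thesis by simp
qed

lemma resum_summable:
  fixes g :: "int \<Rightarrow> complex" and c x :: complex
  assumes g: "\<And>k. k < k0 \<Longrightarrow> g k = 0" and cx: "norm (c * x) < 1"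
    and B: "\<And>k. k \<ge> K \<Longrightarrow> (\<Sum>\<^sub>\<infinity>i. norm ((of_int (E k) gchoose i) * (c * x) ^ i)) \<le> B k"
    and sB: "(\<lambda>k. norm (g k * x powi k) * B k) summable_on UNIV"
  shows "(\<lambda>(k, i::nat). g k * x powi k * ((of_int (E k) gchoose i) * (c * x) ^ i)) summable_on (UNIV \<times> UNIV)"
proof -
  let ?F = "\<lambda>(k, i::nat). g k * x powi k * ((of_int (E k) gchoose i) * (c * x) ^ i)"
  let ?b = "\<lambda>k i. (of_int (E k) gchoose i) * (c * x) ^ i"
  let ?h = "\<lambda>k. norm (g k * x powi k) * (\<Sum>\<^sub>\<infinity>i. norm (?b k i))"
  have sb: "(\<lambda>i. norm (?b k i)) summable_on UNIV" for k
    using binomial_series_abs_summable[OF cx, of "of_int (E k)"] by (auto intro!: summable_nonneg_imp_summable_on)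
  have "(\<lambda>p. norm (?F p)) summable_on (UNIV \<times> UNIV)"
  proof (rule Infinite_Sum.abs_summable_on_Sigma_iff[THEN iffD2], intro conjI ballI)
    fix k :: int
    show "(\<lambda>i. norm (?F (k, i))) summable_on UNIV"
      using summable_on_cmult_right[OF sb[of k], of "norm (g k * x powi k)"] by (simp add: norm_mult)
  next
    have e: "(\<Sum>\<^sub>\<infinity>i. norm (?F (k, i))) = ?h k" for k
      by (simp add: norm_mult infsum_cmult_right')
    have fin: "?h summable_on {k0..<K}"
      by (rule summable_on_finite) simp
    have "?h summable_on {max k0 K..}"
    proof (rule summable_on_comparison_test)
      show "(\<lambda>k. norm (g k * x powi k) * B k) summable_on {max k0 K..}"
        by (rule summable_on_subset_banach[OF sB]) simp
      fix k assume "k \<in> {max k0 K..}"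
      then show "?h k \<le> norm (g k * x powi k) * B k"
        by (intro mult_left_mono B) auto
      show "0 \<le> ?h k"
        by (intro mult_nonneg_nonneg infsum_nonneg) auto
    qed
    then have "?h summable_on ({k0..<K} \<union> {max k0 K..})"
      by (intro summable_on_Un_disjoint fin) auto
    then have "?h summable_on UNIV"
      by (rule summable_on_cong_neutral[THEN iffD1, rotated 3]) (use g in auto)
    moreover have "?h k \<ge> 0" for k
      by (intro mult_nonneg_nonneg infsum_nonneg) auto
    ultimately show "(\<lambda>k. norm (\<Sum>\<^sub>\<infinity>i. norm (?F (k, i)))) summable_on UNIV"
      unfolding e by simp
  qed
  then show ?thesis by (simp only: summable_on_iff_abs_summable_on_complex)
qed

lemma lconv_abs_summable:
  assumes "lconv g \<rho>" "0 < norm x" "norm x < \<rho>"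
  shows "(\<lambda>k. norm (g k * x powi k)) summable_on UNIV"
proof -
  have "(\<lambda>k. g k * x powi k) summable_on UNIV" using assms unfolding lconv_def by auto
  then show ?thesis by (simp only: summable_on_iff_abs_summable_on_complex)
qed

text \<open>For a negative integral exponent the moduli of the terms form the binomial series at \<open>- norm z\<close>, so the
  double series of a translation is dominated by a Laurent series at a slightly larger point.\<close>

lemma binomial_norm_has_sum:
  fixes z :: complex
  assumes "norm z < 1"
  shows "((\<lambda>i. norm ((of_int (- int n) gchoose i) * z ^ i)) has_sum (1 - norm z) powi (- int n)) UNIV"
proof -
  let ?w = "- complex_of_real (norm z)"
  have trm: "complex_of_real (norm ((of_int (- int n) gchoose i) * z ^ i)) = (of_int (- int n) gchoose i) * ?w ^ i" for i
  proof -
    have "\<exists>N::nat. (of_int (- int n) gchoose i :: complex) = (-1) ^ i * of_nat N"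
    proof (cases "n + i = 0")
      case True then show ?thesis by (intro exI[of _ 1]) auto
    next
      case False
      have "(of_int (- int n) gchoose i :: complex) = (-1) ^ i * ((of_nat n + of_nat i - 1) gchoose i)"
        using gbinomial_minus[of "of_nat n :: complex" i] by simp
      also have "of_nat n + of_nat i - 1 = (of_nat (n + i - 1) :: complex)"
      proof -
        have "n + i \<ge> 1" using False by linarith
        then have "(of_nat (n + i - 1) :: complex) = of_nat (n + i) - of_nat 1" by (rule of_nat_diff)
        then show ?thesis by simp
      qed
      finally show ?thesis by (metis binomial_gbinomial)
    qed
    then obtain N :: nat where N: "(of_int (- int n) gchoose i :: complex) = (-1) ^ i * of_nat N" by blast
    have "?w ^ i = (-1) ^ i * complex_of_real (norm z) ^ i" by (rule power_minus)
    moreover have "((-1) ^ i * (-1) ^ i :: complex) = 1" by (simp flip: power_mult_distrib)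
    ultimately show ?thesis unfolding N
      by (simp add: norm_mult norm_power mult_ac)
  qed
  have "((\<lambda>i. complex_of_real (norm ((of_int (- int n) gchoose i) * z ^ i))) has_sum (1 + ?w) powi (- int n)) UNIV"
    unfolding trm by (rule binomial_series_has_sum) (use assms in simp)
  moreover have "(1 + ?w) powi (- int n) = complex_of_real ((1 - norm z) powi (- int n))"
    by simp
  ultimately show ?thesis using has_sum_of_real_iff by metis
qed

lemma laurent_binomial:
  assumes g: "lconv g \<rho>" and x: "0 < norm x" "norm x < \<rho>" and cx: "norm (c * x) < 1"
  shows "((\<lambda>n. resum (\<lambda>_. e) c g n * x powi n) has_sum ((1 + c * x) powi e * lsum g x)) UNIV"
proof -
  obtain k0 where k0: "\<And>k. k < k0 \<Longrightarrow> g k = 0" using g unfolding lconv_def by blast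
  let ?S = "\<Sum>\<^sub>\<infinity>i. norm ((of_int e gchoose i) * (c * x) ^ i)"
  have "(\<lambda>k. norm (g k * x powi k)) summable_on UNIV"
    by (rule lconv_abs_summable[OF g x])
  then have "(\<lambda>k. norm (g k * x powi k) * ?S) summable_on UNIV" by (rule summable_on_cmult_left)
  from resum_summable[where E = "\<lambda>_. e", OF k0 cx _ this]
  have sm: "(\<lambda>(k, i::nat). g k * x powi k * ((of_int e gchoose i) * (c * x) ^ i)) summable_on (UNIV \<times> UNIV)"
    by auto
  have "x \<noteq> 0" using x by auto
  from resum_has_sum[where E = "\<lambda>_. e", OF k0 this cx sm]
  have "((\<lambda>n. resum (\<lambda>_. e) c g n * x powi n) has_sum (\<Sum>\<^sub>\<infinity>k. g k * x powi k * (1 + c * x) powi e)) UNIV" by simp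
  also have "(\<Sum>\<^sub>\<infinity>k. g k * x powi k * (1 + c * x) powi e) = (1 + c * x) powi e * lsum g x"
    unfolding lsum_def by (simp add: infsum_cmult_left' mult.commute)
  finally show ?thesis .
qed

lemma laurent_translate:
  assumes g: "lconv g \<rho>" and x: "x \<noteq> 0" and cx: "norm (c * x) < 1" and xr: "norm x < \<rho> * (1 - norm (c * x))"
  shows "((\<lambda>n. resum (\<lambda>k. e - k) c g n * x powi n) has_sum ((1 + c * x) powi e * lsum g (x / (1 + c * x)))) UNIV"
proof -
  obtain k0 where k0: "\<And>k. k < k0 \<Longrightarrow> g k = 0" using g unfolding lconv_def by blast
  define r where "r = norm (c * x)"
  define y where "y = x / of_real (1 - r)"
  have r1: "1 - r > 0" using cx r_def by simp
  have ny: "norm y = norm x / (1 - r)" using r1 unfolding y_def by (simp add: norm_divide del: of_real_diff)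
  have y: "0 < norm y" "norm y < \<rho>" using x r1 xr by (auto simp: ny r_def pos_divide_less_eq)
  have "(\<lambda>k. norm (g k * y powi k)) summable_on UNIV"
    by (rule lconv_abs_summable[OF g y])
  then have "(\<lambda>k. (1 - r) powi e * norm (g k * y powi k)) summable_on UNIV" by (rule summable_on_cmult_right)
  moreover have "(1 - r) powi e * norm (g k * y powi k) = norm (g k * x powi k) * (1 - r) powi (e - k)" for k
    using r1 by (simp add: norm_mult norm_power_int ny power_int_divide_distrib power_int_diff)
  ultimately have sB: "(\<lambda>k. norm (g k * x powi k) * (1 - r) powi (e - k)) summable_on UNIV" by simp
  have B: "(\<Sum>\<^sub>\<infinity>i. norm ((of_int (e - k) gchoose i) * (c * x) ^ i)) \<le> (1 - r) powi (e - k)" if "k \<ge> e" for k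
  proof -
    have "e - k = - int (nat (k - e))" using that by simp
    then show ?thesis using infsumI[OF binomial_norm_has_sum[OF cx, of "nat (k - e)"]] r_def by simp
  qed
  have sm: "(\<lambda>(k, i::nat). g k * x powi k * ((of_int (e - k) gchoose i) * (c * x) ^ i)) summable_on (UNIV \<times> UNIV)"
    by (rule resum_summable[where E = "\<lambda>k. e - k", OF k0 cx B sB])
  have nz: "1 + c * x \<noteq> 0" using cx by (metis add_eq_0_iff norm_minus_cancel norm_one less_irrefl)
  from resum_has_sum[where E = "\<lambda>k. e - k", OF k0 x cx sm]
  have "((\<lambda>n. resum (\<lambda>k. e - k) c g n * x powi n) has_sum (\<Sum>\<^sub>\<infinity>k. g k * x powi k * (1 + c * x) powi (e - k))) UNIV" by simp
  also have "(\<lambda>k. g k * x powi k * (1 + c * x) powi (e - k)) = (\<lambda>k. (1 + c * x) powi e * (g k * (x / (1 + c * x)) powi k))"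
    using nz by (simp add: fun_eq_iff power_int_diff power_int_divide_distrib)
  also have "(\<Sum>\<^sub>\<infinity>k. (1 + c * x) powi e * (g k * (x / (1 + c * x)) powi k)) = (1 + c * x) powi e * lsum g (x / (1 + c * x))"
    unfolding lsum_def by (rule infsum_cmult_right')
  finally show ?thesis .
qed

lemma lconv_resum:
  assumes "lconv g \<rho>" "norm c * \<rho> \<le> 1" "c \<noteq> 0"
  shows "lconv (resum (\<lambda>_. e) c g) \<rho>"
  unfolding lconv_def
proof (intro conjI allI impI)
  obtain k0 where k0: "\<And>k. k < k0 \<Longrightarrow> g k = 0" using assms(1) unfolding lconv_def by blast
  then show "\<exists>k0. \<forall>k<k0. resum (\<lambda>_. e) c g k = 0" using resum_bdd[of k0 g _ "\<lambda>_. e" c] by blast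
  fix x :: complex assume x: "0 < norm x \<and> norm x < \<rho>"
  then have "norm (c * x) < 1" using assms(2,3)
    by (metis (no_types, opaque_lifting) mult_strict_left_mono norm_mult order_less_le_trans zero_less_norm_iff)
  then show "(\<lambda>k. resum (\<lambda>_. e) c g k * x powi k) summable_on UNIV"
    using laurent_binomial[OF assms(1), of x c e] x unfolding summable_on_def by blast
qed

lemma lsum_resum:
  assumes "lconv g \<rho>" "0 < norm x" "norm x < \<rho>" "norm (c * x) < 1"
  shows "lsum (resum (\<lambda>_. e) c g) x = (1 + c * x) powi e * lsum g x"
  using infsumI[OF laurent_binomial[OF assms]] unfolding lsum_def by simp

lemma lsum_cmult: "lsum (\<lambda>k. z * g k) x = z * lsum g x"
  unfolding lsum_def by (simp add: mult.assoc infsum_cmult_right')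

lemma lconv_cmult: assumes "lconv g \<rho>" shows "lconv (\<lambda>k. z * g k) \<rho>"
  using assms unfolding lconv_def by (auto simp: mult.assoc intro!: summable_on_cmult_right)

section \<open>Three expansions of one function on the sphere\<close>

text \<open>The discs \<open>|t| < 1\<close> and \<open>|t - 1| < 1\<close> cover \<open>|t - 2/5| < 4/5\<close>, and \<open>|t - 2/5| > 3/5\<close> covers the rest of the
  plane with an overlapping annulus.\<close>

lemma ball_cover:
  fixes t :: complex
  assumes "norm (t - 2/5) < 4/5" "norm t \<ge> 1"
  shows "norm (t - 1) < 1"
proof (rule ccontr)
  assume "\<not> norm (t - 1) < 1"
  then have 1: "(norm (t - 1))\<^sup>2 \<ge> 1" by (simp add: power2_eq_1_iff one_le_power)
  have 2: "(norm t)\<^sup>2 \<ge> 1" using assms(2) by (simp add: one_le_power)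
  have 3: "(norm (t - 2/5))\<^sup>2 < (4/5)\<^sup>2" using assms(1) by (intro power_strict_mono) auto
  have "(norm (t - 2/5))\<^sup>2 = 3/5 * (norm t)\<^sup>2 + 2/5 * (norm (t - 1))\<^sup>2 - 6/25"
    unfolding cmod_power2 by (simp add: power2_eq_square algebra_simps)
  then have "(norm (t - 2/5))\<^sup>2 \<ge> 19/25" using 1 2 by linarith
  then show False using 3 by (simp add: power2_eq_square)
qed

lemma half_disc_props:
  fixes t :: complex
  assumes "Re t > 1"
  shows "norm t > 1" "t \<noteq> 0" "t \<noteq> 1" "norm (t - 2/5) > 3/5"
proof -
  show "norm t > 1" using complex_Re_le_cmod[of t] assms by linarith
  show "t \<noteq> 0" "t \<noteq> 1" using assms by auto
  have "Re (t - 2/5) \<le> norm (t - 2/5)" by (rule complex_Re_le_cmod)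
  then show "norm (t - 2/5) > 3/5" using assms by simp
qed

lemma outside_ne:
  fixes t :: complex
  assumes "norm (t - 2/5) > 3/5"
  shows "t \<noteq> 0" "t \<noteq> 1"
proof -
  show "t \<noteq> 0" using assms by auto
  have "(1 - 2/5 :: complex) = of_real (3/5)" by simp
  then have "norm (1 - 2/5 :: complex) = 3/5" by (simp only: norm_of_real)
  then show "t \<noteq> 1" using assms by auto
qed

lemma holomorphic_eq_on_connected:
  assumes "f holomorphic_on S" "g holomorphic_on S" "open S" "connected S"
    "open U" "U \<subseteq> S" "U \<noteq> {}" "\<And>z. z \<in> U \<Longrightarrow> f z = g z" "w \<in> S"
  shows "f w = g w"
  using analytic_continuation_open[of U S f g] assms by blast

lemma lconv_lower_bound:
  assumes "lconv g \<rho>"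
  obtains N :: nat where "\<And>M k. M \<ge> N \<Longrightarrow> k < - int M \<Longrightarrow> g k = 0"
proof -
  obtain k0 where k0: "\<And>k. k < k0 \<Longrightarrow> g k = 0" using assms unfolding lconv_def by blast
  show thesis by (rule that[of "nat (- k0)"]) (use k0 in auto)
qed

text \<open>Subtract from \<open>f\<close> the polynomial part at infinity and the principal parts at \<open>1\<close> and \<open>0\<close>. What remains continues
  to an entire function that tends to \<open>0\<close> at infinity, so it vanishes by Liouville, and its coefficient of \<open>1 / t\<close> at infinity
  is \<open>a_0 - b_0 - c_0\<close>. The continuation is a sequence
  of applications of the identity theorem on overlapping regions.\<close>

lemma residue_three_points:
  fixes a b c :: "int \<Rightarrow> complex" and f :: "complex \<Rightarrow> complex"
  assumes a: "lconv (\<lambda>k. a (k - 1)) 1" and b: "lconv (\<lambda>k. b (- k - 1)) 1" and c: "lconv (\<lambda>k. c (- k - 1)) 1"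
    and f: "f holomorphic_on {t. 3/5 < norm (t - 2/5)}"
    and fa: "\<And>t. norm t > R \<Longrightarrow> f t = lsum (\<lambda>k. a (k - 1)) (1 / t)"
    and fb: "\<And>t. Re t > 1 \<Longrightarrow> norm (t - 1) < 1 \<Longrightarrow> f t = lsum (\<lambda>k. b (- k - 1)) (t - 1)"
    and bc: "\<And>t. norm (t - 4/5) < 1/10 \<Longrightarrow> lsum (\<lambda>k. b (- k - 1)) (t - 1) = lsum (\<lambda>k. c (- k - 1)) t"
  shows "a 0 = b 0 + c 0"
proof -
  obtain Na where Na: "\<And>M k. M \<ge> Na \<Longrightarrow> k < - int M \<Longrightarrow> a (k - 1) = 0" using lconv_lower_bound[OF a] by blast
  obtain Nb where Nb: "\<And>M k. M \<ge> Nb \<Longrightarrow> k < - int M \<Longrightarrow> b (- k - 1) = 0" using lconv_lower_bound[OF b] by blast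
  obtain Nc where Nc: "\<And>M k. M \<ge> Nc \<Longrightarrow> k < - int M \<Longrightarrow> c (- k - 1) = 0" using lconv_lower_bound[OF c] by blast
  define N where "N = Na + Nb + Nc + 1"
  have N1: "N \<ge> 1" by (simp add: N_def)
  let ?an = "\<lambda>n. a (int n - int N - 1)" and ?bn = "\<lambda>n. b (- (int n - int N) - 1)" and ?cn = "\<lambda>n. c (- (int n - int N) - 1)"
  let ?R = "{t::complex. 3/5 < norm (t - 2/5) \<and> norm (t - 2/5) < 4/5}" and ?L = "ball 0 1 \<inter> ball (1::complex) 1"
  have aN: "\<And>k. k < - int N \<Longrightarrow> a (k - 1) = 0" using Na[of N] by (simp add: N_def)
  have bN: "\<And>k. k < - int N \<Longrightarrow> b (- k - 1) = 0" using Nb[of N] by (simp add: N_def)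
  have cN: "\<And>k. k < - int N \<Longrightarrow> c (- k - 1) = 0" using Nc[of N] by (simp add: N_def)
  define PA where "PA = (\<lambda>t::complex. \<Sum>n<Suc N. ?an n * t ^ (N - n))"
  define PB where "PB = (\<lambda>t::complex. \<Sum>n<N. ?bn n * (t - 1) powi (int n - int N))"
  define PC where "PC = (\<lambda>t::complex. \<Sum>n<N. ?cn n * t powi (int n - int N))"
  obtain rA where rA: "rA holomorphic_on ball 0 1" "rA 0 = a (int (Suc N) - int N - 1)"
    "\<And>x. 0 < norm x \<Longrightarrow> norm x < 1 \<Longrightarrow> lsum (\<lambda>k. a (k - 1)) x =
      (\<Sum>n<Suc N. ?an n * x powi (int n - int N)) + x powi (int (Suc N) - int N) * rA x"
    by (rule lsum_split[OF a _ zero_less_one, where q = "Suc N" and N = N], erule aN) (rule that, assumption+)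
  obtain rB where rB: "rB holomorphic_on ball 0 1"
    "\<And>x. 0 < norm x \<Longrightarrow> norm x < 1 \<Longrightarrow> lsum (\<lambda>k. b (- k - 1)) x =
      (\<Sum>n<N. ?bn n * x powi (int n - int N)) + x powi (int N - int N) * rB x"
    by (rule lsum_split[OF b _ zero_less_one, where q = N and N = N], erule bN) (rule that, assumption+)
  obtain rC where rC: "rC holomorphic_on ball 0 1"
    "\<And>x. 0 < norm x \<Longrightarrow> norm x < 1 \<Longrightarrow> lsum (\<lambda>k. c (- k - 1)) x =
      (\<Sum>n<N. ?cn n * x powi (int n - int N)) + x powi (int N - int N) * rC x"
    by (rule lsum_split[OF c _ zero_less_one, where q = N and N = N], erule cN) (rule that, assumption+)
  have A: "lsum (\<lambda>k. a (k - 1)) (1 / t) = PA t + (1 / t) * rA (1 / t)" if "norm t > 1" for t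
  proof -
    have t0: "t \<noteq> 0" using that by auto
    have e: "(1 / t) powi (int n - int N) = t ^ (N - n)" if "n < Suc N" for n
    proof -
      have i: "int n - int N = - int (N - n)" using that by auto
      show ?thesis unfolding i using t0 by (simp add: power_int_minus power_one_over del: of_nat_diff)
    qed
    have "(\<Sum>n<Suc N. ?an n * (1 / t) powi (int n - int N)) = PA t"
      unfolding PA_def by (intro sum.cong refl) (use e in auto)
    then show ?thesis using rA(3)[of "1 / t"] that t0
      by (simp add: norm_divide del: sum.lessThan_Suc)
  qed
  have B: "lsum (\<lambda>k. b (- k - 1)) (t - 1) = PB t + rB (t - 1)" if "norm (t - 1) < 1" "t \<noteq> 1" for t
    using rB(2)[of "t - 1"] that unfolding PB_def by simp
  have C: "lsum (\<lambda>k. c (- k - 1)) t = PC t + rC t" if "norm t < 1" "t \<noteq> 0" for t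
    using rC(2)[of t] that unfolding PC_def by simp
  let ?D = "{t::complex. 3/5 < norm (t - 2/5)}"
  have hPA: "PA holomorphic_on S" for S unfolding PA_def by (intro holomorphic_intros)
  have hPB: "PB holomorphic_on S" if "1 \<notin> S" for S unfolding PB_def
    using that by (intro holomorphic_intros) auto
  have hPC: "PC holomorphic_on S" if "0 \<notin> S" for S unfolding PC_def
    using that by (intro holomorphic_intros) auto
  \<comment> \<open>One function in three charts: \<open>U\<close> outside, \<open>V\<close> near \<open>0\<close> and \<open>W\<close> near \<open>1\<close>.\<close>
  define U where "U = (\<lambda>t. f t - PA t - PB t - PC t)"
  define V where "V = (\<lambda>t. rC t - PA t - PB t)"
  define W where "W = (\<lambda>t. rB (t - 1) - PA t - PC t)"
  have hU: "U holomorphic_on ?D" unfolding U_def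
    using outside_ne by (intro holomorphic_intros f hPA hPB hPC) force+
  have hV: "V holomorphic_on ball 0 1" unfolding V_def
    by (intro holomorphic_intros rC hPA hPB) auto
  have hrB: "(\<lambda>t. rB (t - 1)) holomorphic_on ball 1 1"
  proof -
    have "rB \<circ> (\<lambda>t. t - 1) holomorphic_on ball 1 1"
      by (rule holomorphic_on_compose_gen[OF _ rB(1)])
        (auto intro!: holomorphic_intros simp: dist_norm norm_minus_commute)
    then show ?thesis by (simp add: o_def)
  qed
  have hW: "W holomorphic_on ball 1 1" unfolding W_def
    by (intro holomorphic_intros hrB hPA hPC) auto
  have VW: "V t = W t" if "norm t < 1" "norm (t - 1) < 1" for t
  proof (rule holomorphic_eq_on_connected[where f = V and g = W and w = t and S = "?L" and U = "ball (4/5) (1/10)"])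
    show "V holomorphic_on ?L" "W holomorphic_on ?L"
      using hV hW by (auto intro: holomorphic_on_subset)
    show "connected (?L)"
      by (intro convex_connected convex_Int convex_ball)
    show sub: "ball (4/5) (1/10) \<subseteq> ?L"
    proof
      fix z :: complex assume "z \<in> ball (4/5) (1/10)"
      then have z: "norm (z - 4/5) < 1/10" by (simp add: dist_norm norm_minus_commute)
      have "norm z \<le> norm (z - 4/5) + norm (4/5 :: complex)" by (metis diff_add_cancel norm_triangle_ineq)
      moreover have "norm (z - 1) \<le> norm (z - 4/5) + norm (- 1/5 :: complex)"
        using norm_triangle_ineq[of "z - 4/5" "-1/5"] by simp
      ultimately show "z \<in> ?L" using z by (simp add: dist_norm norm_minus_commute)
    qed
    fix z :: complex assume z: "z \<in> ball (4/5) (1/10)"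
    then have z': "norm (z - 4/5) < 1/10" by (simp add: dist_norm norm_minus_commute)
    have z1: "z \<in> ?L" using z sub by blast
    have "z \<noteq> 0" "z \<noteq> 1" using z1 by (auto simp: dist_norm)
    moreover have "norm z < 1" "norm (z - 1) < 1" using z1 by (auto simp: dist_norm norm_minus_commute)
    ultimately have "rC z + PC z = rB (z - 1) + PB z"
      using bc[OF z'] B[of z] C[of z] by (simp add: add.commute)
    then have "rC z = rB (z - 1) + PB z - PC z" by (rule eq_diff_eq[THEN iffD2])
    then show "V z = W z" unfolding V_def W_def by simp
  qed (use that in \<open>auto simp: dist_norm norm_minus_commute\<close>)
  let ?b = "ball (2/5 :: complex) (4/5)"
  \<comment> \<open>\<open>V\<close> and \<open>W\<close> agree on the lens, so they glue to \<open>FU\<close> on both discs; \<open>U\<close> agrees with \<open>FU\<close> on the annulus.\<close>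
  define FU where "FU = (\<lambda>t::complex. if norm t < 1 then V t else W t)"
  have FUV: "FU t = V t" if "norm t < 1" for t using that by (simp add: FU_def)
  have FUW: "FU t = W t" if "norm (t - 1) < 1" for t using that VW[of t] by (auto simp: FU_def)
  have hFU: "FU holomorphic_on ?b"
  proof -
    have "FU holomorphic_on ball 0 1" using hV by (rule holomorphic_transform) (simp add: FUV)
    moreover have "FU holomorphic_on ball 1 1" using hW
      by (rule holomorphic_transform) (simp add: FUW dist_norm norm_minus_commute)
    ultimately have "FU holomorphic_on ball 0 1 \<union> ball 1 1" by (intro holomorphic_on_Un) auto
    then show ?thesis
      by (rule holomorphic_on_subset) (use ball_cover in \<open>force simp: dist_norm norm_minus_commute\<close>)
  qed
  have UFU: "U t = FU t" if "t \<in> ?R" for t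
  proof (rule holomorphic_eq_on_connected[where f = U and g = FU and w = t and S = "?R" and U = "ball (11/10) (1/20)"])
    show "U holomorphic_on ?R"
      by (rule holomorphic_on_subset[OF hU]) auto
    show "FU holomorphic_on ?R"
      by (rule holomorphic_on_subset[OF hFU]) (auto simp: dist_norm norm_minus_commute)
    show "open ?R"
      by (intro open_Collect_conj open_Collect_less continuous_intros)
    show "connected ?R"
      by (rule connected_annulus(1)) simp
    have near: "1 < Re z \<and> norm (z - 1) < 1 \<and> norm (z - 2/5) < 4/5" if "z \<in> ball (11/10) (1/20)" for z
    proof -
      have z: "norm (z - 11/10) < 1/20" using that by (simp add: dist_norm norm_minus_commute)
      have "\<bar>Re (z - 11/10)\<bar> \<le> norm (z - 11/10)" by (rule abs_Re_le_cmod)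
      then have "Re z > 1" using z by simp
      moreover have "norm (z - 1) \<le> norm (z - 11/10) + norm (1/10 :: complex)"
        using norm_triangle_ineq[of "z - 11/10" "1/10"] by simp
      moreover have "norm (z - 2/5) \<le> norm (z - 11/10) + norm (7/10 :: complex)"
        using norm_triangle_ineq[of "z - 11/10" "7/10"] by simp
      ultimately show ?thesis using z by simp
    qed
    then show "ball (11/10) (1/20) \<subseteq> ?R"
      using half_disc_props(4) by blast
    fix z :: complex assume "z \<in> ball (11/10) (1/20)"
    note n = near[OF this]
    then have "f z = PB z + rB (z - 1)" using fb[of z] B[of z] half_disc_props(3)[of z] by simp
    then have "U z = W z" unfolding U_def W_def by simp
    then show "U z = FU z" using FUW n by simp
  qed (use that in auto)
  define F where "F = (\<lambda>t. if 3/5 < norm (t - 2/5) then U t else FU t)"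
  have "F holomorphic_on ?D" using hU by (rule holomorphic_transform) (simp add: F_def)
  moreover have "F holomorphic_on ?b" using hFU
    by (rule holomorphic_transform) (use UFU in \<open>auto simp: F_def dist_norm norm_minus_commute\<close>)
  moreover have "open ?D" by (intro open_Collect_less continuous_intros)
  ultimately have "F holomorphic_on ?D \<union> ?b" by (intro holomorphic_on_Un) auto
  moreover have "?D \<union> ?b = UNIV" by (auto simp: dist_norm norm_minus_commute)
  ultimately have hF: "F holomorphic_on UNIV" by simp
  \<comment> \<open>\<open>U t = G (1 / t) / t\<close> near infinity with \<open>G\<close> continuous at \<open>0\<close>: this gives both decay and the coefficient.\<close>
  define G where "G = (\<lambda>x. rA x - (\<Sum>n<N. ?bn n * (x ^ (N - n - 1) / (1 - x) ^ (N - n)))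
                     - (\<Sum>n<N. ?cn n * x ^ (N - n - 1)))"
  have UG: "U t = (1 / t) * G (1 / t)" if "norm t > R" "norm t > 2" for t
  proof -
    have t: "norm t > 1" "t \<noteq> 0" "t \<noteq> 1" "1 - 1 / t \<noteq> 0" using that by auto
    have e: "t powi (int n - int N) = (1 / t) * (1 / t) ^ (N - n - 1)"
      "(t - 1) powi (int n - int N) = (1 / t) * ((1 / t) ^ (N - n - 1) / (1 - 1 / t) ^ (N - n))" if "n < N" for n
    proof -
      have i: "int n - int N = - int (N - n)" using that by auto
      have s: "(1 / t) * (1 / t) ^ (N - n - 1) = (1 / t) ^ (N - n)" using that by (metis Suc_diff_1 power_Suc zero_less_diff)
      show "t powi (int n - int N) = (1 / t) * (1 / t) ^ (N - n - 1)"
        unfolding s i using t by (simp add: power_int_minus power_one_over field_simps)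
      have "t - 1 = t * (1 - 1 / t)" using t by (simp add: field_simps)
      then have "(t - 1) powi (int n - int N) = (1 / t) ^ (N - n) / (1 - 1 / t) ^ (N - n)"
        unfolding i using t by (simp add: power_int_minus power_int_mult_distrib power_mult_distrib power_one_over divide_inverse power_inverse)
      then show "(t - 1) powi (int n - int N) = (1 / t) * ((1 / t) ^ (N - n - 1) / (1 - 1 / t) ^ (N - n))"
        by (simp add: s[symmetric])
    qed
    have "U t = (1 / t) * rA (1 / t) - PB t - PC t" unfolding U_def using fa[OF that(1)] A[OF t(1)] by simp
    also have "PB t = (1 / t) * (\<Sum>n<N. ?bn n * ((1 / t) ^ (N - n - 1) / (1 - 1 / t) ^ (N - n)))"
      unfolding PB_def sum_distrib_left by (intro sum.cong refl) (simp only: e lessThan_iff mult.left_commute)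
    also have "PC t = (1 / t) * (\<Sum>n<N. ?cn n * (1 / t) ^ (N - n - 1))"
      unfolding PC_def sum_distrib_left by (intro sum.cong refl) (simp only: e lessThan_iff mult.left_commute)
    finally show ?thesis unfolding G_def by (simp only: right_diff_distrib)
  qed
  have rAc: "isCont rA 0"
    using rA(1) by (metis at_within_open centre_in_ball holomorphic_on_imp_continuous_on continuous_on_eq_continuous_at open_ball zero_less_one)
  have Gc: "isCont G 0" unfolding G_def by (intro continuous_intros rAc) auto
  have inv: "((\<lambda>t. 1 / t) \<longlongrightarrow> (0::complex)) at_infinity"
    using tendsto_inverse_0 by (simp add: divide_inverse)
  have GI: "((\<lambda>t. G (1 / t)) \<longlongrightarrow> G 0) at_infinity"
    by (rule isCont_tendsto_compose[OF Gc inv])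
  have UI: "(U \<longlongrightarrow> 0) at_infinity"
  proof -
    have "((\<lambda>t. (1 / t) * G (1 / t)) \<longlongrightarrow> 0 * G 0) at_infinity" by (rule tendsto_mult[OF inv GI])
    moreover have "\<forall>\<^sub>F t in at_infinity. (1 / t) * G (1 / t) = U t"
      using UG unfolding eventually_at_infinity by (intro exI[of _ "max R 2 + 1"]) auto
    ultimately show ?thesis using tendsto_cong by fastforce
  qed
  have FU0: "\<forall>\<^sub>F t in at_infinity. F t = U t"
    unfolding eventually_at_infinity
  proof (intro exI allI impI)
    fix t :: complex assume "2 \<le> norm t"
    moreover have "norm t \<le> norm (t - 2/5) + norm (2/5 :: complex)" by (metis diff_add_cancel norm_triangle_ineq)
    ultimately have "norm (t - 2/5) > 3/5" by simp
    then show "F t = U t" by (simp add: F_def)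
  qed
  have "(F \<longlongrightarrow> 0) at_infinity" using UI tendsto_cong[OF FU0] by blast
  then have F0: "F t = 0" for t by (rule Liouville_weak_0[OF hF])
  have "\<forall>\<^sub>F t in at_infinity. G (1 / t) = 0"
  proof -
    have "\<forall>\<^sub>F t::complex in at_infinity. norm t \<ge> max R 2 + 1" unfolding eventually_at_infinity by blast
    with FU0 show ?thesis
    proof eventually_elim
      case (elim t)
      then have "norm t > R" "norm t > 2" "t \<noteq> 0" by auto
      then show ?case using UG[of t] elim F0[of t] by simp
    qed
  qed
  then have "((\<lambda>t. G (1 / t)) \<longlongrightarrow> 0) at_infinity" using tendsto_cong by fastforce
  then have "G 0 = 0" using GI tendsto_unique trivial_limit_at_infinity by blast
  moreover have "(\<Sum>n<N. ?bn n * ((0::complex) ^ (N - n - 1) / (1 - 0) ^ (N - n))) = b 0"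
  proof -
    have "(\<Sum>n<N. ?bn n * ((0::complex) ^ (N - n - 1) / (1 - 0) ^ (N - n))) =
      (\<Sum>n\<in>{N - 1}. ?bn n * ((0::complex) ^ (N - n - 1) / (1 - 0) ^ (N - n)))"
      using N1 by (intro sum.mono_neutral_right) (auto simp: power_0_left)
    also have "\<dots> = b 0" using N1 by (simp add: of_nat_diff)
    finally show ?thesis .
  qed
  moreover have "(\<Sum>n<N. ?cn n * (0::complex) ^ (N - n - 1)) = c 0"
  proof -
    have "(\<Sum>n<N. ?cn n * (0::complex) ^ (N - n - 1)) =
      (\<Sum>n\<in>{N - 1}. ?cn n * (0::complex) ^ (N - n - 1))"
      using N1 by (intro sum.mono_neutral_right) (auto simp: power_0_left)
    also have "\<dots> = c 0" using N1 by (simp add: of_nat_diff)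
    finally show ?thesis .
  qed
  moreover have "rA 0 = a 0" using rA(2) by simp
  ultimately show ?thesis unfolding G_def by (simp add: algebra_simps)
qed

text \<open>A sequence of modes \<open>a_m\<close> is read as the series \<open>\<Sum> a_m t^(-m-1)\<close>, either in the variable \<open>1 / t\<close> (expansion at
  infinity) or in \<open>t\<close> itself (expansion at a finite point).\<close>

abbreviation inf_coeffs :: "(int \<Rightarrow> complex) \<Rightarrow> int \<Rightarrow> complex" where
  "inf_coeffs a \<equiv> (\<lambda>k. a (k - 1))"

abbreviation zero_coeffs :: "(int \<Rightarrow> complex) \<Rightarrow> int \<Rightarrow> complex" where
  "zero_coeffs b \<equiv> (\<lambda>k. b (- k - 1))"

definition jacobi_coeffs :: "(int \<Rightarrow> complex) \<Rightarrow> (int \<Rightarrow> complex) \<Rightarrow> (int \<Rightarrow> complex) \<Rightarrow> int \<Rightarrow> int \<Rightarrow> bool" where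
  "jacobi_coeffs a b c l m \<longleftrightarrow>
     Sum_any (\<lambda>i::nat. (of_int m gchoose i) * b (l + int i)) =
     Sum_any (\<lambda>i::nat. ((-1) ^ i * (of_int l gchoose i)) * a (m + l - int i)) -
     Sum_any (\<lambda>i::nat. ((-1) powi l * (-1) ^ i * (of_int l gchoose i)) * c (m + int i))"

lemma power_int_one_minus: "(1 - 1 / t) powi l * t powi l = (t - 1) powi l" if "t \<noteq> (0::complex)"
proof -
  have "(1 - 1 / t) * t = t - 1" using that by (simp add: field_simps)
  then show ?thesis by (simp flip: power_int_mult_distrib)
qed

lemma Sum_any_cmult_left:
  fixes f :: "'a \<Rightarrow> complex"
  shows "Sum_any (\<lambda>i. z * f i) = z * Sum_any f"
proof (cases "z = 0")
  case False
  then have "{i. z * f i \<noteq> 0} = {i. f i \<noteq> 0}" by auto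
  then show ?thesis by (simp add: Sum_any.expand_set sum_distrib_left)
qed simp

text \<open>Multiplying the function by \<open>t^m (t - 1)^l\<close> multiplies the three expansions by binomial series, so the
  Jacobi identity for \<open>(l, m)\<close> is the residue identity for the product.\<close>

lemma jacobi_of_continuation:
  fixes a b c :: "int \<Rightarrow> complex" and f :: "complex \<Rightarrow> complex"
  assumes a: "lconv (inf_coeffs a) 1" and b: "lconv (zero_coeffs b) 1" and c: "lconv (zero_coeffs c) 1"
    and f: "f holomorphic_on {t. 3/5 < norm (t - 2/5)}"
    and fa: "\<And>t. norm t > R \<Longrightarrow> f t = lsum (inf_coeffs a) (1 / t)"
    and fb: "\<And>t. Re t > 1 \<Longrightarrow> norm (t - 1) < 1 \<Longrightarrow> f t = lsum (zero_coeffs b) (t - 1)"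
    and bc: "\<And>t. norm (t - 4/5) < 1/10 \<Longrightarrow> lsum (zero_coeffs b) (t - 1) = lsum (zero_coeffs c) t"
  shows "jacobi_coeffs a b c l m"
proof -
  define a' where "a' = (\<lambda>j. Sum_any (\<lambda>i::nat. ((-1) ^ i * (of_int l gchoose i)) * a (m + l + j - int i)))"
  define b' where "b' = (\<lambda>j. Sum_any (\<lambda>i::nat. (of_int m gchoose i) * b (l + int i + j)))"
  define c' where "c' = (\<lambda>j. (-1) powi l * Sum_any (\<lambda>i::nat. ((-1) ^ i * (of_int l gchoose i)) * c (m + int i + j)))"
  have ea: "inf_coeffs a' = (\<lambda>k. resum (\<lambda>_. l) (-1) (inf_coeffs a) (k + (m + l)))"
    unfolding a'_def resum_def by (simp add: algebra_simps)
  have eb: "zero_coeffs b' = (\<lambda>k. resum (\<lambda>_. m) 1 (zero_coeffs b) (k + (- l)))"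
    unfolding b'_def resum_def by (simp add: algebra_simps)
  have ec: "zero_coeffs c' = (\<lambda>k. (-1) powi l * resum (\<lambda>_. l) (-1) (zero_coeffs c) (k + (- m)))"
    unfolding c'_def resum_def by (simp add: algebra_simps)
  have la: "lconv (inf_coeffs a') 1" unfolding ea
    by (intro lsum_shift(1) lconv_resum[OF a]) auto
  have lb: "lconv (zero_coeffs b') 1" unfolding eb
    by (intro lsum_shift(1) lconv_resum[OF b]) auto
  have lc: "lconv (zero_coeffs c') 1" unfolding ec
    by (intro lconv_cmult lsum_shift(1) lconv_resum[OF c]) auto
  have va: "lsum (inf_coeffs a') (1 / t) = lsum (inf_coeffs a) (1 / t) * (t powi m * (t - 1) powi l)" if "norm t > 1" for t
  proof -
    have t: "t \<noteq> 0" "1 / t \<noteq> 0" "0 < norm (1 / t)" "norm (1 / t) < 1" using that by (auto simp: norm_divide divide_less_eq)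
    have "lsum (inf_coeffs a') (1 / t) = (1 / t) powi (- (m + l)) * lsum (resum (\<lambda>_. l) (-1) (inf_coeffs a)) (1 / t)"
      unfolding ea by (rule lsum_shift(2)[OF lconv_resum[OF a] t(2)]) auto
    also have "lsum (resum (\<lambda>_. l) (-1) (inf_coeffs a)) (1 / t) = (1 + (-1) * (1 / t)) powi l * lsum (inf_coeffs a) (1 / t)"
      by (rule lsum_resum[OF a t(3,4)]) (use t in simp)
    also have "(1 / t) powi (- (m + l)) = t powi (m + l)"
      by (simp add: power_int_divide_distrib power_int_minus[of _ "m + l"] del: minus_add_distrib)
    also have "t powi (m + l) = t powi m * t powi l" using t by (simp add: power_int_add)
    finally have "lsum (inf_coeffs a') (1 / t) = t powi m * ((1 - 1 / t) powi l * t powi l) * lsum (inf_coeffs a) (1 / t)"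
      by (simp add: mult_ac)
    then show ?thesis using power_int_one_minus[OF t(1), of l] by (simp add: mult_ac)
  qed
  have vb: "lsum (zero_coeffs b') (t - 1) = lsum (zero_coeffs b) (t - 1) * (t powi m * (t - 1) powi l)"
    if "t \<noteq> 1" "norm (t - 1) < 1" for t
  proof -
    have t: "t - 1 \<noteq> 0" "0 < norm (t - 1)" "norm (t - 1) < 1" using that by auto
    have "lsum (zero_coeffs b') (t - 1) = (t - 1) powi (- (- l)) * lsum (resum (\<lambda>_. m) 1 (zero_coeffs b)) (t - 1)"
      unfolding eb by (rule lsum_shift(2)[OF lconv_resum[OF b] t(1)]) auto
    also have "lsum (resum (\<lambda>_. m) 1 (zero_coeffs b)) (t - 1) = (1 + 1 * (t - 1)) powi m * lsum (zero_coeffs b) (t - 1)"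
      by (rule lsum_resum[OF b t(2,3)]) (use t in simp)
    finally show ?thesis by (simp add: mult_ac)
  qed
  have vc: "lsum (zero_coeffs c') t = lsum (zero_coeffs c) t * (t powi m * (t - 1) powi l)"
    if "t \<noteq> 0" "norm t < 1" for t
  proof -
    have t: "0 < norm t" using that by auto
    have "lsum (zero_coeffs c') t = (-1) powi l * lsum (\<lambda>k. resum (\<lambda>_. l) (-1) (zero_coeffs c) (k + (- m))) t"
      unfolding ec by (rule lsum_cmult)
    also have "lsum (\<lambda>k. resum (\<lambda>_. l) (-1) (zero_coeffs c) (k + (- m))) t =
        t powi (- (- m)) * lsum (resum (\<lambda>_. l) (-1) (zero_coeffs c)) t"
      by (rule lsum_shift(2)[OF lconv_resum[OF c] that(1)]) auto
    also have "lsum (resum (\<lambda>_. l) (-1) (zero_coeffs c)) t = (1 + (-1) * t) powi l * lsum (zero_coeffs c) t"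
      by (rule lsum_resum[OF c t that(2)]) (use that in simp)
    also have "(-1) powi l * (t powi (- (- m)) * ((1 + (-1) * t) powi l * lsum (zero_coeffs c) t)) =
       t powi m * ((-1) powi l * (1 - t) powi l) * lsum (zero_coeffs c) t" by simp
    also have "(-1) powi l * (1 - t) powi l = (t - 1) powi l"
      by (simp flip: power_int_mult_distrib)
    finally show ?thesis by (simp add: mult_ac)
  qed
  have "a' 0 = b' 0 + c' 0"
  proof (rule residue_three_points[OF la lb lc, where f = "\<lambda>t. f t * (t powi m * (t - 1) powi l)" and R = "max R 1"])
    show "(\<lambda>t. f t * (t powi m * (t - 1) powi l)) holomorphic_on {t. 3/5 < norm (t - 2/5)}"
      using outside_ne by (intro holomorphic_intros f) force+
  next
    fix t :: complex assume "norm t > max R 1"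
    then show "f t * (t powi m * (t - 1) powi l) = lsum (inf_coeffs a') (1 / t)" using fa[of t] va[of t] by simp
  next
    fix t :: complex assume t: "Re t > 1" "norm (t - 1) < 1"
    then show "f t * (t powi m * (t - 1) powi l) = lsum (zero_coeffs b') (t - 1)"
      using fb[OF t] vb[OF half_disc_props(3)[OF t(1)] t(2)] by simp
  next
    fix t :: complex assume t: "norm (t - 4/5) < 1/10"
    have "norm t \<le> norm (t - 4/5) + norm (4/5 :: complex)" by (metis diff_add_cancel norm_triangle_ineq)
    then have t1: "norm t < 1" using t by simp
    have "norm (t - 1) \<le> norm (t - 4/5) + norm (- 1/5 :: complex)"
      using norm_triangle_ineq[of "t - 4/5" "-1/5"] by simp
    then have t2: "norm (t - 1) < 1" using t by simp
    have t3: "t \<noteq> 0" "t \<noteq> 1" using t1 t2 by auto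
    show "lsum (zero_coeffs b') (t - 1) = lsum (zero_coeffs c') t"
      unfolding vb[OF t3(2) t2] vc[OF t3(1) t1] using bc[OF t] by simp
  qed
  moreover have "c' 0 = Sum_any (\<lambda>i::nat. ((-1) powi l * (-1) ^ i * (of_int l gchoose i)) * c (m + int i))"
    unfolding c'_def by (subst Sum_any_cmult_left[symmetric]) (simp add: mult.assoc)
  ultimately show ?thesis unfolding jacobi_coeffs_def a'_def b'_def by simp
qed

section \<open>Continuation of scalar correlation functions\<close>

lemma inf_series_holomorphic:
  assumes "lconv g \<rho>" "\<And>t. t \<in> S \<Longrightarrow> norm (t - d) * \<rho> > 1" "\<And>t. t \<in> S \<Longrightarrow> t \<noteq> d"
  shows "(\<lambda>t. lsum g (1 / (t - d))) holomorphic_on S"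
proof -
  have "lsum g \<circ> (\<lambda>t. 1 / (t - d)) holomorphic_on S"
  proof (rule holomorphic_on_compose_gen[OF _ lsum_holomorphic[OF assms(1)]])
    show "(\<lambda>t. 1 / (t - d)) holomorphic_on S" using assms(3) by (intro holomorphic_intros) auto
    show "(\<lambda>t. 1 / (t - d)) ` S \<subseteq> ball 0 \<rho> - {0}"
      using assms(2,3) by (auto simp: norm_divide divide_simps mult.commute)
  qed
  then show ?thesis by (simp add: o_def)
qed

lemma right_half_plane: "open {t::complex. Re t > 1}" "connected {t::complex. Re t > 1}"
  by (auto intro: open_halfspace_Re_gt convex_connected convex_halfspace_Re_gt)

lemma gbinomial_shift_negate:
  "((of_int (int i - n)) gchoose i) = (-1) ^ i * ((of_int (n - 1) :: complex) gchoose i)"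
proof -
  have "((of_int (n - 1) :: complex) gchoose i) = (-1) ^ i * ((of_nat i - of_int (n - 1) - 1) gchoose i)"
    by (rule gbinomial_negated_upper)
  moreover have "of_nat i - of_int (n - 1) - 1 = (of_int (int i - n) :: complex)" by simp
  moreover have "((-1) ^ i * (-1) ^ i :: complex) = 1" by (simp flip: power_mult_distrib)
  ultimately show ?thesis by (metis mult.assoc mult.left_neutral)
qed

text \<open>The modes \<open>a2\<close> are those of the same function, expanded at infinity in powers of \<open>t - d\<close> instead of \<open>t\<close>.\<close>

lemma translate_at_infinity:
  assumes a: "lconv (inf_coeffs a) 1" and x: "norm (t - d) > 1 + norm d"
    and a2: "\<And>j. a2 j = Sum_any (\<lambda>i::nat. (- d) ^ i * (of_int j gchoose i) * a (j - int i))"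
  shows "lsum (inf_coeffs a2) (1 / (t - d)) = lsum (inf_coeffs a) (1 / t)"
proof -
  define x where "x = 1 / (t - d)"
  have td: "t \<noteq> d" "norm (t - d) > 0" "t \<noteq> 0"
    using x norm_ge_zero[of d] by (auto simp: norm_minus_commute simp del: norm_ge_zero)
  have cx: "norm (d * x) < 1" using x td norm_ge_zero[of d] unfolding x_def
    by (simp add: norm_mult norm_divide pos_divide_less_eq del: norm_ge_zero)
  have xr: "norm x < 1 * (1 - norm (d * x))"
    using x td unfolding x_def by (simp add: norm_mult norm_divide field_simps)
  have "x \<noteq> 0" using td unfolding x_def by simp
  from infsumI[OF laurent_translate[OF a this cx xr, of 0]]
  have "lsum (resum (\<lambda>k. 0 - k) d (inf_coeffs a)) x = lsum (inf_coeffs a) (x / (1 + d * x))"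
    unfolding lsum_def[of "resum (\<lambda>k. 0 - k) d (inf_coeffs a)"] by (simp only: power_int_0_right mult_1_left)
  also have "x / (1 + d * x) = 1 / t" using td unfolding x_def by (simp add: field_simps)
  also have "resum (\<lambda>k. 0 - k) d (inf_coeffs a) = inf_coeffs a2"
  proof
    fix n :: int
    have "(of_int (0 - (n - int i)) gchoose i) * d ^ i * a (n - int i - 1) =
       (- d) ^ i * (of_int (n - 1) gchoose i) * a (n - 1 - int i)" for i
      using gbinomial_shift_negate[of i n] by (simp add: power_minus[of d] algebra_simps)
    then show "resum (\<lambda>k. 0 - k) d (inf_coeffs a) n = inf_coeffs a2 n"
      unfolding resum_def a2 by simp
  qed
  finally show ?thesis unfolding x_def .
qed

text \<open>The hypothesis on \<open>a2\<close> provides the function on \<open>|t - 2/5| > 3/5\<close>: the expansion in powers of \<open>t - 2/5\<close> converges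
  up to radius \<open>3/5\<close>, beyond the unit circle that limits the expansion in powers of \<open>t\<close>.\<close>

theorem three_point_jacobi:
  fixes a b c :: "int \<Rightarrow> complex"
  assumes a: "lconv (inf_coeffs a) 1" and b: "lconv (zero_coeffs b) 1" and c: "lconv (zero_coeffs c) 1"
    and a2: "lconv (inf_coeffs a2) (5/3)"
    and a2_eq: "\<And>j. a2 j = Sum_any (\<lambda>i::nat. (- (2/5)) ^ i * (of_int j gchoose i) * a (j - int i))"
    and ab: "\<And>t. Re t > 1 \<Longrightarrow> norm (t - 1) < 1 \<Longrightarrow> lsum (inf_coeffs a) (1 / t) = lsum (zero_coeffs b) (t - 1)"
    and bc: "\<And>t. norm (t - 4/5) < 1/10 \<Longrightarrow> lsum (zero_coeffs b) (t - 1) = lsum (zero_coeffs c) t"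
  shows "jacobi_coeffs a b c l m"
proof -
  define f where "f = (\<lambda>t. lsum (inf_coeffs a2) (1 / (t - 2/5)))"
  have fh: "f holomorphic_on {t. 3/5 < norm (t - 2/5)}" unfolding f_def
  proof (rule inf_series_holomorphic[OF a2])
    fix t :: complex assume t: "t \<in> {t. 3/5 < norm (t - 2/5)}"
    show "t \<noteq> 2/5"
    proof
      assume "t = 2/5"
      then show False using t by (simp only: mem_Collect_eq) simp
    qed
  qed auto
  have fa: "f t = lsum (inf_coeffs a) (1 / t)" if "norm t > 3" for t
    unfolding f_def
  proof (rule translate_at_infinity[OF a _ a2_eq])
    have "norm t \<le> norm (t - 2/5) + norm (2/5 :: complex)" by (metis diff_add_cancel norm_triangle_ineq)
    then show "norm (t - 2/5) > 1 + norm (2/5 :: complex)" using that by simp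
  qed
  have fa': "f t = lsum (inf_coeffs a) (1 / t)" if "Re t > 1" for t
  proof (rule holomorphic_eq_on_connected[where f = f and g = "\<lambda>t. lsum (inf_coeffs a) (1 / t)"
        and w = t and S = "{t. Re t > 1}" and U = "{t. Re t > 3}"])
    show "f holomorphic_on {t. Re t > 1}"
      by (rule holomorphic_on_subset[OF fh]) (use half_disc_props(4) in auto)
    have "(\<lambda>t. lsum (inf_coeffs a) (1 / (t - 0))) holomorphic_on {t. Re t > 1}"
      by (rule inf_series_holomorphic[OF a]) (use half_disc_props in force)+
    then show "(\<lambda>t. lsum (inf_coeffs a) (1 / t)) holomorphic_on {t. Re t > 1}" by simp
    have "Complex 4 0 \<in> {t. Re t > 3}" by simp
    then show "{t. Re t > 3} \<noteq> {}" by blast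
    fix z assume "z \<in> {t. Re t > 3}"
    then have "norm z > 3" using complex_Re_le_cmod[of z] by simp
    then show "f z = lsum (inf_coeffs a) (1 / z)" by (rule fa)
  qed (use right_half_plane that open_halfspace_Re_gt in auto)
  show ?thesis
    by (rule jacobi_of_continuation[OF a b c fh fa, where R = 3]) (use fa' ab bc in auto)
qed

text \<open>Choose \<open>m = M\<close> so large that the third sum disappears for every \<open>l\<close>. Then the identity says that \<open>t^M A(t)\<close> and
  \<open>t^M B(t)\<close> have the same modes \<open>r_l\<close> in powers of \<open>t - 1\<close>; only finitely many are nonzero, so both are one Laurent polynomial.\<close>

theorem associativity_of_jacobi:
  fixes a b c :: "int \<Rightarrow> complex"
  assumes a: "lconv (inf_coeffs a) 1" and b: "lconv (zero_coeffs b) 1"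
    and c: "\<And>m. m \<ge> M \<Longrightarrow> c m = 0"
    and J: "\<And>l m. jacobi_coeffs a b c l m"
    and t: "Re t > 1" "norm (t - 1) < 1"
  shows "lsum (inf_coeffs a) (1 / t) = lsum (zero_coeffs b) (t - 1)"
proof -
  define r where "r = (\<lambda>l. Sum_any (\<lambda>i::nat. (of_int M gchoose i) * b (l + int i)))"
  have r2: "r l = Sum_any (\<lambda>i::nat. ((-1) ^ i * (of_int l gchoose i)) * a (M + l - int i))" for l
    using J[of l M] c unfolding jacobi_coeffs_def r_def by simp
  obtain kb where kb: "\<And>k. k < kb \<Longrightarrow> b (- k - 1) = 0" using b unfolding lconv_def by blast
  obtain ka where ka: "\<And>k. k < ka \<Longrightarrow> a (k - 1) = 0" using a unfolding lconv_def by blast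
  have rz: "r l = 0" if "l > - kb - 1" for l
  proof -
    have "b (l + int i) = 0" for i using kb[of "- (l + int i) - 1"] that by simp
    then show ?thesis unfolding r_def by simp
  qed
  have rz2: "r l = 0" if "l < ka - 1 - M" for l
  proof -
    have "a (M + l - int i) = 0" for i using ka[of "M + l - int i + 1"] that by simp
    then show ?thesis unfolding r2 by simp
  qed
  let ?R = "\<lambda>s::complex. \<Sum>n\<in>{kb..M - ka}. r (- n - 1) * s powi n"
  have R: "((\<lambda>n. r (- n - 1) * s powi n) has_sum ?R s) UNIV" for s
  proof (rule has_sum_finite_neutralI)
    fix n assume n: "n \<in> UNIV - {kb..M - ka}"
    then have "r (- n - 1) = 0" using rz[of "- n - 1"] rz2[of "- n - 1"] by auto
    then show "r (- n - 1) * s powi n = 0" by simp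
  qed auto
  have B: "t powi M * lsum (zero_coeffs b) (t - 1) = ?R (t - 1)" if "t \<noteq> 1" "norm (t - 1) < 1" for t
  proof -
    have "((\<lambda>n. resum (\<lambda>_. M) 1 (zero_coeffs b) n * (t - 1) powi n) has_sum
        ((1 + 1 * (t - 1)) powi M * lsum (zero_coeffs b) (t - 1))) UNIV"
      by (rule laurent_binomial[OF b]) (use that in auto)
    moreover have "resum (\<lambda>_. M) 1 (zero_coeffs b) = (\<lambda>n. r (- n - 1))"
      unfolding resum_def r_def by (simp add: fun_eq_iff algebra_simps)
    ultimately show ?thesis using has_sum_unique[OF _ R] by fastforce
  qed
  have A: "t powi M * lsum (inf_coeffs a) (1 / t) = ?R (t - 1)" if "norm t > 3" for t
  proof -
    define a' where "a' = (\<lambda>j. a (j + M))"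
    have t0: "t \<noteq> 0" "1 / t \<noteq> 0" using that by auto
    have ea': "inf_coeffs a' = (\<lambda>k. inf_coeffs a (k + M))" unfolding a'_def by (simp add: algebra_simps)
    have la': "lconv (inf_coeffs a') 1" unfolding ea' by (rule lsum_shift(1)[OF a])
    have "norm t \<le> norm (t - 1) + 1" by (metis diff_add_cancel norm_triangle_ineq norm_one)
    then have nt: "norm (t - 1) > 1 + norm (1::complex)" using that by simp
    have t1: "t \<noteq> 1" using nt by auto
    have r': "r j = Sum_any (\<lambda>i::nat. (- 1) ^ i * (of_int j gchoose i) * a' (j - int i))" for j
      unfolding r2 a'_def by (simp add: algebra_simps)
    have "lsum (inf_coeffs r) (1 / (t - 1)) = lsum (inf_coeffs a') (1 / t)"
      by (rule translate_at_infinity[OF la' nt r'])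
    also have "\<dots> = (1 / t) powi (- M) * lsum (inf_coeffs a) (1 / t)"
      unfolding ea' by (rule lsum_shift(2)[OF a t0(2)])
    also have "(1 / t) powi (- M) = t powi M"
      using t0 by (simp add: power_int_divide_distrib power_int_minus field_simps)
    finally have 1: "t powi M * lsum (inf_coeffs a) (1 / t) = lsum (inf_coeffs r) (1 / (t - 1))" by simp
    have "((\<lambda>n. (\<lambda>n. r (- n - 1) * (t - 1) powi n) (- n)) has_sum ?R (t - 1)) UNIV"
      by (subst has_sum_reindex_bij_betw[of uminus UNIV UNIV]) (auto intro: R bij_betwI[of _ _ _ uminus])
    moreover have "(\<lambda>n. (\<lambda>n. r (- n - 1) * (t - 1) powi n) (- n)) = (\<lambda>n. r (n - 1) * (1 / (t - 1)) powi n)"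
      using t1 by (simp add: fun_eq_iff power_int_divide_distrib power_int_minus field_simps)
    ultimately have "((\<lambda>n. r (n - 1) * (1 / (t - 1)) powi n) has_sum ?R (t - 1)) UNIV" by simp
    then have "lsum (inf_coeffs r) (1 / (t - 1)) = ?R (t - 1)" unfolding lsum_def by (rule infsumI)
    with 1 show ?thesis by simp
  qed
  have A': "t powi M * lsum (inf_coeffs a) (1 / t) = ?R (t - 1)"
  proof (rule holomorphic_eq_on_connected[where f = "\<lambda>t. t powi M * lsum (inf_coeffs a) (1 / t)"
        and g = "\<lambda>t. ?R (t - 1)" and w = t and S = "{t. Re t > 1}" and U = "{t. Re t > 3}"])
    have "(\<lambda>t. lsum (inf_coeffs a) (1 / (t - 0))) holomorphic_on {t. Re t > 1}"
      by (rule inf_series_holomorphic[OF a]) (use half_disc_props in force)+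
    then show "(\<lambda>t. t powi M * lsum (inf_coeffs a) (1 / t)) holomorphic_on {t. Re t > 1}"
      using half_disc_props(2) by (intro holomorphic_intros) auto
    show "(\<lambda>t. ?R (t - 1)) holomorphic_on {t. Re t > 1}"
      using half_disc_props(3) by (intro holomorphic_intros) auto
    have "Complex 4 0 \<in> {t. Re t > 3}" by simp
    then show "{t. Re t > 3} \<noteq> {}" by blast
    fix z assume "z \<in> {t. Re t > 3}"
    then have "norm z > 3" using complex_Re_le_cmod[of z] by simp
    then show "z powi M * lsum (inf_coeffs a) (1 / z) = ?R (z - 1)" by (rule A)
  qed (use right_half_plane t open_halfspace_Re_gt in auto)
  show ?thesis
    using A' B[of t] half_disc_props[OF t(1)] t(2) by (metis mult_left_cancel power_int_not_zero)
qed

text \<open>The primed data belong to the exchanged pair. The substitution \<open>t \<mapsto> 1 / t\<close> maps the region near \<open>4/5\<close> into the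
  half disc where \<open>A' = B'\<close>; skew-symmetry says that \<open>B'(1 / t)\<close> is \<open>B(t)\<close> up to a power of \<open>t\<close>, and \<open>A'(1 / t)\<close> is \<open>C(t)\<close> up to the
  same power.\<close>

lemma skew_symmetric_continuation:
  assumes b: "lconv (zero_coeffs b) 1"
    and b': "\<And>j. b' j = - ((-1) powi j * Sum_any (\<lambda>i::nat. (of_int (K - j) gchoose i) * b (j + int i)))"
    and a': "lconv (inf_coeffs a') 1"
    and ab': "\<And>t. Re t > 1 \<Longrightarrow> norm (t - 1) < 1 \<Longrightarrow> lsum (inf_coeffs a') (1 / t) = lsum (zero_coeffs b') (t - 1)"
    and c: "\<And>m. c m = a' (K - m)"
    and t: "norm (t - 4/5) < 1/10"
  shows "lsum (zero_coeffs b) (t - 1) = lsum (zero_coeffs c) t"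
proof -
  have n1: "norm (4/5::complex) \<le> norm (t - 4/5) + norm t"
    using norm_triangle_ineq[of "4/5 - t" t] by (simp add: norm_minus_commute)
  have "norm t \<le> norm (t - 4/5) + norm (4/5 :: complex)" by (metis diff_add_cancel norm_triangle_ineq)
  then have nt: "norm t > 7/10" "norm t < 9/10" using n1 t by simp_all
  have t0: "t \<noteq> 0" using nt by auto
  have nt1: "norm (t - 1) < 3/10"
    using norm_triangle_ineq[of "t - 4/5" "-1/5"] t by simp
  have t1: "t \<noteq> 1" using nt by auto
  define x where "x = 1 / t - 1"
  have xt: "x = (1 - t) / t" "1 + x = 1 / t" using t0 unfolding x_def by (auto simp: field_simps)
  have x0: "x \<noteq> 0" using t0 t1 xt by auto
  have "norm x = norm (t - 1) / norm t" unfolding xt by (simp add: norm_divide norm_minus_commute)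
  also have "\<dots> < 1 / 2" using nt nt1 t0 by (simp add: pos_divide_less_eq)
  finally have nx: "norm x < 1/2" .
  have re: "Re (1 / t) > 1"
  proof -
    have "\<bar>Re (t - 4/5)\<bar> \<le> norm (t - 4/5)" by (rule abs_Re_le_cmod)
    then have r: "Re t > 7/10" "Re t < 9/10" using t by auto
    have "\<bar>Im (t - 4/5)\<bar> \<le> norm (t - 4/5)" by (rule abs_Im_le_cmod)
    then have i: "\<bar>Im t\<bar> \<le> 1/10" using t by auto
    have "(Re t)\<^sup>2 + (Im t)\<^sup>2 < Re t"
    proof -
      have "\<bar>Im t\<bar>\<^sup>2 \<le> (1/10)\<^sup>2" using i by (intro power_mono) auto
      then have "(Im t)\<^sup>2 \<le> 1/100" by (simp add: power2_eq_square)
      moreover have "(Re t)\<^sup>2 \<le> 9/10 * Re t" using r by (simp add: power2_eq_square)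
      ultimately show ?thesis using r by linarith
    qed
    moreover have "(Re t)\<^sup>2 + (Im t)\<^sup>2 > 0" using r by (intro add_pos_nonneg) auto
    ultimately show ?thesis by (simp add: Re_divide)
  qed
  define g where "g = (\<lambda>k. (-1) powi k * b (- k - 1))"
  have gl: "lconv g 1"
    using b unfolding lconv_def g_def
  proof (intro conjI allI impI, goal_cases)
    case (1)
    then show ?case by fastforce
  next
    case (2 y)
    then have "0 < norm (- y) \<and> norm (- y) < 1" by simp
    then have "(\<lambda>k. b (- k - 1) * (- y) powi k) summable_on UNIV" using 2 by blast
    moreover have "b (- k - 1) * (- y) powi k = (-1) powi k * b (- k - 1) * y powi k" for k
      using power_int_mult_distrib[of "-1" y k] by simp
    ultimately show ?case by simp
  qed
  have gv: "lsum g y = lsum (zero_coeffs b) (- y)" for y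
    unfolding lsum_def g_def using power_int_mult_distrib[of "-1" y] by (simp add: mult_ac)
  have "((\<lambda>n. resum (\<lambda>k. - K - 2 - k) 1 g n * x powi n) has_sum ((1 + 1 * x) powi (- K - 2) * lsum g (x / (1 + 1 * x)))) UNIV"
    by (rule laurent_translate[OF gl x0]) (use nx in auto)
  moreover have "resum (\<lambda>k. - K - 2 - k) 1 g = zero_coeffs b'"
  proof
    fix n :: int
    define j where "j = - n - 1"
    have n: "n = - j - 1" by (simp add: j_def)
    have tm: "(of_int (- K - 2 - (n - int i)) gchoose i) * 1 ^ i * g (n - int i) =
       (- ((-1) powi j)) * ((of_int (K - j) gchoose i) * b (j + int i))" for i
    proof -
      have e1: "- K - 2 - (n - int i) = int i - (K - j + 1)" by (simp add: n)
      have e2: "(of_int (int i - (K - j + 1)) gchoose i) = (-1) ^ i * ((of_int (K - j) :: complex) gchoose i)"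
        using gbinomial_shift_negate[of i "K - j + 1"] by simp
      have e3: "(-1) powi (n - int i) = - ((-1) powi j) * ((-1) ^ i :: complex)"
        unfolding n by (simp add: power_int_diff power_int_minus) (simp add: power_int_def power_one_over divide_inverse flip: power_inverse)
      have e4: "- (n - int i) - 1 = j + int i" by (simp add: n)
      have s: "((-1) ^ i * (-1) ^ i :: complex) = 1" by (simp flip: power_mult_distrib)
      have "((-1) ^ i * (of_int (K - j) gchoose i)) * 1 ^ i * ((- ((-1) powi j) * ((-1) ^ i)) * b (j + int i)) =
          ((-1) ^ i * (-1) ^ i) * ((- ((-1) powi j)) * ((of_int (K - j) gchoose i) * b (j + int i)))"
        by (simp add: mult_ac)
      then show ?thesis unfolding g_def e1 e2 e3 e4 s by simp
    qed
    have "resum (\<lambda>k. - K - 2 - k) 1 g n =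
        Sum_any (\<lambda>i::nat. (- ((-1) powi j)) * ((of_int (K - j) gchoose i) * b (j + int i)))"
      unfolding resum_def by (simp only: tm)
    also have "\<dots> = (- ((-1) powi j)) * Sum_any (\<lambda>i::nat. (of_int (K - j) gchoose i) * b (j + int i))"
      by (rule Sum_any_cmult_left)
    also have "\<dots> = b' j" unfolding b' by (simp only: minus_mult_left)
    finally show "resum (\<lambda>k. - K - 2 - k) 1 g n = zero_coeffs b' n" by (simp only: j_def)
  qed
  ultimately have "lsum (zero_coeffs b') x = (1 + x) powi (- K - 2) * lsum g (x / (1 + x))"
    unfolding lsum_def[of "zero_coeffs b'"] using infsumI by fastforce
  also have "x / (1 + x) = 1 - t" using t0 unfolding xt(2) unfolding x_def by (simp add: field_simps)
  also have "lsum g (1 - t) = lsum (zero_coeffs b) (t - 1)" by (simp add: gv)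
  also have "(1 + x) powi (- K - 2) = t powi (K + 2)"
    unfolding xt(2) using t0 power_int_minus[of "1 / t" "K + 2"] by (simp add: power_int_divide_distrib)
  finally have B: "lsum (zero_coeffs b') x = t powi (K + 2) * lsum (zero_coeffs b) (t - 1)" .
  have "zero_coeffs c = (\<lambda>k. inf_coeffs a' (k + (K + 2)))" unfolding c by (simp add: algebra_simps)
  then have "lsum (zero_coeffs c) t = t powi (- (K + 2)) * lsum (inf_coeffs a') t"
    using lsum_shift(2)[OF a' t0, of "K + 2"] by simp
  also have "lsum (inf_coeffs a') t = lsum (inf_coeffs a') (1 / (1 / t))" by simp
  also have "\<dots> = lsum (zero_coeffs b') (1 / t - 1)"
    by (rule ab'[OF re]) (use nx x_def in simp)
  also have "\<dots> = t powi (K + 2) * lsum (zero_coeffs b) (t - 1)" using B x_def by simp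
  finally have e: "lsum (zero_coeffs c) t = (t powi (- (K + 2)) * t powi (K + 2)) * lsum (zero_coeffs b) (t - 1)"
    by (simp only: mult.assoc)
  have "t powi (- (K + 2)) * t powi (K + 2) = 1"
    using t0 power_int_minus[of t "K + 2"] by (simp del: minus_add_distrib)
  with e show ?thesis by simp
qed

lemma lsum_inf_has_derivative:
  assumes a: "lconv (inf_coeffs a) 1" and a1: "\<And>m. a1 m = - of_int m * a (m - 1)" and t: "norm t > 1"
  shows "((\<lambda>t. lsum (inf_coeffs a) (1 / t)) has_field_derivative lsum (inf_coeffs a1) (1 / t)) (at t)"
proof -
  have t0: "t \<noteq> 0" "1 / t \<noteq> 0" "0 < norm (1 / t)" "norm (1 / t) < 1" using t by (auto simp: norm_divide divide_less_eq)
  let ?g' = "\<lambda>k. of_int (k + 1) * inf_coeffs a (k + 1)"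
  have "((\<lambda>t. 1 / t) has_field_derivative (- ((1 / t) powi 2))) (at t)"
    using t0 by (auto intro!: derivative_eq_intros simp: power_int_numeral power2_eq_square)
  from DERIV_chain2[OF lsum_has_derivative(2)[OF a t0(3,4)] this]
  have d: "((\<lambda>t. lsum (inf_coeffs a) (1 / t)) has_field_derivative lsum ?g' (1 / t) * (- ((1 / t) powi 2))) (at t)" .
  have lg: "lconv ?g' 1" by (rule lsum_has_derivative(1)[OF a t0(3,4)])
  have "inf_coeffs a1 = (\<lambda>k. (-1) * ?g' (k + (- 2)))" unfolding a1 by (simp add: algebra_simps)
  then have "lsum (inf_coeffs a1) (1 / t) = (-1) * lsum (\<lambda>k. ?g' (k + (- 2))) (1 / t)"
    using lsum_cmult[of "-1" "\<lambda>k. ?g' (k + (- 2))" "1 / t"] by simp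
  also have "lsum (\<lambda>k. ?g' (k + (- 2))) (1 / t) = (1 / t) powi (- (- 2)) * lsum ?g' (1 / t)"
    by (rule lsum_shift(2)[OF lg t0(2)])
  finally have "lsum (inf_coeffs a1) (1 / t) = lsum ?g' (1 / t) * (- ((1 / t) powi 2))" by (simp add: mult_ac)
  with d show ?thesis by simp
qed

lemma lsum_zero_has_derivative:
  assumes b: "lconv (zero_coeffs b) 1" and b1: "\<And>m. b1 m = - of_int m * b (m - 1)" and s: "t \<noteq> 1" "norm (t - 1) < 1"
  shows "((\<lambda>t. lsum (zero_coeffs b) (t - 1)) has_field_derivative lsum (zero_coeffs b1) (t - 1)) (at t)"
proof -
  have "((\<lambda>t. t - 1) has_field_derivative 1) (at t)" by (auto intro!: derivative_eq_intros)
  from DERIV_chain2[OF lsum_has_derivative(2)[OF b, of "t - 1"] this] s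
  have "((\<lambda>t. lsum (zero_coeffs b) (t - 1)) has_field_derivative
     lsum (\<lambda>k. of_int (k + 1) * zero_coeffs b (k + 1)) (t - 1) * 1) (at t)" by simp
  moreover have "(\<lambda>k. of_int (k + 1) * zero_coeffs b (k + 1)) = zero_coeffs b1"
    unfolding b1 by (simp add: fun_eq_iff algebra_simps)
  ultimately show ?thesis by simp
qed

text \<open>The index \<open>n\<close> counts derivatives: the hypotheses \<open>a1\<close>, \<open>b1\<close> say that the next sequence belongs to the
  derivative. Equality of all derivatives at one point is equality on the connected half disc.\<close>

theorem associativity_propagates:
  fixes a b :: "nat \<Rightarrow> int \<Rightarrow> complex"
  assumes a: "\<And>n. lconv (inf_coeffs (a n)) 1" and b: "\<And>n. lconv (zero_coeffs (b n)) 1"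
    and a1: "\<And>n m. a (Suc n) m = - of_int m * a n (m - 1)"
    and b1: "\<And>n m. b (Suc n) m = - of_int m * b n (m - 1)"
    and t0: "Re t0 > 1" "norm (t0 - 1) < 1"
    and eq: "\<And>n. lsum (inf_coeffs (a n)) (1 / t0) = lsum (zero_coeffs (b n)) (t0 - 1)"
    and t: "Re t > 1" "norm (t - 1) < 1"
  shows "lsum (inf_coeffs (a 0)) (1 / t) = lsum (zero_coeffs (b 0)) (t - 1)"
proof -
  let ?H = "{t. Re t > 1} \<inter> ball (1::complex) 1"
  have op: "open ?H" by (intro open_Int open_halfspace_Re_gt open_ball)
  have H: "norm z > 1" "z \<noteq> 1" "norm (z - 1) < 1" if "z \<in> ?H" for z
    using half_disc_props[of z] that by (auto simp: dist_norm norm_minus_commute)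
  have dA: "((\<lambda>t. lsum (inf_coeffs (a n)) (1 / t)) has_field_derivative lsum (inf_coeffs (a (Suc n))) (1 / z)) (at z)"
    if "z \<in> ?H" for n z by (rule lsum_inf_has_derivative[OF a a1 H(1)[OF that]])
  have dB: "((\<lambda>t. lsum (zero_coeffs (b n)) (t - 1)) has_field_derivative lsum (zero_coeffs (b (Suc n))) (z - 1)) (at z)"
    if "z \<in> ?H" for n z by (rule lsum_zero_has_derivative[OF b b1 H(2,3)[OF that]])
  have higher: "(deriv ^^ k) (F n) z = F (n + k) z"
    if d: "\<And>n z. z \<in> ?H \<Longrightarrow> (F n has_field_derivative F (Suc n) z) (at z)" and z: "z \<in> ?H"
    for F :: "nat \<Rightarrow> complex \<Rightarrow> complex" and k n z
    using z
  proof (induction k arbitrary: n z)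
    case (Suc k)
    have "(deriv ^^ Suc k) (F n) z = deriv ((deriv ^^ k) (F n)) z" by simp
    also have "\<dots> = deriv (F (n + k)) z"
    proof (rule complex_derivative_transform_within_open[OF _ _ op Suc.prems])
      have FH: "F n holomorphic_on ?H" for n
        by (rule holomorphic_onI) (use d in \<open>auto simp: field_differentiable_def intro: has_field_derivative_at_within\<close>)
      show "(deriv ^^ k) (F n) holomorphic_on ?H" by (rule holomorphic_higher_deriv[OF FH op])
      show "F (n + k) holomorphic_on ?H" by (rule FH)
      fix w assume "w \<in> ?H"
      then show "(deriv ^^ k) (F n) w = F (n + k) w" by (rule Suc.IH)
    qed
    also have "\<dots> = F (n + Suc k) z" using DERIV_imp_deriv[OF d[OF Suc.prems]] by simp
    finally show ?case .
  qed simp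
  show ?thesis
  proof (rule holomorphic_fun_eq_on_connected[where f = "\<lambda>t. lsum (inf_coeffs (a 0)) (1 / t)"
        and g = "\<lambda>t. lsum (zero_coeffs (b 0)) (t - 1)" and S = ?H and z = t0 and w = t])
    show "(\<lambda>t. lsum (inf_coeffs (a 0)) (1 / t)) holomorphic_on ?H"
      by (rule holomorphic_onI) (use dA in \<open>auto simp: field_differentiable_def intro: has_field_derivative_at_within\<close>)
    show "(\<lambda>t. lsum (zero_coeffs (b 0)) (t - 1)) holomorphic_on ?H"
      by (rule holomorphic_onI) (use dB in \<open>auto simp: field_differentiable_def intro: has_field_derivative_at_within\<close>)
    show "connected ?H"
      by (intro convex_connected convex_Int convex_halfspace_Re_gt convex_ball)
    show tH: "t0 \<in> ?H" using t0 by (simp add: dist_norm norm_minus_commute)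
    show "t \<in> ?H" using t by (simp add: dist_norm norm_minus_commute)
    fix n
    show "(deriv ^^ n) (\<lambda>t. lsum (inf_coeffs (a 0)) (1 / t)) t0 = (deriv ^^ n) (\<lambda>t. lsum (zero_coeffs (b 0)) (t - 1)) t0"
      using higher[of "\<lambda>n t. lsum (inf_coeffs (a n)) (1 / t)", OF dA tH, of n 0]
        higher[of "\<lambda>n t. lsum (zero_coeffs (b n)) (t - 1)", OF dB tH, of n 0] eq by simp
  qed (rule op)
qed

section \<open>Linear maps and finite sums\<close>

abbreviation binomial_sum :: "int \<Rightarrow> (nat \<Rightarrow> 'a) \<Rightarrow> 'a::complex_vector" where
  "binomial_sum m f \<equiv> Sum_any (\<lambda>i. (of_int m gchoose i) *\<^sub>C f i)"

abbreviation alternating_sum :: "int \<Rightarrow> (nat \<Rightarrow> 'a) \<Rightarrow> 'a::complex_vector" where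
  "alternating_sum l f \<equiv> Sum_any (\<lambda>i. ((-1) ^ i * (of_int l gchoose i)) *\<^sub>C f i)"

abbreviation signed_sum :: "int \<Rightarrow> (nat \<Rightarrow> 'a) \<Rightarrow> 'a::complex_vector" where
  "signed_sum l f \<equiv> Sum_any (\<lambda>i. ((-1) powi l * (-1) ^ i * (of_int l gchoose i)) *\<^sub>C f i)"

lemma clinear_on_add: "clinear_on S f \<Longrightarrow> x \<in> S \<Longrightarrow> y \<in> S \<Longrightarrow> f (x + y) = f x + f y"
  by (simp add: clinear_on_def)

lemma clinear_on_scale: "clinear_on S f \<Longrightarrow> x \<in> S \<Longrightarrow> f (c *\<^sub>C x) = c *\<^sub>C f x"
  by (simp add: clinear_on_def)

lemma clinear_on_0:
  assumes "clinear_on S f" "cvs.subspace S"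
  shows "f 0 = 0"
  using clinear_on_scale[OF assms(1) cvs.subspace_0[OF assms(2)], of 0] by simp

lemma clinear_on_minus:
  assumes "clinear_on S f" "x \<in> S"
  shows "f (- x) = - f x"
  using clinear_on_scale[OF assms, of "-1"] by simp

lemma clinear_on_diff:
  assumes "clinear_on S f" "cvs.subspace S" "x \<in> S" "y \<in> S"
  shows "f (x - y) = f x - f y"
  using clinear_on_add[OF assms(1,3), of "- y"] clinear_on_minus[OF assms(1,4)] cvs.subspace_neg[OF assms(2,4)]
  by simp

lemma clinear_on_sum:
  assumes "clinear_on S f" "cvs.subspace S" "\<And>i. i \<in> I \<Longrightarrow> g i \<in> S"
  shows "f (\<Sum>i\<in>I. g i) = (\<Sum>i\<in>I. f (g i))"
  using assms(3)
proof (induction I rule: infinite_finite_induct)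
  case (insert i I)
  then show ?case using cvs.subspace_sum[OF assms(2), of I g]
    by (simp add: clinear_on_add[OF assms(1)])
qed (use clinear_on_0[OF assms(1,2)] in auto)

lemma clinear_on_Sum_any:
  assumes "clinear_on S f" "cvs.subspace S" "\<And>i. g i \<in> S" "finite {i. g i \<noteq> 0}"
  shows "f (Sum_any g) = Sum_any (\<lambda>i. f (g i))"
proof -
  have "{i. f (g i) \<noteq> 0} \<subseteq> {i. g i \<noteq> 0}" using clinear_on_0[OF assms(1,2)] by auto
  then have "Sum_any (\<lambda>i. f (g i)) = (\<Sum>i\<in>{i. g i \<noteq> 0}. f (g i))"
    using assms(4) by (rule Sum_any.expand_superset[rotated])
  then show ?thesis
    by (simp add: Sum_any.expand_set[of g] clinear_on_sum[OF assms(1,2)] assms(3))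
qed

lemma subspace_Sum_any:
  assumes "cvs.subspace S" "\<And>i. g i \<in> S"
  shows "Sum_any g \<in> S"
  unfolding Sum_any.expand_set by (rule cvs.subspace_sum[OF assms(1)]) (rule assms(2))

lemma clinear_on_compose:
  assumes "clinear_on S f" "clinear_on T g" "f ` S \<subseteq> T"
  shows "clinear_on S (\<lambda>x. g (f x))"
  using assms unfolding clinear_on_def by (simp add: image_subset_iff)

lemma cbilinear_onI:
  assumes "\<And>y. y \<in> B \<Longrightarrow> clinear_on A (\<lambda>x. f x y)" "\<And>x. x \<in> A \<Longrightarrow> clinear_on B (f x)"
  shows "cbilinear_on A B f"
  using assms by (simp add: cbilinear_on_def)

lemma Sum_any_nat:
  fixes f :: "nat \<Rightarrow> 'a::comm_monoid_add"
  assumes "\<And>i. i \<ge> N \<Longrightarrow> f i = 0"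
  shows "Sum_any f = (\<Sum>i<N. f i)"
proof (rule Sum_any.expand_superset)
  show "{i. f i \<noteq> 0} \<subseteq> {..<N}" using assms by (auto simp: not_le[symmetric])
qed simp

lemma Sum_any_single:
  assumes "\<And>i. i \<noteq> k \<Longrightarrow> f i = 0"
  shows "Sum_any f = f k"
proof -
  have "Sum_any f = (\<Sum>i\<in>{k}. f i)"
  proof (rule Sum_any.expand_superset)
    show "{i. f i \<noteq> 0} \<subseteq> {k}" using assms by blast
  qed simp
  then show ?thesis by simp
qed

lemma Sum_any_scaleC:
  "Sum_any (\<lambda>i. c *\<^sub>C f i) = c *\<^sub>C Sum_any f"
proof (cases "c = 0")
  case False
  then have "{i. c *\<^sub>C f i \<noteq> 0} = {i. f i \<noteq> 0}" by auto
  then show ?thesis by (simp add: Sum_any.expand_set cvs.scale_sum_right)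
qed simp

lemma clinear_on_Sum_any_fun:
  assumes S: "cvs.subspace S" and F: "\<And>i. clinear_on S (F i)" and fin: "\<And>x. x \<in> S \<Longrightarrow> finite {i. F i x \<noteq> 0}"
  shows "clinear_on S (\<lambda>x. Sum_any (\<lambda>i. F i x))"
  unfolding clinear_on_def
proof (intro conjI ballI allI)
  show "Sum_any (\<lambda>i. F i (x + y)) = Sum_any (\<lambda>i. F i x) + Sum_any (\<lambda>i. F i y)" if "x \<in> S" "y \<in> S" for x y
    using Sum_any.distrib[OF fin[OF that(1)] fin[OF that(2)]] by (simp only: clinear_on_add[OF F that])
  show "Sum_any (\<lambda>i. F i (c *\<^sub>C x)) = c *\<^sub>C Sum_any (\<lambda>i. F i x)" if "x \<in> S" for c x
    by (simp only: clinear_on_scale[OF F that] Sum_any_scaleC)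
qed

lemma clinear_on_scaleC: "clinear_on S f \<Longrightarrow> clinear_on S (\<lambda>x. c *\<^sub>C f x)"
  by (simp add: clinear_on_def scaleC_add_right scaleC_scaleC mult.commute)

lemma clinear_on_diff_fun: "clinear_on S f \<Longrightarrow> clinear_on S g \<Longrightarrow> clinear_on S (\<lambda>x. f x - g x)"
  by (simp add: clinear_on_def cvs.scale_right_diff_distrib)

lemma Sum_any_minus:
  fixes f :: "'a \<Rightarrow> 'b::ab_group_add"
  shows "Sum_any (\<lambda>i. - f i) = - Sum_any f"
  by (simp add: Sum_any.expand_set sum_negf)

lemma Sum_any_reindex_inj:
  fixes f :: "'b \<Rightarrow> 'c::comm_monoid_add"
  assumes "inj h" "\<And>y. y \<notin> range h \<Longrightarrow> f y = 0"
  shows "Sum_any f = Sum_any (\<lambda>x. f (h x))"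
proof -
  have eq: "{y. f y \<noteq> 0} = h ` {x. f (h x) \<noteq> 0}"
  proof (intro set_eqI iffI)
    fix y assume y: "y \<in> {y. f y \<noteq> 0}"
    then have "y \<in> range h" using assms(2)[of y] by (cases "y \<in> range h") simp_all
    then obtain x where "y = h x" by (rule rangeE)
    then show "y \<in> h ` {x. f (h x) \<noteq> 0}" using y by simp
  qed auto
  have "sum f (h ` {x. f (h x) \<noteq> 0}) = sum (\<lambda>x. f (h x)) {x. f (h x) \<noteq> 0}"
    using sum.reindex[OF inj_on_subset[OF assms(1) subset_UNIV]] by (simp add: o_def)
  then show ?thesis unfolding Sum_any.expand_set eq by simp
qed

text \<open>Linear functionals separate points; this reduces vector identities to scalar series.\<close>

lemma exists_functional:
  fixes x :: "'u::complex_vector"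
  assumes "x \<noteq> 0"
  obtains p :: "'u \<Rightarrow> complex" where "clinear_on UNIV p" "p x \<noteq> 0"
proof -
  interpret vp: vector_space_pair "scaleC :: complex \<Rightarrow> 'u \<Rightarrow> 'u" "scaleC :: complex \<Rightarrow> complex \<Rightarrow> complex"
    by unfold_locales
  have "cvs.independent {x}" using assms by simp
  from vp.linear_independent_extend[OF this, of "\<lambda>_. 1"]
  obtain g where g: "Vector_Spaces.linear (scaleC :: complex \<Rightarrow> 'u \<Rightarrow> 'u) (scaleC :: complex \<Rightarrow> complex \<Rightarrow> complex) g" "g x = 1" by auto
  interpret g: Vector_Spaces.linear "scaleC :: complex \<Rightarrow> 'u \<Rightarrow> 'u" "scaleC :: complex \<Rightarrow> complex \<Rightarrow> complex" g
    by (rule g(1))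
  show thesis by (rule that[of g]) (auto simp: clinear_on_def g.add g.scale g(2))
qed

section \<open>Gradings\<close>

locale graded_space =
  fixes V :: "'u::complex_vector voa" and W :: "'u vmod"
  assumes sub: "cvs.subspace (mcar W)"
    and L0_lin: "clinear_on (mcar W) (Lop V W 0)"
    and span: "cvs.span (\<Union>n. wspace V W n) = mcar W"
begin

lemma wspace_mcar: "w \<in> wspace V W n \<Longrightarrow> w \<in> mcar W" by (auto simp: wspace_def)

lemma wspaceD: "w \<in> wspace V W n \<Longrightarrow> Lop V W 0 w = n *\<^sub>C w" by (auto simp: wspace_def)

lemma wspaceI: "w \<in> mcar W \<Longrightarrow> Lop V W 0 w = n *\<^sub>C w \<Longrightarrow> w \<in> wspace V W n" by (auto simp: wspace_def)

lemma wspace_subspace: "cvs.subspace (wspace V W n)"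
  unfolding cvs.subspace_def wspace_def
  using sub L0_lin clinear_on_0[OF L0_lin sub]
  by (auto simp: cvs.subspace_0 cvs.subspace_add cvs.subspace_scale clinear_on_add clinear_on_scale
      cvs.scale_right_distrib mult.commute)

lemma zero_wspace: "0 \<in> wspace V W n" by (rule cvs.subspace_0[OF wspace_subspace])

text \<open>Eigenvectors of \<open>L(0)\<close> for different eigenvalues are independent, so the projections to the weight spaces are
  well defined.\<close>

lemma eigen_independent:
  assumes "finite F" "\<And>k. k \<in> F \<Longrightarrow> x k \<in> wspace V W k" "(\<Sum>k\<in>F. x k) = 0" "k \<in> F"
  shows "x k = 0"
proof -
  have "(\<forall>k\<in>F. x k \<in> wspace V W k) \<Longrightarrow> (\<Sum>k\<in>F. x k) = 0 \<Longrightarrow> \<forall>k\<in>F. x k = 0"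
    using assms(1)
  proof (induction F arbitrary: x)
    case (insert a F)
    have xk: "x k \<in> wspace V W k" if "k \<in> insert a F" for k using insert that by auto
    have mk: "x k \<in> mcar W" if "k \<in> insert a F" for k using xk[OF that] wspace_mcar by blast
    have s: "(\<Sum>k\<in>insert a F. x k) = 0" by (rule insert.prems(2))
    have "0 = Lop V W 0 (\<Sum>k\<in>insert a F. x k)" unfolding s using clinear_on_0[OF L0_lin sub] by simp
    also have "\<dots> = (\<Sum>k\<in>insert a F. Lop V W 0 (x k))" by (rule clinear_on_sum[OF L0_lin sub mk])
    also have "\<dots> = (\<Sum>k\<in>insert a F. k *\<^sub>C x k)" using wspaceD[OF xk] by (intro sum.cong) auto
    finally have "(\<Sum>k\<in>insert a F. k *\<^sub>C x k) = 0" by simp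
    moreover have "a *\<^sub>C (\<Sum>k\<in>insert a F. x k) = 0" unfolding s by simp
    ultimately have "(\<Sum>k\<in>insert a F. k *\<^sub>C x k) - (\<Sum>k\<in>insert a F. a *\<^sub>C x k) = 0"
      by (simp only: cvs.scale_sum_right diff_self)
    then have "(\<Sum>k\<in>insert a F. (k - a) *\<^sub>C x k) = 0"
      by (simp add: sum_subtractf[symmetric] cvs.scale_left_diff_distrib)
    then have "(\<Sum>k\<in>F. (k - a) *\<^sub>C x k) = 0" using insert.hyps by simp
    moreover have "\<forall>k\<in>F. (k - a) *\<^sub>C x k \<in> wspace V W k"
      using xk cvs.subspace_scale[OF wspace_subspace] by auto
    ultimately have "\<forall>k\<in>F. (k - a) *\<^sub>C x k = 0" using insert.IH[of "\<lambda>k. (k - a) *\<^sub>C x k"] by blast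
    then have F: "\<forall>k\<in>F. x k = 0" using insert.hyps by (metis cvs.scale_eq_0_iff eq_iff_diff_eq_0)
    then have "x a = 0" using s insert.hyps by simp
    with F show ?case by simp
  qed simp
  then show ?thesis using assms by blast
qed

lemma decomposition_exists:
  assumes "w \<in> mcar W"
  shows "\<exists>f. (\<forall>k. f k \<in> wspace V W k) \<and> finite {k. f k \<noteq> 0} \<and> Sum_any f = w" (is "?P w")
proof -
  have "w \<in> cvs.span (\<Union>n. wspace V W n)" using assms span by simp
  then show ?thesis
  proof (rule cvs.span_induct)
    show "cvs.subspace {w. ?P w}"
    proof (rule cvs.subspaceI)
      show "0 \<in> {w. ?P w}"
        by (auto intro!: exI[of _ "\<lambda>_. 0"] zero_wspace)
    next
      fix x y assume "x \<in> {w. ?P w}"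
        "y \<in> {w. ?P w}"
      then obtain f g where f: "\<forall>k. f k \<in> wspace V W k" "finite {k. f k \<noteq> 0}" "Sum_any f = x"
        and g: "\<forall>k. g k \<in> wspace V W k" "finite {k. g k \<noteq> 0}" "Sum_any g = y" by blast
      have "finite {k. f k + g k \<noteq> 0}"
        by (rule finite_subset[of _ "{k. f k \<noteq> 0} \<union> {k. g k \<noteq> 0}"]) (use f g in auto)
      then show "x + y \<in> {w. ?P w}"
        using f g cvs.subspace_add[OF wspace_subspace] Sum_any.distrib[OF f(2) g(2)]
        by (auto intro!: exI[of _ "\<lambda>k. f k + g k"])
    next
      fix c x assume "x \<in> {w. ?P w}"
      then obtain f where f: "\<forall>k. f k \<in> wspace V W k" "finite {k. f k \<noteq> 0}" "Sum_any f = x" by blast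
      have "finite {k. c *\<^sub>C f k \<noteq> 0}"
        by (rule finite_subset[of _ "{k. f k \<noteq> 0}"]) (use f in auto)
      then show "c *\<^sub>C x \<in> {w. ?P w}"
        using f cvs.subspace_scale[OF wspace_subspace] Sum_any_scaleC[of c f]
        by (auto intro!: exI[of _ "\<lambda>k. c *\<^sub>C f k"])
    qed
  next
    fix x assume "x \<in> (\<Union>n. wspace V W n)"
    then obtain n where n: "x \<in> wspace V W n" by blast
    have "Sum_any (\<lambda>k. if k = n then x else 0) = x" by (subst Sum_any_single[of n]) auto
    moreover have "finite {k. (if k = n then x else 0) \<noteq> 0}" by (rule finite_subset[of _ "{n}"]) auto
    ultimately show "?P x"
      using n zero_wspace by (intro exI[of _ "\<lambda>k. if k = n then x else 0"]) auto
  qed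
qed

lemma decomposition_unique:
  assumes "\<And>k. f k \<in> wspace V W k" "finite {k. f k \<noteq> 0}" "\<And>k. g k \<in> wspace V W k" "finite {k. g k \<noteq> 0}"
    "Sum_any f = Sum_any g"
  shows "f = g"
proof
  fix k
  let ?F = "{k. f k \<noteq> 0} \<union> {k. g k \<noteq> 0}"
  have "Sum_any f = (\<Sum>k\<in>?F. f k)" "Sum_any g = (\<Sum>k\<in>?F. g k)"
    by (rule Sum_any.expand_superset, use assms in auto)+
  then have "(\<Sum>k\<in>?F. f k - g k) = 0" using assms(5) by (simp add: sum_subtractf)
  then have "f k - g k = 0" if "k \<in> ?F"
    using eigen_independent[of ?F "\<lambda>k. f k - g k"] assms cvs.subspace_diff[OF wspace_subspace] that by blast
  then show "f k = g k" by (cases "f k = 0 \<and> g k = 0") auto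
qed

lemma wproj_eqI:
  assumes "\<And>k. f k \<in> wspace V W k" "finite {k. f k \<noteq> 0}" "Sum_any f = w"
  shows "wproj V W n w = f n"
proof -
  have "(THE f. (\<forall>k. f k \<in> wspace V W k) \<and> finite {k. f k \<noteq> 0} \<and> Sum_any f = w) = f"
  proof (rule the_equality)
    show "(\<forall>k. f k \<in> wspace V W k) \<and> finite {k. f k \<noteq> 0} \<and> Sum_any f = w" using assms by blast
  next
    fix g assume "(\<forall>k. g k \<in> wspace V W k) \<and> finite {k. g k \<noteq> 0} \<and> Sum_any g = w"
    then show "g = f" using decomposition_unique[of g f] assms by metis
  qed
  then show ?thesis unfolding wproj_def by simp
qed

lemma wproj:
  assumes "w \<in> mcar W"
  shows wproj_in: "wproj V W n w \<in> wspace V W n"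
    and wproj_finite: "finite {n. wproj V W n w \<noteq> 0}"
    and wproj_Sum_any: "Sum_any (\<lambda>n. wproj V W n w) = w"
proof -
  obtain f where f: "\<And>k. f k \<in> wspace V W k" "finite {k. f k \<noteq> 0}" "Sum_any f = w"
    using decomposition_exists[OF assms] by blast
  have e: "wproj V W n w = f n" for n by (rule wproj_eqI[OF f])
  show "wproj V W n w \<in> wspace V W n" "finite {n. wproj V W n w \<noteq> 0}" "Sum_any (\<lambda>n. wproj V W n w) = w"
    unfolding e using f by auto
qed

lemma wproj_mcar: "w \<in> mcar W \<Longrightarrow> wproj V W n w \<in> mcar W"
  using wproj_in wspace_mcar by blast

lemma wproj_hom:
  assumes "w \<in> wspace V W k"
  shows "wproj V W n w = (if n = k then w else 0)"
proof (rule wproj_eqI)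
  show "(if j = k then w else 0) \<in> wspace V W j" for j using assms zero_wspace by auto
  show "finite {j. (if j = k then w else 0) \<noteq> 0}" by (rule finite_subset[of _ "{k}"]) auto
  show "Sum_any (\<lambda>j. if j = k then w else 0) = w" by (subst Sum_any_single[of k]) auto
qed

lemma wproj_0 [simp]: "wproj V W n 0 = 0"
  using wproj_hom[OF zero_wspace[of n]] by simp

lemma wproj_linear: "clinear_on (mcar W) (wproj V W n)"
  unfolding clinear_on_def
proof (intro conjI ballI allI)
  fix x y assume xy: "x \<in> mcar W" "y \<in> mcar W"
  show "wproj V W n (x + y) = wproj V W n x + wproj V W n y"
  proof (rule wproj_eqI)
    show "wproj V W k x + wproj V W k y \<in> wspace V W k" for k
      using xy wproj_in cvs.subspace_add[OF wspace_subspace] by blast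
    show "finite {k. wproj V W k x + wproj V W k y \<noteq> 0}"
      by (rule finite_subset[OF _ finite_UnI[OF wproj_finite[OF xy(1)] wproj_finite[OF xy(2)]]]) auto
    show "Sum_any (\<lambda>k. wproj V W k x + wproj V W k y) = x + y"
      using Sum_any.distrib[OF wproj_finite[OF xy(1)] wproj_finite[OF xy(2)]] wproj_Sum_any xy by simp
  qed
next
  fix c x assume x: "x \<in> mcar W"
  show "wproj V W n (c *\<^sub>C x) = c *\<^sub>C wproj V W n x"
  proof (rule wproj_eqI)
    show "c *\<^sub>C wproj V W k x \<in> wspace V W k" for k
      using x wproj_in cvs.subspace_scale[OF wspace_subspace] by blast
    show "finite {k. c *\<^sub>C wproj V W k x \<noteq> 0}"
      by (rule finite_subset[OF _ wproj_finite[OF x]]) auto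
    show "Sum_any (\<lambda>k. c *\<^sub>C wproj V W k x) = c *\<^sub>C x"
      using Sum_any_scaleC[of c "\<lambda>k. wproj V W k x"] wproj_Sum_any[OF x] by simp
  qed
qed

lemma homogeneous_induct [consumes 1, case_names hom add]:
  assumes "w \<in> mcar W"
    and "\<And>n x. x \<in> wspace V W n \<Longrightarrow> P x"
    and "\<And>x y. x \<in> mcar W \<Longrightarrow> y \<in> mcar W \<Longrightarrow> P x \<Longrightarrow> P y \<Longrightarrow> P (x + y)"
  shows "P w"
proof -
  have "P (\<Sum>n\<in>F. wproj V W n w)" if "finite F" for F
    using that
  proof induction
    case empty
    then show ?case using assms(2)[OF zero_wspace] by simp
  next
    case (insert n F)
    then show ?case
      using assms(2)[OF wproj_in[OF assms(1)]] wproj_mcar[OF assms(1)] cvs.subspace_sum[OF sub, of F]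
      by (auto intro!: assms(3))
  qed
  from this[OF wproj_finite[OF assms(1)]] show ?thesis
    using wproj_Sum_any[OF assms(1)] by (simp add: Sum_any.expand_set)
qed

lemma eq_if_wproj_eq:
  assumes "x \<in> mcar W" "y \<in> mcar W" "\<And>n. wproj V W n x = wproj V W n y"
  shows "x = y"
proof -
  have e: "(\<lambda>n. wproj V W n x) = (\<lambda>n. wproj V W n y)" using assms(3) by (rule ext)
  show ?thesis
    using wproj_Sum_any[OF assms(1)] wproj_Sum_any[OF assms(2)] unfolding e by (rule trans[OF sym])
qed

lemma emb_inj: "x \<in> mcar W \<Longrightarrow> y \<in> mcar W \<Longrightarrow> emb V W x = emb V W y \<Longrightarrow> x = y"
  by (rule eq_if_wproj_eq) (auto simp: emb_def fun_eq_iff)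

lemma formal_completion_mcar: "f \<in> formal_completion V W \<Longrightarrow> f n \<in> mcar W"
  by (auto simp: formal_completion_def wspace_def)

text \<open>Contragredient vectors that see a single weight. They suffice to separate elements of the completion, so weak
  sums are unique.\<close>

definition wfunctional :: "complex \<Rightarrow> ('u \<Rightarrow> complex) \<Rightarrow> 'u \<Rightarrow> complex" where
  "wfunctional e p w = p (wproj V W e w)"

lemma wfunctional_contragredient:
  assumes "clinear_on (mcar W) p"
  shows "wfunctional e p \<in> contragredient V W"
proof -
  have p0: "p 0 = 0" by (rule clinear_on_0[OF assms sub])
  have "clinear_on (mcar W) (wfunctional e p)"
    unfolding wfunctional_def
    by (rule clinear_on_compose[OF wproj_linear assms]) (auto simp: wproj_mcar)
  moreover have "{n. \<exists>w\<in>wspace V W n. wfunctional e p w \<noteq> 0} \<subseteq> {e}"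
    using p0 by (auto simp: wfunctional_def wproj_hom split: if_splits)
  ultimately show ?thesis unfolding contragredient_def by (auto intro: finite_subset)
qed

lemma pairing_wfunctional:
  assumes "clinear_on (mcar W) p" "f \<in> formal_completion V W"
  shows "pairing (wfunctional e p) f = p (f e)"
proof -
  have p0: "p 0 = 0" by (rule clinear_on_0[OF assms(1) sub])
  have "f n \<in> wspace V W n" for n using assms(2) by (simp add: formal_completion_def)
  then have "wfunctional e p (f n) = (if n = e then p (f e) else 0)" for n
    unfolding wfunctional_def using wproj_hom[of "f n" n e] p0 by simp
  then show ?thesis unfolding pairing_def by (subst Sum_any_single[of e]) auto
qed

lemma clinear_on_UNIV_subset: "clinear_on UNIV p \<Longrightarrow> clinear_on (mcar W) p"
  by (simp add: clinear_on_def)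

lemma completion_eqI:
  assumes "f \<in> formal_completion V W" "g \<in> formal_completion V W"
    "\<And>p. p \<in> contragredient V W \<Longrightarrow> pairing p f = pairing p g"
  shows "f = g"
proof (rule ccontr)
  assume "f \<noteq> g"
  then obtain n where n: "f n - g n \<noteq> 0" by auto
  obtain p :: "'u \<Rightarrow> complex" where p: "clinear_on UNIV p" "p (f n - g n) \<noteq> 0" by (rule exists_functional[OF n])
  have pl: "clinear_on (mcar W) p" by (rule clinear_on_UNIV_subset[OF p(1)])
  have "p (f n) = p (g n)"
    using assms(3)[OF wfunctional_contragredient[OF pl, of n]] pairing_wfunctional[OF pl assms(1)]
      pairing_wfunctional[OF pl assms(2)] by simp
  then show False using p clinear_on_diff[OF p(1)] by simp
qed

lemma has_weak_sum_unique:
  assumes "has_weak_sum V W F S f" "has_weak_sum V W F S g"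
  shows "f = g"
proof (rule completion_eqI)
  show "f \<in> formal_completion V W" "g \<in> formal_completion V W"
    using assms by (auto simp: has_weak_sum_def)
  fix p assume "p \<in> contragredient V W"
  then show "pairing p f = pairing p g"
    using assms unfolding has_weak_sum_def by (blast intro: has_sum_unique)
qed

end

lemma graded_space_module:
  assumes "vac V \<in> vcar V" "omega V \<in> vcar V" "is_module V W"
  shows "graded_space V W"
proof
  have va: "vertex_action V W" using assms by (simp add: is_module_def)
  show "cvs.subspace (mcar W)" using va by (simp add: vertex_action_def)
  show "clinear_on (mcar W) (Lop V W 0)" unfolding Lop_def
    using va assms(2) by (simp add: vertex_action_def cbilinear_on_def)
  show "cvs.span (\<Union>n. wspace V W n) = mcar W" using assms by (simp add: is_module_def)
qed

lemma is_module_adj: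
  assumes "is_voa V"
  shows "is_module V (adj V)" and "wspace V (adj V) n \<noteq> {0} \<Longrightarrow> n \<in> \<int>"
proof -
  have va: "vertex_action V (adj V)" and vo: "vac V \<in> vcar V" "omega V \<in> vcar V"
    and sp: "cvs.span (\<Union>n::int. wspace V (adj V) (of_int n)) = vcar V"
    and fin: "\<And>n::int. finite_dimensional (wspace V (adj V) (of_int n))"
    using assms by (auto simp: is_voa_def)
  obtain N :: int where N: "\<And>n::int. n < N \<Longrightarrow> wspace V (adj V) (of_int n) = {0}"
    using assms unfolding is_voa_def by blast
  have car: "mcar (adj V) = vcar V" by (simp add: adj_def)
  have gs: "graded_space V (adj V)"
  proof
    show sub: "cvs.subspace (mcar (adj V))" using va by (simp add: vertex_action_def)
    show "clinear_on (mcar (adj V)) (Lop V (adj V) 0)" unfolding Lop_def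
      using va vo(2) by (simp add: vertex_action_def cbilinear_on_def)
    show "cvs.span (\<Union>n. wspace V (adj V) n) = mcar (adj V)"
    proof
      show "cvs.span (\<Union>n. wspace V (adj V) n) \<subseteq> mcar (adj V)"
        by (rule cvs.span_minimal[OF _ sub]) (auto simp: wspace_def)
      show "mcar (adj V) \<subseteq> cvs.span (\<Union>n. wspace V (adj V) n)"
        unfolding car sp[symmetric] by (rule cvs.span_mono) auto
    qed
  qed
  interpret gs: graded_space V "adj V" by (rule gs)
  have nz: "wspace V (adj V) n = {0}" if n: "n \<notin> \<int>" for n
  proof -
    have "w \<in> vcar V \<and> wproj V (adj V) n w = 0" if "w \<in> cvs.span (\<Union>n::int. wspace V (adj V) (of_int n))" for w
      using that
    proof (rule cvs.span_induct)
      fix x assume "x \<in> (\<Union>n::int. wspace V (adj V) (of_int n))"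
      then obtain k :: int where "x \<in> wspace V (adj V) (of_int k)" by blast
      then show "x \<in> vcar V \<and> wproj V (adj V) n x = 0"
        using n gs.wspace_mcar by (auto simp: gs.wproj_hom car)
    next
      show "cvs.subspace {x. x \<in> vcar V \<and> wproj V (adj V) n x = 0}"
        using gs.sub gs.wproj_linear[of n] unfolding car cvs.subspace_def
        by (auto simp: clinear_on_add clinear_on_scale)
    qed
    then have z: "wproj V (adj V) n w = 0" if "w \<in> vcar V" for w using that sp by simp
    have "w = 0" if "w \<in> wspace V (adj V) n" for w
      using z[of w] gs.wproj_hom[OF that, of n] gs.wspace_mcar[OF that] car by simp
    then show ?thesis using gs.zero_wspace by blast
  qed
  show "wspace V (adj V) n \<noteq> {0} \<Longrightarrow> n \<in> \<int>" using nz by blast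
  show "is_module V (adj V)"
    unfolding is_module_def
  proof (intro conjI allI)
    show "vertex_action V (adj V)" by (rule va)
    show "cvs.span (\<Union>n. wspace V (adj V) n) = mcar (adj V)" by (rule gs.span)
    show "finite_dimensional (wspace V (adj V) n)" for n
    proof (cases "n \<in> \<int>")
      case True
      then show ?thesis using fin by (auto elim: Ints_cases)
    next
      case False
      then show ?thesis unfolding finite_dimensional_def nz[OF False] by (intro exI[of _ "{}"]) auto
    qed
    show "\<exists>N::real. \<forall>n. Re n < N \<longrightarrow> wspace V (adj V) n = {0}"
    proof (intro exI[of _ "of_int N"] allI impI)
      fix n :: complex assume n: "Re n < of_int N"
      show "wspace V (adj V) n = {0}"
      proof (cases "n \<in> \<int>")
        case True
        then obtain k where "n = of_int k" by (auto elim: Ints_cases)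
        then show ?thesis using n N by simp
      qed (rule nz)
    qed
  qed
qed

section \<open>Modules of a fixed vertex operator algebra\<close>

text \<open>A family of integral modes, regarded as a complex-indexed family as in an intertwining operator.\<close>

definition cmodes :: "('u \<Rightarrow> int \<Rightarrow> 'u \<Rightarrow> 'u::zero) \<Rightarrow> 'u \<Rightarrow> complex \<Rightarrow> 'u \<Rightarrow> 'u" where
  "cmodes y = (\<lambda>w1 n w2. if n \<in> \<int> then y w1 \<lfloor>Re n\<rfloor> w2 else 0)"

lemma cmodes_of_int [simp]: "cmodes y w1 (of_int k) w2 = y w1 k w2"
  by (simp add: cmodes_def)

lemma cmodes_not_int: "n \<notin> \<int> \<Longrightarrow> cmodes y w1 n w2 = 0"
  by (simp add: cmodes_def)

lemma of_int_index: "of_int m + of_int k - of_nat i = (of_int (m + k - int i) :: complex)"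
  "of_int k + of_nat i = (of_int (k + int i) :: complex)"
  by simp_all

lemma finite_nat_support:
  assumes "\<And>i. i \<ge> N \<Longrightarrow> f i = (0::'a::zero)"
  shows "finite {i::nat. f i \<noteq> 0}"
  by (rule finite_subset[of _ "{..<N}"]) (use assms in \<open>auto simp: not_le[symmetric]\<close>)

locale fixed_voa =
  fixes V :: "'u::complex_vector voa"
  assumes voa: "is_voa V"
begin

lemma vac_in: "vac V \<in> vcar V" and omega_in: "omega V \<in> vcar V"
  using voa by (simp_all add: is_voa_def)

lemma adj_module: "is_module V (adj V)" by (rule is_module_adj(1)[OF voa])

lemma adj_car [simp]: "mcar (adj V) = vcar V" and adj_act [simp]: "mact (adj V) = vY V"
  by (simp_all add: adj_def)

lemma V_sub: "cvs.subspace (vcar V)"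
  using adj_module by (simp add: is_module_def vertex_action_def)

lemma creation: "v \<in> vcar V \<Longrightarrow> vY V v (-1) (vac V) = v"
  and creation_nonneg: "v \<in> vcar V \<Longrightarrow> n \<ge> 0 \<Longrightarrow> vY V v n (vac V) = 0"
  using voa by (simp_all add: is_voa_def)

lemma gs: "is_module V W \<Longrightarrow> graded_space V W"
  by (rule graded_space_module[OF vac_in omega_in])

lemma Lop_vac: "n \<ge> -1 \<Longrightarrow> Lop V (adj V) n (vac V) = 0"
  unfolding Lop_def using creation_nonneg[OF omega_in, of "n + 1"] by simp

lemma vac_weight: "vac V \<in> wspace V (adj V) 0"
  using Lop_vac[of 0] vac_in by (simp add: wspace_def)

context
  fixes W assumes mW: "is_module V W"
begin

lemma va: "vertex_action V W" using mW by (simp add: is_module_def)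

lemma mod_sub: "cvs.subspace (mcar W)" using va by (simp add: vertex_action_def)

lemma mod_0: "0 \<in> mcar W" by (rule cvs.subspace_0[OF mod_sub])

lemma act_lin: "v \<in> vcar V \<Longrightarrow> clinear_on (mcar W) (mact W v n)"
  using va by (simp add: vertex_action_def cbilinear_on_def)

lemma act_linv: "w \<in> mcar W \<Longrightarrow> clinear_on (vcar V) (\<lambda>v. mact W v n w)"
  using va by (simp add: vertex_action_def cbilinear_on_def)

lemma act_closed: "v \<in> vcar V \<Longrightarrow> w \<in> mcar W \<Longrightarrow> mact W v n w \<in> mcar W"
  using va by (simp add: vertex_action_def)

lemma act_trunc: "v \<in> vcar V \<Longrightarrow> w \<in> mcar W \<Longrightarrow> \<exists>N. \<forall>n\<ge>N. mact W v n w = 0"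
  using va by (simp add: vertex_action_def)

lemma act_vac: "w \<in> mcar W \<Longrightarrow> mact W (vac V) n w = (if n = -1 then w else 0)"
  using va by (simp add: vertex_action_def)

lemma act_jac: "jacobi V (adj V) W W (mact W)"
  using va by (simp add: vertex_action_def)

lemma act_deriv: "v \<in> vcar V \<Longrightarrow> w \<in> mcar W \<Longrightarrow>
   mact W (Lop V (adj V) (-1) v) n w = - (of_int n *\<^sub>C mact W v (n - 1) w)"
  using va by (simp add: vertex_action_def)

lemma act_out: "v \<notin> vcar V \<or> w \<notin> mcar W \<Longrightarrow> mact W v n w = 0"
  using va by (simp add: vertex_action_def)

lemma act_0: "mact W v n 0 = 0"
  using act_out clinear_on_0[OF act_lin mod_sub] by (cases "v \<in> vcar V") auto

lemma Lop_lin: "clinear_on (mcar W) (Lop V W n)"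
  unfolding Lop_def by (rule act_lin[OF omega_in])

lemma Lop_closed: "w \<in> mcar W \<Longrightarrow> Lop V W n w \<in> mcar W"
  unfolding Lop_def by (rule act_closed[OF omega_in])

lemma act_trunc_nat: "v \<in> vcar V \<Longrightarrow> w \<in> mcar W \<Longrightarrow> \<exists>N::nat. \<forall>i\<ge>N. mact W v (l + int i) w = 0"
proof -
  assume "v \<in> vcar V" "w \<in> mcar W"
  from act_trunc[OF this] obtain N where N: "\<And>n. n \<ge> N \<Longrightarrow> mact W v n w = 0" by blast
  show ?thesis by (rule exI[of _ "nat (N - l)"]) (use N in auto)
qed

lemma weights_bounded_below: "\<exists>N::real. \<forall>n. Re n < N \<longrightarrow> wspace V W n = {0}"
  using mW by (simp add: is_module_def)

end

text \<open>The case \<open>l = 0\<close> of the Jacobi identity.\<close>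

lemma jacobi_commutator:
  fixes n :: "'i::ring_1"
  assumes J: "jacobi V W1 W2 W3 Y" and "u \<in> vcar V" "w1 \<in> mcar W1" "w2 \<in> mcar W2"
  shows "binomial_sum m (\<lambda>i. Y (mact W1 u (int i) w1) (of_int m + n - of_nat i) w2) =
    mact W3 u m (Y w1 n w2) - Y w1 n (mact W2 u m w2)"
proof -
  have "binomial_sum m (\<lambda>i. Y (mact W1 u (0 + int i) w1) (of_int m + n - of_nat i) w2)
      = alternating_sum 0 (\<lambda>i. mact W3 u (m + 0 - int i) (Y w1 (n + of_nat i) w2))
      - signed_sum 0 (\<lambda>i.
            Y w1 (n + of_int 0 - of_nat i) (mact W2 u (m + int i) w2))"
    using J assms(2-4) unfolding jacobi_def by blast
  also have "alternating_sum 0 (\<lambda>i. mact W3 u (m + 0 - int i) (Y w1 (n + of_nat i) w2)) =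
      mact W3 u m (Y w1 n w2)"
    by (subst Sum_any_single[of 0]) (auto simp: gbinomial_0_left)
  also have "signed_sum 0 (\<lambda>i.
            Y w1 (n + of_int 0 - of_nat i) (mact W2 u (m + int i) w2)) = Y w1 n (mact W2 u m w2)"
    by (subst Sum_any_single[of 0]) (auto simp: gbinomial_0_left)
  finally show ?thesis by simp
qed

lemma act_commutator:
  assumes "is_module V W" "u \<in> vcar V" "v \<in> vcar V" "w \<in> mcar W"
  shows "binomial_sum m (\<lambda>i. mact W (vY V u (int i) v) (m + n - int i) w) =
    mact W u m (mact W v n w) - mact W v n (mact W u m w)"
  using jacobi_commutator[OF act_jac[OF assms(1)] assms(2), of v w m n] assms by simp

section \<open>Intertwining operators\<close>

context
  fixes W1 W2 W3 Y
  assumes m1: "is_module V W1" and m2: "is_module V W2" and m3: "is_module V W3"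
    and it: "intertwining_operator V W1 W2 W3 Y"
begin

lemma it_lin1: "w2 \<in> mcar W2 \<Longrightarrow> clinear_on (mcar W1) (\<lambda>w1. Y w1 n w2)"
  using it by (simp add: intertwining_operator_def cbilinear_on_def)

lemma it_lin2: "w1 \<in> mcar W1 \<Longrightarrow> clinear_on (mcar W2) (Y w1 n)"
  using it by (simp add: intertwining_operator_def cbilinear_on_def)

lemma it_closed: "w1 \<in> mcar W1 \<Longrightarrow> w2 \<in> mcar W2 \<Longrightarrow> Y w1 n w2 \<in> mcar W3"
  using it by (simp add: intertwining_operator_def)

lemma it_trunc: "w1 \<in> mcar W1 \<Longrightarrow> w2 \<in> mcar W2 \<Longrightarrow> \<exists>N::real. \<forall>n. Re n \<ge> N \<longrightarrow> Y w1 n w2 = 0"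
  using it by (simp add: intertwining_operator_def)

lemma it_jac: "jacobi V W1 W2 W3 Y"
  using it by (simp add: intertwining_operator_def)

lemma it_deriv: "w1 \<in> mcar W1 \<Longrightarrow> w2 \<in> mcar W2 \<Longrightarrow> Y (Lop V W1 (-1) w1) n w2 = - (n *\<^sub>C Y w1 (n - 1) w2)"
  using it by (simp add: intertwining_operator_def)

lemma it_trunc_nat: "w1 \<in> mcar W1 \<Longrightarrow> w2 \<in> mcar W2 \<Longrightarrow> \<exists>N::nat. \<forall>i\<ge>N. Y w1 (n + of_nat i) w2 = 0"
proof -
  assume "w1 \<in> mcar W1" "w2 \<in> mcar W2"
  from it_trunc[OF this] obtain N where N: "\<And>n. Re n \<ge> N \<Longrightarrow> Y w1 n w2 = 0" by blast
  obtain M :: nat where M: "N - Re n \<le> of_nat M" using real_arch_simple by blast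
  show ?thesis
  proof (intro exI allI impI)
    fix i assume "i \<ge> M"
    then have "real M \<le> real i" by simp
    then have "Re (n + of_nat i) \<ge> N" using M by simp
    then show "Y w1 (n + of_nat i) w2 = 0" by (rule N)
  qed
qed

lemma it_01: "w2 \<in> mcar W2 \<Longrightarrow> Y 0 n w2 = 0"
  using clinear_on_0[OF it_lin1 mod_sub[OF m1]] by simp

lemma it_02: "w1 \<in> mcar W1 \<Longrightarrow> Y w1 n 0 = 0"
  using clinear_on_0[OF it_lin2 mod_sub[OF m2]] by simp

lemma it_support:
  assumes "u \<in> vcar V" "w1 \<in> mcar W1" "w2 \<in> mcar W2"
  shows "\<exists>N::nat. \<forall>i\<ge>N. \<forall>k. Y (mact W1 u (l + int i) w1) k w2 = 0"
    and "\<exists>N::nat. \<forall>i\<ge>N. \<forall>k. mact W3 u k (Y w1 (n + of_nat i) w2) = 0"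
    and "\<exists>N::nat. \<forall>i\<ge>N. \<forall>k. Y w1 k (mact W2 u (m + int i) w2) = 0"
proof -
  show "\<exists>N::nat. \<forall>i\<ge>N. \<forall>k. Y (mact W1 u (l + int i) w1) k w2 = 0"
    using act_trunc_nat[OF m1 assms(1,2), of l] it_01[OF assms(3)] by metis
  show "\<exists>N::nat. \<forall>i\<ge>N. \<forall>k. mact W3 u k (Y w1 (n + of_nat i) w2) = 0"
    using it_trunc_nat[OF assms(2,3), of n] act_0[OF m3] by metis
  show "\<exists>N::nat. \<forall>i\<ge>N. \<forall>k. Y w1 k (mact W2 u (m + int i) w2) = 0"
    using act_trunc_nat[OF m2 assms(1,3), of m] it_02[OF assms(2)] by metis
qed

lemma it_D:
  assumes "w1 \<in> mcar W1" "w2 \<in> mcar W2"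
  shows "Lop V W3 (-1) (Y w1 n w2) = Y w1 n (Lop V W2 (-1) w2) - n *\<^sub>C Y w1 (n - 1) w2"
proof -
  have "binomial_sum 0 (\<lambda>i. Y (mact W1 (omega V) (int i) w1) (of_int 0 + n - of_nat i) w2) =
    mact W3 (omega V) 0 (Y w1 n w2) - Y w1 n (mact W2 (omega V) 0 w2)"
    by (rule jacobi_commutator[OF it_jac omega_in assms])
  also have "binomial_sum 0 (\<lambda>i. Y (mact W1 (omega V) (int i) w1) (of_int 0 + n - of_nat i) w2) =
     Y (Lop V W1 (-1) w1) n w2"
    by (subst Sum_any_single[of 0]) (auto simp: gbinomial_0_left Lop_def)
  finally show ?thesis using it_deriv[OF assms, of n] by (simp add: Lop_def algebra_simps)
qed

text \<open>From the commutator formula for \<open>\<omega>\<close> and \<open>m = 1\<close>: \<open>L(0)\<close> acts on \<open>w1_n w2\<close> through \<open>L(0)\<close> on both arguments and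
  through \<open>L(-1) w1\<close>, which the derivative property turns into \<open>- n - 1\<close>.\<close>

lemma it_weight:
  assumes "w1 \<in> wspace V W1 a" "w2 \<in> wspace V W2 b"
  shows "Y w1 n w2 \<in> wspace V W3 (a + b - n - 1)"
proof -
  interpret g1: graded_space V W1 by (rule gs[OF m1])
  interpret g2: graded_space V W2 by (rule gs[OF m2])
  interpret g3: graded_space V W3 by (rule gs[OF m3])
  have w: "w1 \<in> mcar W1" "w2 \<in> mcar W2" using assms g1.wspace_mcar g2.wspace_mcar by auto
  have z: "(1::complex) gchoose i = 0" if "i \<ge> 2" for i
    using that binomial_gbinomial[of 1 i, where 'a = complex] by (simp add: binomial_eq_0)
  have "binomial_sum 1 (\<lambda>i. Y (mact W1 (omega V) (int i) w1) (of_int 1 + n - of_nat i) w2) =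
    mact W3 (omega V) 1 (Y w1 n w2) - Y w1 n (mact W2 (omega V) 1 w2)"
    by (rule jacobi_commutator[OF it_jac omega_in w])
  also have "binomial_sum 1 (\<lambda>i. Y (mact W1 (omega V) (int i) w1) (of_int 1 + n - of_nat i) w2) =
     Y (Lop V W1 (-1) w1) (1 + n) w2 + Y (Lop V W1 0 w1) n w2"
    by (subst Sum_any_nat[of 2]) (auto simp: z Lop_def numeral_2_eq_2)
  finally have E: "Y (Lop V W1 (-1) w1) (1 + n) w2 + Y (Lop V W1 0 w1) n w2 = Lop V W3 0 (Y w1 n w2) - Y w1 n (Lop V W2 0 w2)"
    by (simp add: Lop_def)
  have D: "Y (Lop V W1 (-1) w1) (1 + n) w2 = - ((1 + n) *\<^sub>C Y w1 n w2)"
    using it_deriv[OF w, of "1 + n"] by simp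
  have "Lop V W3 0 (Y w1 n w2) = Y w1 n (Lop V W2 0 w2) + Y (Lop V W1 0 w1) n w2 - (1 + n) *\<^sub>C Y w1 n w2"
    using E unfolding D by (simp add: algebra_simps)
  also have "Y w1 n (Lop V W2 0 w2) = b *\<^sub>C Y w1 n w2"
    using g2.wspaceD[OF assms(2)] clinear_on_scale[OF it_lin2[OF w(1)] w(2)] by simp
  also have "Y (Lop V W1 0 w1) n w2 = a *\<^sub>C Y w1 n w2"
    using g1.wspaceD[OF assms(1)] clinear_on_scale[OF it_lin1[OF w(2)] w(1)] by simp
  finally have "Lop V W3 0 (Y w1 n w2) = (a + b - n - 1) *\<^sub>C Y w1 n w2"
    by (simp add: cvs.scale_left_distrib cvs.scale_left_diff_distrib algebra_simps)
  then show ?thesis using it_closed[OF w] by (simp add: g3.wspaceI)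
qed

lemma it_wproj:
  assumes "w1 \<in> wspace V W1 a" "w2 \<in> wspace V W2 b"
  shows "wproj V W3 m (Y w1 n w2) = (if n = a + b - m - 1 then Y w1 n w2 else 0)"
proof -
  have "m = a + b - n - 1 \<longleftrightarrow> n = a + b - m - 1" by (auto simp: algebra_simps)
  then show ?thesis
    using graded_space.wproj_hom[OF gs[OF m3] it_weight[OF assms], of m n] by simp
qed

lemma subst_at_homogeneous:
  assumes "w1 \<in> wspace V W1 a" "w2 \<in> wspace V W2 b"
  shows "subst_at V W3 Y l w1 w2 m = exp ((m - a - b) * l) *\<^sub>C Y w1 (a + b - m - 1) w2"
  unfolding subst_at_def
  by (subst Sum_any_single[of "a + b - m - 1"]) (auto simp: it_wproj[OF assms] algebra_simps)

lemma subst_at_finite: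
  assumes "w1 \<in> mcar W1" "w2 \<in> mcar W2"
  shows "finite {n. c n *\<^sub>C wproj V W3 m (Y w1 n w2) \<noteq> 0}"
proof -
  interpret g1: graded_space V W1 by (rule gs[OF m1])
  interpret g2: graded_space V W2 by (rule gs[OF m2])
  interpret g3: graded_space V W3 by (rule gs[OF m3])
  have "finite {n. wproj V W3 m (Y w1 n w2) \<noteq> 0}"
    using assms(1)
  proof (induction rule: g1.homogeneous_induct)
    case (hom a x)
    show ?case using assms(2)
    proof (induction rule: g2.homogeneous_induct)
      case (hom b y)
      show ?case
        by (rule finite_subset[of _ "{a + b - m - 1}"]) (auto simp: it_wproj[OF \<open>x \<in> wspace V W1 a\<close> hom])
    next
      case (add y z)
      have x: "x \<in> mcar W1" using hom g1.wspace_mcar by blast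
      have "{n. wproj V W3 m (Y x n (y + z)) \<noteq> 0} \<subseteq> {n. wproj V W3 m (Y x n y) \<noteq> 0} \<union> {n. wproj V W3 m (Y x n z) \<noteq> 0}"
        using add x by (auto simp: clinear_on_add[OF it_lin2] clinear_on_add[OF g3.wproj_linear] it_closed)
      then show ?case using add by (auto intro: finite_subset)
    qed
  next
    case (add x z)
    have "{n. wproj V W3 m (Y (x + z) n w2) \<noteq> 0} \<subseteq> {n. wproj V W3 m (Y x n w2) \<noteq> 0} \<union> {n. wproj V W3 m (Y z n w2) \<noteq> 0}"
      using add assms by (auto simp: clinear_on_add[OF it_lin1] clinear_on_add[OF g3.wproj_linear] it_closed)
    then show ?case using add by (auto intro: finite_subset)
  qed
  then show ?thesis by (rule rev_finite_subset) auto
qed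

lemma subst_at_lin2:
  assumes "w1 \<in> mcar W1"
  shows "clinear_on (mcar W2) (\<lambda>w2. subst_at V W3 Y l w1 w2 m)"
  unfolding subst_at_def
  by (intro clinear_on_Sum_any_fun[OF mod_sub[OF m2]] clinear_on_scaleC subst_at_finite[OF assms]
      clinear_on_compose[OF it_lin2[OF assms] graded_space.wproj_linear[OF gs[OF m3]]])
    (auto intro: it_closed assms)

lemma subst_at_lin1:
  assumes "w2 \<in> mcar W2"
  shows "clinear_on (mcar W1) (\<lambda>w1. subst_at V W3 Y l w1 w2 m)"
  unfolding subst_at_def
  by (intro clinear_on_Sum_any_fun[OF mod_sub[OF m1]] clinear_on_scaleC subst_at_finite[OF _ assms]
      clinear_on_compose[OF it_lin1[OF assms] graded_space.wproj_linear[OF gs[OF m3]]])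
    (auto intro: it_closed assms)

lemma subst_at_completion:
  assumes "w1 \<in> mcar W1" "w2 \<in> mcar W2"
  shows "subst_at V W3 Y l w1 w2 \<in> formal_completion V W3"
  unfolding formal_completion_def
proof safe
  interpret g3: graded_space V W3 by (rule gs[OF m3])
  fix m
  show "subst_at V W3 Y l w1 w2 m \<in> wspace V W3 m" unfolding subst_at_def
    by (rule subspace_Sum_any[OF g3.wspace_subspace])
      (use assms in \<open>auto intro!: cvs.subspace_scale[OF g3.wspace_subspace] g3.wproj_in it_closed\<close>)
qed

end

lemma bilinear_eqI:
  assumes m1: "is_module V W1" and m2: "is_module V W2"
    and f: "cbilinear_on (mcar W1) (mcar W2) f" and g: "cbilinear_on (mcar W1) (mcar W2) g"
    and eq: "\<And>a b x y. x \<in> wspace V W1 a \<Longrightarrow> y \<in> wspace V W2 b \<Longrightarrow> f x y = g x y"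
    and w: "w1 \<in> mcar W1" "w2 \<in> mcar W2"
  shows "f w1 w2 = g w1 w2"
proof -
  interpret g1: graded_space V W1 by (rule gs[OF m1])
  interpret g2: graded_space V W2 by (rule gs[OF m2])
  note fl = f[unfolded cbilinear_on_def] and gl = g[unfolded cbilinear_on_def]
  show ?thesis using w(1)
  proof (induction rule: g1.homogeneous_induct)
    case (hom a x)
    show ?case using w(2)
    proof (induction rule: g2.homogeneous_induct)
      case (hom b y)
      then show ?case using eq \<open>x \<in> wspace V W1 a\<close> by blast
    next
      case (add y z)
      have x: "x \<in> mcar W1" using hom g1.wspace_mcar by blast
      then show ?case using add fl gl clinear_on_add[of "mcar W2" "f x"] clinear_on_add[of "mcar W2" "g x"] by simp
    qed
  next
    case (add x z)
    then show ?case using w(2) fl gl clinear_on_add[of "mcar W1" "\<lambda>x. f x w2"] clinear_on_add[of "mcar W1" "\<lambda>x. g x w2"] by simp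
  qed
qed

text \<open>On homogeneous arguments each mode is, up to a nonzero scalar, one weight component of the value at \<open>e^l\<close>. Hence an
  intertwining operator is determined by its values at one point.\<close>

lemma intertwining_determined:
  assumes m: "is_module V W1" "is_module V W2" "is_module V W3"
    and Y: "intertwining_operator V W1 W2 W3 Y" and Y': "intertwining_operator V W1 W2 W3 Y'"
    and eq: "\<And>w1 w2. w1 \<in> mcar W1 \<Longrightarrow> w2 \<in> mcar W2 \<Longrightarrow> subst_at V W3 Y l w1 w2 = subst_at V W3 Y' l w1 w2"
    and w: "w1 \<in> mcar W1" "w2 \<in> mcar W2"
  shows "Y w1 n w2 = Y' w1 n w2"
proof (rule bilinear_eqI[OF m(1,2) _ _ _ w, where f = "\<lambda>w1 w2. Y w1 n w2" and g = "\<lambda>w1 w2. Y' w1 n w2"])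
  show "cbilinear_on (mcar W1) (mcar W2) (\<lambda>w1 w2. Y w1 n w2)"
    "cbilinear_on (mcar W1) (mcar W2) (\<lambda>w1 w2. Y' w1 n w2)"
    using Y Y' by (auto simp: intertwining_operator_def)
  fix a b x y assume xy: "x \<in> wspace V W1 a" "y \<in> wspace V W2 b"
  have "x \<in> mcar W1" "y \<in> mcar W2"
    using xy graded_space.wspace_mcar gs m by blast+
  from eq[OF this] have "subst_at V W3 Y l x y (a + b - n - 1) = subst_at V W3 Y' l x y (a + b - n - 1)" by simp
  then show "Y x n y = Y' x n y"
    by (simp add: subst_at_homogeneous[OF m Y xy] subst_at_homogeneous[OF m Y' xy])
qed

section \<open>Module maps\<close>

lemma HomD:
  assumes "f \<in> Hom V W1 W2"
  shows Hom_lin: "clinear_on (mcar W1) f" and Hom_closed: "w \<in> mcar W1 \<Longrightarrow> f w \<in> mcar W2"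
    and Hom_act: "v \<in> vcar V \<Longrightarrow> w \<in> mcar W1 \<Longrightarrow> f (mact W1 v n w) = mact W2 v n (f w)"
    and Hom_out: "w \<notin> mcar W1 \<Longrightarrow> f w = 0"
  using assms by (auto simp: Hom_def)

lemma Hom_compose:
  assumes "f \<in> Hom V W1 W2" "g \<in> Hom V W2 W3" "is_module V W1" "is_module V W2" "is_module V W3"
  shows "g \<circ> f \<in> Hom V W1 W3"
proof -
  have "g 0 = 0" using clinear_on_0[OF Hom_lin[OF assms(2)] mod_sub[OF assms(4)]] .
  then show ?thesis
    using clinear_on_compose[OF Hom_lin[OF assms(1)] Hom_lin[OF assms(2)]] HomD[OF assms(1)] HomD[OF assms(2)]
    unfolding Hom_def by (auto simp: o_def)
qed

lemma idm_Hom: "is_module V W \<Longrightarrow> idm W \<in> Hom V W W"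
  unfolding Hom_def idm_def clinear_on_def
  using cvs.subspace_add[OF mod_sub] cvs.subspace_scale[OF mod_sub] act_closed by auto

lemma Hom_Lop: "f \<in> Hom V W1 W2 \<Longrightarrow> w \<in> mcar W1 \<Longrightarrow> f (Lop V W1 n w) = Lop V W2 n (f w)"
  unfolding Lop_def by (rule Hom_act[OF _ omega_in])

lemma Hom_wspace:
  assumes "f \<in> Hom V W1 W2" "w \<in> wspace V W1 n"
  shows "f w \<in> wspace V W2 n"
  using assms Hom_Lop[OF assms(1), of w 0] Hom_closed[OF assms(1)] clinear_on_scale[OF Hom_lin[OF assms(1)]]
  by (auto simp: wspace_def)

lemma Hom_wproj:
  assumes f: "f \<in> Hom V W1 W2" and m: "is_module V W1" "is_module V W2" and w: "w \<in> mcar W1"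
  shows "f (wproj V W1 n w) = wproj V W2 n (f w)"
proof -
  interpret g1: graded_space V W1 by (rule gs[OF m(1)])
  interpret g2: graded_space V W2 by (rule gs[OF m(2)])
  have f0: "f 0 = 0" by (rule clinear_on_0[OF Hom_lin[OF f] g1.sub])
  have "wproj V W2 n (f w) = (\<lambda>n. f (wproj V W1 n w)) n"
  proof (rule g2.wproj_eqI)
    show "f (wproj V W1 k w) \<in> wspace V W2 k" for k by (rule Hom_wspace[OF f g1.wproj_in[OF w]])
    show "finite {k. f (wproj V W1 k w) \<noteq> 0}"
      by (rule rev_finite_subset[OF g1.wproj_finite[OF w]]) (auto simp: f0)
    show "Sum_any (\<lambda>k. f (wproj V W1 k w)) = f w"
      using clinear_on_Sum_any[OF Hom_lin[OF f] g1.sub g1.wproj_mcar[OF w] g1.wproj_finite[OF w]] g1.wproj_Sum_any[OF w]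
      by simp
  qed
  then show ?thesis by simp
qed

lemma cext_emb:
  assumes f: "f \<in> Hom V W1 W2" and m: "is_module V W1" "is_module V W2" and w: "w \<in> mcar W1"
  shows "cext f (emb V W1 w) = emb V W2 (f w)"
  unfolding cext_def emb_def using Hom_wproj[OF assms] by simp

lemma cext_completion:
  assumes f: "f \<in> Hom V W1 W2" and g: "g \<in> formal_completion V W1"
  shows "cext f g \<in> formal_completion V W2"
  using g Hom_wspace[OF f] unfolding formal_completion_def cext_def by auto

lemma cext_comp: "cext (g \<circ> f) x = cext g (cext f x)"
  by (simp add: cext_def o_def)

lemma contragredient_pullback:
  assumes f: "f \<in> Hom V W1 W2" and p: "p \<in> contragredient V W2"
  shows "p \<circ> f \<in> contragredient V W1"
proof -
  have "clinear_on (mcar W1) (p \<circ> f)"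
    using clinear_on_compose[OF Hom_lin[OF f], of "mcar W2" p] p Hom_closed[OF f]
    by (auto simp: contragredient_def o_def)
  moreover have "finite {n. \<exists>w\<in>wspace V W1 n. (p \<circ> f) w \<noteq> 0}"
    by (rule finite_subset[of _ "{n. \<exists>w\<in>wspace V W2 n. p w \<noteq> 0}"])
      (use p Hom_wspace[OF f] in \<open>auto simp: contragredient_def\<close>)
  ultimately show ?thesis by (simp add: contragredient_def)
qed

lemma pairing_cext: "pairing p (cext f g) = pairing (p \<circ> f) g"
  by (simp add: pairing_def cext_def o_def)

lemma has_weak_sum_cext:
  assumes f: "f \<in> Hom V W1 W2" and s: "has_weak_sum V W1 F S g"
  shows "has_weak_sum V W2 (\<lambda>s. cext f (F s)) S (cext f g)"
  using s contragredient_pullback[OF f] cext_completion[OF f] unfolding has_weak_sum_def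
  by (simp add: pairing_cext)

lemma subst_at_cext:
  assumes h: "h \<in> Hom V W3 W4" and m: "is_module V W1" "is_module V W2" "is_module V W3" "is_module V W4"
    and Y: "intertwining_operator V W1 W2 W3 Y" and w: "w1 \<in> mcar W1" "w2 \<in> mcar W2"
  shows "cext h (subst_at V W3 Y l w1 w2) = subst_at V W4 (\<lambda>w1 n w2. h (Y w1 n w2)) l w1 w2"
proof
  fix k
  interpret g3: graded_space V W3 by (rule gs[OF m(3)])
  have mem: "exp ((- n - 1) * l) *\<^sub>C wproj V W3 k (Y w1 n w2) \<in> mcar W3" for n
    by (rule cvs.subspace_scale[OF g3.sub g3.wproj_mcar[OF it_closed[OF m(1-3) Y w]]])
  have "h (exp ((- n - 1) * l) *\<^sub>C wproj V W3 k (Y w1 n w2)) = exp ((- n - 1) * l) *\<^sub>C wproj V W4 k (h (Y w1 n w2))" for n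
    using clinear_on_scale[OF Hom_lin[OF h] g3.wproj_mcar[OF it_closed[OF m(1-3) Y w]]]
      Hom_wproj[OF h m(3,4) it_closed[OF m(1-3) Y w]] by simp
  then show "cext h (subst_at V W3 Y l w1 w2) k = subst_at V W4 (\<lambda>w1 n w2. h (Y w1 n w2)) l w1 w2 k"
    unfolding cext_def subst_at_def
    using clinear_on_Sum_any[OF Hom_lin[OF h] g3.sub mem subst_at_finite[OF m(1-3) Y w]] by simp
qed

lemma intertwining_compose:
  assumes h: "h \<in> Hom V W3 W4" and m: "is_module V W1" "is_module V W2" "is_module V W3" "is_module V W4"
    and Y: "intertwining_operator V W1 W2 W3 Y"
  shows "intertwining_operator V W1 W2 W4 (\<lambda>w1 n w2. h (Y w1 n w2))"
  unfolding intertwining_operator_def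
proof (intro conjI allI ballI)
  note hl = Hom_lin[OF h] and s3 = mod_sub[OF m(3)]
  have h0: "h 0 = 0" by (rule clinear_on_0[OF hl s3])
  show "cbilinear_on (mcar W1) (mcar W2) (\<lambda>w1 w2. h (Y w1 n w2))" for n
    by (rule cbilinear_onI; rule clinear_on_compose[OF _ hl])
      (auto intro!: it_lin1[OF m(1-3) Y] it_lin2[OF m(1-3) Y] it_closed[OF m(1-3) Y])
  show "h (Y w1 n w2) \<in> mcar W4" if "w1 \<in> mcar W1" "w2 \<in> mcar W2" for w1 n w2
    by (rule Hom_closed[OF h it_closed[OF m(1-3) Y that]])
  show "\<exists>N::real. \<forall>n. Re n \<ge> N \<longrightarrow> h (Y w1 n w2) = 0" if "w1 \<in> mcar W1" "w2 \<in> mcar W2" for w1 w2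
    using it_trunc[OF m(1-3) Y that] h0 by metis
  show "h (Y (Lop V W1 (-1) w1) n w2) = - (n *\<^sub>C h (Y w1 (n - 1) w2))"
    if "w1 \<in> mcar W1" "w2 \<in> mcar W2" for w1 n w2
  proof -
    have c: "Y w1 (n - 1) w2 \<in> mcar W3" by (rule it_closed[OF m(1-3) Y that])
    then have "n *\<^sub>C Y w1 (n - 1) w2 \<in> mcar W3" by (rule cvs.subspace_scale[OF s3])
    then show ?thesis
      unfolding it_deriv[OF m(1-3) Y that] using clinear_on_minus[OF hl] clinear_on_scale[OF hl c] by simp
  qed
  show "jacobi V W1 W2 W4 (\<lambda>w1 n w2. h (Y w1 n w2))"
    unfolding jacobi_def
  proof (intro ballI allI)
    fix u w1 w2 l m' n assume u: "u \<in> vcar V" and w: "w1 \<in> mcar W1" "w2 \<in> mcar W2"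
    obtain N1 :: nat where N1: "\<And>i k. i \<ge> N1 \<Longrightarrow> Y (mact W1 u (l + int i) w1) k w2 = 0"
      using it_support(1)[OF m(1-3) Y u w] by blast
    obtain N2 :: nat where N2: "\<And>i k. i \<ge> N2 \<Longrightarrow> mact W3 u k (Y w1 (n + of_nat i) w2) = 0"
      using it_support(2)[OF m(1-3) Y u w] by blast
    obtain N3 :: nat where N3: "\<And>i k. i \<ge> N3 \<Longrightarrow> Y w1 k (mact W2 u (m' + int i) w2) = 0"
      using it_support(3)[OF m(1-3) Y u w] by blast
    let ?A = "\<lambda>i::nat. Y (mact W1 u (l + int i) w1) (of_int m' + n - of_nat i) w2"
    let ?B = "\<lambda>i::nat. mact W3 u (m' + l - int i) (Y w1 (n + of_nat i) w2)"
    let ?C = "\<lambda>i::nat. Y w1 (n + of_int l - of_nat i) (mact W2 u (m' + int i) w2)"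
    have A: "?A i \<in> mcar W3" for i by (intro it_closed[OF m(1-3) Y] act_closed[OF m(1)] u w)
    have B: "?B i \<in> mcar W3" for i by (intro it_closed[OF m(1-3) Y] act_closed[OF m(3)] u w)
    have C: "?C i \<in> mcar W3" for i by (intro it_closed[OF m(1-3) Y] act_closed[OF m(2)] u w)
    have hs: "h (Sum_any (\<lambda>i. c i *\<^sub>C f i)) = Sum_any (\<lambda>i. c i *\<^sub>C h (f i))" "Sum_any (\<lambda>i. c i *\<^sub>C f i) \<in> mcar W3"
      if f: "\<And>i. f i \<in> mcar W3" and z: "\<And>i. i \<ge> N \<Longrightarrow> f i = 0" for c :: "nat \<Rightarrow> complex" and f N
    proof -
      have cf: "c i *\<^sub>C f i \<in> mcar W3" for i by (rule cvs.subspace_scale[OF s3 f])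
      have fin: "finite {i. c i *\<^sub>C f i \<noteq> 0}" by (rule finite_nat_support[of N]) (simp add: z)
      show "h (Sum_any (\<lambda>i. c i *\<^sub>C f i)) = Sum_any (\<lambda>i. c i *\<^sub>C h (f i))"
        using clinear_on_Sum_any[OF hl s3 cf fin] clinear_on_scale[OF hl f] by simp
      show "Sum_any (\<lambda>i. c i *\<^sub>C f i) \<in> mcar W3" by (rule subspace_Sum_any[OF s3 cf])
    qed
    have "binomial_sum m' (\<lambda>i. ?A i) =
        alternating_sum l (\<lambda>i. ?B i) -
        signed_sum l (\<lambda>i. ?C i)"
      using it_jac[OF m(1-3) Y] u w unfolding jacobi_def by blast
    then have "h (binomial_sum m' (\<lambda>i. ?A i)) =
        h (alternating_sum l (\<lambda>i. ?B i)) -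
        h (signed_sum l (\<lambda>i. ?C i))"
      using clinear_on_diff[OF hl s3 hs(2)[where f = ?B, OF B N2] hs(2)[where f = ?C, OF C N3]] by simp
    moreover have "h (binomial_sum m' (\<lambda>i. ?A i)) = binomial_sum m' (\<lambda>i. h (?A i))"
      by (rule hs(1)[where f = ?A, OF A N1])
    moreover have "h (alternating_sum l (\<lambda>i. ?B i)) = alternating_sum l (\<lambda>i. h (?B i))"
      by (rule hs(1)[where f = ?B, OF B N2])
    moreover have "h (signed_sum l (\<lambda>i. ?C i)) = signed_sum l (\<lambda>i. h (?C i))"
      by (rule hs(1)[where f = ?C, OF C N3])
    ultimately show "binomial_sum m' (\<lambda>i. h (?A i)) =
        alternating_sum l (\<lambda>i. mact W4 u (m' + l - int i) (h (Y w1 (n + of_nat i) w2))) -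
        signed_sum l (\<lambda>i. h (?C i))"
      by (simp only: Hom_act[OF h u it_closed[OF m(1-3) Y w]])
  qed
qed

lemma intertwining_precompose:
  assumes f: "f \<in> Hom V U1 W1" and g: "g \<in> Hom V U2 W2"
    and Y: "intertwining_operator V W1 W2 W3 Y"
  shows "intertwining_operator V U1 U2 W3 (\<lambda>w1 n w2. Y (f w1) n (g w2))"
  unfolding intertwining_operator_def
proof (intro conjI allI ballI)
  have bl: "\<And>n. cbilinear_on (mcar W1) (mcar W2) (\<lambda>w1 w2. Y w1 n w2)"
    and cl: "\<And>w1 w2 n. w1 \<in> mcar W1 \<Longrightarrow> w2 \<in> mcar W2 \<Longrightarrow> Y w1 n w2 \<in> mcar W3"
    and tr: "\<And>w1 w2. w1 \<in> mcar W1 \<Longrightarrow> w2 \<in> mcar W2 \<Longrightarrow> \<exists>N::real. \<forall>n. Re n \<ge> N \<longrightarrow> Y w1 n w2 = 0"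
    and jc: "jacobi V W1 W2 W3 Y"
    and dr: "\<And>w1 w2 n. w1 \<in> mcar W1 \<Longrightarrow> w2 \<in> mcar W2 \<Longrightarrow> Y (Lop V W1 (-1) w1) n w2 = - (n *\<^sub>C Y w1 (n - 1) w2)"
    using Y by (auto simp: intertwining_operator_def)
  note fc = Hom_closed[OF f] and gc = Hom_closed[OF g]
  show "cbilinear_on (mcar U1) (mcar U2) (\<lambda>w1 w2. Y (f w1) n (g w2))" for n
  proof (rule cbilinear_onI)
    fix y assume "y \<in> mcar U2"
    then have "clinear_on (mcar W1) (\<lambda>x. Y x n (g y))" using bl gc by (simp add: cbilinear_on_def)
    then show "clinear_on (mcar U1) (\<lambda>x. Y (f x) n (g y))"
      using clinear_on_compose[OF Hom_lin[OF f]] fc by blast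
  next
    fix x assume "x \<in> mcar U1"
    then have "clinear_on (mcar W2) (Y (f x) n)" using bl fc by (simp add: cbilinear_on_def)
    then show "clinear_on (mcar U2) (\<lambda>y. Y (f x) n (g y))"
      using clinear_on_compose[OF Hom_lin[OF g]] gc by blast
  qed
  show "Y (f w1) n (g w2) \<in> mcar W3" if "w1 \<in> mcar U1" "w2 \<in> mcar U2" for w1 n w2 using that fc gc cl by blast
  show "\<exists>N::real. \<forall>n. Re n \<ge> N \<longrightarrow> Y (f w1) n (g w2) = 0" if "w1 \<in> mcar U1" "w2 \<in> mcar U2" for w1 w2
    using that fc gc tr by blast
  show "Y (f (Lop V U1 (-1) w1)) n (g w2) = - (n *\<^sub>C Y (f w1) (n - 1) (g w2))"
    if "w1 \<in> mcar U1" "w2 \<in> mcar U2" for w1 n w2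
    using that fc gc dr Hom_Lop[OF f that(1)] by simp
  show "jacobi V U1 U2 W3 (\<lambda>w1 n w2. Y (f w1) n (g w2))"
    unfolding jacobi_def
  proof (intro ballI allI, goal_cases)
    case (1 u w1 w2 l m' n)
    show ?case
      unfolding Hom_act[OF f 1(1,2)] Hom_act[OF g 1(1,3)]
      using jc 1(1) fc[OF 1(2)] gc[OF 1(3)] unfolding jacobi_def by blast
  qed
qed

text \<open>For non-integral \<open>n\<close> all three sums in the Jacobi identity are empty.\<close>

lemma cmodes_intertwining:
  assumes m: "is_module V W3"
    and bl: "\<And>n. cbilinear_on (mcar W1) (mcar W2) (\<lambda>w1 w2. y w1 n w2)"
    and cl: "\<And>w1 w2 n. w1 \<in> mcar W1 \<Longrightarrow> w2 \<in> mcar W2 \<Longrightarrow> y w1 n w2 \<in> mcar W3"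
    and tr: "\<And>w1 w2. w1 \<in> mcar W1 \<Longrightarrow> w2 \<in> mcar W2 \<Longrightarrow> \<exists>N. \<forall>n\<ge>N. y w1 n w2 = 0"
    and jc: "jacobi V W1 W2 W3 y"
    and dr: "\<And>w1 w2 n. w1 \<in> mcar W1 \<Longrightarrow> w2 \<in> mcar W2 \<Longrightarrow> y (Lop V W1 (-1) w1) n w2 = - (of_int n *\<^sub>C y w1 (n - 1) w2)"
  shows "intertwining_operator V W1 W2 W3 (cmodes y)"
  unfolding intertwining_operator_def
proof (intro conjI allI ballI)
  show "cbilinear_on (mcar W1) (mcar W2) (\<lambda>w1 w2. cmodes y w1 n w2)" for n
  proof (cases "n \<in> \<int>")
    case True
    then obtain k where "n = of_int k" by (auto elim: Ints_cases)
    then show ?thesis using bl by simp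
  next
    case False
    then show ?thesis by (simp add: cmodes_not_int cbilinear_on_def clinear_on_def)
  qed
  show "cmodes y w1 n w2 \<in> mcar W3" if "w1 \<in> mcar W1" "w2 \<in> mcar W2" for w1 n w2
    using cl[OF that] mod_0[OF m] by (simp add: cmodes_def)
  show "\<exists>N::real. \<forall>n. Re n \<ge> N \<longrightarrow> cmodes y w1 n w2 = 0" if w: "w1 \<in> mcar W1" "w2 \<in> mcar W2" for w1 w2
  proof -
    obtain N where N: "\<And>n. n \<ge> N \<Longrightarrow> y w1 n w2 = 0" using tr[OF w] by blast
    show ?thesis
    proof (intro exI[of _ "of_int N"] allI impI)
      fix n :: complex assume n: "Re n \<ge> of_int N"
      show "cmodes y w1 n w2 = 0"
      proof (cases "n \<in> \<int>")
        case True
        then obtain k where "n = of_int k" by (auto elim: Ints_cases)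
        then show ?thesis using n N by simp
      qed (rule cmodes_not_int)
    qed
  qed
  show "cmodes y (Lop V W1 (-1) w1) n w2 = - (n *\<^sub>C cmodes y w1 (n - 1) w2)"
    if w: "w1 \<in> mcar W1" "w2 \<in> mcar W2" for w1 n w2
  proof (cases "n \<in> \<int>")
    case True
    then obtain k where k: "n = of_int k" by (auto elim: Ints_cases)
    then have "n - 1 = of_int (k - 1)" by simp
    then show ?thesis unfolding k using dr[OF w, of k] by (simp only: cmodes_of_int)
  next
    case False
    then have "n - 1 \<notin> \<int>" using Ints_add[of "n - 1" 1] by auto
    then show ?thesis using False by (simp add: cmodes_not_int)
  qed
  show "jacobi V W1 W2 W3 (cmodes y)"
    unfolding jacobi_def
  proof (intro ballI allI, goal_cases)
    case (1 u w1 w2 l m' n)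
    show ?case
    proof (cases "n \<in> \<int>")
      case True
      then obtain k where k: "n = of_int k" by (auto elim: Ints_cases)
      show ?thesis
        using jc[unfolded jacobi_def, rule_format, OF 1, of m' l k] unfolding k of_int_index cmodes_of_int by simp
    next
      case False
      have n1: "of_int m' + n - of_nat i \<notin> \<int>" for i
        using False Ints_diff[of "of_int m' + n - of_nat i" "of_int (m' - int i)"] by (auto simp: algebra_simps)
      have n2: "n + of_nat i \<notin> \<int>" for i
        using False Ints_diff[of "n + of_nat i" "of_nat i"] by auto
      have n3: "n + of_int l - of_nat i \<notin> \<int>" for i
        using n1[of i] False Ints_diff[of "n + of_int l - of_nat i" "of_int (l - int i)"] by (auto simp: algebra_simps)
      show ?thesis by (simp add: cmodes_not_int n1 n2 n3 act_0[OF m])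
    qed
  qed
qed

lemma action_intertwining:
  assumes "is_module V W"
  shows "intertwining_operator V (adj V) W W (cmodes (mact W))"
  by (rule cmodes_intertwining[OF assms])
    (use assms act_lin act_linv act_closed act_trunc act_jac act_deriv in \<open>auto simp: cbilinear_on_def\<close>)

lemma act_D:
  assumes "is_module V W" "v \<in> vcar V" "w \<in> mcar W"
  shows "Lop V W (-1) (mact W v n w) = mact W v n (Lop V W (-1) w) - of_int n *\<^sub>C mact W v (n - 1) w"
proof -
  have "of_int n - 1 = (of_int (n - 1) :: complex)" by simp
  then show ?thesis
    using it_D[OF adj_module assms(1,1) action_intertwining[OF assms(1)], of v w "of_int n"] assms
    by (simp only: cmodes_of_int adj_car)
qed

lemma Lop_weight:
  assumes "is_module V W" "w \<in> wspace V W b"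
  shows "Lop V W (-1) w \<in> wspace V W (b + 1)"
proof -
  have g: "graded_space V W" by (rule gs[OF assms(1)])
  have w: "w \<in> mcar W" by (rule graded_space.wspace_mcar[OF g assms(2)])
  have "Lop V W 0 (Lop V W (-1) w) = (b + 1) *\<^sub>C Lop V W (-1) w"
  proof -
    have o: "Lop V W 0 w = b *\<^sub>C w" by (rule graded_space.wspaceD[OF g assms(2)])
    have "Lop V W (-1) (mact W (omega V) 1 w) = mact W (omega V) 1 (Lop V W (-1) w) - of_int 1 *\<^sub>C mact W (omega V) (1 - 1) w"
      by (rule act_D[OF assms(1) omega_in w])
    then have "Lop V W (-1) (b *\<^sub>C w) = Lop V W 0 (Lop V W (-1) w) - Lop V W (-1) w"
      using o by (simp add: Lop_def)
    then show ?thesis using clinear_on_scale[OF Lop_lin[OF assms(1)] w]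
      by (simp add: cvs.scale_left_distrib algebra_simps)
  qed
  then show ?thesis using graded_space.wspaceI[OF g] Lop_closed[OF assms(1) w] by blast
qed

end

section \<open>The exponential of the translation operator\<close>

lemma sum_square_triangle:
  fixes F :: "nat \<Rightarrow> nat \<Rightarrow> 'a::comm_monoid_add"
  assumes "\<And>j r. j + r \<ge> N \<Longrightarrow> F j r = 0"
  shows "(\<Sum>j<N. \<Sum>r<N. F j r) = (\<Sum>k<N. \<Sum>j\<le>k. F j (k - j))"
proof -
  have nz: "j + r < N" if "F j r \<noteq> 0" for j r using assms[of j r] that by (meson not_less)
  have "(\<Sum>j<N. \<Sum>r<N. F j r) = (\<Sum>(j, r)\<in>{..<N} \<times> {..<N}. F j r)"
    by (simp add: sum.cartesian_product)
  also have "\<dots> = (\<Sum>(j, r)\<in>{(j, r). j + r < N}. F j r)"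
    by (rule sum.mono_neutral_right) (auto dest: nz)
  also have "\<dots> = (\<Sum>k<N. \<Sum>j\<le>k. F j (k - j))" by (rule sum.triangle_reindex)
  finally show ?thesis .
qed

lemma uniform_bound:
  fixes P :: "nat \<Rightarrow> nat \<Rightarrow> bool"
  assumes "\<And>i r. i \<ge> N1 \<Longrightarrow> P i r" "\<And>i. \<exists>R. \<forall>r\<ge>R. P i r"
  shows "\<exists>N. \<forall>i r. i \<ge> N \<or> r \<ge> N \<longrightarrow> P i r"
proof -
  obtain R where R: "\<And>i r. r \<ge> R i \<Longrightarrow> P i r" using assms(2) by metis
  have "P i r" if "i \<ge> N1 + (\<Sum>i<N1. R i) \<or> r \<ge> N1 + (\<Sum>i<N1. R i)" for i r
  proof (cases "i \<ge> N1")
    case False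
    then have "R i \<le> (\<Sum>i<N1. R i)" by (intro member_le_sum) auto
    then show ?thesis using R[of i r] that False by linarith
  qed (rule assms(1))
  then show ?thesis by blast
qed

text \<open>An alternating form of Vandermonde's convolution, with upper index descending along the sum. It collapses
  the double sum that arises from moving a mode through \<open>e^(- x L(-1))\<close>.\<close>

lemma vandermonde_alternating:
  fixes l m :: complex
  shows "(\<Sum>i\<le>q. (l gchoose i) * ((-1) ^ (q - i) * (m + l - of_nat i gchoose (q - i)))) = (-1) ^ q * (m gchoose q)"
proof -
  have s: "(-1) ^ j * ((-1) ^ j * x) = (x::complex)" for j x
    by (simp add: mult.assoc[symmetric] flip: power_mult_distrib)
  have e: "(-1) ^ (q - i) * (m + l - of_nat i gchoose (q - i)) = (of_nat q - m - l - 1 gchoose (q - i))" if "i \<le> q" for i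
  proof -
    have "of_nat (q - i) - (m + l - of_nat i) - 1 = of_nat q - m - l - 1"
      using that by (simp add: of_nat_diff)
    then show ?thesis using gbinomial_negated_upper[of "m + l - of_nat i" "q - i"] s by metis
  qed
  have "(\<Sum>i\<le>q. (l gchoose i) * ((-1) ^ (q - i) * (m + l - of_nat i gchoose (q - i)))) =
     (\<Sum>i=0..q. (l gchoose i) * (of_nat q - m - l - 1 gchoose (q - i)))"
    unfolding atMost_atLeast0 by (intro sum.cong refl) (use e in auto)
  also have "\<dots> = (l + (of_nat q - m - l - 1) gchoose q)" by (rule gbinomial_Vandermonde)
  also have "l + (of_nat q - m - l - 1) = of_nat q - m - 1" by simp
  also have "(of_nat q - m - 1 gchoose q) = (-1) ^ q * (m gchoose q)"
    using gbinomial_negated_upper[of m q] s by metis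
  finally show ?thesis .
qed

text \<open>The component of degree \<open>k\<close> of \<open>e^(s L(-1)) x\<close>.\<close>

definition dexp :: "'u::complex_vector voa \<Rightarrow> 'u vmod \<Rightarrow> complex \<Rightarrow> nat \<Rightarrow> 'u \<Rightarrow> 'u" where
  "dexp V W s k x = (s ^ k / fact k) *\<^sub>C ((Lop V W (-1)) ^^ k) x"

text \<open>The opposite operator \<open>e^(x L(-1)) Y(w2, e^(\<i> \<pi>) x) w1\<close>, written in modes. The branch \<open>e^(\<i> \<pi>)\<close> matches the
  path in the upper half plane in the definition of the braiding.\<close>

definition skew_op :: "'u::complex_vector voa \<Rightarrow> 'u vmod \<Rightarrow> ('u \<Rightarrow> complex \<Rightarrow> 'u \<Rightarrow> 'u) \<Rightarrow> 'u \<Rightarrow> complex \<Rightarrow> 'u \<Rightarrow> 'u" where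
  "skew_op V W Y w1 n w2 = exp ((- n - 1) * (\<i> * pi)) *\<^sub>C
     Sum_any (\<lambda>k::nat. dexp V W (-1) k (Y w2 (n + of_nat k) w1))"

lemma skew_phase: "exp ((- (n + of_int k) - 1) * (\<i> * pi)) = (-1) powi k * exp ((- n - 1) * (\<i> * pi))"
proof -
  have "exp ((- (n + of_int k) - 1) * (\<i> * pi)) = exp ((- n - 1) * (\<i> * pi)) * exp (of_int (- k) * (\<i> * pi))"
    by (simp add: exp_add[symmetric] algebra_simps)
  also have "exp (of_int (- k) * (\<i> * pi)) = exp (\<i> * pi) powi (- k)"
    by (rule exp_power_int[symmetric])
  also have "exp (\<i> * pi) = -1" using exp_pi_i' by (simp add: mult.commute)
  also have "(-1 :: complex) powi (- k) = (-1) powi k"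
    by (cases "even k") (auto simp: power_int_minus)
  finally show ?thesis by (simp add: mult.commute)
qed

context fixed_voa
begin

context
  fixes W assumes mW: "is_module V W"
begin

lemma Dpow_closed: "x \<in> mcar W \<Longrightarrow> ((Lop V W (-1)) ^^ k) x \<in> mcar W"
  by (induction k) (auto intro: Lop_closed[OF mW])

lemma Dpow_lin: "clinear_on (mcar W) ((Lop V W (-1)) ^^ k)"
proof (induction k)
  case (Suc k)
  have "clinear_on (mcar W) (\<lambda>x. Lop V W (-1) (((Lop V W (-1)) ^^ k) x))"
    by (rule clinear_on_compose[OF Suc Lop_lin[OF mW]]) (auto intro: Dpow_closed)
  then show ?case by (simp add: o_def)
qed (simp add: clinear_on_def)

lemma dexp_closed: "x \<in> mcar W \<Longrightarrow> dexp V W s k x \<in> mcar W"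
  unfolding dexp_def by (rule cvs.subspace_scale[OF mod_sub[OF mW] Dpow_closed])

lemma dexp_lin: "clinear_on (mcar W) (dexp V W s k)"
  using Dpow_lin[of k] unfolding dexp_def clinear_on_def
  by (simp add: cvs.scale_right_distrib mult.commute)

lemma dexp_0 [simp]: "dexp V W s 0 x = x"
  by (simp add: dexp_def)

lemma dexp_zero: "dexp V W s k 0 = 0"
  by (rule clinear_on_0[OF dexp_lin mod_sub[OF mW]])

lemma dexp_Suc: "x \<in> mcar W \<Longrightarrow> s *\<^sub>C Lop V W (-1) (dexp V W s k x) = of_nat (Suc k) *\<^sub>C dexp V W s (Suc k) x"
proof -
  assume x: "x \<in> mcar W"
  have "s *\<^sub>C Lop V W (-1) (dexp V W s k x) = (s * (s ^ k / fact k)) *\<^sub>C ((Lop V W (-1)) ^^ Suc k) x"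
    unfolding dexp_def using clinear_on_scale[OF Lop_lin[OF mW] Dpow_closed[OF x]] by simp
  also have "s * (s ^ k / fact k) = of_nat (Suc k) * (s ^ Suc k / fact (Suc k))"
    by (simp add: fact_Suc del: of_nat_Suc)
  finally show ?thesis by (simp add: dexp_def)
qed

lemma dexp_Suc': "x \<in> mcar W \<Longrightarrow> s *\<^sub>C dexp V W s k (Lop V W (-1) x) = of_nat (Suc k) *\<^sub>C dexp V W s (Suc k) x"
proof -
  assume x: "x \<in> mcar W"
  have "s *\<^sub>C dexp V W s k (Lop V W (-1) x) = (s * (s ^ k / fact k)) *\<^sub>C ((Lop V W (-1)) ^^ Suc k) x"
    unfolding dexp_def by (simp add: funpow_swap1)
  also have "s * (s ^ k / fact k) = of_nat (Suc k) * (s ^ Suc k / fact (Suc k))"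
    by (simp add: fact_Suc del: of_nat_Suc)
  finally show ?thesis by (simp add: dexp_def)
qed

lemma dexp_weight: "x \<in> wspace V W b \<Longrightarrow> dexp V W s k x \<in> wspace V W (b + of_nat k)"
proof -
  assume x: "x \<in> wspace V W b"
  have "((Lop V W (-1)) ^^ k) x \<in> wspace V W (b + of_nat k)"
  proof (induction k)
    case (Suc k)
    from Lop_weight[OF mW Suc] show ?case by (simp add: algebra_simps)
  qed (simp add: x)
  then show ?thesis unfolding dexp_def
    by (rule cvs.subspace_scale[OF graded_space.wspace_subspace[OF gs[OF mW]]])
qed

text \<open>Conjugation by \<open>e^(s L(-1))\<close> translates the formal variable: this is \<open>op(x) e^(s L(-1)) = e^(s L(-1)) op(x - s)\<close>
  in modes, for any field with the \<open>L(-1)\<close>-commutator formula.\<close>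

lemma op_dexp:
  fixes op :: "int \<Rightarrow> 'u \<Rightarrow> 'u"
  assumes cl: "\<And>m x. x \<in> mcar W \<Longrightarrow> op m x \<in> mcar W"
    and lin: "\<And>m. clinear_on (mcar W) (op m)"
    and D: "\<And>m x. x \<in> mcar W \<Longrightarrow> op m (Lop V W (-1) x) = Lop V W (-1) (op m x) + of_int m *\<^sub>C op (m - 1) x"
    and x: "x \<in> mcar W"
  shows "op m (dexp V W s k x) = (\<Sum>j\<le>k. (s ^ j * (of_int m gchoose j)) *\<^sub>C dexp V W s (k - j) (op (m - int j) x))"
proof (induction k arbitrary: m)
  case (Suc k)
  let ?D = "Lop V W (-1)"
  let ?T = "\<lambda>j. (s ^ j * (of_int m gchoose j)) *\<^sub>C dexp V W s (Suc k - j) (op (m - int j) x)"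
  have dc: "dexp V W s k x \<in> mcar W" by (rule dexp_closed[OF x])
  have "of_nat (Suc k) *\<^sub>C op m (dexp V W s (Suc k) x) = op m (of_nat (Suc k) *\<^sub>C dexp V W s (Suc k) x)"
    by (rule clinear_on_scale[OF lin dexp_closed[OF x], symmetric])
  also have "\<dots> = op m (s *\<^sub>C ?D (dexp V W s k x))" by (simp only: dexp_Suc[OF x])
  also have "\<dots> = s *\<^sub>C (?D (op m (dexp V W s k x)) + of_int m *\<^sub>C op (m - 1) (dexp V W s k x))"
    using clinear_on_scale[OF lin Lop_closed[OF mW dc]] D[OF dc] by simp
  also have "\<dots> = s *\<^sub>C ?D (op m (dexp V W s k x)) + (s * of_int m) *\<^sub>C op (m - 1) (dexp V W s k x)"
    by (simp add: cvs.scale_right_distrib)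
  also have "s *\<^sub>C ?D (op m (dexp V W s k x)) = (\<Sum>j\<le>k. of_nat (Suc k - j) *\<^sub>C ?T j)"
  proof -
    have c: "dexp V W s (k - j) (op (m - int j) x) \<in> mcar W" for j by (intro dexp_closed cl x)
    have "s *\<^sub>C ?D (op m (dexp V W s k x)) =
       (\<Sum>j\<le>k. s *\<^sub>C ?D ((s ^ j * (of_int m gchoose j)) *\<^sub>C dexp V W s (k - j) (op (m - int j) x)))"
      unfolding Suc cvs.scale_sum_right[symmetric]
      by (subst clinear_on_sum[OF Lop_lin[OF mW] mod_sub[OF mW]]) (auto intro: cvs.subspace_scale[OF mod_sub[OF mW]] c)
    also have "\<dots> = (\<Sum>j\<le>k. (s ^ j * (of_int m gchoose j)) *\<^sub>C (s *\<^sub>C ?D (dexp V W s (k - j) (op (m - int j) x))))"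
      by (simp add: clinear_on_scale[OF Lop_lin[OF mW] c] mult.commute)
    also have "\<dots> = (\<Sum>j\<le>k. of_nat (Suc k - j) *\<^sub>C ?T j)"
    proof (rule sum.cong)
      fix j assume "j \<in> {..k}"
      then have "Suc (k - j) = Suc k - j" by auto
      then show "(s ^ j * (of_int m gchoose j)) *\<^sub>C (s *\<^sub>C ?D (dexp V W s (k - j) (op (m - int j) x))) = of_nat (Suc k - j) *\<^sub>C ?T j"
        using dexp_Suc[OF cl[OF x], of s "k - j" "m - int j"] by (simp add: mult.commute del: of_nat_Suc)
    qed simp
    finally show ?thesis .
  qed
  also have "(s * of_int m) *\<^sub>C op (m - 1) (dexp V W s k x) = (\<Sum>j\<le>k. of_nat (Suc j) *\<^sub>C ?T (Suc j))"
    unfolding Suc cvs.scale_sum_right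
  proof (rule sum.cong)
    fix j
    have "of_int m * (of_int (m - 1) gchoose j) = of_nat (Suc j) * (of_int m gchoose Suc j :: complex)"
      using gbinomial_absorption[of j "of_int m :: complex"] by simp
    then have "(s * of_int m) * (s ^ j * (of_int (m - 1) gchoose j)) = of_nat (Suc j) * (s ^ Suc j * (of_int m gchoose Suc j))"
      by (simp add: mult_ac)
    then show "(s * of_int m) *\<^sub>C ((s ^ j * (of_int (m - 1) gchoose j)) *\<^sub>C dexp V W s (k - j) (op (m - 1 - int j) x)) = of_nat (Suc j) *\<^sub>C ?T (Suc j)"
      by (simp add: algebra_simps)
  qed simp
  also have "(\<Sum>j\<le>k. of_nat (Suc k - j) *\<^sub>C ?T j) = (\<Sum>j\<le>Suc k. of_nat (Suc k - j) *\<^sub>C ?T j)" by simp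
  also have "(\<Sum>j\<le>k. of_nat (Suc j) *\<^sub>C ?T (Suc j)) = (\<Sum>j\<le>Suc k. of_nat j *\<^sub>C ?T j)"
    by (subst sum.atMost_Suc_shift) simp
  also have "(\<Sum>j\<le>Suc k. of_nat (Suc k - j) *\<^sub>C ?T j) + (\<Sum>j\<le>Suc k. of_nat j *\<^sub>C ?T j) = (\<Sum>j\<le>Suc k. of_nat (Suc k) *\<^sub>C ?T j)"
    unfolding sum.distrib[symmetric]
  proof (rule sum.cong)
    fix j assume "j \<in> {..Suc k}"
    then have "(of_nat (Suc k - j) :: complex) + of_nat j = of_nat (Suc k)" by (simp flip: of_nat_add)
    then show "of_nat (Suc k - j) *\<^sub>C ?T j + of_nat j *\<^sub>C ?T j = of_nat (Suc k) *\<^sub>C ?T j"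
      by (simp only: cvs.scale_left_distrib[symmetric])
  qed simp
  also have "\<dots> = of_nat (Suc k) *\<^sub>C (\<Sum>j\<le>Suc k. ?T j)" by (rule cvs.scale_sum_right[symmetric])
  finally show ?case by (simp only: cvs.scale_cancel_left of_nat_eq_0_iff) auto
qed simp

lemma act_dexp:
  assumes "u \<in> vcar V" "x \<in> mcar W"
  shows "mact W u m (dexp V W s k x) = (\<Sum>j\<le>k. (s ^ j * (of_int m gchoose j)) *\<^sub>C dexp V W s (k - j) (mact W u (m - int j) x))"
proof (rule op_dexp)
  show "mact W u m (Lop V W (-1) x) = Lop V W (-1) (mact W u m x) + of_int m *\<^sub>C mact W u (m - 1) x"
    if "x \<in> mcar W" for m x using act_D[OF mW assms(1) that, of m] by simp
qed (use assms act_closed[OF mW] act_lin[OF mW] in auto)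

end

lemma it_dexp1:
  assumes m: "is_module V W1" "is_module V W2" "is_module V W3"
    and Y: "intertwining_operator V W1 W2 W3 Y" and w: "w1 \<in> mcar W1" "w2 \<in> mcar W2"
  shows "Y (dexp V W1 s k w1) n w2 = ((- s) ^ k * (n gchoose k)) *\<^sub>C Y w1 (n - of_nat k) w2"
proof (induction k arbitrary: n)
  case 0
  then show ?case by (simp add: dexp_0[OF m(1)])
next
  case (Suc k)
  have dc: "dexp V W1 s j w1 \<in> mcar W1" for j by (rule dexp_closed[OF m(1) w(1)])
  have "of_nat (Suc k) *\<^sub>C Y (dexp V W1 s (Suc k) w1) n w2 = Y (s *\<^sub>C Lop V W1 (-1) (dexp V W1 s k w1)) n w2"
    unfolding dexp_Suc[OF m(1) w(1)] by (rule clinear_on_scale[OF it_lin1[OF m Y w(2)] dc, symmetric])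
  also have "\<dots> = s *\<^sub>C Y (Lop V W1 (-1) (dexp V W1 s k w1)) n w2"
    by (rule clinear_on_scale[OF it_lin1[OF m Y w(2)] Lop_closed[OF m(1) dc]])
  also have "\<dots> = (- s * n * ((- s) ^ k * (n - 1 gchoose k))) *\<^sub>C Y w1 (n - 1 - of_nat k) w2"
    unfolding it_deriv[OF m Y dc w(2)] Suc by (simp add: mult_ac)
  also have "- s * n * ((- s) ^ k * (n - 1 gchoose k)) = of_nat (Suc k) * ((- s) ^ Suc k * (n gchoose Suc k))"
  proof -
    have "- s * n * ((- s) ^ k * (n - 1 gchoose k)) = (- s) ^ Suc k * (n * (n - 1 gchoose k))" by (simp add: mult_ac)
    also have "\<dots> = (- s) ^ Suc k * (of_nat (Suc k) * (n gchoose Suc k))" by (simp only: gbinomial_absorption)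
    finally show ?thesis by (simp only: mult_ac)
  qed
  finally have "of_nat (Suc k) *\<^sub>C Y (dexp V W1 s (Suc k) w1) n w2 =
      of_nat (Suc k) *\<^sub>C (((- s) ^ Suc k * (n gchoose Suc k)) *\<^sub>C Y w1 (n - of_nat (Suc k)) w2)"
    by (simp add: algebra_simps)
  then show ?case by (simp only: cvs.scale_cancel_left of_nat_eq_0_iff) auto
qed

section \<open>Skew-symmetry\<close>

context
  fixes W1 W2 W3 Y
  assumes m1: "is_module V W1" and m2: "is_module V W2" and m3: "is_module V W3"
    and it: "intertwining_operator V W2 W1 W3 Y"
begin

lemma skew_op_finite:
  assumes "\<And>r. r \<ge> R \<Longrightarrow> Y w2 (n + of_nat r) w1 = 0"
  shows "skew_op V W3 Y w1 n w2 = exp ((- n - 1) * (\<i> * pi)) *\<^sub>C (\<Sum>r<R. dexp V W3 (-1) r (Y w2 (n + of_nat r) w1))"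
  unfolding skew_op_def by (subst Sum_any_nat[of R]) (simp_all add: assms dexp_zero[OF m3])

lemma skew_op_support:
  assumes "w1 \<in> mcar W1" "w2 \<in> mcar W2"
  shows "finite {k::nat. dexp V W3 (-1) k (Y w2 (n + of_nat k) w1) \<noteq> 0}"
proof -
  obtain N :: nat where "\<And>i. i \<ge> N \<Longrightarrow> Y w2 (n + of_nat i) w1 = 0"
    using it_trunc_nat[OF m2 m1 m3 it assms(2,1)] by blast
  then show ?thesis by (intro finite_nat_support[of N]) (simp add: dexp_zero[OF m3])
qed

lemma skew_op_closed:
  assumes "w1 \<in> mcar W1" "w2 \<in> mcar W2"
  shows "skew_op V W3 Y w1 n w2 \<in> mcar W3"
  unfolding skew_op_def
  by (intro cvs.subspace_scale[OF mod_sub[OF m3]] subspace_Sum_any[OF mod_sub[OF m3]] dexp_closed[OF m3]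
      it_closed[OF m2 m1 m3 it] assms)

lemma skew_op_bilinear: "cbilinear_on (mcar W1) (mcar W2) (\<lambda>w1 w2. skew_op V W3 Y w1 n w2)"
proof (rule cbilinear_onI)
  fix w2 assume w2: "w2 \<in> mcar W2"
  have l: "clinear_on (mcar W1) (\<lambda>w1. dexp V W3 (-1) k (Y w2 (n + of_nat k) w1))" for k
    by (rule clinear_on_compose[OF it_lin2[OF m2 m1 m3 it w2] dexp_lin[OF m3]])
      (auto intro: it_closed[OF m2 m1 m3 it w2])
  show "clinear_on (mcar W1) (\<lambda>w1. skew_op V W3 Y w1 n w2)"
    unfolding skew_op_def by (intro clinear_on_scaleC clinear_on_Sum_any_fun[OF mod_sub[OF m1] l] skew_op_support[OF _ w2])
next
  fix w1 assume w1: "w1 \<in> mcar W1"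
  have l: "clinear_on (mcar W2) (\<lambda>w2. dexp V W3 (-1) k (Y w2 (n + of_nat k) w1))" for k
    by (rule clinear_on_compose[OF it_lin1[OF m2 m1 m3 it w1] dexp_lin[OF m3]])
      (auto intro: it_closed[OF m2 m1 m3 it _ w1])
  show "clinear_on (mcar W2) (skew_op V W3 Y w1 n)"
    unfolding skew_op_def by (intro clinear_on_scaleC clinear_on_Sum_any_fun[OF mod_sub[OF m2] l] skew_op_support[OF w1])
qed

lemma skew_op_trunc:
  assumes "w1 \<in> mcar W1" "w2 \<in> mcar W2"
  shows "\<exists>N::real. \<forall>n. Re n \<ge> N \<longrightarrow> skew_op V W3 Y w1 n w2 = 0"
proof -
  obtain N where N: "\<And>n. Re n \<ge> N \<Longrightarrow> Y w2 n w1 = 0"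
    using it_trunc[OF m2 m1 m3 it assms(2,1)] by blast
  have "skew_op V W3 Y w1 n w2 = 0" if "Re n \<ge> N" for n
    by (subst skew_op_finite[of 0]) (use that in \<open>auto intro!: N\<close>)
  then show ?thesis by blast
qed

lemma skew_op_deriv:
  assumes w: "w1 \<in> mcar W1" "w2 \<in> mcar W2"
  shows "skew_op V W3 Y (Lop V W1 (-1) w1) n w2 = - (n *\<^sub>C skew_op V W3 Y w1 (n - 1) w2)"
proof -
  let ?e = "dexp V W3 (-1)" and ?\<epsilon> = "exp ((- n - 1) * (\<i> * pi))"
  let ?D1 = "Lop V W1 (-1)" and ?D = "Lop V W3 (-1)"
  obtain N :: nat where N: "\<And>i. i \<ge> N \<Longrightarrow> Y w2 (n - 1 + of_nat i) w1 = 0"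
    using it_trunc_nat[OF m2 m1 m3 it w(2,1)] by blast
  obtain N' :: nat where N': "\<And>i. i \<ge> N' \<Longrightarrow> Y w2 (n + of_nat i) (?D1 w1) = 0"
    using it_trunc_nat[OF m2 m1 m3 it w(2) Lop_closed[OF m1 w(1)]] by blast
  define R where "R = N + N'"
  let ?X = "\<lambda>k::nat. Y w2 (n - 1 + of_nat k) w1"
  have Xc: "?X k \<in> mcar W3" for k by (rule it_closed[OF m2 m1 m3 it w(2,1)])
  have "skew_op V W3 Y (?D1 w1) n w2 = ?\<epsilon> *\<^sub>C (\<Sum>k<R. ?e k (Y w2 (n + of_nat k) (?D1 w1)))"
    by (rule skew_op_finite) (simp add: N' R_def)
  also have "(\<Sum>k<R. ?e k (Y w2 (n + of_nat k) (?D1 w1))) = (\<Sum>k<R. n *\<^sub>C ?e k (?X k))"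
  proof -
    have t: "?e k (Y w2 (n + of_nat k) (?D1 w1)) = (n + of_nat k) *\<^sub>C ?e k (?X k) - of_nat (Suc k) *\<^sub>C ?e (Suc k) (?X (Suc k))" for k
    proof -
      have h: "n + of_nat k - 1 = n - 1 + of_nat k" by simp
      have i: "Y w2 (n + of_nat k - 1) w1 = ?X k" "Y w2 (n + of_nat k) w1 = ?X (Suc k)"
        unfolding h by simp_all
      have "Y w2 (n + of_nat k) (?D1 w1) = ?D (Y w2 (n + of_nat k) w1) + (n + of_nat k) *\<^sub>C Y w2 (n + of_nat k - 1) w1"
        using it_D[OF m2 m1 m3 it w(2,1), of "n + of_nat k"] by simp
      also have "\<dots> = ?D (?X (Suc k)) + (n + of_nat k) *\<^sub>C ?X k" by (simp only: i)
      finally have e1: "Y w2 (n + of_nat k) (?D1 w1) = ?D (?X (Suc k)) + (n + of_nat k) *\<^sub>C ?X k" .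
      have "?e k (Y w2 (n + of_nat k) (?D1 w1)) = ?e k (?D (?X (Suc k))) + (n + of_nat k) *\<^sub>C ?e k (?X k)"
        unfolding e1 by (simp only: clinear_on_add[OF dexp_lin[OF m3] Lop_closed[OF m3 Xc] cvs.subspace_scale[OF mod_sub[OF m3] Xc]]
          clinear_on_scale[OF dexp_lin[OF m3] Xc])
      moreover have "(-1) *\<^sub>C ?e k (?D (?X (Suc k))) = of_nat (Suc k) *\<^sub>C ?e (Suc k) (?X (Suc k))"
        by (rule dexp_Suc'[OF m3 Xc])
      then have "?e k (?D (?X (Suc k))) = - (of_nat (Suc k) *\<^sub>C ?e (Suc k) (?X (Suc k)))"
        by (metis cvs.scale_minus_left cvs.scale_one minus_minus)
      ultimately show ?thesis by (simp only: diff_conv_add_uminus add.commute)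
    qed
    have "(\<Sum>k<R. of_nat (Suc k) *\<^sub>C ?e (Suc k) (?X (Suc k))) = (\<Sum>k<R. of_nat k *\<^sub>C ?e k (?X k))"
    proof -
      have "(\<Sum>k<Suc R. of_nat k *\<^sub>C ?e k (?X k)) = (\<Sum>k<R. of_nat (Suc k) *\<^sub>C ?e (Suc k) (?X (Suc k)))"
        by (subst sum.lessThan_Suc_shift) simp
      moreover have "?X R = 0" by (rule N) (simp add: R_def)
      then have "?e R (?X R) = 0" by (simp add: dexp_zero[OF m3])
      ultimately show ?thesis by simp
    qed
    then show ?thesis unfolding t sum_subtractf by (simp add: cvs.scale_left_distrib sum.distrib)
  qed
  also have "?\<epsilon> *\<^sub>C (\<Sum>k<R. n *\<^sub>C ?e k (?X k)) = n *\<^sub>C (?\<epsilon> *\<^sub>C (\<Sum>k<R. ?e k (?X k)))"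
    by (simp add: cvs.scale_sum_right mult.commute)
  also have "?\<epsilon> = - exp ((- (n - 1) - 1) * (\<i> * pi))"
    using skew_phase[of "n - 1" 1] by simp
  also have "(- exp ((- (n - 1) - 1) * (\<i> * pi))) *\<^sub>C (\<Sum>k<R. ?e k (?X k)) = - skew_op V W3 Y w1 (n - 1) w2"
    by (subst skew_op_finite[of R]) (simp_all add: N R_def)
  finally show ?thesis by simp
qed

text \<open>The Jacobi identity for the opposite operator is the one for \<open>Y\<close> with the roles of the last two sums exchanged and
  \<open>l\<close>, \<open>m\<close> swapped with the sign \<open>(-1)^m\<close>. Each of the three sums is brought to the form \<open>\<epsilon> \<Sum>_r e_r (...)\<close>, where the
  inner sums are those of the Jacobi identity for \<open>Y\<close>; only the sum in which \<open>u\<close> acts from the outside needs work, since the mode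
  of \<open>u\<close> has to pass \<open>e^(- L(-1))\<close>.\<close>

lemma skew_op_jacobi: "jacobi V W1 W2 W3 (skew_op V W3 Y)"
  unfolding jacobi_def
proof (intro ballI allI)
  fix u w1 w2 l m and n :: complex assume u: "u \<in> vcar V" and w: "w1 \<in> mcar W1" "w2 \<in> mcar W2"
  let ?e = "dexp V W3 (-1)" and ?\<epsilon> = "\<lambda>n. exp ((- n - 1) * (\<i> * pi))"
  let ?O = "skew_op V W3 Y"
  let ?a = "\<lambda>q. (-1) ^ q * (of_int m gchoose q) :: complex" and ?b = "\<lambda>i. (-1) powi m * (-1) ^ i * (of_int m gchoose i) :: complex"
    and ?g = "\<lambda>i j. (-1) ^ j * (of_int m + of_int l - of_nat i gchoose j) :: complex"
  let ?O1 = "\<lambda>i::nat. ?O (mact W1 u (l + int i) w1) (of_int m + n - of_nat i) w2"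
    and ?O2 = "\<lambda>i::nat. ?O w1 (n + of_int l - of_nat i) (mact W2 u (m + int i) w2)"
    and ?O3 = "\<lambda>i::nat. ?O w1 (n + of_nat i) w2" and ?u = "\<lambda>i. mact W3 u (m + l - int i)"
  note s3 = mod_sub[OF m3] and itc = it_closed[OF m2 m1 m3 it]
  define A where "A = (\<lambda>q r::nat. mact W3 u (l + m - int q) (Y w2 (n + of_nat r + of_nat q) w1))"
  define B where "B = (\<lambda>i r::nat. Y w2 (n + of_nat r + of_int m - of_nat i) (mact W1 u (l + int i) w1))"
  define C where "C = (\<lambda>i r::nat. Y (mact W2 u (m + int i) w2) (of_int l + (n + of_nat r) - of_nat i) w1)"
  have Ac: "A q r \<in> mcar W3" for q r unfolding A_def by (intro act_closed[OF m3] itc u w)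
  have Bc: "B q r \<in> mcar W3" for q r unfolding B_def by (intro act_closed[OF m1] itc u w)
  have Cc: "C q r \<in> mcar W3" for q r unfolding C_def by (intro act_closed[OF m2] itc u w)
  obtain NA :: nat where NA: "\<And>i. i \<ge> NA \<Longrightarrow> Y w2 (n + of_nat i) w1 = 0"
    using it_trunc_nat[OF m2 m1 m3 it w(2,1)] by blast
  have "\<exists>N. \<forall>i r. i \<ge> N \<or> r \<ge> N \<longrightarrow> B i r = 0"
  proof -
    obtain N1 :: nat where "\<And>i. i \<ge> N1 \<Longrightarrow> mact W1 u (l + int i) w1 = 0" using act_trunc_nat[OF m1 u w(1)] by blast
    then have 1: "\<And>i r. i \<ge> N1 \<Longrightarrow> B i r = 0" unfolding B_def using it_02[OF m2 m1 m3 it w(2)] by simp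
    have 2: "\<exists>R. \<forall>r\<ge>R. B i r = 0" for i
      using it_trunc_nat[OF m2 m1 m3 it w(2) act_closed[OF m1 u w(1)], of "n + of_int m - of_nat i" "l + int i"]
      unfolding B_def by (simp add: algebra_simps)
    show ?thesis by (rule uniform_bound[of N1]) (use 1 2 in auto)
  qed
  then obtain NB where NB: "\<And>i r. i \<ge> NB \<or> r \<ge> NB \<Longrightarrow> B i r = 0" by blast
  have "\<exists>N. \<forall>i r. i \<ge> N \<or> r \<ge> N \<longrightarrow> C i r = 0"
  proof -
    obtain N1 :: nat where "\<And>i. i \<ge> N1 \<Longrightarrow> mact W2 u (m + int i) w2 = 0" using act_trunc_nat[OF m2 u w(2)] by blast
    then have 1: "\<And>i r. i \<ge> N1 \<Longrightarrow> C i r = 0" unfolding C_def using it_01[OF m2 m1 m3 it w(1)] by simp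
    have 2: "\<exists>R. \<forall>r\<ge>R. C i r = 0" for i
      using it_trunc_nat[OF m2 m1 m3 it act_closed[OF m2 u w(2)] w(1), of "m + int i" "of_int l + n - of_nat i"]
      unfolding C_def by (simp add: algebra_simps)
    show ?thesis by (rule uniform_bound[of N1]) (use 1 2 in auto)
  qed
  then obtain NC where NC: "\<And>i r. i \<ge> NC \<or> r \<ge> NC \<Longrightarrow> C i r = 0" by blast
  define N where "N = NA + NB + NC"
  let ?A = "\<lambda>r. \<Sum>q<N. ?a q *\<^sub>C A q r" and ?B = "\<lambda>r. \<Sum>i<N. ?b i *\<^sub>C B i r"
    and ?C = "\<lambda>r. \<Sum>i<N. (of_int l gchoose i) *\<^sub>C C i r"
    and ?D = "\<lambda>i. \<Sum>k<N. \<Sum>j\<le>k. ?g i j *\<^sub>C ?e (k - j) (A (i + j) (k - j))"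
  have Az: "A q r = 0" if "q + r \<ge> N" for q r
  proof -
    have "Y w2 (n + of_nat (q + r)) w1 = 0" by (rule NA) (use that N_def in simp)
    then show ?thesis unfolding A_def by (simp add: add_ac act_0[OF m3])
  qed
  have Bz: "B i r = 0" if "i \<ge> N \<or> r \<ge> N" for i r using NB[of i r] that by (auto simp: N_def)
  have Cz: "C i r = 0" if "i \<ge> N \<or> r \<ge> N" for i r using NC[of i r] that by (auto simp: N_def)
  have e0: "?e r 0 = 0" for r by (rule dexp_zero[OF m3])
  have eS: "?e r (\<Sum>i<N. c i *\<^sub>C f i) = (\<Sum>i<N. c i *\<^sub>C ?e r (f i))" if "\<And>i. f i \<in> mcar W3" for c f r
  proof -
    have "?e r (\<Sum>i<N. c i *\<^sub>C f i) = (\<Sum>i<N. ?e r (c i *\<^sub>C f i))"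
      by (rule clinear_on_sum[OF dexp_lin[OF m3] s3]) (rule cvs.subspace_scale[OF s3 that])
    then show ?thesis using clinear_on_scale[OF dexp_lin[OF m3] that] by simp
  qed
  have sq: "(-1) ^ i * (-1) ^ i = (1::complex)" for i :: nat by (simp flip: power_mult_distrib)
  have LHS: "binomial_sum m (\<lambda>i. ?O1 i) =
     ?\<epsilon> n *\<^sub>C (\<Sum>r<N. ?e r (?B r))"
  proof -
    have idx: "of_int m + n - of_nat i + of_nat r = n + of_nat r + of_int m - of_nat i" for i r :: nat by simp
    have O: "?O1 i =
        (((-1) powi m * (-1) ^ i) * ?\<epsilon> n) *\<^sub>C (\<Sum>r<N. ?e r (B i r))" for i
    proof -
      have "?O1 i =
         ?\<epsilon> (of_int m + n - of_nat i) *\<^sub>C (\<Sum>r<N. ?e r (Y w2 (of_int m + n - of_nat i + of_nat r) (mact W1 u (l + int i) w1)))"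
        by (rule skew_op_finite) (use Bz[of i] in \<open>simp add: B_def idx\<close>)
      moreover have "of_int m + n - of_nat i = n + of_int (m - int i)" by simp
      then have "?\<epsilon> (of_int m + n - of_nat i) = (-1) powi (m - int i) * ?\<epsilon> n" by (simp only: skew_phase)
      moreover have "(-1) powi (m - int i) = (-1) powi m * ((-1) ^ i :: complex)"
        using power_int_diff[of "-1::complex" m "int i"] by (simp add: divide_inverse power_inverse[symmetric])
      ultimately show ?thesis unfolding B_def idx by simp
    qed
    have "binomial_sum m (\<lambda>i. ?O1 i) =
       (\<Sum>i<N. (of_int m gchoose i) *\<^sub>C ?O1 i)"
      by (rule Sum_any_nat) (simp add: O Bz e0)
    also have "\<dots> = (\<Sum>i<N. \<Sum>r<N. ?\<epsilon> n *\<^sub>C (?b i *\<^sub>C ?e r (B i r)))"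
      unfolding O by (simp add: cvs.scale_sum_right mult_ac)
    also have "\<dots> = (\<Sum>r<N. \<Sum>i<N. ?\<epsilon> n *\<^sub>C (?b i *\<^sub>C ?e r (B i r)))"
      by (rule sum.swap)
    finally show ?thesis unfolding eS[OF Bc] cvs.scale_sum_right .
  qed
  have RHS2: "signed_sum l (\<lambda>i.
            ?O2 i) =
     ?\<epsilon> n *\<^sub>C (\<Sum>r<N. ?e r (?C r))"
  proof -
    have idx: "n + of_int l - of_nat i + of_nat r = of_int l + (n + of_nat r) - of_nat i" for i r :: nat by simp
    have O: "?O2 i =
        (((-1) powi l * (-1) ^ i) * ?\<epsilon> n) *\<^sub>C (\<Sum>r<N. ?e r (C i r))" for i
    proof -
      have "?O2 i =
         ?\<epsilon> (n + of_int l - of_nat i) *\<^sub>C (\<Sum>r<N. ?e r (Y (mact W2 u (m + int i) w2) (n + of_int l - of_nat i + of_nat r) w1))"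
        by (rule skew_op_finite) (use Cz[of i] in \<open>simp add: C_def idx\<close>)
      moreover have "n + of_int l - of_nat i = n + of_int (l - int i)" by simp
      then have "?\<epsilon> (n + of_int l - of_nat i) = (-1) powi (l - int i) * ?\<epsilon> n" by (simp only: skew_phase)
      moreover have "(-1) powi (l - int i) = (-1) powi l * ((-1) ^ i :: complex)"
        using power_int_diff[of "-1::complex" l "int i"] by (simp add: divide_inverse power_inverse[symmetric])
      ultimately show ?thesis unfolding C_def idx by simp
    qed
    have sql: "(-1) powi l * (-1) powi l = (1::complex)" by (simp flip: power_int_mult_distrib)
    have co: "((-1) powi l * (-1) ^ i * g) * (((-1) powi l * (-1) ^ i) * h) = h * (g::complex)" for i g h
    proof -
      have "((-1) powi l * (-1) ^ i * g) * (((-1) powi l * (-1) ^ i) * h) = (((-1) powi l * (-1) powi l) * ((-1) ^ i * (-1) ^ i)) * (h * g)"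
        by (simp only: mult_ac)
      then show ?thesis unfolding sql sq by simp
    qed
    have "signed_sum l (\<lambda>i.
            ?O2 i) =
       (\<Sum>i<N. ((-1) powi l * (-1) ^ i * (of_int l gchoose i)) *\<^sub>C
            ?O2 i)"
      by (rule Sum_any_nat) (simp add: O Cz e0)
    also have "\<dots> = (\<Sum>i<N. \<Sum>r<N. ?\<epsilon> n *\<^sub>C ((of_int l gchoose i) *\<^sub>C ?e r (C i r)))"
      unfolding O by (simp only: cvs.scale_sum_right cvs.scale_scale co)
    also have "\<dots> = (\<Sum>r<N. \<Sum>i<N. ?\<epsilon> n *\<^sub>C ((of_int l gchoose i) *\<^sub>C ?e r (C i r)))"
      by (rule sum.swap)
    finally show ?thesis unfolding eS[OF Cc] cvs.scale_sum_right .
  qed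
  \<comment> \<open>Moving \<open>u\<close> inside gives a triple sum over \<open>i\<close>, \<open>j\<close>, \<open>r\<close>; collecting \<open>q = i + j\<close> is Vandermonde.\<close>
  have RHS1: "alternating_sum l (\<lambda>i. ?u i (?O3 i)) =
     ?\<epsilon> n *\<^sub>C (\<Sum>r<N. ?e r (?A r))"
  proof -
    let ?f = "\<lambda>i j r. ((of_int l gchoose i) * ?g i j) *\<^sub>C ?e r (A (i + j) r)"
    have f0: "?f i j r = 0" if "i + j + r \<ge> N" for i j r using Az[of "i + j" r] that by (simp add: e0)
    have Yz: "Y w2 (n + of_nat i + of_nat k) w1 = 0" if "i + k \<ge> N" for i k
      using NA[of "i + k"] that by (simp add: N_def add.assoc)
    have t: "((-1) ^ i * (of_int l gchoose i)) *\<^sub>C ?u i (?O3 i) =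
       ?\<epsilon> n *\<^sub>C (\<Sum>j<N. \<Sum>r<N. ?f i j r)" for i
    proof -
      let ?X = "\<lambda>k::nat. Y w2 (n + of_nat i + of_nat k) w1"
      have Xc: "?X k \<in> mcar W3" for k by (rule itc[OF w(2,1)])
      have ph: "?\<epsilon> (n + of_nat i) = (-1) ^ i * ?\<epsilon> n" using skew_phase[of n "int i"] by simp
      have inner: "?u i (?e k (?X k)) =
          (\<Sum>j\<le>k. ?g i j *\<^sub>C ?e (k - j) (A (i + j) (k - j)))" for k
      proof -
        have "?u i (?e k (?X k)) = (\<Sum>j\<le>k. ((-1) ^ j * (of_int (m + l - int i) gchoose j)) *\<^sub>C
           ?e (k - j) (mact W3 u (m + l - int i - int j) (?X k)))"
          by (rule act_dexp[OF m3 u Xc])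
        also have "\<dots> = (\<Sum>j\<le>k. ?g i j *\<^sub>C ?e (k - j) (A (i + j) (k - j)))"
        proof (rule sum.cong)
          fix j assume "j \<in> {..k}"
          then have "n + of_nat (k - j) + of_nat (i + j) = n + of_nat i + of_nat k" by (simp add: of_nat_diff)
          moreover have "l + m - int (i + j) = m + l - int i - int j" by simp
          ultimately have "A (i + j) (k - j) = mact W3 u (m + l - int i - int j) (?X k)" unfolding A_def by (simp only:)
          then show "((-1) ^ j * (of_int (m + l - int i) gchoose j)) *\<^sub>C ?e (k - j) (mact W3 u (m + l - int i - int j) (?X k)) =
            ?g i j *\<^sub>C ?e (k - j) (A (i + j) (k - j))" by simp
        qed simp
        finally show ?thesis .
      qed
      have ec: "?e k (?X k) \<in> mcar W3" for k by (rule dexp_closed[OF m3 Xc])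
      have "?O w1 (n + of_nat i) w2 = ?\<epsilon> (n + of_nat i) *\<^sub>C (\<Sum>k<N. ?e k (?X k))"
        by (rule skew_op_finite) (simp add: Yz)
      then have "?u i (?O3 i) =
          ?\<epsilon> (n + of_nat i) *\<^sub>C (\<Sum>k<N. ?u i (?e k (?X k)))"
        using clinear_on_scale[OF act_lin[OF m3 u] cvs.subspace_sum[OF s3, of "{..<N}" "\<lambda>k. ?e k (?X k)"]]
          clinear_on_sum[OF act_lin[OF m3 u] s3, of "{..<N}" "\<lambda>k. ?e k (?X k)"] ec by simp
      also have "\<dots> = ((-1) ^ i * ?\<epsilon> n) *\<^sub>C (?D i)"
        unfolding ph inner ..
      finally have "((-1) ^ i * (of_int l gchoose i)) *\<^sub>C ?u i (?O3 i) =
         (((-1) ^ i * (of_int l gchoose i)) * ((-1) ^ i * ?\<epsilon> n)) *\<^sub>C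
           (?D i)"
        by simp
      also have "((-1) ^ i * (of_int l gchoose i)) * ((-1) ^ i * ?\<epsilon> n) = ((-1) ^ i * (-1) ^ i) * (?\<epsilon> n * (of_int l gchoose i))"
        by (simp only: mult_ac)
      also have "\<dots> = ?\<epsilon> n * (of_int l gchoose i)" unfolding sq by simp
      also have "(?\<epsilon> n * (of_int l gchoose i)) *\<^sub>C (?D i)
         = ?\<epsilon> n *\<^sub>C (\<Sum>k<N. \<Sum>j\<le>k. ?f i j (k - j))"
        by (simp add: cvs.scale_sum_right mult.assoc)
      also have "(\<Sum>k<N. \<Sum>j\<le>k. ?f i j (k - j)) = (\<Sum>j<N. \<Sum>r<N. ?f i j r)"
        by (rule sum_square_triangle[symmetric]) (rule f0, simp)
      finally show ?thesis .
    qed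
    have "alternating_sum l (\<lambda>i. ?u i (?O3 i)) =
       (\<Sum>i<N. ?\<epsilon> n *\<^sub>C (\<Sum>j<N. \<Sum>r<N. ?f i j r))"
      unfolding t by (rule Sum_any_nat) (simp add: f0)
    also have "\<dots> = ?\<epsilon> n *\<^sub>C (\<Sum>i<N. \<Sum>j<N. \<Sum>r<N. ?f i j r)" by (rule cvs.scale_sum_right[symmetric])
    also have "(\<Sum>i<N. \<Sum>j<N. \<Sum>r<N. ?f i j r) = (\<Sum>i<N. \<Sum>r<N. \<Sum>j<N. ?f i j r)"
      by (intro sum.cong refl sum.swap)
    also have "(\<Sum>i<N. \<Sum>r<N. \<Sum>j<N. ?f i j r) = (\<Sum>r<N. \<Sum>i<N. \<Sum>j<N. ?f i j r)" by (rule sum.swap)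
    also have "\<dots> = (\<Sum>r<N. \<Sum>q<N. \<Sum>i\<le>q. ?f i (q - i) r)"
      by (intro sum.cong refl sum_square_triangle f0) simp
    also have "\<dots> = (\<Sum>r<N. \<Sum>q<N. ?a q *\<^sub>C ?e r (A q r))"
    proof (intro sum.cong refl)
      fix r q :: nat
      have "(\<Sum>i\<le>q. ?f i (q - i) r) = (\<Sum>i\<le>q. ((of_int l gchoose i) * ?g i (q - i)) *\<^sub>C ?e r (A q r))"
        by (intro sum.cong) auto
      also have "\<dots> = (\<Sum>i\<le>q. (of_int l gchoose i) * ?g i (q - i)) *\<^sub>C ?e r (A q r)"
        by (rule cvs.scale_sum_left[symmetric])
      finally show "(\<Sum>i\<le>q. ?f i (q - i) r) = ?a q *\<^sub>C ?e r (A q r)"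
        unfolding vandermonde_alternating .
    qed
    finally show ?thesis unfolding eS[OF Ac] .
  qed
  have J: "(?C r) = (?A r) -
      (?B r)" for r
  proof -
    have "binomial_sum l (\<lambda>i. C i r) = alternating_sum m (\<lambda>q. A q r) -
      signed_sum m (\<lambda>i. B i r)"
      using it_jac[OF m2 m1 m3 it] u w unfolding jacobi_def A_def B_def C_def by blast
    moreover have "binomial_sum l (\<lambda>i. C i r) = (?C r)"
      by (rule Sum_any_nat) (simp add: Cz)
    moreover have "alternating_sum m (\<lambda>q. A q r) = (?A r)"
      by (rule Sum_any_nat) (simp add: Az)
    moreover have "signed_sum m (\<lambda>i. B i r) = (?B r)"
      by (rule Sum_any_nat) (simp add: Bz)
    ultimately show ?thesis by simp
  qed
  have sc: "(\<Sum>i<N. c i *\<^sub>C f i) \<in> mcar W3" if "\<And>i. f i \<in> mcar W3" for c f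
    by (intro cvs.subspace_sum[OF s3] cvs.subspace_scale[OF s3] that)
  have h: "?e r ((?A r) - (?B r)) =
      ?e r (?A r) - ?e r (?B r)" for r
    by (rule clinear_on_diff[OF dexp_lin[OF m3] s3 sc[OF Ac] sc[OF Bc]])
  show "binomial_sum m (\<lambda>i. ?O1 i)
      = alternating_sum l (\<lambda>i. ?u i (?O3 i))
      - signed_sum l (\<lambda>i.
            ?O2 i)"
    unfolding LHS RHS1 RHS2 J h sum_subtractf cvs.scale_right_diff_distrib by simp
qed

lemma skew_op_intertwining: "intertwining_operator V W1 W2 W3 (skew_op V W3 Y)"
  unfolding intertwining_operator_def
  using skew_op_bilinear skew_op_closed skew_op_trunc skew_op_jacobi skew_op_deriv by blast

end

end

section \<open>Evaluation of intertwining operators\<close>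

lemma subst_at_cong:
  assumes "\<And>n. Y w1 n w2 = Y' w1 n w2"
  shows "subst_at V W Y l w1 w2 = subst_at V W Y' l w1 w2"
  using assms by (simp add: subst_at_def fun_eq_iff)

lemma logz_of_real: "p > 0 \<Longrightarrow> logz (complex_of_real p) = complex_of_real (ln p)"
  by (simp add: logz_def complex_eq_iff Arg2pi_of_real)

lemma logz_1: "logz 1 = 0"
  using logz_of_real[of 1] by simp

lemma exp_logz: "z \<noteq> 0 \<Longrightarrow> exp (logz z) = z"
proof -
  assume "z \<noteq> 0"
  then have "exp (logz z) = of_real (cmod z) * cis (Arg2pi z)"
    unfolding exp_eq_polar[of "logz z"] by (simp add: logz_def)
  also have "\<dots> = z" unfolding cis_conv_exp by (rule Arg2pi_eq[symmetric])
  finally show ?thesis .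
qed

context fixed_voa
begin

lemma exp_Lm1_support:
  assumes m: "is_module V W" and f: "f \<in> formal_completion V W"
  shows "finite {k::nat. (1 / fact k) *\<^sub>C (Lop V W (-1) ^^ k) (f (n - of_nat k)) \<noteq> 0}"
proof -
  obtain N :: real where N: "\<And>n. Re n < N \<Longrightarrow> wspace V W n = {0}" using weights_bounded_below[OF m] by blast
  obtain K :: nat where K: "Re n - N < of_nat K" using reals_Archimedean2 by blast
  show ?thesis
  proof (rule finite_nat_support[of K])
    fix k assume "k \<ge> K"
    then have "real K \<le> real k" by simp
    then have "Re (n - of_nat k) < N" using K by simp
    then have "f (n - of_nat k) = 0" using N f unfolding formal_completion_def by blast
    then show "(1 / fact k) *\<^sub>C (Lop V W (-1) ^^ k) (f (n - of_nat k)) = 0"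
      using clinear_on_0[OF Dpow_lin[OF m] mod_sub[OF m]] by simp
  qed
qed

text \<open>Evaluation at \<open>e^(\<i> \<pi>)\<close> followed by \<open>e^(L(-1))\<close> is evaluation of the opposite operator at \<open>e^0\<close>.\<close>

lemma exp_Lm1_subst_at:
  assumes m: "is_module V W1" "is_module V W2" "is_module V W"
    and Y: "intertwining_operator V W2 W1 W Y" and w: "w1 \<in> mcar W1" "w2 \<in> mcar W2"
  shows "exp_Lm1 V W (subst_at V W Y (\<i> * pi) w2 w1) = subst_at V W (skew_op V W Y) 0 w1 w2"
proof
  fix n
  note m' = m(2,1,3)
  note sk = skew_op_intertwining[OF m Y]
  note fc = subst_at_completion[OF m' Y]
  let ?F = "\<lambda>w1 w2. subst_at V W Y (\<i> * pi) w2 w1"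
  have Fm: "?F x y k \<in> mcar W" if "x \<in> mcar W1" "y \<in> mcar W2" for x y k
    using fc[OF that(2,1)] unfolding formal_completion_def wspace_def by blast
  show "exp_Lm1 V W (?F w1 w2) n = subst_at V W (skew_op V W Y) 0 w1 w2 n"
  proof (rule bilinear_eqI[OF m(1,2) _ _ _ w, where f = "\<lambda>x y. exp_Lm1 V W (?F x y) n" and g = "\<lambda>x y. subst_at V W (skew_op V W Y) 0 x y n"])
    show "cbilinear_on (mcar W1) (mcar W2) (\<lambda>x y. subst_at V W (skew_op V W Y) 0 x y n)"
      by (rule cbilinear_onI; rule subst_at_lin1[OF m sk] subst_at_lin2[OF m sk])
    show "cbilinear_on (mcar W1) (mcar W2) (\<lambda>x y. exp_Lm1 V W (?F x y) n)"
    proof (rule cbilinear_onI)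
      fix y assume y: "y \<in> mcar W2"
      have l: "clinear_on (mcar W1) (\<lambda>x. (Lop V W (-1) ^^ k) (?F x y (n - of_nat k)))" for k
        by (rule clinear_on_compose[OF subst_at_lin2[OF m' Y y] Dpow_lin[OF m(3)]]) (auto intro: Fm y)
      show "clinear_on (mcar W1) (\<lambda>x. exp_Lm1 V W (?F x y) n)"
        unfolding exp_Lm1_def
        by (intro clinear_on_Sum_any_fun[OF mod_sub[OF m(1)]] clinear_on_scaleC l exp_Lm1_support[OF m(3) fc[OF y]])
    next
      fix x assume x: "x \<in> mcar W1"
      have l: "clinear_on (mcar W2) (\<lambda>y. (Lop V W (-1) ^^ k) (?F x y (n - of_nat k)))" for k
        by (rule clinear_on_compose[OF subst_at_lin1[OF m' Y x] Dpow_lin[OF m(3)]]) (auto intro: Fm x)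
      show "clinear_on (mcar W2) (\<lambda>y. exp_Lm1 V W (?F x y) n)"
        unfolding exp_Lm1_def
        by (intro clinear_on_Sum_any_fun[OF mod_sub[OF m(2)]] clinear_on_scaleC l exp_Lm1_support[OF m(3) fc[OF _ x]])
    qed
    fix a b x y assume xy: "x \<in> wspace V W1 a" "y \<in> wspace V W2 b"
    have "x \<in> mcar W1" "y \<in> mcar W2" using xy graded_space.wspace_mcar gs m by blast+
    then have Yc: "Y y k x \<in> mcar W" for k by (intro it_closed[OF m' Y])
    have "exp_Lm1 V W (?F x y) n = Sum_any (\<lambda>k::nat. exp ((n - a - b) * (\<i> * pi)) *\<^sub>C dexp V W (-1) k (Y y (a + b - n - 1 + of_nat k) x))"
    proof -
      have "(1 / fact k) *\<^sub>C (Lop V W (-1) ^^ k) (?F x y (n - of_nat k)) =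
         exp ((n - a - b) * (\<i> * pi)) *\<^sub>C dexp V W (-1) k (Y y (a + b - n - 1 + of_nat k) x)" for k
      proof -
        have i: "b + a - (n - of_nat k) - 1 = a + b - n - 1 + of_nat k" by simp
        have "(n - of_nat k - b - a) = (- (a + b - n - 1 + of_int (int k)) - 1)" by simp
        then have e: "exp ((n - of_nat k - b - a) * (\<i> * pi)) = (-1) ^ k * exp ((n - a - b) * (\<i> * pi))"
          using skew_phase[of "a + b - n - 1" "int k"] by (simp add: algebra_simps)
        have "?F x y (n - of_nat k) = ((-1) ^ k * exp ((n - a - b) * (\<i> * pi))) *\<^sub>C Y y (a + b - n - 1 + of_nat k) x"
          unfolding subst_at_homogeneous[OF m' Y xy(2,1)] i e ..
        then show ?thesis unfolding dexp_def
          using clinear_on_scale[OF Dpow_lin[OF m(3)] Yc] by (simp add: mult_ac)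
      qed
      then show ?thesis by (simp add: exp_Lm1_def)
    qed
    also have "\<dots> = skew_op V W Y x (a + b - n - 1) y"
    proof -
      have "- (a + b - n - 1) - 1 = n - a - b" by simp
      then show ?thesis unfolding Sum_any_scaleC skew_op_def by (simp only:)
    qed
    also have "\<dots> = subst_at V W (skew_op V W Y) 0 x y n"
      by (simp add: subst_at_homogeneous[OF m sk xy])
    finally show "exp_Lm1 V W (?F x y) n = subst_at V W (skew_op V W Y) 0 x y n" .
  qed
qed

lemma Hom_skew_op:
  assumes h: "h \<in> Hom V W3 W4" and m: "is_module V W1" "is_module V W2" "is_module V W3" "is_module V W4"
    and Y: "intertwining_operator V W2 W1 W3 Y" and w: "w1 \<in> mcar W1" "w2 \<in> mcar W2"
  shows "h (skew_op V W3 Y w1 n w2) = skew_op V W4 (\<lambda>w1 n w2. h (Y w1 n w2)) w1 n w2"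
proof -
  have Yc: "Y w2 k w1 \<in> mcar W3" for k by (rule it_closed[OF m(2,1,3) Y w(2,1)])
  have D: "h ((Lop V W3 (-1) ^^ k) x) = (Lop V W4 (-1) ^^ k) (h x)" if "x \<in> mcar W3" for k x
    by (induction k) (auto simp: Hom_Lop[OF h] Dpow_closed[OF m(3) that])
  have e: "h (dexp V W3 s k x) = dexp V W4 s k (h x)" if "x \<in> mcar W3" for s k x
    unfolding dexp_def using clinear_on_scale[OF Hom_lin[OF h] Dpow_closed[OF m(3) that]] D[OF that] by simp
  have c: "dexp V W3 (-1) k (Y w2 (n + of_nat k) w1) \<in> mcar W3" for k by (rule dexp_closed[OF m(3) Yc])
  have s: "Sum_any (\<lambda>k. dexp V W3 (-1) k (Y w2 (n + of_nat k) w1)) \<in> mcar W3"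
    by (rule subspace_Sum_any[OF mod_sub[OF m(3)] c])
  show ?thesis unfolding skew_op_def
    using clinear_on_scale[OF Hom_lin[OF h] s]
      clinear_on_Sum_any[OF Hom_lin[OF h] mod_sub[OF m(3)] c skew_op_support[OF m(1-3) Y w]] e[OF Yc] by simp
qed

section \<open>Intertwining operators with the algebra in the first slot\<close>

context
  fixes W T Y
  assumes mW: "is_module V W" and mT: "is_module V T" and it: "intertwining_operator V (adj V) W T Y"
begin

lemma vac_modes: "w \<in> mcar W \<Longrightarrow> n \<noteq> -1 \<Longrightarrow> Y (vac V) n w = 0"
proof -
  assume w: "w \<in> mcar W" and n: "n \<noteq> -1"
  have "Y (Lop V (adj V) (-1) (vac V)) (n + 1) w = - ((n + 1) *\<^sub>C Y (vac V) (n + 1 - 1) w)"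
    by (rule it_deriv[OF adj_module mW mT it]) (use vac_in w in simp_all)
  moreover have "Y 0 (n + 1) w = 0" by (rule it_01[OF adj_module mW mT it w])
  ultimately have "(n + 1) *\<^sub>C Y (vac V) n w = 0" by (simp add: Lop_vac)
  moreover have "n + 1 \<noteq> 0" using n by (metis add_eq_0_iff2)
  ultimately show ?thesis using cvs.scale_eq_0_iff by blast
qed

lemma vac_mode_act:
  assumes u: "u \<in> vcar V" and w: "w \<in> mcar W"
  shows "Y (vac V) (-1) (mact W u m w) = mact T u m (Y (vac V) (-1) w)"
proof -
  have "binomial_sum m (\<lambda>i. Y (mact (adj V) u (int i) (vac V)) (of_int m + -1 - of_nat i) w) =
    mact T u m (Y (vac V) (-1) w) - Y (vac V) (-1) (mact W u m w)"
    by (rule jacobi_commutator[OF it_jac[OF adj_module mW mT it] u]) (use vac_in w in simp_all)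
  moreover have "(\<lambda>i::nat. (of_int m gchoose i) *\<^sub>C Y (mact (adj V) u (int i) (vac V)) (of_int m + -1 - of_nat i) w) = (\<lambda>i. 0)"
    using creation_nonneg[OF u] it_01[OF adj_module mW mT it w] by simp
  ultimately show ?thesis by (simp only: Sum_any.neutral) simp
qed

text \<open>The Jacobi identity with \<open>w1\<close> the vacuum, \<open>l = -1\<close> and \<open>m = 0\<close> expresses \<open>Y(u, x)\<close> through the single vacuum
  mode \<open>1_(-1)\<close>, which is a module map. In particular such an operator vanishes at non-integral modes.\<close>

lemma unit_intertwiner:
  assumes u: "u \<in> vcar V" and w: "w \<in> mcar W"
  shows "Y u n w = cmodes (mact T) u n (Y (vac V) (-1) w)"
proof -
  define e where "e = Y (vac V) (-1)"
  have b1: "((-1::complex) gchoose i) = (-1) ^ i" for i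
    using gbinomial_minus[of "1::complex" i] binomial_gbinomial[of i i, where 'a = complex] by simp
  have s: "(-1) ^ i * (-1) ^ i = (1::complex)" for i :: nat by (simp flip: power_mult_distrib)
  have "binomial_sum 0 (\<lambda>i. Y (mact (adj V) u (-1 + int i) (vac V)) (of_int 0 + n - of_nat i) w)
      = alternating_sum (-1) (\<lambda>i. mact T u (0 + -1 - int i) (Y (vac V) (n + of_nat i) w))
      - signed_sum (-1) (\<lambda>i.
            Y (vac V) (n + of_int (-1) - of_nat i) (mact W u (0 + int i) w))"
    using it_jac[OF adj_module mW mT it] u w vac_in unfolding jacobi_def adj_car by blast
  moreover have "binomial_sum 0 (\<lambda>i. Y (mact (adj V) u (-1 + int i) (vac V)) (of_int 0 + n - of_nat i) w) = Y u n w"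
    by (subst Sum_any_single[of 0]) (auto simp: gbinomial_0_left creation[OF u])
  moreover have "alternating_sum (-1) (\<lambda>i. mact T u (0 + -1 - int i) (Y (vac V) (n + of_nat i) w)) =
     Sum_any (\<lambda>i::nat. mact T u (-1 - int i) (Y (vac V) (n + of_nat i) w))"
    by (simp add: b1 s)
  moreover have "signed_sum (-1) (\<lambda>i.
            Y (vac V) (n + of_int (-1) - of_nat i) (mact W u (0 + int i) w)) =
     - Sum_any (\<lambda>i::nat. Y (vac V) (n - 1 - of_nat i) (mact W u (int i) w))"
    by (simp add: b1 s mult.assoc Sum_any_minus)
  ultimately have main: "Y u n w = Sum_any (\<lambda>i::nat. mact T u (-1 - int i) (Y (vac V) (n + of_nat i) w)) +
     Sum_any (\<lambda>i::nat. Y (vac V) (n - 1 - of_nat i) (mact W u (int i) w))" by simp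
  have aw: "mact W u k w \<in> mcar W" for k by (rule act_closed[OF mW u w])
  have vm: "Y (vac V) k x = (if k = -1 then e x else 0)" if "x \<in> mcar W" for k x using vac_modes[OF that] by (simp add: e_def)
  have em: "e (mact W u k w) = mact T u k (e w)" for k unfolding e_def by (rule vac_mode_act[OF u w])
  have idx: "n + of_nat i = -1 \<longleftrightarrow> n = of_int (-1 - int i)" "n - 1 - of_nat i = -1 \<longleftrightarrow> n = of_int (int i)" for i
    by (auto simp: algebra_simps)
  have sum: "Y u n w = Sum_any (\<lambda>i::nat. if n = of_int (-1 - int i) then mact T u (-1 - int i) (e w) else 0) +
     Sum_any (\<lambda>i::nat. if n = of_int (int i) then mact T u (int i) (e w) else 0)"
    unfolding main vm[OF w] vm[OF aw] idx em using act_0[OF mT] by (simp add: if_distrib cong: if_cong)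
  show ?thesis
  proof (cases "n \<in> \<int>")
    case False
    then have n: "n \<noteq> of_int k" for k by auto
    show ?thesis unfolding sum cmodes_not_int[OF False] by (simp only: n if_False) simp
  next
    case True
    then obtain j where j: "n = of_int j" by (auto elim: Ints_cases)
    have s1: "Sum_any (\<lambda>i::nat. if j = -1 - int i then mact T u (-1 - int i) (e w) else 0) = (if j < 0 then mact T u j (e w) else 0)"
      by (subst Sum_any_single[of "nat (-1 - j)"]) auto
    have s2: "Sum_any (\<lambda>i::nat. if j = int i then mact T u (int i) (e w) else 0) = (if j < 0 then 0 else mact T u j (e w))"
      by (subst Sum_any_single[of "nat j"]) auto
    show ?thesis using sum unfolding j of_int_eq_iff s1 s2 cmodes_of_int by (simp add: e_def split: if_splits)
  qed
qed

end

end

section \<open>Universal property of the tensor product\<close>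

locale vtc = fixed_voa V for V :: "'u::complex_vector voa" +
  fixes D :: "'u vertex_tensor"
  assumes vtc: "vertex_tensor_category V D"
begin

lemma tensor:
  assumes "z \<noteq> 0" "is_module V W1" "is_module V W2"
  shows tprod_module: "is_module V (tprod D z W1 W2)"
    and telem_map: "intertwining_map V z W1 W2 (tprod D z W1 W2) (telem D z W1 W2)"
    and telem_span: "cvs.span {telem D z W1 W2 w1 w2 n | w1 w2 n. w1 \<in> mcar W1 \<and> w2 \<in> mcar W2} = mcar (tprod D z W1 W2)"
  using vtc assms unfolding vertex_tensor_category_def tensor_products_exist_def tensor_product_def by auto

lemma universal:
  assumes "z \<noteq> 0" "is_module V W1" "is_module V W2" "is_module V W3" "intertwining_operator V W1 W2 W3 Y"
  shows "\<exists>!\<eta>. \<eta> \<in> Hom V (tprod D z W1 W2) W3 \<and>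
           (\<forall>w1\<in>mcar W1. \<forall>w2\<in>mcar W2. cext \<eta> (telem D z W1 W2 w1 w2) = subst_at V W3 Y (logz z) w1 w2)"
proof -
  have im: "intertwining_map V z W1 W2 W3 (subst_at V W3 Y (logz z))"
    using assms(5) unfolding intertwining_map_def by blast
  have "tensor_product V z W1 W2 (tprod D z W1 W2) (telem D z W1 W2)"
    using vtc assms(1-3) by (simp add: vertex_tensor_category_def tensor_products_exist_def)
  then have "\<forall>W3 I. is_module V W3 \<and> intertwining_map V z W1 W2 W3 I \<longrightarrow>
        (\<exists>!\<eta>. \<eta> \<in> Hom V (tprod D z W1 W2) W3 \<and>
           (\<forall>w1\<in>mcar W1. \<forall>w2\<in>mcar W2. cext \<eta> (telem D z W1 W2 w1 w2) = I w1 w2))"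
    unfolding tensor_product_def by (elim conjE)
  from this[THEN spec, THEN spec, THEN mp, OF conjI[OF assms(4) im]] show ?thesis .
qed

text \<open>The intertwining operator behind the universal \<open>P(z)\<close>-intertwining map.\<close>

definition tY :: "complex \<Rightarrow> 'u vmod \<Rightarrow> 'u vmod \<Rightarrow> 'u \<Rightarrow> complex \<Rightarrow> 'u \<Rightarrow> 'u" where
  "tY z W1 W2 = (SOME Y. intertwining_operator V W1 W2 (tprod D z W1 W2) Y \<and>
     (\<forall>w1\<in>mcar W1. \<forall>w2\<in>mcar W2. telem D z W1 W2 w1 w2 = subst_at V (tprod D z W1 W2) Y (logz z) w1 w2))"

lemma tY:
  assumes "z \<noteq> 0" "is_module V W1" "is_module V W2"
  shows tY_it: "intertwining_operator V W1 W2 (tprod D z W1 W2) (tY z W1 W2)"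
    and telem_tY: "w1 \<in> mcar W1 \<Longrightarrow> w2 \<in> mcar W2 \<Longrightarrow>
        telem D z W1 W2 w1 w2 = subst_at V (tprod D z W1 W2) (tY z W1 W2) (logz z) w1 w2"
proof -
  have "\<exists>Y. intertwining_operator V W1 W2 (tprod D z W1 W2) Y \<and>
     (\<forall>w1\<in>mcar W1. \<forall>w2\<in>mcar W2. telem D z W1 W2 w1 w2 = subst_at V (tprod D z W1 W2) Y (logz z) w1 w2)"
    using telem_map[OF assms] unfolding intertwining_map_def .
  from someI_ex[OF this]
  show "intertwining_operator V W1 W2 (tprod D z W1 W2) (tY z W1 W2)"
    "w1 \<in> mcar W1 \<Longrightarrow> w2 \<in> mcar W2 \<Longrightarrow>
        telem D z W1 W2 w1 w2 = subst_at V (tprod D z W1 W2) (tY z W1 W2) (logz z) w1 w2"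
    unfolding tY_def by blast+
qed

lemma Hom_eq_on_span:
  assumes f: "f \<in> Hom V W W3" and g: "g \<in> Hom V W W3" and m: "is_module V W"
    and S: "cvs.span S = mcar W" and eq: "\<And>x. x \<in> S \<Longrightarrow> f x = g x"
  shows "f = g"
proof
  fix x
  show "f x = g x"
  proof (cases "x \<in> mcar W")
    case True
    then have "x \<in> cvs.span S" by (simp add: S)
    then have "x \<in> mcar W \<and> f x = g x"
    proof (rule cvs.span_induct)
      show "cvs.subspace {x. x \<in> mcar W \<and> f x = g x}"
        using mod_sub[OF m] Hom_lin[OF f] Hom_lin[OF g] clinear_on_0[OF Hom_lin[OF f] mod_sub[OF m]]
          clinear_on_0[OF Hom_lin[OF g] mod_sub[OF m]]
        unfolding cvs.subspace_def by (auto simp: clinear_on_add clinear_on_scale)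
      show "x \<in> mcar W \<and> f x = g x" if "x \<in> S" for x
        using eq[OF that] cvs.span_base[OF that] S by auto
    qed
    then show ?thesis by blast
  next
    case False
    then show ?thesis using Hom_out[OF f] Hom_out[OF g] by simp
  qed
qed

lemma Hom_ext:
  assumes "z \<noteq> 0" "is_module V W1" "is_module V W2"
    and f: "f \<in> Hom V (tprod D z W1 W2) W3" and g: "g \<in> Hom V (tprod D z W1 W2) W3"
    and eq: "\<And>w1 w2. w1 \<in> mcar W1 \<Longrightarrow> w2 \<in> mcar W2 \<Longrightarrow> cext f (telem D z W1 W2 w1 w2) = cext g (telem D z W1 W2 w1 w2)"
  shows "f = g"
  by (rule Hom_eq_on_span[OF f g tprod_module[OF assms(1-3)] telem_span[OF assms(1-3)]])
    (use eq in \<open>auto simp: cext_def fun_eq_iff\<close>)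

text \<open>The module map on \<open>W1 \<boxtimes>_P(z) W2\<close> that represents an intertwining operator. All structure maps of the
  category become statements about how \<open>eta\<close> changes under composition.\<close>

definition eta :: "complex \<Rightarrow> 'u vmod \<Rightarrow> 'u vmod \<Rightarrow> 'u vmod \<Rightarrow> ('u \<Rightarrow> complex \<Rightarrow> 'u \<Rightarrow> 'u) \<Rightarrow> 'u \<Rightarrow> 'u" where
  "eta z W1 W2 W3 Y = (THE \<eta>. \<eta> \<in> Hom V (tprod D z W1 W2) W3 \<and>
           (\<forall>w1\<in>mcar W1. \<forall>w2\<in>mcar W2. cext \<eta> (telem D z W1 W2 w1 w2) = subst_at V W3 Y (logz z) w1 w2))"

context
  fixes z :: complex and W1 W2 W3 Y
  assumes z: "z \<noteq> 0" and m1: "is_module V W1" and m2: "is_module V W2" and m3: "is_module V W3"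
    and it: "intertwining_operator V W1 W2 W3 Y"
begin

lemma eta_Hom: "eta z W1 W2 W3 Y \<in> Hom V (tprod D z W1 W2) W3"
  and eta_telem: "w1 \<in> mcar W1 \<Longrightarrow> w2 \<in> mcar W2 \<Longrightarrow>
    cext (eta z W1 W2 W3 Y) (telem D z W1 W2 w1 w2) = subst_at V W3 Y (logz z) w1 w2"
  using theI'[OF universal[OF z m1 m2 m3 it]] unfolding eta_def by blast+

lemma eta_unique:
  assumes "f \<in> Hom V (tprod D z W1 W2) W3"
    "\<And>w1 w2. w1 \<in> mcar W1 \<Longrightarrow> w2 \<in> mcar W2 \<Longrightarrow> cext f (telem D z W1 W2 w1 w2) = subst_at V W3 Y (logz z) w1 w2"
  shows "f = eta z W1 W2 W3 Y"
  by (rule Hom_ext[OF z m1 m2 assms(1) eta_Hom]) (simp add: assms(2) eta_telem)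

text \<open>Stronger than the universal property, which only speaks of values at one point; it follows since modes are
  determined by values.\<close>

lemma eta_tY:
  assumes "w1 \<in> mcar W1" "w2 \<in> mcar W2"
  shows "eta z W1 W2 W3 Y (tY z W1 W2 w1 n w2) = Y w1 n w2"
proof -
  note t = tprod_module[OF z m1 m2]
  note ty = tY_it[OF z m1 m2]
  show ?thesis
  proof (rule intertwining_determined[OF m1 m2 m3 intertwining_compose[OF eta_Hom m1 m2 t m3 ty] it _ assms, where l = "logz z"])
    fix w1 w2 assume w: "w1 \<in> mcar W1" "w2 \<in> mcar W2"
    show "subst_at V W3 (\<lambda>w1 n w2. eta z W1 W2 W3 Y (tY z W1 W2 w1 n w2)) (logz z) w1 w2 = subst_at V W3 Y (logz z) w1 w2"
      using subst_at_cext[OF eta_Hom m1 m2 t m3 ty w, of "logz z"] telem_tY[OF z m1 m2 w] eta_telem[OF w] by simp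
  qed
qed

lemma eta_subst_at:
  assumes "w1 \<in> mcar W1" "w2 \<in> mcar W2"
  shows "cext (eta z W1 W2 W3 Y) (subst_at V (tprod D z W1 W2) (tY z W1 W2) l w1 w2) = subst_at V W3 Y l w1 w2"
  unfolding subst_at_cext[OF eta_Hom m1 m2 tprod_module[OF z m1 m2] m3 tY_it[OF z m1 m2] assms]
  by (rule subst_at_cong) (rule eta_tY[OF assms])

end

context
  fixes z :: complex and W1 W2 U1 U2 f g
  assumes z: "z \<noteq> 0" and m1: "is_module V W1" and m2: "is_module V W2" and u1: "is_module V U1" and u2: "is_module V U2"
    and f: "f \<in> Hom V W1 U1" and g: "g \<in> Hom V W2 U2"
begin

lemma tmap_eta: "tmap V D z W1 W2 U1 U2 f g = eta z W1 W2 (tprod D z U1 U2) (\<lambda>w1 n w2. tY z U1 U2 (f w1) n (g w2))"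
proof -
  note it = intertwining_precompose[OF f g tY_it[OF z u1 u2]]
  note t = tprod_module[OF z u1 u2]
  have *: "subst_at V (tprod D z U1 U2) (\<lambda>w1 n w2. tY z U1 U2 (f w1) n (g w2)) (logz z) w1 w2 = telem D z U1 U2 (f w1) (g w2)"
    if "w1 \<in> mcar W1" "w2 \<in> mcar W2" for w1 w2
    using telem_tY[OF z u1 u2 Hom_closed[OF f that(1)] Hom_closed[OF g that(2)]] by (simp add: subst_at_def)
  show ?thesis unfolding tmap_def
  proof (rule the_equality)
    show "eta z W1 W2 (tprod D z U1 U2) (\<lambda>w1 n w2. tY z U1 U2 (f w1) n (g w2)) \<in> Hom V (tprod D z W1 W2) (tprod D z U1 U2) \<and>
      (\<forall>w1\<in>mcar W1. \<forall>w2\<in>mcar W2. cext (eta z W1 W2 (tprod D z U1 U2) (\<lambda>w1 n w2. tY z U1 U2 (f w1) n (g w2))) (telem D z W1 W2 w1 w2) = telem D z U1 U2 (f w1) (g w2))"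
      using eta_Hom[OF z m1 m2 t it] eta_telem[OF z m1 m2 t it] * by simp
    fix h assume "h \<in> Hom V (tprod D z W1 W2) (tprod D z U1 U2) \<and>
      (\<forall>w1\<in>mcar W1. \<forall>w2\<in>mcar W2. cext h (telem D z W1 W2 w1 w2) = telem D z U1 U2 (f w1) (g w2))"
    then show "h = eta z W1 W2 (tprod D z U1 U2) (\<lambda>w1 n w2. tY z U1 U2 (f w1) n (g w2))"
      by (intro eta_unique[OF z m1 m2 t it]) (simp_all add: *)
  qed
qed

lemma tmap_Hom: "tmap V D z W1 W2 U1 U2 f g \<in> Hom V (tprod D z W1 W2) (tprod D z U1 U2)"
  unfolding tmap_eta by (rule eta_Hom[OF z m1 m2 tprod_module[OF z u1 u2] intertwining_precompose[OF f g tY_it[OF z u1 u2]]])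

lemma tmap_telem:
  assumes "w1 \<in> mcar W1" "w2 \<in> mcar W2"
  shows "cext (tmap V D z W1 W2 U1 U2 f g) (telem D z W1 W2 w1 w2) = telem D z U1 U2 (f w1) (g w2)"
  unfolding tmap_eta eta_telem[OF z m1 m2 tprod_module[OF z u1 u2] intertwining_precompose[OF f g tY_it[OF z u1 u2]] assms]
  using telem_tY[OF z u1 u2 Hom_closed[OF f assms(1)] Hom_closed[OF g assms(2)]] by (simp add: subst_at_def)

lemma eta_tmap:
  assumes m3: "is_module V W3" and it: "intertwining_operator V U1 U2 W3 Y"
  shows "eta z U1 U2 W3 Y \<circ> tmap V D z W1 W2 U1 U2 f g = eta z W1 W2 W3 (\<lambda>w1 n w2. Y (f w1) n (g w2))"
proof (rule eta_unique[OF z m1 m2 m3 intertwining_precompose[OF f g it]])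
  show "eta z U1 U2 W3 Y \<circ> tmap V D z W1 W2 U1 U2 f g \<in> Hom V (tprod D z W1 W2) W3"
    by (rule Hom_compose[OF tmap_Hom eta_Hom[OF z u1 u2 m3 it] tprod_module[OF z m1 m2] tprod_module[OF z u1 u2] m3])
  fix w1 w2 assume w: "w1 \<in> mcar W1" "w2 \<in> mcar W2"
  show "cext (eta z U1 U2 W3 Y \<circ> tmap V D z W1 W2 U1 U2 f g) (telem D z W1 W2 w1 w2) =
     subst_at V W3 (\<lambda>w1 n w2. Y (f w1) n (g w2)) (logz z) w1 w2"
    unfolding cext_comp tmap_telem[OF w] eta_telem[OF z u1 u2 m3 it Hom_closed[OF f w(1)] Hom_closed[OF g w(2)]]
    by (simp add: subst_at_def)
qed

end

section \<open>Parallel transport along real paths and the braiding\<close>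

lemma transport:
  assumes "path \<gamma>" "0 \<notin> path_image \<gamma>" "is_module V W1" "is_module V W2" "start_log \<gamma> l"
  shows transport_Iso: "ttrans D \<gamma> W1 W2 \<in> Iso V (tprod D (pathstart \<gamma>) W1 W2) (tprod D (pathfinish \<gamma>) W1 W2)"
    and transport_telem: "w1 \<in> mcar W1 \<Longrightarrow> w2 \<in> mcar W2 \<Longrightarrow>
      cext (ttrans D \<gamma> W1 W2) (telem D (pathstart \<gamma>) W1 W2 w1 w2) =
      subst_at V (tprod D (pathfinish \<gamma>) W1 W2) (tY (pathfinish \<gamma>) W1 W2) l w1 w2"
proof -
  let ?f = "pathfinish \<gamma>" and ?s = "pathstart \<gamma>" and ?T = "tprod D (pathfinish \<gamma>) W1 W2"
  have pt: "parallel_transport V D" using vtc by (simp add: vertex_tensor_category_def)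
  show "ttrans D \<gamma> W1 W2 \<in> Iso V (tprod D ?s W1 W2) ?T"
    using pt assms(1-4) unfolding parallel_transport_def by blast
  have z: "?f \<noteq> 0" using assms(2) by (metis pathfinish_in_path_image)
  have all: "\<forall>l Y. start_log \<gamma> l \<and>
           intertwining_operator V W1 W2 ?T Y \<and>
           (\<forall>w1\<in>mcar W1. \<forall>w2\<in>mcar W2.
              subst_at V ?T Y (logz ?f) w1 w2
              = telem D ?f W1 W2 w1 w2) \<longrightarrow>
           (\<forall>w1\<in>mcar W1. \<forall>w2\<in>mcar W2.
              cext (ttrans D \<gamma> W1 W2) (telem D ?s W1 W2 w1 w2)
              = subst_at V ?T Y l w1 w2)"
    using pt assms(1-4) unfolding parallel_transport_def by blast
  show "w1 \<in> mcar W1 \<Longrightarrow> w2 \<in> mcar W2 \<Longrightarrow>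
      cext (ttrans D \<gamma> W1 W2) (telem D ?s W1 W2 w1 w2) =
      subst_at V ?T (tY ?f W1 W2) l w1 w2"
    using all[rule_format, of l "tY ?f W1 W2" w1 w2] assms(5) tY_it[OF z assms(3,4)] telem_tY[OF z assms(3,4)]
    by simp
qed

lemma start_log_linepath:
  assumes "p > 0" "q > 0"
  shows "start_log (linepath (complex_of_real p) (complex_of_real q)) (complex_of_real (ln p))"
    and "0 \<notin> path_image (linepath (complex_of_real p) (complex_of_real q))"
proof -
  have pos: "(1 - t) * p + t * q > 0" if "t \<in> {0..1}" for t
  proof (cases "t = 0")
    case False
    then show ?thesis using that assms by (intro add_nonneg_pos) auto
  qed (use assms in simp)
  have lp: "linepath (complex_of_real p) (complex_of_real q) t = complex_of_real ((1 - t) * p + t * q)" for t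
    by (rule linepath_of_real)
  let ?h = "\<lambda>t. complex_of_real (ln ((1 - t) * p + t * q))"
  show "start_log (linepath (complex_of_real p) (complex_of_real q)) (complex_of_real (ln p))"
    unfolding start_log_def
  proof (intro exI[of _ ?h] conjI ballI)
    show "continuous_on {0..1} ?h"
      using pos by (intro continuous_intros) (metis less_irrefl)
    fix t :: real assume "t \<in> {0..1}"
    then show "exp (?h t) = linepath (complex_of_real p) (complex_of_real q) t"
      unfolding lp using pos by (simp add: exp_of_real del: of_real_add of_real_mult of_real_diff)
  qed (use assms in \<open>simp_all add: logz_of_real linepath_def\<close>)
  show "0 \<notin> path_image (linepath (complex_of_real p) (complex_of_real q))"
    unfolding path_image_def lp using pos by (force simp del: of_real_add of_real_mult of_real_diff)
qed

context
  fixes p q :: real and W1 W2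
  assumes pq: "p > 0" "q > 0" and m1: "is_module V W1" and m2: "is_module V W2"
begin

lemma transport_real_Iso:
  "ttrans D (linepath (complex_of_real p) (complex_of_real q)) W1 W2 \<in> Iso V (tprod D p W1 W2) (tprod D q W1 W2)"
  using transport_Iso[OF path_linepath start_log_linepath(2)[OF pq] m1 m2 start_log_linepath(1)[OF pq]] by simp

lemma transport_real_Hom:
  "ttrans D (linepath (complex_of_real p) (complex_of_real q)) W1 W2 \<in> Hom V (tprod D p W1 W2) (tprod D q W1 W2)"
  using transport_real_Iso by (simp add: Iso_def)

text \<open>Between positive real points transport does not change the branch of the logarithm, so it does not change the
  intertwining operator that a module map represents.\<close>

lemma eta_transport:
  assumes m3: "is_module V W3" and it: "intertwining_operator V W1 W2 W3 Y"
  shows "eta q W1 W2 W3 Y \<circ> ttrans D (linepath (complex_of_real p) (complex_of_real q)) W1 W2 = eta p W1 W2 W3 Y"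
proof (rule eta_unique[OF _ m1 m2 m3 it])
  have z: "complex_of_real p \<noteq> 0" "complex_of_real q \<noteq> 0" using pq by auto
  show "complex_of_real p \<noteq> 0" by (rule z(1))
  show "eta q W1 W2 W3 Y \<circ> ttrans D (linepath (complex_of_real p) (complex_of_real q)) W1 W2 \<in> Hom V (tprod D p W1 W2) W3"
    by (rule Hom_compose[OF transport_real_Hom eta_Hom[OF z(2) m1 m2 m3 it] tprod_module[OF z(1) m1 m2] tprod_module[OF z(2) m1 m2] m3])
  fix w1 w2 assume w: "w1 \<in> mcar W1" "w2 \<in> mcar W2"
  show "cext (eta q W1 W2 W3 Y \<circ> ttrans D (linepath (complex_of_real p) (complex_of_real q)) W1 W2) (telem D p W1 W2 w1 w2) =
     subst_at V W3 Y (logz p) w1 w2"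
    using transport_telem[OF path_linepath start_log_linepath(2)[OF pq] m1 m2 start_log_linepath(1)[OF pq] w]
      eta_subst_at[OF z(2) m1 m2 m3 it w, of "ln p"] logz_of_real[OF pq(1)]
    by (simp add: cext_comp)
qed

end

lemma upper_half_circle:
  defines "\<gamma> \<equiv> (\<lambda>t. cis (pi * (1 - t)))"
  shows "path \<gamma>" "0 \<notin> path_image \<gamma>" "pathstart \<gamma> = -1" "pathfinish \<gamma> = 1" "start_log \<gamma> (\<i> * pi)"
proof -
  show "path \<gamma>" unfolding path_def \<gamma>_def by (intro continuous_intros)
  show "0 \<notin> path_image \<gamma>" by (auto simp: path_image_def \<gamma>_def)
  show "pathstart \<gamma> = -1" "pathfinish \<gamma> = 1" by (simp_all add: pathstart_def pathfinish_def \<gamma>_def)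
  show "start_log \<gamma> (\<i> * pi)" unfolding start_log_def
  proof (intro exI[of _ "\<lambda>t. \<i> * complex_of_real (pi * (1 - t))"] conjI ballI)
    show "continuous_on {0..1} (\<lambda>t. \<i> * complex_of_real (pi * (1 - t)))" by (intro continuous_intros)
    show "exp (\<i> * complex_of_real (pi * (1 - t))) = \<gamma> t" for t unfolding \<gamma>_def by (simp add: cis_conv_exp)
  qed (simp_all add: \<gamma>_def logz_1)
qed

context
  fixes W1 W2
  assumes m1: "is_module V W1" and m2: "is_module V W2"
begin

lemma braiding_target:
  assumes w: "w1 \<in> mcar W1" "w2 \<in> mcar W2"
  shows "exp_Lm1 V (tprod D 1 W2 W1) (cext (ttrans D (\<lambda>t. cis (pi * (1 - t))) W2 W1) (telem D (-1) W2 W1 w2 w1)) =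
     subst_at V (tprod D 1 W2 W1) (skew_op V (tprod D 1 W2 W1) (tY 1 W2 W1)) 0 w1 w2"
  using transport_telem[OF upper_half_circle(1,2) m2 m1 upper_half_circle(5) w(2,1)]
    exp_Lm1_subst_at[OF m1 m2 tprod_module[OF one_neq_zero m2 m1] tY_it[OF one_neq_zero m2 m1] w]
  by (simp add: upper_half_circle)

lemma braiding_eta: "braiding V D W1 W2 = eta 1 W1 W2 (tprod D 1 W2 W1) (skew_op V (tprod D 1 W2 W1) (tY 1 W2 W1))"
proof -
  note t = tprod_module[OF one_neq_zero m2 m1]
  note sk = skew_op_intertwining[OF m1 m2 t tY_it[OF one_neq_zero m2 m1]]
  note eu = eta_unique[OF one_neq_zero m1 m2 t sk]
  show ?thesis unfolding braiding_def
  proof (rule the_equality)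
    show "eta 1 W1 W2 (tprod D 1 W2 W1) (skew_op V (tprod D 1 W2 W1) (tY 1 W2 W1)) \<in> Hom V (tprod D 1 W1 W2) (tprod D 1 W2 W1) \<and>
        (\<forall>w1\<in>mcar W1. \<forall>w2\<in>mcar W2.
           cext (eta 1 W1 W2 (tprod D 1 W2 W1) (skew_op V (tprod D 1 W2 W1) (tY 1 W2 W1))) (telem D 1 W1 W2 w1 w2)
           = exp_Lm1 V (tprod D 1 W2 W1)
               (cext (ttrans D (\<lambda>t. cis (pi * (1 - t))) W2 W1) (telem D (-1) W2 W1 w2 w1)))"
      using eta_Hom[OF one_neq_zero m1 m2 t sk] eta_telem[OF one_neq_zero m1 m2 t sk] by (simp add: braiding_target logz_1)
    fix f assume "f \<in> Hom V (tprod D 1 W1 W2) (tprod D 1 W2 W1) \<and>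
        (\<forall>w1\<in>mcar W1. \<forall>w2\<in>mcar W2.
           cext f (telem D 1 W1 W2 w1 w2)
           = exp_Lm1 V (tprod D 1 W2 W1)
               (cext (ttrans D (\<lambda>t. cis (pi * (1 - t))) W2 W1) (telem D (-1) W2 W1 w2 w1)))"
    then show "f = eta 1 W1 W2 (tprod D 1 W2 W1) (skew_op V (tprod D 1 W2 W1) (tY 1 W2 W1))"
      by (intro eu) (simp_all add: braiding_target logz_1)
  qed
qed

lemma braiding_Hom: "braiding V D W1 W2 \<in> Hom V (tprod D 1 W1 W2) (tprod D 1 W2 W1)"
  unfolding braiding_eta
  by (rule eta_Hom[OF one_neq_zero m1 m2 tprod_module[OF one_neq_zero m2 m1]
        skew_op_intertwining[OF m1 m2 tprod_module[OF one_neq_zero m2 m1] tY_it[OF one_neq_zero m2 m1]]])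

text \<open>The braiding represents passage to the opposite operator.\<close>

lemma eta_braiding:
  assumes m3: "is_module V W3" and it: "intertwining_operator V W2 W1 W3 Y"
  shows "eta 1 W2 W1 W3 Y \<circ> braiding V D W1 W2 = eta 1 W1 W2 W3 (skew_op V W3 Y)"
proof (rule eta_unique[OF one_neq_zero m1 m2 m3 skew_op_intertwining[OF m1 m2 m3 it]])
  note t = tprod_module[OF one_neq_zero m2 m1]
  note ty = tY_it[OF one_neq_zero m2 m1]
  note sk = skew_op_intertwining[OF m1 m2 t ty]
  note eh = eta_Hom[OF one_neq_zero m2 m1 m3 it]
  show "eta 1 W2 W1 W3 Y \<circ> braiding V D W1 W2 \<in> Hom V (tprod D 1 W1 W2) W3"
    by (rule Hom_compose[OF braiding_Hom eh tprod_module[OF one_neq_zero m1 m2] t m3])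
  fix w1 w2 assume w: "w1 \<in> mcar W1" "w2 \<in> mcar W2"
  have "cext (eta 1 W2 W1 W3 Y \<circ> braiding V D W1 W2) (telem D 1 W1 W2 w1 w2) =
     cext (eta 1 W2 W1 W3 Y) (subst_at V (tprod D 1 W2 W1) (skew_op V (tprod D 1 W2 W1) (tY 1 W2 W1)) (logz 1) w1 w2)"
    unfolding cext_comp braiding_eta eta_telem[OF one_neq_zero m1 m2 t sk w] ..
  also have "\<dots> = subst_at V W3 (\<lambda>w1 n w2. eta 1 W2 W1 W3 Y (skew_op V (tprod D 1 W2 W1) (tY 1 W2 W1) w1 n w2)) (logz 1) w1 w2"
    by (rule subst_at_cext[OF eh m1 m2 t m3 sk w])
  also have "\<dots> = subst_at V W3 (skew_op V W3 Y) (logz 1) w1 w2"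
  proof (rule subst_at_cong)
    fix n
    have "eta 1 W2 W1 W3 Y (skew_op V (tprod D 1 W2 W1) (tY 1 W2 W1) w1 n w2) =
       skew_op V W3 (\<lambda>w1 n w2. eta 1 W2 W1 W3 Y (tY 1 W2 W1 w1 n w2)) w1 n w2"
      by (rule Hom_skew_op[OF eh m1 m2 t m3 ty w])
    also have "\<dots> = skew_op V W3 Y w1 n w2"
      unfolding skew_op_def eta_tY[OF one_neq_zero m2 m1 m3 it w(2,1)] ..
    finally show "eta 1 W2 W1 W3 Y (skew_op V (tprod D 1 W2 W1) (tY 1 W2 W1) w1 n w2) = skew_op V W3 Y w1 n w2" .
  qed
  finally show "cext (eta 1 W2 W1 W3 Y \<circ> braiding V D W1 W2) (telem D 1 W1 W2 w1 w2) =
    subst_at V W3 (skew_op V W3 Y) (logz 1) w1 w2" .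
qed

end

section \<open>The unit\<close>

context
  fixes W assumes mW: "is_module V W"
begin

text \<open>The inverse of the left unit isomorphism is \<open>w \<mapsto> 1_(-1) w\<close> for the universal operator; the two compositions are
  identities because operators out of \<open>V\<close> are determined by their vacuum mode.\<close>

lemma left_unit_inverse:
  assumes a: "a \<in> mcar W"
  shows "inv_into (mcar (tprod D 1 (adj V) W)) (left_unit V D W) a = tY 1 (adj V) W (vac V) (-1) a"
proof -
  let ?T = "tprod D 1 (adj V) W" and ?Y = "tY 1 (adj V) W"
  note m1 = one_neq_zero adj_module mW
  note t = tprod_module[OF m1]
  note ty = tY_it[OF m1]
  note ai = action_intertwining[OF mW]
  define e where "e = (\<lambda>w. if w \<in> mcar W then ?Y (vac V) (-1) w else 0)"
  define f where "f = eta 1 (adj V) W W (cmodes (mact W))"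
  have vv: "vac V \<in> mcar (adj V)" using vac_in by simp
  have eH: "e \<in> Hom V W ?T"
    using it_lin2[OF adj_module mW t ty vv, of "-1"] it_closed[OF adj_module mW t ty vv] vac_mode_act[OF mW t ty] act_closed[OF mW]
      mod_sub[OF mW]
    unfolding Hom_def e_def clinear_on_def by (auto simp: cvs.subspace_add cvs.subspace_scale)
  have fH: "f \<in> Hom V ?T W" unfolding f_def by (rule eta_Hom[OF m1 mW ai])
  have fe: "f (e w) = w" if "w \<in> mcar W" for w
  proof -
    have "f (e w) = cmodes (mact W) (vac V) (-1) w"
      unfolding f_def e_def using that eta_tY[OF m1 mW ai vv that] by simp
    also have "\<dots> = w" using cmodes_of_int[of "mact W" "vac V" "-1" w] act_vac[OF mW that] by simp
    finally show ?thesis .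
  qed
  have efH: "e \<circ> f \<in> Hom V ?T ?T" by (rule Hom_compose[OF fH eH t mW t])
  have "e \<circ> f = idm ?T"
  proof (rule Hom_ext[OF m1 efH idm_Hom[OF t]])
    fix v w assume v: "v \<in> mcar (adj V)" and w: "w \<in> mcar W"
    have v': "v \<in> vcar V" using v by simp
    have ef: "(e \<circ> f) (?Y v n w) = ?Y v n w" for n
    proof -
      have "(e \<circ> f) (?Y v n w) = e (cmodes (mact W) v n w)"
        unfolding f_def using eta_tY[OF m1 mW ai v w] by simp
      also have "\<dots> = cmodes (mact ?T) v n (e w)"
        using Hom_act[OF eH v' w] clinear_on_0[OF Hom_lin[OF eH] mod_sub[OF mW]] by (simp add: cmodes_def)
      also have "\<dots> = ?Y v n w" using unit_intertwiner[OF mW t ty v' w] w by (simp add: e_def)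
      finally show ?thesis .
    qed
    have "cext (e \<circ> f) (telem D 1 (adj V) W v w) = subst_at V ?T (\<lambda>v n w. (e \<circ> f) (?Y v n w)) (logz 1) v w"
      unfolding telem_tY[OF m1 v w] by (rule subst_at_cext[OF efH adj_module mW t t ty v w])
    also have "\<dots> = telem D 1 (adj V) W v w"
      unfolding telem_tY[OF m1 v w] by (rule subst_at_cong) (rule ef)
    also have "\<dots> = cext (idm ?T) (telem D 1 (adj V) W v w)"
    proof -
      have "telem D 1 (adj V) W v w n \<in> mcar ?T" for n
        using subst_at_completion[OF adj_module mW t ty v w, of "logz 1"] telem_tY[OF m1 v w]
        unfolding formal_completion_def wspace_def by auto
      then show ?thesis by (simp add: cext_def idm_def)
    qed
    finally show "cext (e \<circ> f) (telem D 1 (adj V) W v w) = cext (idm ?T) (telem D 1 (adj V) W v w)" .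
  qed
  then have ef: "e (f x) = x" if "x \<in> mcar ?T" for x using that by (metis comp_apply idm_def)
  have bij: "bij_betw f (mcar ?T) (mcar W)"
    by (rule bij_betwI[of _ _ _ e]) (use fe ef Hom_closed[OF fH] Hom_closed[OF eH] in auto)
  have tv: "telem D 1 (adj V) W (vac V) w = emb V ?T (e w)" if w: "w \<in> mcar W" for w
  proof
    fix m
    have "telem D 1 (adj V) W (vac V) w m = Sum_any (\<lambda>n. exp ((- n - 1) * logz 1) *\<^sub>C wproj V ?T m (?Y (vac V) n w))"
      unfolding telem_tY[OF m1 vv w] subst_at_def ..
    also have "\<dots> = wproj V ?T m (?Y (vac V) (-1) w)"
      by (subst Sum_any_single[of "-1"]) (auto simp: logz_1 vac_modes[OF mW t ty w] graded_space.wproj_0[OF gs[OF t]])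
    finally show "telem D 1 (adj V) W (vac V) w m = emb V ?T (e w) m" using w by (simp add: emb_def e_def)
  qed
  have lu: "left_unit V D W = f" unfolding left_unit_def
  proof (rule the_equality)
    show "f \<in> Iso V ?T W \<and> (\<forall>w\<in>mcar W. cext f (telem D 1 (adj V) W (vac V) w) = emb V W w)"
      using fH bij cext_emb[OF fH t mW Hom_closed[OF eH]] fe by (simp add: Iso_def tv)
    fix g assume g: "g \<in> Iso V ?T W \<and> (\<forall>w\<in>mcar W. cext g (telem D 1 (adj V) W (vac V) w) = emb V W w)"
    then have gH: "g \<in> Hom V ?T W" by (simp add: Iso_def)
    have ge: "g (e w) = w" if w: "w \<in> mcar W" for w
      using g w cext_emb[OF gH t mW Hom_closed[OF eH w]] tv[OF w]
      by (intro graded_space.emb_inj[OF gs[OF mW]] Hom_closed[OF gH] Hom_closed[OF eH]) auto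
    show "g = f"
    proof
      fix x
      show "g x = f x"
        using ge[of "f x"] ef[of x] Hom_closed[OF fH, of x] Hom_out[OF gH, of x] Hom_out[OF fH, of x] by (cases "x \<in> mcar ?T") auto
    qed
  qed
  have "inv_into (mcar ?T) f a = e a"
    using inv_into_f_f[OF bij_betw_imp_inj_on[OF bij] Hom_closed[OF eH a]] fe[OF a] by simp
  then show ?thesis unfolding lu using a by (simp add: e_def)
qed

lemma unit_axiom:
  assumes it: "intertwining_operator V W W W Y" and \<iota>: "\<iota> \<in> Hom V (adj V) W" and a: "a \<in> mcar W"
  shows "eta 1 W W W Y (tmap V D 1 (adj V) W W W \<iota> (idm W)
              (inv_into (mcar (tprod D 1 (adj V) W)) (left_unit V D W) a)) = Y (\<iota> (vac V)) (-1) a"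
proof -
  note it' = intertwining_precompose[OF \<iota> idm_Hom[OF mW] it]
  have "eta 1 W W W Y (tmap V D 1 (adj V) W W W \<iota> (idm W) x) = eta 1 (adj V) W W (\<lambda>w1 n w2. Y (\<iota> w1) n (idm W w2)) x" for x
    using eta_tmap[OF one_neq_zero adj_module mW mW mW \<iota> idm_Hom[OF mW] mW it] by (metis comp_apply)
  then show ?thesis unfolding left_unit_inverse[OF a]
    using eta_tY[OF one_neq_zero adj_module mW mW it', of "vac V" a "-1"] vac_in a by (simp add: idm_def)
qed

end

end

section \<open>The associativity axiom\<close>

lemma has_weak_sum_reindex:
  assumes "bij_betw h S T"
  shows "has_weak_sum V W F T f \<longleftrightarrow> has_weak_sum V W (\<lambda>s. F (h s)) S f"
  unfolding has_weak_sum_def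
  using summable_on_reindex_bij_betw[OF assms, of "\<lambda>s. norm (pairing _ (F s))"]
    has_sum_reindex_bij_betw[OF assms, of "\<lambda>s. pairing _ (F s)"] by simp

lemma has_tree_value_right:
  "has_tree_value V (Node W I1 z1 (Leaf W1 u) (Node M I2 z2 (Leaf W2 v) (Leaf W3 w))) f \<longleftrightarrow>
   has_weak_sum V W (\<lambda>n. I1 u (I2 v w n)) UNIV f"
proof -
  let ?T = "labellings (Leaf W1 u) \<times> labellings (Node M I2 z2 (Leaf W2 v) (Leaf W3 w))"
  have "bij_betw (\<lambda>n. (NoLabel, Label n NoLabel NoLabel)) UNIV ?T"
    by (auto simp: bij_betw_def inj_on_def)
  then show ?thesis unfolding has_tree_value.simps by (subst has_weak_sum_reindex) (assumption, simp)
qed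

lemma has_tree_value_left:
  "has_tree_value V (Node W I1 z1 (Node M I2 z2 (Leaf W2 u) (Leaf W3 v)) (Leaf W1 w)) f \<longleftrightarrow>
   has_weak_sum V W (\<lambda>n. I1 (I2 u v n) w) UNIV f"
proof -
  let ?T = "labellings (Node M I2 z2 (Leaf W2 u) (Leaf W3 v)) \<times> labellings (Leaf W1 w)"
  have "bij_betw (\<lambda>n. (Label n NoLabel NoLabel, NoLabel)) UNIV ?T"
    by (auto simp: bij_betw_def inj_on_def)
  then show ?thesis unfolding has_tree_value.simps by (subst has_weak_sum_reindex) (assumption, simp)
qed

lemma has_tree_value_right3:
  "has_tree_value V (Node W I1 z1 (Leaf W1 u) (Node M I2 z2 (Leaf W2 v) (Node M' I3 z3 (Leaf W3 w) (Leaf W4 x)))) f \<longleftrightarrow>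
   has_weak_sum V W (\<lambda>(m, n). I1 u (I2 v (I3 w x n) m)) UNIV f"
proof -
  let ?T = "labellings (Leaf W1 u) \<times> labellings (Node M I2 z2 (Leaf W2 v) (Node M' I3 z3 (Leaf W3 w) (Leaf W4 x)))"
  have "bij_betw (\<lambda>(m, n). (NoLabel, Label m NoLabel (Label n NoLabel NoLabel))) UNIV ?T"
    by (auto simp: bij_betw_def inj_on_def image_def)
  then show ?thesis unfolding has_tree_value.simps
    by (subst has_weak_sum_reindex) (assumption, simp add: case_prod_unfold)
qed

lemma clinear_image_subspace:
  assumes "clinear_on S f" "cvs.subspace S"
  shows "cvs.subspace (f ` S)"
proof (rule cvs.subspaceI)
  show "0 \<in> f ` S" using clinear_on_0[OF assms] cvs.subspace_0[OF assms(2)] by force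
  fix x y assume "x \<in> f ` S" "y \<in> f ` S"
  then obtain a b where "a \<in> S" "b \<in> S" "x = f a" "y = f b" by blast
  then show "x + y \<in> f ` S"
    using clinear_on_add[OF assms(1), of a b] cvs.subspace_add[OF assms(2), of a b] by (auto intro!: image_eqI[of _ _ "a + b"])
next
  fix c x assume "x \<in> f ` S"
  then obtain a where "a \<in> S" "x = f a" by blast
  then show "c *\<^sub>C x \<in> f ` S"
    using clinear_on_scale[OF assms(1), of a c] cvs.subspace_scale[OF assms(2), of a c] by (auto intro!: image_eqI[of _ _ "c *\<^sub>C a"])
qed

lemma shape_TLeaf: "shape s = TLeaf W x \<Longrightarrow> \<exists>w. s = TLeaf W w"
  by (cases s) auto

lemma shape_TNode: "shape s = TNode z l r \<Longrightarrow> \<exists>l' r'. s = TNode z l' r' \<and> shape l' = l \<and> shape r' = r"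
  by (cases s) auto

lemma idm_idm [simp]: "idm A (idm A w) = idm A w"
  by (simp add: idm_def)

lemma idm_in [simp]: "w \<in> mcar A \<Longrightarrow> idm A w = w"
  by (simp add: idm_def)

context vtc
begin

lemma telem_in:
  assumes "z \<noteq> 0" "is_module V W1" "is_module V W2" "w1 \<in> mcar W1" "w2 \<in> mcar W2"
  shows "telem D z W1 W2 w1 w2 n \<in> mcar (tprod D z W1 W2)"
  unfolding telem_span[OF assms(1-3), symmetric] by (rule cvs.span_base) (use assms(4,5) in blast)

lemma has_tree_value_unique:
  assumes "tree_wf V t" "has_tree_value V t f" "has_tree_value V t g"
  shows "f = g"
proof (cases t)
  case (Leaf W w)
  then show ?thesis using assms by simp
next
  case (Node W I z l r)
  then have "graded_space V W" using assms(1) gs by simp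
  then show ?thesis using assms(2,3) graded_space.has_weak_sum_unique unfolding Node by fastforce
qed

lemma has_tree_value_tree_value:
  assumes "tree_wf V t" "in_region t"
  shows "has_tree_value V t (tree_value V t)"
proof -
  have "convergence V" using vtc by (simp add: vertex_tensor_category_def)
  then obtain f where f: "has_tree_value V t f" using assms unfolding convergence_def by blast
  show ?thesis unfolding tree_value_def
    by (rule theI[where P = "has_tree_value V t", OF f]) (rule has_tree_value_unique[OF assms(1) _ f])
qed

context
  fixes A Y and z1 z2 :: real
  assumes mA: "is_module V A" and it: "intertwining_operator V A A A Y"
    and z: "z1 > z2" "z2 > z1 - z2" "z1 - z2 > 0"
begin

private abbreviation "a \<equiv> complex_of_real z1"
private abbreviation "b \<equiv> complex_of_real z2"
private abbreviation "AA z \<equiv> tprod D z A A"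
private abbreviation "et z \<equiv> eta z A A A Y"
private abbreviation "I z \<equiv> subst_at V A Y (logz z)"
private abbreviation "P u v w \<equiv> TNode a (TLeaf A u) (TNode b (TLeaf A v) (TLeaf A w))"
private abbreviation "T u v w \<equiv> TNode b (TNode (a - b) (TLeaf A u) (TLeaf A v)) (TLeaf A w)"

lemma z_nonzero: "a \<noteq> 0" "b \<noteq> 0" "a - b \<noteq> 0"
  using z by auto

lemma z_regions: "cmod a > cmod b" "cmod b > cmod (a - b)" "cmod (a - b) > 0"
  using z by (simp_all del: of_real_diff add: of_real_diff[symmetric])

lemma AA_module: "c \<noteq> 0 \<Longrightarrow> is_module V (AA c)"
  by (rule tprod_module[OF _ mA mA])

lemma et_Hom: "c \<noteq> 0 \<Longrightarrow> et c \<in> Hom V (AA c) A"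
  by (rule eta_Hom[OF _ mA mA mA it])

lemma prod_module: "is_module V (tprod D a A (AA b))" "is_module V (tprod D b (AA (a - b)) A)"
  using z_nonzero by (auto intro!: tprod_module AA_module mA)

text \<open>The two iterated multiplications, with the points in their natural positions instead of all at \<open>1\<close>.\<close>

definition right_map :: "'u \<Rightarrow> 'u" where
  "right_map = et a \<circ> tmap V D a A (AA b) A A (idm A) (et b)"

definition left_map :: "'u \<Rightarrow> 'u" where
  "left_map = et b \<circ> tmap V D b (AA (a - b)) A A A (et (a - b)) (idm A)"

text \<open>The part of the associativity isomorphism that moves the points from \<open>1\<close> to their natural positions.\<close>

definition reposition :: "'u \<Rightarrow> 'u" where
  "reposition = tmap V D a A (AA 1) A (AA b) (idm A) (ttrans D (linepath 1 b) A A) \<circ> ttrans D (linepath 1 a) A (AA 1)"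

lemma right_map_eta: "right_map = eta a A (AA b) A (\<lambda>w1 n w2. Y (idm A w1) n (et b w2))"
  unfolding right_map_def
  by (rule eta_tmap[OF z_nonzero(1) mA AA_module[OF z_nonzero(2)] mA mA idm_Hom[OF mA] et_Hom[OF z_nonzero(2)] mA it])

lemma left_map_eta: "left_map = eta b (AA (a - b)) A A (\<lambda>w1 n w2. Y (et (a - b) w1) n (idm A w2))"
  unfolding left_map_def
  by (rule eta_tmap[OF z_nonzero(2) AA_module[OF z_nonzero(3)] mA mA mA et_Hom[OF z_nonzero(3)] idm_Hom[OF mA] mA it])

lemma right_map_Hom: "right_map \<in> Hom V (tprod D a A (AA b)) A"
  unfolding right_map_eta
  by (rule eta_Hom[OF z_nonzero(1) mA AA_module[OF z_nonzero(2)] mA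
        intertwining_precompose[OF idm_Hom[OF mA] et_Hom[OF z_nonzero(2)] it]])

lemma left_map_Hom: "left_map \<in> Hom V (tprod D b (AA (a - b)) A) A"
  unfolding left_map_eta
  by (rule eta_Hom[OF z_nonzero(2) AA_module[OF z_nonzero(3)] mA mA
        intertwining_precompose[OF et_Hom[OF z_nonzero(3)] idm_Hom[OF mA] it]])

lemma pos: "z1 > 0" "z2 > 0" "z1 - z2 > 0" using z by auto

lemma transport_1b: "ttrans D (linepath 1 b) A A \<in> Iso V (AA 1) (AA b)"
  using transport_real_Iso[of 1 z2 A A] pos mA by simp

lemma transport_1a: "ttrans D (linepath 1 a) A (AA 1) \<in> Iso V (tprod D 1 A (AA 1)) (tprod D a A (AA 1))"
  using transport_real_Iso[of 1 z1 A "AA 1"] pos mA AA_module[OF one_neq_zero] by simp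

lemma reposition_right: "et 1 \<circ> tmap V D 1 A (AA 1) A A (idm A) (et 1) = right_map \<circ> reposition"
proof -
  note m1 = AA_module[OF one_neq_zero] and mb = AA_module[OF z_nonzero(2)]
  have tb: "ttrans D (linepath 1 b) A A \<in> Hom V (AA 1) (AA b)" using transport_1b by (simp add: Iso_def)
  have eb: "et b (ttrans D (linepath 1 b) A A w) = et 1 w" for w
    using eta_transport[of 1 z2, OF zero_less_one pos(2) mA mA mA it] by (metis comp_apply of_real_1)
  let ?Y1 = "\<lambda>w1 n w2. Y (idm A w1) n (et 1 w2)"
  have i1: "intertwining_operator V A (AA 1) A ?Y1"
    by (rule intertwining_precompose[OF idm_Hom[OF mA] et_Hom[OF one_neq_zero] it])
  have "right_map \<circ> tmap V D a A (AA 1) A (AA b) (idm A) (ttrans D (linepath 1 b) A A) =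
      eta a A (AA 1) A (\<lambda>w1 n w2. Y (idm A (idm A w1)) n (et b (ttrans D (linepath 1 b) A A w2)))"
    unfolding right_map_eta
    by (rule eta_tmap[OF z_nonzero(1) mA m1 mA mb idm_Hom[OF mA] tb mA
          intertwining_precompose[OF idm_Hom[OF mA] et_Hom[OF z_nonzero(2)] it]])
  then have "right_map \<circ> tmap V D a A (AA 1) A (AA b) (idm A) (ttrans D (linepath 1 b) A A) = eta a A (AA 1) A ?Y1"
    by (simp add: eb)
  then have "right_map \<circ> reposition = eta a A (AA 1) A ?Y1 \<circ> ttrans D (linepath 1 a) A (AA 1)"
    unfolding reposition_def by (simp add: o_assoc)
  also have "\<dots> = eta 1 A (AA 1) A ?Y1"
    using eta_transport[of 1 z1, OF zero_less_one pos(1) mA m1 mA i1] by simp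
  also have "\<dots> = et 1 \<circ> tmap V D 1 A (AA 1) A A (idm A) (et 1)"
    by (rule eta_tmap[OF one_neq_zero mA m1 mA mA idm_Hom[OF mA] et_Hom[OF one_neq_zero] mA it, symmetric])
  finally show ?thesis by simp
qed

lemma reposition_left:
  "et 1 \<circ> tmap V D 1 (AA 1) A A A (et 1) (idm A) \<circ> assoc_iso V D z1 z2 A A A = left_map \<circ> tassoc D a b A A A \<circ> reposition"
proof -
  note m1 = AA_module[OF one_neq_zero] and mab = AA_module[OF z_nonzero(3)]
  let ?t = "ttrans D (linepath (a - b) 1) A A"
  have t: "?t \<in> Hom V (AA (a - b)) (AA 1)"
    using transport_real_Hom[of "z1 - z2" 1 A A] pos mA by simp
  have e: "et 1 (?t w) = et (a - b) w" for w
    using eta_transport[of "z1 - z2" 1, OF pos(3) zero_less_one mA mA mA it] by (metis comp_apply of_real_1 of_real_diff)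
  let ?Y1 = "\<lambda>w1 n w2. Y (et 1 w1) n (idm A w2)"
  have i1: "intertwining_operator V (AA 1) A A ?Y1"
    by (rule intertwining_precompose[OF et_Hom[OF one_neq_zero] idm_Hom[OF mA] it])
  have "et 1 \<circ> tmap V D 1 (AA 1) A A A (et 1) (idm A) = eta 1 (AA 1) A A ?Y1"
    by (rule eta_tmap[OF one_neq_zero m1 mA mA mA et_Hom[OF one_neq_zero] idm_Hom[OF mA] mA it])
  then have "et 1 \<circ> tmap V D 1 (AA 1) A A A (et 1) (idm A) \<circ> ttrans D (linepath b 1) (AA 1) A = eta b (AA 1) A A ?Y1"
    using eta_transport[of z2 1, OF pos(2) zero_less_one m1 mA mA i1] by simp
  moreover have "eta b (AA 1) A A ?Y1 \<circ> tmap V D b (AA (a - b)) A (AA 1) A ?t (idm A) =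
      eta b (AA (a - b)) A A (\<lambda>w1 n w2. Y (et 1 (?t w1)) n (idm A (idm A w2)))"
    by (rule eta_tmap[OF z_nonzero(2) mab mA m1 mA t idm_Hom[OF mA] mA i1])
  ultimately have "et 1 \<circ> tmap V D 1 (AA 1) A A A (et 1) (idm A) \<circ> ttrans D (linepath b 1) (AA 1) A \<circ>
      tmap V D b (AA (a - b)) A (AA 1) A ?t (idm A) = left_map"
    unfolding left_map_eta by (simp add: e)
  then show ?thesis unfolding assoc_iso_def Let_def reposition_def
    by (simp add: o_assoc)
qed

lemma reposition_onto: "reposition ` mcar (tprod D 1 A (AA 1)) = mcar (tprod D a A (AA b))"
proof -
  note m1 = AA_module[OF one_neq_zero] and mb = AA_module[OF z_nonzero(2)]
  let ?t = "ttrans D (linepath 1 b) A A" and ?s = "ttrans D (linepath 1 a) A (AA 1)"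
  let ?h = "tmap V D a A (AA 1) A (AA b) (idm A) ?t"
  have tb: "?t \<in> Hom V (AA 1) (AA b)" and tbij: "?t ` mcar (AA 1) = mcar (AA b)"
    using transport_1b by (auto simp: Iso_def bij_betw_def)
  have s: "?s ` mcar (tprod D 1 A (AA 1)) = mcar (tprod D a A (AA 1))"
    using transport_1a by (simp add: Iso_def bij_betw_def)
  note hH = tmap_Hom[OF z_nonzero(1) mA m1 mA mb idm_Hom[OF mA] tb]
  note ma1 = tprod_module[OF z_nonzero(1) mA m1]
  have "mcar (tprod D a A (AA b)) \<subseteq> ?h ` mcar (tprod D a A (AA 1))"
    unfolding telem_span[OF z_nonzero(1) mA mb, symmetric]
  proof (rule cvs.span_minimal)
    show "cvs.subspace (?h ` mcar (tprod D a A (AA 1)))"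
      by (rule clinear_image_subspace[OF Hom_lin[OF hH] mod_sub[OF ma1]])
    show "{telem D a A (AA b) w1 w2 n |w1 w2 n. w1 \<in> mcar A \<and> w2 \<in> mcar (AA b)} \<subseteq> ?h ` mcar (tprod D a A (AA 1))"
    proof safe
      fix w1 w2 n assume w: "w1 \<in> mcar A" "w2 \<in> mcar (AA b)"
      then obtain x where x: "x \<in> mcar (AA 1)" "w2 = ?t x" using tbij by blast
      have "?h (telem D a A (AA 1) w1 x n) = telem D a A (AA b) w1 w2 n"
        using fun_cong[OF tmap_telem[OF z_nonzero(1) mA m1 mA mb idm_Hom[OF mA] tb w(1) x(1)], of n] w x
        by (simp add: cext_def)
      moreover have "telem D a A (AA 1) w1 x n \<in> mcar (tprod D a A (AA 1))"
        by (rule telem_in[OF z_nonzero(1) mA m1 w(1) x(1)])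
      ultimately show "telem D a A (AA b) w1 w2 n \<in> ?h ` mcar (tprod D a A (AA 1))" by (rule image_eqI[OF sym])
    qed
  qed
  moreover have "?h ` mcar (tprod D a A (AA 1)) \<subseteq> mcar (tprod D a A (AA b))" using Hom_closed[OF hH] by blast
  ultimately show ?thesis unfolding reposition_def image_comp[symmetric] s by blast
qed

lemma tensor_tree_wf:
  assumes "u \<in> mcar A" "v \<in> mcar A" "w \<in> mcar A"
  shows "tree_wf V (tensor_tree D (P u v w))" "in_region (tensor_tree D (P u v w))"
    "tree_wf V (tensor_tree D (T u v w))" "in_region (tensor_tree D (T u v w))"
  using assms mA z_nonzero z_regions prod_module AA_module
    telem_map[OF z_nonzero(1) mA AA_module[OF z_nonzero(2)]] telem_map[OF z_nonzero(2) mA mA]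
    telem_map[OF z_nonzero(2) AA_module[OF z_nonzero(3)] mA] telem_map[OF z_nonzero(3) mA mA]
  by auto

lemma right_map_value:
  assumes w: "u \<in> mcar A" "v \<in> mcar A" "w \<in> mcar A"
  shows "has_weak_sum V A (\<lambda>n. I a u (I b v w n)) UNIV (cext right_map (tree_value V (tensor_tree D (P u v w))))"
proof -
  note mb = AA_module[OF z_nonzero(2)]
  have "has_weak_sum V (tprod D a A (AA b)) (\<lambda>n. telem D a A (AA b) u (telem D b A A v w n)) UNIV (tree_value V (tensor_tree D (P u v w)))"
    using has_tree_value_tree_value[OF tensor_tree_wf(1,2)[OF w]] unfolding tensor_tree.simps ttree_mod.simps has_tree_value_right .
  from has_weak_sum_cext[OF right_map_Hom this]
  have "has_weak_sum V A (\<lambda>n. cext right_map (telem D a A (AA b) u (telem D b A A v w n))) UNIV (cext right_map (tree_value V (tensor_tree D (P u v w))))" .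
  moreover have "cext right_map (telem D a A (AA b) u (telem D b A A v w n)) = I a u (I b v w n)" for n
  proof -
    have x: "telem D b A A v w n \<in> mcar (AA b)"
      by (rule telem_in[OF z_nonzero(2) mA mA w(2,3)])
    have e: "et b (telem D b A A v w n) = I b v w n"
      using fun_cong[OF eta_telem[OF z_nonzero(2) mA mA mA it w(2,3)], of n] by (simp add: cext_def)
    have "cext right_map (telem D a A (AA b) u (telem D b A A v w n)) = cext (et a) (telem D a A A (idm A u) (et b (telem D b A A v w n)))"
      unfolding right_map_def cext_comp
        tmap_telem[OF z_nonzero(1) mA mb mA mA idm_Hom[OF mA] et_Hom[OF z_nonzero(2)] w(1) x] ..
    also have "\<dots> = I a u (I b v w n)"
      using eta_telem[OF z_nonzero(1) mA mA mA it w(1) Hom_closed[OF et_Hom[OF z_nonzero(2)] x]] w e by simp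
    finally show ?thesis .
  qed
  ultimately show ?thesis by simp
qed

lemma left_map_value:
  assumes w: "u \<in> mcar A" "v \<in> mcar A" "w \<in> mcar A"
  shows "has_weak_sum V A (\<lambda>n. I b (I (a - b) u v n) w) UNIV (cext left_map (tree_value V (tensor_tree D (T u v w))))"
proof -
  note mab = AA_module[OF z_nonzero(3)]
  have "has_weak_sum V (tprod D b (AA (a - b)) A) (\<lambda>n. telem D b (AA (a - b)) A (telem D (a - b) A A u v n) w) UNIV (tree_value V (tensor_tree D (T u v w)))"
    using has_tree_value_tree_value[OF tensor_tree_wf(3,4)[OF w]] unfolding tensor_tree.simps ttree_mod.simps has_tree_value_left .
  from has_weak_sum_cext[OF left_map_Hom this]
  have "has_weak_sum V A (\<lambda>n. cext left_map (telem D b (AA (a - b)) A (telem D (a - b) A A u v n) w)) UNIV (cext left_map (tree_value V (tensor_tree D (T u v w))))" .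
  moreover have "cext left_map (telem D b (AA (a - b)) A (telem D (a - b) A A u v n) w) = I b (I (a - b) u v n) w" for n
  proof -
    have x: "telem D (a - b) A A u v n \<in> mcar (AA (a - b))"
      by (rule telem_in[OF z_nonzero(3) mA mA w(1,2)])
    have e: "et (a - b) (telem D (a - b) A A u v n) = I (a - b) u v n"
      using fun_cong[OF eta_telem[OF z_nonzero(3) mA mA mA it w(1,2)], of n] by (simp add: cext_def)
    have "cext left_map (telem D b (AA (a - b)) A (telem D (a - b) A A u v n) w) = cext (et b) (telem D b A A (et (a - b) (telem D (a - b) A A u v n)) (idm A w))"
      unfolding left_map_def cext_comp
        tmap_telem[OF z_nonzero(2) mab mA mA mA et_Hom[OF z_nonzero(3)] idm_Hom[OF mA] x w(3)] ..
    also have "\<dots> = I b (I (a - b) u v n) w"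
      using eta_telem[OF z_nonzero(2) mA mA mA it Hom_closed[OF et_Hom[OF z_nonzero(3)] x] w(3)] w e by simp
    finally show ?thesis .
  qed
  ultimately show ?thesis by simp
qed

lemma tassoc_props:
  shows "tassoc D a b A A A \<in> Hom V (tprod D a A (AA b)) (tprod D b (AA (a - b)) A)"
    and "u \<in> mcar A \<Longrightarrow> v \<in> mcar A \<Longrightarrow> w \<in> mcar A \<Longrightarrow>
      cext (tassoc D a b A A A) (tree_value V (tensor_tree D (P u v w))) = tree_value V (tensor_tree D (T u v w))"
proof -
  have as: "associativity V D" using vtc by (simp add: vertex_tensor_category_def)
  have "tassoc D a b A A A \<in> Iso V (tprod D a A (AA b)) (tprod D b (AA (a - b)) A)"
    using as z_regions mA unfolding associativity_def by blast
  then show "tassoc D a b A A A \<in> Hom V (tprod D a A (AA b)) (tprod D b (AA (a - b)) A)" by (simp add: Iso_def)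
  show "u \<in> mcar A \<Longrightarrow> v \<in> mcar A \<Longrightarrow> w \<in> mcar A \<Longrightarrow>
      cext (tassoc D a b A A A) (tree_value V (tensor_tree D (P u v w))) = tree_value V (tensor_tree D (T u v w))"
    using as z_regions mA unfolding associativity_def by blast
qed

text \<open>After moving the points, the axiom compares \<open>right_map\<close> with \<open>left_map \<circ> tassoc\<close>. Both are module maps, and the
  components of triple products span the source, so it suffices to compare them on triple products, where \<open>right_map\<close> gives the
  product and \<open>left_map\<close> the iterate of the operator.\<close>

theorem associativity_axiom_iff:
  "(\<forall>x\<in>mcar (tprod D 1 A (AA 1)).
      et 1 (tmap V D 1 (AA 1) A A A (et 1) (idm A) (assoc_iso V D z1 z2 A A A x))
      = et 1 (tmap V D 1 A (AA 1) A A (idm A) (et 1) x)) \<longleftrightarrow>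
   (\<forall>u\<in>mcar A. \<forall>v\<in>mcar A. \<forall>w\<in>mcar A. \<exists>f.
      has_weak_sum V A (\<lambda>n. I a u (I b v w n)) UNIV f \<and>
      has_weak_sum V A (\<lambda>n. I b (I (a - b) u v n) w) UNIV f)" (is "?L \<longleftrightarrow> ?R")
proof -
  let ?l = "\<lambda>u v w. cext left_map (tree_value V (tensor_tree D (T u v w)))"
    and ?r = "\<lambda>u v w. cext right_map (tree_value V (tensor_tree D (P u v w)))" and ?c = "left_map \<circ> tassoc D a b A A A"
  note lt = Hom_compose[OF tassoc_props(1) left_map_Hom prod_module mA]
  have g: "graded_space V A" by (rule gs[OF mA])
  have "?L \<longleftrightarrow> (\<forall>x\<in>mcar (tprod D 1 A (AA 1)). (?c) (reposition x) = right_map (reposition x))"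
    using fun_cong[OF reposition_left] fun_cong[OF reposition_right] by simp
  also have "\<dots> \<longleftrightarrow> (\<forall>y\<in>mcar (tprod D a A (AA b)). (?c) y = right_map y)"
    unfolding reposition_onto[symmetric] by simp
  also have "\<dots> \<longleftrightarrow> ?c = right_map"
    using Hom_out[OF lt] Hom_out[OF right_map_Hom] by (metis ext)
  also have "\<dots> \<longleftrightarrow> (\<forall>u\<in>mcar A. \<forall>v\<in>mcar A. \<forall>w\<in>mcar A.
      ?l u v w = ?r u v w)" (is "?E \<longleftrightarrow> ?V")
  proof
    assume e: ?E
    show ?V
    proof (intro ballI)
      fix u v w assume "u \<in> mcar A" "v \<in> mcar A" "w \<in> mcar A"
      from tassoc_props(2)[OF this]
      show "?l u v w = ?r u v w"
        using cext_comp[of left_map "tassoc D a b A A A"] e by metis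
    qed
  next
    assume v: ?V
    have zero: "0 \<in> mcar A" by (rule mod_0[OF mA])
    have cs: "components_span V D" using vtc by (simp add: vertex_tensor_category_def)
    show ?E
    proof (rule Hom_eq_on_span[OF lt right_map_Hom prod_module(1)])
      show "cvs.span {tree_value V (tensor_tree D s) n | s n.
                    shape s = shape (P 0 0 0) \<and> tree_wf V (tensor_tree D s)} = mcar (tprod D a A (AA b))"
        using cs[unfolded components_span_def, rule_format, OF conjI[OF tensor_tree_wf(1,2)[OF zero zero zero]]] by simp
      fix x assume "x \<in> {tree_value V (tensor_tree D s) n | s n. shape s = shape (P 0 0 0) \<and> tree_wf V (tensor_tree D s)}"
      then obtain s n where s: "x = tree_value V (tensor_tree D s) n" "shape s = shape (P 0 0 0)" "tree_wf V (tensor_tree D s)" by blast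
      from s(2) obtain u v w where s': "s = P u v w"
        by (auto dest!: shape_TNode shape_TLeaf)
      have w: "u \<in> mcar A" "v \<in> mcar A" "w \<in> mcar A" using s(3) unfolding s' by auto
      have "cext (?c) (tree_value V (tensor_tree D (P u v w))) = ?r u v w"
        using v w tassoc_props(2)[OF w] by (simp add: cext_comp)
      from fun_cong[OF this, of n] show "(?c) x = right_map x"
        unfolding s(1) s' by (simp add: cext_def)
    qed
  qed
  also have "\<dots> \<longleftrightarrow> ?R"
  proof -
    have "(?l u v w = ?r u v w) \<longleftrightarrow>
       (\<exists>f. has_weak_sum V A (\<lambda>n. I a u (I b v w n)) UNIV f \<and> has_weak_sum V A (\<lambda>n. I b (I (a - b) u v n) w) UNIV f)"
      if w: "u \<in> mcar A" "v \<in> mcar A" "w \<in> mcar A" for u v w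
      using right_map_value[OF w] left_map_value[OF w] graded_space.has_weak_sum_unique[OF g] by metis
    then show ?thesis by blast
  qed
  finally show ?thesis .
qed

end

end

section \<open>Multiplications with integral modes\<close>

lemma exp_powi: "z \<noteq> 0 \<Longrightarrow> exp (of_int k * logz z) = z powi k"
  using exp_power_int[of "logz z" k] exp_logz by simp

lemma has_sum_of_int:
  fixes F :: "complex \<Rightarrow> complex"
  assumes "\<And>n. n \<notin> \<int> \<Longrightarrow> F n = 0"
  shows "(F has_sum S) UNIV \<longleftrightarrow> ((\<lambda>k::int. F (of_int (k + d))) has_sum S) UNIV"
proof -
  have "(F has_sum S) UNIV \<longleftrightarrow> (F has_sum S) (range (\<lambda>k::int. of_int (k + d)))"
  proof (rule has_sum_cong_neutral)
    fix n assume "n \<in> UNIV - range (\<lambda>k::int. of_int (k + d) :: complex)"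
    moreover have "n \<in> range (\<lambda>k::int. of_int (k + d))" if ni: "n \<in> \<int>"
    proof -
      obtain j where "n = of_int j" using ni by (auto elim: Ints_cases)
      then show ?thesis by (intro image_eqI[of _ _ "j - d"]) auto
    qed
    ultimately show "F n = 0" using assms by blast
  qed auto
  also have "\<dots> \<longleftrightarrow> ((F \<circ> (\<lambda>k::int. of_int (k + d))) has_sum S) UNIV"
    by (rule has_sum_reindex) (auto simp: inj_on_def)
  finally show ?thesis by (simp add: o_def)
qed

lemma has_sum_int_reflect:
  fixes F :: "int \<Rightarrow> complex"
  shows "((\<lambda>k. F (d - k)) has_sum S) UNIV \<longleftrightarrow> (F has_sum S) UNIV"
  by (rule has_sum_reindex_bij_betw, rule bij_betwI[of _ _ _ "\<lambda>k. d - k"]) auto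

lemma has_sum_int_shift:
  fixes F :: "int \<Rightarrow> complex"
  shows "((\<lambda>k. F (k + d)) has_sum S) UNIV \<longleftrightarrow> (F has_sum S) UNIV"
  by (rule has_sum_reindex_bij_betw, rule bij_betwI[of _ _ _ "\<lambda>k. k - d"]) auto

lemma one_div_powi: "(1 / t) powi (- k) = t powi k" for t :: complex
  by (simp add: power_int_divide_distrib power_int_minus)

text \<open>A multiplication on a \<open>V\<close>-module by a \<open>V\<close>-intertwining operator, without any associativity.\<close>

locale mode_algebra = fixed_voa V for V :: "'u::complex_vector voa" +
  fixes A :: "'u vmod" and y :: "'u \<Rightarrow> int \<Rightarrow> 'u \<Rightarrow> 'u"
  assumes mA: "is_module V A"
    and ycit: "intertwining_operator V A A A (cmodes y)"
    and integral: "wspace V A n \<noteq> {0} \<Longrightarrow> n \<in> \<int>"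
    and conv: "convergence V"
begin

sublocale graded_space V A by (rule gs[OF mA])

abbreviation W :: "int \<Rightarrow> 'u set" where "W k \<equiv> wspace V A (of_int k)"
abbreviation I :: "complex \<Rightarrow> 'u \<Rightarrow> 'u \<Rightarrow> complex \<Rightarrow> 'u" where "I z \<equiv> subst_at V A (cmodes y) (logz z)"
abbreviation D :: "'u \<Rightarrow> 'u" where "D \<equiv> Lop V A (-1)"
abbreviation dx :: "complex \<Rightarrow> nat \<Rightarrow> 'u \<Rightarrow> 'u" where "dx \<equiv> dexp V A"

lemma W_mcar: "x \<in> W k \<Longrightarrow> x \<in> mcar A" by (rule wspace_mcar)

lemma homogeneous_int_induct [consumes 1, case_names hom add]:
  assumes "w \<in> mcar A" "\<And>k x. x \<in> W k \<Longrightarrow> P x"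
    "\<And>x y. x \<in> mcar A \<Longrightarrow> y \<in> mcar A \<Longrightarrow> P x \<Longrightarrow> P y \<Longrightarrow> P (x + y)"
  shows "P w"
  using assms(1)
proof (induction rule: homogeneous_induct)
  case (hom n x)
  show ?case
  proof (cases "n \<in> \<int>")
    case True
    then show ?thesis using hom assms(2) by (auto elim: Ints_cases)
  next
    case False
    then have "x = 0" using hom integral[of n] by blast
    then show ?thesis using assms(2)[of 0 0] zero_wspace by blast
  qed
qed (rule assms(3))

lemma y_lin1: "v \<in> mcar A \<Longrightarrow> clinear_on (mcar A) (\<lambda>u. y u n v)"
  using it_lin1[OF mA mA mA ycit, of v "of_int n"] by simp

lemma y_lin2: "u \<in> mcar A \<Longrightarrow> clinear_on (mcar A) (y u n)"
proof -
  assume "u \<in> mcar A"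
  from it_lin2[OF mA mA mA ycit this, of "of_int n"] show ?thesis by (simp add: clinear_on_def)
qed

lemma y_closed: "u \<in> mcar A \<Longrightarrow> v \<in> mcar A \<Longrightarrow> y u n v \<in> mcar A"
  using it_closed[OF mA mA mA ycit, of u v "of_int n"] by simp

lemma y_trunc:
  assumes "u \<in> mcar A" "v \<in> mcar A"
  shows "\<exists>N. \<forall>n\<ge>N. y u n v = 0"
proof -
  obtain R :: real where R: "\<And>n. Re n \<ge> R \<Longrightarrow> cmodes y u n v = 0" using it_trunc[OF mA mA mA ycit assms] by blast
  have "y u n v = 0" if "n \<ge> \<lceil>R\<rceil>" for n
    using R[of "of_int n"] that by (simp add: ceiling_le_iff)
  then show ?thesis by blast
qed

lemma y_01: "v \<in> mcar A \<Longrightarrow> y 0 n v = 0" by (rule clinear_on_0[OF y_lin1 sub])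
lemma y_02: "u \<in> mcar A \<Longrightarrow> y u n 0 = 0" by (rule clinear_on_0[OF y_lin2 sub])

lemma y_weight: "u \<in> W a \<Longrightarrow> v \<in> W b \<Longrightarrow> y u n v \<in> W (a + b - n - 1)"
  using it_weight[OF mA mA mA ycit, of u "of_int a" v "of_int b" "of_int n"] by simp

lemma y_D_left: "u \<in> mcar A \<Longrightarrow> v \<in> mcar A \<Longrightarrow> y (D u) n v = - (of_int n *\<^sub>C y u (n - 1) v)"
proof -
  assume "u \<in> mcar A" "v \<in> mcar A"
  moreover have "of_int n - 1 = (of_int (n - 1) :: complex)" by simp
  ultimately show ?thesis using it_deriv[OF mA mA mA ycit, of u v "of_int n"] by (simp only: cmodes_of_int)
qed

lemma y_D_right: "u \<in> mcar A \<Longrightarrow> v \<in> mcar A \<Longrightarrow> y u n (D v) = D (y u n v) + of_int n *\<^sub>C y u (n - 1) v"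
proof -
  assume "u \<in> mcar A" "v \<in> mcar A"
  moreover have "of_int n - 1 = (of_int (n - 1) :: complex)" by simp
  ultimately show ?thesis using it_D[OF mA mA mA ycit, of u v "of_int n"] by (simp only: cmodes_of_int) simp
qed

lemma y_dexp_right:
  assumes "u \<in> mcar A" "x \<in> mcar A"
  shows "y u m (dx s k x) = (\<Sum>j\<le>k. (s ^ j * (of_int m gchoose j)) *\<^sub>C dx s (k - j) (y u (m - int j) x))"
  by (rule op_dexp[OF mA]) (use assms y_closed y_lin2 y_D_right in auto)

lemma y_dexp_left:
  assumes "u \<in> mcar A" "x \<in> mcar A"
  shows "y (dx s k u) n x = ((- s) ^ k * (of_int n gchoose k)) *\<^sub>C y u (n - int k) x"
proof -
  have "of_int n - of_nat k = (of_int (n - int k) :: complex)" by simp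
  then show ?thesis using it_dexp1[OF mA mA mA ycit assms, of s k "of_int n"] by (simp only: cmodes_of_int)
qed

lemma I_int:
  assumes "u \<in> W a" "v \<in> W b" "z \<noteq> 0"
  shows "I z u v (of_int k) = z powi (k - a - b) *\<^sub>C y u (a + b - k - 1) v"
proof -
  have "of_int a + of_int b - of_int k - 1 = (of_int (a + b - k - 1) :: complex)"
    "of_int k - of_int a - of_int b = (of_int (k - a - b) :: complex)" by simp_all
  then show ?thesis unfolding subst_at_homogeneous[OF mA mA mA ycit assms(1,2)]
    using exp_powi[OF assms(3)] by (simp only: cmodes_of_int)
qed

lemma I_completion: "u \<in> mcar A \<Longrightarrow> v \<in> mcar A \<Longrightarrow> I z u v \<in> formal_completion V A"
  by (rule subst_at_completion[OF mA mA mA ycit])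

lemma I_mcar: "u \<in> mcar A \<Longrightarrow> v \<in> mcar A \<Longrightarrow> I z u v n \<in> mcar A"
  using I_completion formal_completion_mcar by blast

lemma I_not_int: "u \<in> mcar A \<Longrightarrow> v \<in> mcar A \<Longrightarrow> n \<notin> \<int> \<Longrightarrow> I z u v n = 0"
  using I_completion[of u v z] integral[of n] unfolding formal_completion_def by blast

lemma I_lin1: "v \<in> mcar A \<Longrightarrow> clinear_on (mcar A) (\<lambda>u. I z u v n)"
  by (rule subst_at_lin1[OF mA mA mA ycit])

lemma I_lin2: "u \<in> mcar A \<Longrightarrow> clinear_on (mcar A) (\<lambda>v. I z u v n)"
  by (rule subst_at_lin2[OF mA mA mA ycit])

lemma I_map: "intertwining_map V z A A A (I z)"
  unfolding intertwining_map_def using ycit by blast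

lemma product_converges:
  assumes "u \<in> mcar A" "v \<in> mcar A" "w \<in> mcar A" "cmod z1 > cmod z2" "z2 \<noteq> 0"
  shows "\<exists>f. has_weak_sum V A (\<lambda>n. I z1 u (I z2 v w n)) UNIV f"
proof -
  have "z1 \<noteq> 0" using assms(4) by auto
  then have "tree_wf V (Node A (I z1) z1 (Leaf A u) (Node A (I z2) z2 (Leaf A v) (Leaf A w))) \<and> in_region (Node A (I z1) z1 (Leaf A u) (Node A (I z2) z2 (Leaf A v) (Leaf A w)))"
    using assms mA I_map by simp
  then have "\<exists>f. has_tree_value V (Node A (I z1) z1 (Leaf A u) (Node A (I z2) z2 (Leaf A v) (Leaf A w))) f"
    using conv unfolding convergence_def by blast
  then show ?thesis unfolding has_tree_value_right .
qed

lemma iterate_converges: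
  assumes "u \<in> mcar A" "v \<in> mcar A" "w \<in> mcar A" "cmod z2 > cmod z0" "z0 \<noteq> 0"
  shows "\<exists>f. has_weak_sum V A (\<lambda>n. I z2 (I z0 u v n) w) UNIV f"
proof -
  have "z2 \<noteq> 0" using assms(4) by auto
  then have "tree_wf V (Node A (I z2) z2 (Node A (I z0) z0 (Leaf A u) (Leaf A v)) (Leaf A w)) \<and> in_region (Node A (I z2) z2 (Node A (I z0) z0 (Leaf A u) (Leaf A v)) (Leaf A w))"
    using assms mA I_map by simp
  then have "\<exists>f. has_tree_value V (Node A (I z2) z2 (Node A (I z0) z0 (Leaf A u) (Leaf A v)) (Leaf A w)) f"
    using conv unfolding convergence_def by blast
  then show ?thesis unfolding has_tree_value_left .
qed

lemma triple_product_converges: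
  assumes "u \<in> mcar A" "v \<in> mcar A" "w \<in> mcar A" "x \<in> mcar A" "cmod z1 > cmod z2" "cmod z2 > cmod z3" "z3 \<noteq> 0"
  shows "\<exists>f. has_weak_sum V A (\<lambda>(m, n). I z1 u (I z2 v (I z3 w x n) m)) UNIV f"
proof -
  have "z1 \<noteq> 0" "z2 \<noteq> 0" using assms(5,6) by auto
  then have "tree_wf V (Node A (I z1) z1 (Leaf A u) (Node A (I z2) z2 (Leaf A v) (Node A (I z3) z3 (Leaf A w) (Leaf A x)))) \<and> in_region (Node A (I z1) z1 (Leaf A u) (Node A (I z2) z2 (Leaf A v) (Node A (I z3) z3 (Leaf A w) (Leaf A x))))"
    using assms mA I_map by simp
  then have "\<exists>f. has_tree_value V (Node A (I z1) z1 (Leaf A u) (Node A (I z2) z2 (Leaf A v) (Node A (I z3) z3 (Leaf A w) (Leaf A x)))) f"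
    using conv unfolding convergence_def by blast
  then show ?thesis unfolding has_tree_value_right3 .
qed

section \<open>Correlation sequences\<close>

text \<open>The modes of the three expansions. The functional \<open>p\<close> fixes the weight \<open>e\<close> of the output, so only one index is
  free: the two modes add up to \<open>K\<close>.\<close>

definition aseq :: "('u \<Rightarrow> complex) \<Rightarrow> int \<Rightarrow> 'u \<Rightarrow> 'u \<Rightarrow> 'u \<Rightarrow> int \<Rightarrow> complex" where
  "aseq p K u v w m = p (y u m (y v (K - m) w))"
definition bseq :: "('u \<Rightarrow> complex) \<Rightarrow> int \<Rightarrow> 'u \<Rightarrow> 'u \<Rightarrow> 'u \<Rightarrow> int \<Rightarrow> complex" where
  "bseq p K u v w m = p (y (y u m v) (K - m) w)"
definition cseq :: "('u \<Rightarrow> complex) \<Rightarrow> int \<Rightarrow> 'u \<Rightarrow> 'u \<Rightarrow> 'u \<Rightarrow> int \<Rightarrow> complex" where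
  "cseq p K u v w m = p (y v (K - m) (y u m w))"

lemma cseq_aseq: "cseq p K u v w m = aseq p K v u w (K - m)"
  by (simp add: aseq_def cseq_def)

context
  fixes p :: "'u \<Rightarrow> complex" and a b c e K :: int and u v w
  assumes p: "clinear_on (mcar A) p" and u: "u \<in> W a" and v: "v \<in> W b" and w: "w \<in> W c"
    and K: "K = a + b + c - 2 - e"
begin

lemma p0: "p 0 = 0" by (rule clinear_on_0[OF p sub])

lemma uvw: "u \<in> mcar A" "v \<in> mcar A" "w \<in> mcar A" using u v w W_mcar by auto

lemma aseq_bdd: "\<exists>N. \<forall>m<N. aseq p K u v w m = 0"
proof -
  obtain N where N: "\<And>n. n \<ge> N \<Longrightarrow> y v n w = 0" using y_trunc[OF uvw(2,3)] by blast
  have "aseq p K u v w m = 0" if "m < K - N" for m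
    using N[of "K - m"] that by (simp add: aseq_def y_02[OF uvw(1)] p0)
  then show ?thesis by blast
qed

lemma bseq_bdd: "\<exists>N. \<forall>m\<ge>N. bseq p K u v w m = 0"
proof -
  obtain N where N: "\<And>n. n \<ge> N \<Longrightarrow> y u n v = 0" using y_trunc[OF uvw(1,2)] by blast
  then show ?thesis by (intro exI[of _ N]) (simp add: bseq_def y_01[OF uvw(3)] p0)
qed

lemma cseq_bdd: "\<exists>N. \<forall>m\<ge>N. cseq p K u v w m = 0"
proof -
  obtain N where N: "\<And>n. n \<ge> N \<Longrightarrow> y u n w = 0" using y_trunc[OF uvw(1,3)] by blast
  then show ?thesis by (intro exI[of _ N]) (simp add: cseq_def y_02[OF uvw(2)] p0)
qed

lemma component_has_sum:
  assumes f: "has_weak_sum V A F S f" and F: "\<And>s. F s \<in> formal_completion V A"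
  shows "((\<lambda>s. p (F s k)) has_sum p (f k)) S"
proof -
  have "f \<in> formal_completion V A" and s: "((\<lambda>s. pairing (wfunctional k p) (F s)) has_sum pairing (wfunctional k p) f) S"
    using f wfunctional_contragredient[OF p] by (simp_all add: has_weak_sum_def)
  then show ?thesis unfolding pairing_wfunctional[OF p F] by (simp only: pairing_wfunctional[OF p])
qed

lemma product_has_sum:
  assumes f: "has_weak_sum V A (\<lambda>n. I z1 u (I z2 v w n)) UNIV f" and z: "z1 \<noteq> 0" "z2 \<noteq> 0"
  shows "((\<lambda>m. aseq p K u v w m * (z1 powi (- m - 1) * z2 powi (m - K - 1))) has_sum p (f (of_int e))) UNIV"
proof -
  have s: "((\<lambda>n. p (I z1 u (I z2 v w n) (of_int e))) has_sum p (f (of_int e))) UNIV"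
    by (rule component_has_sum[OF f I_completion[OF uvw(1) I_mcar[OF uvw(2,3)]]])
  have ni: "p (I z1 u (I z2 v w n) (of_int e)) = 0" if "n \<notin> \<int>" for n
    using I_not_int[OF uvw(2,3) that] clinear_on_0[OF I_lin2[OF uvw(1)] sub] p0 by simp
  have "((\<lambda>m. p (I z1 u (I z2 v w (of_int (m + (e + 1 - a)))) (of_int e))) has_sum p (f (of_int e))) UNIV"
    using s has_sum_of_int[of "\<lambda>n. p (I z1 u (I z2 v w n) (of_int e))" "p (f (of_int e))" "e + 1 - a", OF ni] by blast
  moreover have "p (I z1 u (I z2 v w (of_int (m + (e + 1 - a)))) (of_int e)) = aseq p K u v w m * (z1 powi (- m - 1) * z2 powi (m - K - 1))" for m
  proof -
    define k where "k = m + (e + 1 - a)"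
    have i: "b + c - k - 1 = K - m" "k - b - c = m - K - 1" unfolding k_def K by simp_all
    have "b + c - (K - m) - 1 = k" unfolding k_def K by simp
    then have x: "y v (K - m) w \<in> W k" using y_weight[OF v w, of "K - m"] by (simp only:)
    have "I z2 v w (of_int k) = z2 powi (m - K - 1) *\<^sub>C y v (K - m) w"
      unfolding I_int[OF v w z(2)] i ..
    then have "I z1 u (I z2 v w (of_int k)) (of_int e) = z2 powi (m - K - 1) *\<^sub>C I z1 u (y v (K - m) w) (of_int e)"
      using clinear_on_scale[OF I_lin2[OF uvw(1)] W_mcar[OF x]] by simp
    also have "I z1 u (y v (K - m) w) (of_int e) = z1 powi (- m - 1) *\<^sub>C y u m (y v (K - m) w)"
    proof -
      have i2: "e - a - k = - m - 1" "a + k - e - 1 = m" unfolding k_def by simp_all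
      show ?thesis unfolding I_int[OF u x z(1)] i2 ..
    qed
    finally have "I z1 u (I z2 v w (of_int k)) (of_int e) = (z2 powi (m - K - 1) * z1 powi (- m - 1)) *\<^sub>C y u m (y v (K - m) w)" by simp
    then show ?thesis unfolding k_def[symmetric] aseq_def
      using clinear_on_scale[OF p y_closed[OF uvw(1) y_closed[OF uvw(2,3)]]] by (simp add: scaleC_complex_def mult_ac)
  qed
  ultimately show ?thesis by simp
qed

lemma iterate_has_sum:
  assumes f: "has_weak_sum V A (\<lambda>n. I z2 (I z0 u v n) w) UNIV f" and z: "z0 \<noteq> 0" "z2 \<noteq> 0"
  shows "((\<lambda>m. bseq p K u v w m * (z0 powi (- m - 1) * z2 powi (m - K - 1))) has_sum p (f (of_int e))) UNIV"
proof -
  have s: "((\<lambda>n. p (I z2 (I z0 u v n) w (of_int e))) has_sum p (f (of_int e))) UNIV"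
    by (rule component_has_sum[OF f I_completion[OF I_mcar[OF uvw(1,2)] uvw(3)]])
  have ni: "p (I z2 (I z0 u v n) w (of_int e)) = 0" if "n \<notin> \<int>" for n
    using I_not_int[OF uvw(1,2) that] clinear_on_0[OF I_lin1[OF uvw(3)] sub] p0 by simp
  have "((\<lambda>n. p (I z2 (I z0 u v (of_int (n + 0))) w (of_int e))) has_sum p (f (of_int e))) UNIV"
    using s has_sum_of_int[of "\<lambda>n. p (I z2 (I z0 u v n) w (of_int e))" "p (f (of_int e))" 0, OF ni] by blast
  then have "((\<lambda>n. p (I z2 (I z0 u v (of_int n)) w (of_int e))) has_sum p (f (of_int e))) UNIV" by simp
  then have "((\<lambda>m. p (I z2 (I z0 u v (of_int (a + b - 1 - m))) w (of_int e))) has_sum p (f (of_int e))) UNIV"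
    using has_sum_int_reflect[of "\<lambda>n. p (I z2 (I z0 u v (of_int n)) w (of_int e))" "a + b - 1"] by blast
  moreover have "p (I z2 (I z0 u v (of_int (a + b - 1 - m))) w (of_int e)) = bseq p K u v w m * (z0 powi (- m - 1) * z2 powi (m - K - 1))" for m
  proof -
    define k where "k = a + b - 1 - m"
    have i: "a + b - k - 1 = m" "k - a - b = - m - 1" unfolding k_def by simp_all
    have "a + b - m - 1 = k" unfolding k_def by simp
    then have x: "y u m v \<in> W k" using y_weight[OF u v, of m] by (simp only:)
    have "I z0 u v (of_int k) = z0 powi (- m - 1) *\<^sub>C y u m v"
      unfolding I_int[OF u v z(1)] i ..
    then have "I z2 (I z0 u v (of_int k)) w (of_int e) = z0 powi (- m - 1) *\<^sub>C I z2 (y u m v) w (of_int e)"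
      using clinear_on_scale[OF I_lin1[OF uvw(3)] W_mcar[OF x]] by simp
    also have "I z2 (y u m v) w (of_int e) = z2 powi (m - K - 1) *\<^sub>C y (y u m v) (K - m) w"
    proof -
      have i2: "e - k - c = m - K - 1" "k + c - e - 1 = K - m" unfolding k_def K by simp_all
      show ?thesis unfolding I_int[OF x w z(2)] i2 ..
    qed
    finally have "I z2 (I z0 u v (of_int k)) w (of_int e) = (z0 powi (- m - 1) * z2 powi (m - K - 1)) *\<^sub>C y (y u m v) (K - m) w" by simp
    then show ?thesis unfolding k_def[symmetric] bseq_def
      using clinear_on_scale[OF p y_closed[OF y_closed[OF uvw(1,2)] uvw(3)]] by (simp add: scaleC_complex_def mult_ac)
  qed
  ultimately show ?thesis by simp
qed

lemma product_series:
  assumes t: "norm t > 1" and f: "has_weak_sum V A (\<lambda>n. I t u (I 1 v w n)) UNIV f"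
  shows "((\<lambda>k. inf_coeffs (aseq p K u v w) k * (1 / t) powi k) has_sum p (f (of_int e))) UNIV"
proof -
  have t0: "t \<noteq> 0" using t by auto
  have "((\<lambda>m. aseq p K u v w m * (1 / t) powi (m + 1)) has_sum p (f (of_int e))) UNIV"
  proof -
    have "t powi (- m - 1) = (1 / t) powi (m + 1)" for m
      using one_div_powi[of t "- m - 1"] by (simp add: add.commute)
    then show ?thesis using product_has_sum[OF f t0 one_neq_zero] by simp
  qed
  then have "((\<lambda>k. (\<lambda>m. aseq p K u v w m * (1 / t) powi (m + 1)) (k + (- 1))) has_sum p (f (of_int e))) UNIV"
    by (subst has_sum_int_shift)
  then show ?thesis by simp
qed

lemma iterate_series:
  assumes s: "0 < norm s" "norm s < 1" and f: "has_weak_sum V A (\<lambda>n. I 1 (I s u v n) w) UNIV f"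
  shows "((\<lambda>k. zero_coeffs (bseq p K u v w) k * s powi k) has_sum p (f (of_int e))) UNIV"
proof -
  have s0: "s \<noteq> 0" using s by auto
  have "((\<lambda>m. bseq p K u v w m * s powi (- m - 1)) has_sum p (f (of_int e))) UNIV"
    using iterate_has_sum[OF f s0 one_neq_zero] by simp
  then have "((\<lambda>k. (\<lambda>m. bseq p K u v w m * s powi (- m - 1)) (- 1 - k)) has_sum p (f (of_int e))) UNIV"
    by (subst has_sum_int_reflect)
  moreover have "- 1 - k = - k - 1" "- (- k - 1) - 1 = k" for k :: int by simp_all
  ultimately show ?thesis by (simp only:)
qed

lemma aseq_lconv: "lconv (inf_coeffs (aseq p K u v w)) 1"
  unfolding lconv_def
proof (intro conjI allI impI)
  obtain N where N: "\<And>m. m < N \<Longrightarrow> aseq p K u v w m = 0" using aseq_bdd by blast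
  show "\<exists>k0. \<forall>k<k0. inf_coeffs (aseq p K u v w) k = 0" by (rule exI[of _ N]) (use N in auto)
  fix x :: complex assume x: "0 < norm x \<and> norm x < 1"
  then have t: "norm (1 / x) > 1" by (simp add: norm_divide)
  obtain f where "has_weak_sum V A (\<lambda>n. I (1 / x) u (I 1 v w n)) UNIV f"
    using product_converges[OF uvw, of 1 "1 / x"] t by auto
  from product_series[OF t this] show "(\<lambda>k. inf_coeffs (aseq p K u v w) k * x powi k) summable_on UNIV"
    by (auto simp: summable_on_def)
qed

lemma bseq_lconv: "lconv (zero_coeffs (bseq p K u v w)) 1"
  unfolding lconv_def
proof (intro conjI allI impI)
  obtain N where N: "\<And>m. m \<ge> N \<Longrightarrow> bseq p K u v w m = 0" using bseq_bdd by blast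
  show "\<exists>k0. \<forall>k<k0. zero_coeffs (bseq p K u v w) k = 0" by (rule exI[of _ "- N"]) (use N in auto)
  fix x :: complex assume x: "0 < norm x \<and> norm x < 1"
  obtain f where "has_weak_sum V A (\<lambda>n. I 1 (I x u v n) w) UNIV f"
    using iterate_converges[OF uvw, of x 1] x by auto
  from iterate_series[OF _ _ this] x show "(\<lambda>k. zero_coeffs (bseq p K u v w) k * x powi k) summable_on UNIV"
    by (auto simp: summable_on_def)
qed

text \<open>A term depends on the two points only through their ratio, up to a power of \<open>z2\<close> that is common to all terms.\<close>

lemma rescale:
  fixes z1 z2 g :: complex
  assumes "z2 \<noteq> 0" "z1 \<noteq> 0"
  shows "g * (z1 powi (- m - 1) * z2 powi (m - K - 1)) = z2 powi (- K - 2) * (g * (z1 / z2) powi (- m - 1))"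
proof -
  have "z2 powi (m - K - 1) = z2 powi (- K - 2) * z2 powi (m + 1)"
    using assms power_int_add[of z2 "- K - 2" "m + 1"] by simp
  moreover have "(z1 / z2) powi (- m - 1) = z1 powi (- m - 1) * z2 powi (m + 1)"
  proof -
    have "z2 powi (- m - 1) * z2 powi (m + 1) = 1"
      using assms power_int_add[of z2 "- m - 1" "m + 1"] by simp
    then have "inverse (z2 powi (- m - 1)) = z2 powi (m + 1)" by (rule inverse_unique)
    then show ?thesis by (subst power_int_divide_distrib) (simp only: divide_inverse)
  qed
  ultimately show ?thesis by simp
qed

lemma product_value:
  assumes f: "has_weak_sum V A (\<lambda>n. I z1 u (I z2 v w n)) UNIV f" and z: "z2 \<noteq> 0" "cmod z1 > cmod z2"
  shows "p (f (of_int e)) = z2 powi (- K - 2) * lsum (inf_coeffs (aseq p K u v w)) (1 / (z1 / z2))"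
proof -
  let ?t = "z1 / z2"
  have z1: "z1 \<noteq> 0" using z by auto
  have t: "norm ?t > 1" "?t \<noteq> 0" using z z1 by (auto simp: norm_divide)
  obtain g where g: "has_weak_sum V A (\<lambda>n. I ?t u (I 1 v w n)) UNIV g"
    using product_converges[OF uvw, of 1 ?t] t by auto
  have "((\<lambda>m. z2 powi (- K - 2) * (aseq p K u v w m * ?t powi (- m - 1))) has_sum p (f (of_int e))) UNIV"
    using product_has_sum[OF f z1 z(1)] unfolding rescale[OF z(1) z1] .
  moreover have "((\<lambda>m. aseq p K u v w m * ?t powi (- m - 1)) has_sum p (g (of_int e))) UNIV"
    using product_has_sum[OF g t(2) one_neq_zero] by simp
  then have "((\<lambda>m. z2 powi (- K - 2) * (aseq p K u v w m * ?t powi (- m - 1))) has_sum z2 powi (- K - 2) * p (g (of_int e))) UNIV"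
    by (rule has_sum_cmult_right)
  ultimately have "p (f (of_int e)) = z2 powi (- K - 2) * p (g (of_int e))" by (rule has_sum_unique)
  moreover have "p (g (of_int e)) = lsum (inf_coeffs (aseq p K u v w)) (1 / ?t)"
    using product_series[OF t(1) g] unfolding lsum_def by (rule infsumI[symmetric])
  ultimately show ?thesis by simp
qed

lemma iterate_value:
  assumes f: "has_weak_sum V A (\<lambda>n. I z2 (I z0 u v n) w) UNIV f" and z: "z0 \<noteq> 0" "cmod z2 > cmod z0"
  shows "p (f (of_int e)) = z2 powi (- K - 2) * lsum (zero_coeffs (bseq p K u v w)) (z0 / z2)"
proof -
  let ?t = "z0 / z2"
  have z2: "z2 \<noteq> 0" using z by auto
  have t: "0 < norm ?t" "norm ?t < 1" "?t \<noteq> 0" using z z2 by (auto simp: norm_divide)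
  obtain g where g: "has_weak_sum V A (\<lambda>n. I 1 (I ?t u v n) w) UNIV g"
    using iterate_converges[OF uvw, of ?t 1] t by auto
  have "((\<lambda>m. z2 powi (- K - 2) * (bseq p K u v w m * ?t powi (- m - 1))) has_sum p (f (of_int e))) UNIV"
    using iterate_has_sum[OF f z(1) z2] unfolding rescale[OF z2 z(1)] .
  moreover have "((\<lambda>m. bseq p K u v w m * ?t powi (- m - 1)) has_sum p (g (of_int e))) UNIV"
    using iterate_has_sum[OF g t(3) one_neq_zero] by simp
  then have "((\<lambda>m. z2 powi (- K - 2) * (bseq p K u v w m * ?t powi (- m - 1))) has_sum z2 powi (- K - 2) * p (g (of_int e))) UNIV"
    by (rule has_sum_cmult_right)
  ultimately have "p (f (of_int e)) = z2 powi (- K - 2) * p (g (of_int e))" by (rule has_sum_unique)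
  moreover have "p (g (of_int e)) = lsum (zero_coeffs (bseq p K u v w)) ?t"
    using iterate_series[OF t(1,2) g] unfolding lsum_def by (rule infsumI[symmetric])
  ultimately show ?thesis by simp
qed

end

section \<open>The Jacobi identity in coefficients\<close>

definition jacobi_at :: "'u \<Rightarrow> 'u \<Rightarrow> 'u \<Rightarrow> int \<Rightarrow> int \<Rightarrow> int \<Rightarrow> bool" where
  "jacobi_at u v w l m n \<longleftrightarrow>
     binomial_sum m (\<lambda>i. y (y u (l + int i) v) (m + n - int i) w)
      = alternating_sum l (\<lambda>i. y u (m + l - int i) (y v (n + int i) w))
      - signed_sum l (\<lambda>i.
            y v (n + l - int i) (y u (m + int i) w))"

lemma jacobi_terms:
  assumes "u \<in> mcar A" "v \<in> mcar A" "w \<in> mcar A"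
  shows "\<exists>N::nat. \<forall>i\<ge>N. y (y u (l + int i) v) (m + n - int i) w = 0"
    and "\<exists>N::nat. \<forall>i\<ge>N. y u (m + l - int i) (y v (n + int i) w) = 0"
    and "\<exists>N::nat. \<forall>i\<ge>N. y v (n + l - int i) (y u (m + int i) w) = 0"
proof -
  have *: "\<exists>N::nat. \<forall>i\<ge>N. y x (k + int i) z = 0" if xz: "x \<in> mcar A" "z \<in> mcar A" for x z k
  proof -
    obtain N where N: "\<And>n. n \<ge> N \<Longrightarrow> y x n z = 0" using y_trunc[OF xz] by blast
    show ?thesis by (rule exI[of _ "nat (N - k)"]) (use N in auto)
  qed
  show "\<exists>N::nat. \<forall>i\<ge>N. y (y u (l + int i) v) (m + n - int i) w = 0"
    using *[OF assms(1,2), of l] y_01[OF assms(3)] by metis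
  show "\<exists>N::nat. \<forall>i\<ge>N. y u (m + l - int i) (y v (n + int i) w) = 0"
    using *[OF assms(2,3), of n] y_02[OF assms(1)] by metis
  show "\<exists>N::nat. \<forall>i\<ge>N. y v (n + l - int i) (y u (m + int i) w) = 0"
    using *[OF assms(1,3), of m] y_02[OF assms(2)] by metis
qed

text \<open>Pairing with functionals loses nothing, and makes \<open>l + m + n\<close> the total mode number \<open>K\<close>.\<close>

lemma jacobi_at_iff:
  assumes u: "u \<in> W a" and v: "v \<in> W b" and w: "w \<in> W c"
  shows "jacobi_at u v w l m n \<longleftrightarrow>
    (\<forall>p. clinear_on (mcar A) p \<longrightarrow> jacobi_coeffs (aseq p (l + m + n) u v w) (bseq p (l + m + n) u v w) (cseq p (l + m + n) u v w) l m)" (is "_ = (\<forall>p. _ \<longrightarrow> ?J p)")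
proof -
  note uvw = W_mcar[OF u] W_mcar[OF v] W_mcar[OF w]
  let ?A = "\<lambda>i::nat. y (y u (l + int i) v) (m + n - int i) w"
  let ?B = "\<lambda>i::nat. y u (m + l - int i) (y v (n + int i) w)"
  let ?C = "\<lambda>i::nat. y v (n + l - int i) (y u (m + int i) w)"
  let ?a = "\<lambda>i::nat. (of_int m gchoose i) :: complex"
  let ?b = "\<lambda>i::nat. (-1) ^ i * (of_int l gchoose i) :: complex"
  let ?c = "\<lambda>i::nat. (-1) powi l * (-1) ^ i * (of_int l gchoose i) :: complex"
  have A: "?A i \<in> mcar A" and B: "?B i \<in> mcar A" and C: "?C i \<in> mcar A" for i
    using uvw by (auto intro!: y_closed)
  have hs: "finite {i. co i *\<^sub>C f i \<noteq> 0}" if h: "\<exists>N::nat. \<forall>i\<ge>N. f i = 0" for co :: "nat \<Rightarrow> complex" and f :: "nat \<Rightarrow> 'u"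
  proof -
    obtain N where "\<forall>i\<ge>N. f i = 0" using h by blast
    then show ?thesis by (intro finite_nat_support[of N]) simp
  qed
  have ps: "p (Sum_any (\<lambda>i. co i *\<^sub>C f i)) = Sum_any (\<lambda>i. co i * p (f i))"
    if p: "clinear_on (mcar A) p" and "\<exists>N::nat. \<forall>i\<ge>N. f i = 0" and f: "\<And>i. f i \<in> mcar A" for co :: "nat \<Rightarrow> complex" and f :: "nat \<Rightarrow> 'u" and p
    using clinear_on_Sum_any[OF p sub cvs.subspace_scale[OF sub f] hs[OF that(2)], of co] clinear_on_scale[OF p f]
    by (simp add: scaleC_complex_def)
  have mem: "Sum_any (\<lambda>i. co i *\<^sub>C f i) \<in> mcar A" if "\<And>i. f i \<in> mcar A" for co :: "nat \<Rightarrow> complex" and f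
    by (intro subspace_Sum_any[OF sub] cvs.subspace_scale[OF sub] that)
  have coeffs: "?J p \<longleftrightarrow>
      p (Sum_any (\<lambda>i. ?a i *\<^sub>C ?A i)) = p (Sum_any (\<lambda>i. ?b i *\<^sub>C ?B i)) - p (Sum_any (\<lambda>i. ?c i *\<^sub>C ?C i))"
    if p: "clinear_on (mcar A) p" for p
  proof -
    have "l + m + n - (l + int i) = m + n - int i" "l + m + n - (m + l - int i) = n + int i" "l + m + n - (m + int i) = n + l - int i" for i :: nat
      by simp_all
    note idx = this
    show ?thesis
      unfolding jacobi_coeffs_def aseq_def bseq_def cseq_def ps[OF p jacobi_terms(1)[OF uvw] A] ps[OF p jacobi_terms(2)[OF uvw] B] ps[OF p jacobi_terms(3)[OF uvw] C]
      by (simp only: idx)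
  qed
  let ?X = "Sum_any (\<lambda>i. ?a i *\<^sub>C ?A i)" and ?Y = "Sum_any (\<lambda>i. ?b i *\<^sub>C ?B i)" and ?Z = "Sum_any (\<lambda>i. ?c i *\<^sub>C ?C i)"
  show ?thesis
  proof
    assume "jacobi_at u v w l m n"
    then have e: "?X = ?Y - ?Z" unfolding jacobi_at_def .
    show "\<forall>p. clinear_on (mcar A) p \<longrightarrow> ?J p"
    proof (intro allI impI)
      fix p :: "'u \<Rightarrow> complex" assume p: "clinear_on (mcar A) p"
      have "p (?Y - ?Z) = p ?Y - p ?Z" by (rule clinear_on_diff[OF p sub mem[OF B] mem[OF C]])
      then show "?J p"
        unfolding coeffs[OF p] e .
    qed
  next
    assume h: "\<forall>p. clinear_on (mcar A) p \<longrightarrow> ?J p"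
    have "?X - (?Y - ?Z) = 0"
    proof (rule ccontr)
      assume "?X - (?Y - ?Z) \<noteq> 0"
      then obtain p :: "'u \<Rightarrow> complex" where p: "clinear_on UNIV p" "p (?X - (?Y - ?Z)) \<noteq> 0" by (rule exists_functional)
      have "p ?X = p ?Y - p ?Z" using h coeffs[OF clinear_on_UNIV_subset[OF p(1)]] clinear_on_UNIV_subset[OF p(1)] by blast
      then show False using p clinear_on_diff[OF p(1), of ?X "?Y - ?Z"] clinear_on_diff[OF p(1), of ?Y ?Z] by simp
    qed
    then show "jacobi_at u v w l m n" unfolding jacobi_at_def by simp
  qed
qed

end

section \<open>From the Jacobi identity to associativity\<close>

context graded_space
begin

lemma pairing_add:
  assumes "p \<in> contragredient V W" "f \<in> formal_completion V W" "g \<in> formal_completion V W"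
  shows "pairing p (\<lambda>n. f n + g n) = pairing p f + pairing p g"
proof -
  have pl: "clinear_on (mcar W) p" and fin: "finite {n. \<exists>w\<in>wspace V W n. p w \<noteq> 0}"
    using assms(1) by (auto simp: contragredient_def)
  have "finite {n. p (h n) \<noteq> 0}" if "h \<in> formal_completion V W" for h
    by (rule finite_subset[OF _ fin]) (use that in \<open>auto simp: formal_completion_def\<close>)
  from Sum_any.distrib[OF this[OF assms(2)] this[OF assms(3)]]
  show ?thesis unfolding pairing_def
    using clinear_on_add[OF pl formal_completion_mcar[OF assms(2)] formal_completion_mcar[OF assms(3)]] by simp
qed

lemma has_weak_sum_add:
  assumes F: "has_weak_sum V W F S f" and G: "has_weak_sum V W G S g"
    and cF: "\<And>s. F s \<in> formal_completion V W" and cG: "\<And>s. G s \<in> formal_completion V W"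
  shows "has_weak_sum V W (\<lambda>s n. F s n + G s n) S (\<lambda>n. f n + g n)"
proof -
  have fg: "f \<in> formal_completion V W" "g \<in> formal_completion V W" using F G by (auto simp: has_weak_sum_def)
  then have "(\<lambda>n. f n + g n) \<in> formal_completion V W"
    using cvs.subspace_add[OF wspace_subspace] by (simp add: formal_completion_def)
  moreover have "((\<lambda>s. pairing p (\<lambda>n. F s n + G s n)) has_sum pairing p (\<lambda>n. f n + g n)) S" if p: "p \<in> contragredient V W" for p
    unfolding pairing_add[OF p fg] pairing_add[OF p cF cG]
    using F G p by (auto simp: has_weak_sum_def intro!: has_sum_add)
  moreover have "(\<lambda>s. norm (pairing p (\<lambda>n. F s n + G s n))) summable_on S" if p: "p \<in> contragredient V W" for p
  proof -
    have "(\<lambda>s. pairing p (\<lambda>n. F s n + G s n)) summable_on S"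
      by (rule has_sum_imp_summable[OF calculation(2)[OF p]])
    then show ?thesis by (simp only: summable_on_iff_abs_summable_on_complex)
  qed
  ultimately show ?thesis unfolding has_weak_sum_def by (intro conjI ballI)
qed

end

context mode_algebra
begin

lemma completion_eq_homogeneous:
  assumes f: "f \<in> formal_completion V A" and g: "g \<in> formal_completion V A"
    and eq: "\<And>(p :: 'u \<Rightarrow> complex) e. clinear_on (mcar A) p \<Longrightarrow> p (f (of_int e)) = p (g (of_int e))"
  shows "f = g"
proof
  fix n
  show "f n = g n"
  proof (cases "n \<in> \<int>")
    case True
    then obtain e where e: "n = of_int e" by (auto elim: Ints_cases)
    show ?thesis
    proof (rule ccontr)
      assume "f n \<noteq> g n"
      then have "f n - g n \<noteq> 0" by simp
      then obtain p :: "'u \<Rightarrow> complex" where p: "clinear_on UNIV p" "p (f n - g n) \<noteq> 0" by (rule exists_functional)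
      then show False using eq[OF clinear_on_UNIV_subset[OF p(1)], of e] clinear_on_diff[OF p(1), of "f n" "g n"] e by simp
    qed
  next
    case False
    then have "wspace V A n = {0}" using integral by blast
    moreover have "f n \<in> wspace V A n" "g n \<in> wspace V A n" using f g by (simp_all add: formal_completion_def)
    ultimately show ?thesis by simp
  qed
qed

text \<open>On homogeneous vectors this is \<open>associativity_of_jacobi\<close> at \<open>t = z1 / z2\<close>. Both sides are additive in each
  argument, and homogeneous vectors span.\<close>

theorem product_eq_iterate_of_jacobi:
  assumes J: "\<And>u v w a b c l m n. u \<in> W a \<Longrightarrow> v \<in> W b \<Longrightarrow> w \<in> W c \<Longrightarrow> jacobi_at u v w l m n"
    and z: "z1 > z2" "z2 > z1 - z2" "z1 - z2 > 0"
    and uvw: "u \<in> mcar A" "v \<in> mcar A" "w \<in> mcar A"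
  shows "\<exists>f. has_weak_sum V A (\<lambda>n. I (complex_of_real z1) u (I (complex_of_real z2) v w n)) UNIV f \<and>
             has_weak_sum V A (\<lambda>n. I (complex_of_real z2) (I (complex_of_real z1 - complex_of_real z2) u v n) w) UNIV f"
proof -
  let ?x = "complex_of_real z1" and ?y = "complex_of_real z2"
  have zn: "?x \<noteq> 0" "?y \<noteq> 0" "?x - ?y \<noteq> 0" "cmod ?x > cmod ?y" "cmod ?y > cmod (?x - ?y)"
    using z by (auto simp del: of_real_diff simp add: of_real_diff[symmetric])
  let ?F = "\<lambda>u v w. has_weak_sum V A (\<lambda>n. I ?x u (I ?y v w n)) UNIV" and ?G = "\<lambda>u v w. has_weak_sum V A (\<lambda>n. I ?y (I (?x - ?y) u v n) w) UNIV"
  let ?P = "\<lambda>u v w. \<exists>f. ?F u v w f \<and> ?G u v w f"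
  have homg: "?P u v w" if u: "u \<in> W a" and v: "v \<in> W b" and w: "w \<in> W c" for u v w a b c
  proof -
    note m = W_mcar[OF u] W_mcar[OF v] W_mcar[OF w]
    obtain f where f: "?F u v w f"
      using product_converges[OF m zn(4,2)] by blast
    obtain g where g: "?G u v w g"
      using iterate_converges[OF m zn(5,3)] by blast
    have "f = g"
    proof (rule completion_eq_homogeneous)
      show "f \<in> formal_completion V A" "g \<in> formal_completion V A" using f g by (auto simp: has_weak_sum_def)
      fix p :: "'u \<Rightarrow> complex" and e :: int assume p: "clinear_on (mcar A) p"
      define K where K: "K = a + b + c - 2 - e"
      have t: "Re (?x / ?y) > 1" "norm (?x / ?y - 1) < 1"
      proof -
        show "Re (?x / ?y) > 1" using z by (simp flip: of_real_divide)
        have "?x / ?y - 1 = (?x - ?y) / ?y" using zn(2) by (simp add: diff_divide_distrib)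
        then show "norm (?x / ?y - 1) < 1" using zn by (simp add: norm_divide divide_less_eq)
      qed
      obtain M where M: "\<And>m. m \<ge> M \<Longrightarrow> cseq p K u v w m = 0" using cseq_bdd[OF p u v w K] by auto
      have jc: "jacobi_coeffs (aseq p K u v w) (bseq p K u v w) (cseq p K u v w) l m" for l m
        using J[OF u v w, of l m "K - l - m"] p unfolding jacobi_at_iff[OF u v w] by (auto simp add: algebra_simps)
      have "lsum (inf_coeffs (aseq p K u v w)) (1 / (?x / ?y)) = lsum (zero_coeffs (bseq p K u v w)) (?x / ?y - 1)"
        by (rule associativity_of_jacobi[OF aseq_lconv[OF p u v w K] bseq_lconv[OF p u v w K] M jc t])
      moreover have "?x / ?y - 1 = (?x - ?y) / ?y" using zn(2) by (simp add: diff_divide_distrib)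
      ultimately show "p (f (of_int e)) = p (g (of_int e))"
        using product_value[OF p u v w K f zn(2,4)] iterate_value[OF p u v w K g zn(3,5)] by simp
    qed
    then show ?thesis using f g by blast
  qed
  have add: "?P U V' W'" if P: "?P u v w" "?P u' v' w'"
    and m: "u \<in> mcar A" "v \<in> mcar A" "w \<in> mcar A" "u' \<in> mcar A" "v' \<in> mcar A" "w' \<in> mcar A"
    and F: "\<And>n k. I ?x U (I ?y V' W' n) k = I ?x u (I ?y v w n) k + I ?x u' (I ?y v' w' n) k"
    and G: "\<And>n k. I ?y (I (?x - ?y) U V' n) W' k = I ?y (I (?x - ?y) u v n) w k + I ?y (I (?x - ?y) u' v' n) w' k"
    for u v w u' v' w' U V' W'
  proof -
    obtain f f' where f: "?F u v w f" "?G u v w f" and f': "?F u' v' w' f'" "?G u' v' w' f'" using P by blast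
    have "(\<lambda>n. I ?x U (I ?y V' W' n)) = (\<lambda>n k. I ?x u (I ?y v w n) k + I ?x u' (I ?y v' w' n) k)"
      "(\<lambda>n. I ?y (I (?x - ?y) U V' n) W') = (\<lambda>n k. I ?y (I (?x - ?y) u v n) w k + I ?y (I (?x - ?y) u' v' n) w' k)"
      using F G by (simp_all add: fun_eq_iff)
    then show ?thesis
      using has_weak_sum_add[OF f(1) f'(1)] has_weak_sum_add[OF f(2) f'(2)] m
      by (intro exI[of _ "\<lambda>n. f n + f' n"]) (simp add: I_completion I_mcar)
  qed
  note l1 = clinear_on_add[OF I_lin1] and l2 = clinear_on_add[OF I_lin2]
  have addu: "?P (u + u') v w" if P: "?P u v w" "?P u' v w" and m: "u \<in> mcar A" "u' \<in> mcar A" "v \<in> mcar A" "w \<in> mcar A" for u u' v w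
    by (rule add[OF P m(1,3,4,2,3,4)]) (simp_all only: l1 I_mcar m)
  have addv: "?P u (v + v') w" if P: "?P u v w" "?P u v' w" and m: "v \<in> mcar A" "v' \<in> mcar A" "u \<in> mcar A" "w \<in> mcar A" for u v v' w
    by (rule add[OF P m(3,1,4,3,2,4)]) (simp_all only: l1 l2 I_mcar m)
  have addw: "?P u v (w + w')" if P: "?P u v w" "?P u v w'" and m: "w \<in> mcar A" "w' \<in> mcar A" "u \<in> mcar A" "v \<in> mcar A" for u v w w'
    by (rule add[OF P m(3,4,1,3,4,2)]) (simp_all only: l2 I_mcar m)
  have hw: "?P u v w" if u: "u \<in> W a" and v: "v \<in> W b" and w: "w \<in> mcar A" for u v w a b
    using w
  proof (induction rule: homogeneous_int_induct)
    case (hom k x)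
    show ?case by (rule homg[OF u v hom])
  next
    case (add x y)
    show ?case by (rule addw[OF add.IH add.hyps W_mcar[OF u] W_mcar[OF v]])
  qed
  have hv: "?P u v w" if u: "u \<in> W a" and v: "v \<in> mcar A" and w: "w \<in> mcar A" for u v w a
    using v
  proof (induction rule: homogeneous_int_induct)
    case (hom k x)
    show ?case by (rule hw[OF u hom w])
  next
    case (add x y)
    show ?case by (rule addv[OF add.IH add.hyps W_mcar[OF u] w])
  qed
  show ?thesis
    using uvw(1)
  proof (induction rule: homogeneous_int_induct)
    case (hom k x)
    show ?case by (rule hv[OF hom uvw(2,3)])
  next
    case (add x y)
    show ?case by (rule addu[OF add.IH add.hyps uvw(2,3)])
  qed
qed

end

section \<open>From associativity to the Jacobi identity\<close>

lemma has_sum_finite_sum: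
  fixes f :: "'k \<Rightarrow> 'x \<Rightarrow> complex"
  assumes "finite K" "\<And>k. k \<in> K \<Longrightarrow> (f k has_sum s k) A"
  shows "((\<lambda>x. \<Sum>k\<in>K. f k x) has_sum (\<Sum>k\<in>K. s k)) A"
  using assms by (induction K rule: finite_induct) (auto intro!: has_sum_add)

text \<open>The coefficient of degree \<open>n\<close> in \<open>e^(d x) e^(- d x) = 1\<close>.\<close>

lemma exp_product_zero:
  fixes d :: complex
  shows "(\<Sum>k\<le>n. (d ^ k / fact k) * ((- d) ^ (n - k) / fact (n - k))) = (if n = 0 then 1 else 0)"
proof -
  have "(\<Sum>k\<le>n. (d ^ k / fact k) * ((- d) ^ (n - k) / fact (n - k))) = (\<Sum>k\<le>n. (of_nat (n choose k) * d ^ k * (- d) ^ (n - k)) / fact n)"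
  proof (rule sum.cong)
    fix k assume "k \<in> {..n}"
    then have "(of_nat (n choose k) :: complex) = fact n / (fact k * fact (n - k))" by (simp add: binomial_fact)
    then show "(d ^ k / fact k) * ((- d) ^ (n - k) / fact (n - k)) = (of_nat (n choose k) * d ^ k * (- d) ^ (n - k)) / fact n" by simp
  qed simp
  also have "\<dots> = (d + - d) ^ n / fact n" unfolding binomial_ring sum_divide_distrib ..
  also have "\<dots> = (if n = 0 then 1 else 0)" by simp
  finally show ?thesis .
qed

lemma has_sum_nat_shift:
  fixes f :: "nat \<Rightarrow> complex"
  assumes "(f has_sum S) UNIV"
  shows "((\<lambda>r. if s \<le> r then f (r - s) else 0) has_sum S) UNIV"
proof -
  have "((\<lambda>r. if s \<le> r then f (r - s) else 0) has_sum S) UNIV \<longleftrightarrow> ((\<lambda>r. if s \<le> r then f (r - s) else 0) has_sum S) (range (\<lambda>q. q + s))"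
  proof (rule has_sum_cong_neutral)
    fix r assume r: "r \<in> UNIV - range (\<lambda>q. q + s)"
    have "\<not> s \<le> r"
    proof
      assume "s \<le> r"
      then have "r = (r - s) + s" by simp
      then show False using r by blast
    qed
    then show "(if s \<le> r then f (r - s) else 0) = 0" by simp
  qed auto
  also have "\<dots> \<longleftrightarrow> (((\<lambda>r. if s \<le> r then f (r - s) else 0) \<circ> (\<lambda>q. q + s)) has_sum S) UNIV"
    by (rule has_sum_reindex) (auto simp: inj_on_def)
  finally show ?thesis using assms by (simp add: o_def)
qed

lemma skew_op_cmodes:
  fixes V :: "'u::complex_vector voa"
  shows "skew_op V A (cmodes y) u (of_int j) v = - ((-1) powi j *\<^sub>C Sum_any (\<lambda>i::nat. dexp V A (-1) i (y v (j + int i) u)))"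
proof -
  have ph: "exp ((- of_int j - 1) * (\<i> * pi)) = - ((-1) powi j)"
  proof -
    have "exp ((- (0 + of_int j) - 1) * (\<i> * pi)) = (-1) powi j * exp ((- 0 - 1) * (\<i> * pi))" by (rule skew_phase)
    moreover have "exp ((- 0 - 1) * (\<i> * pi)) = -1" using exp_pi_i' by (simp add: exp_minus mult.commute)
    ultimately show ?thesis by simp
  qed
  have "of_int j + of_nat i = (of_int (j + int i) :: complex)" for i by simp
  then show ?thesis unfolding skew_op_def ph by (simp only: cmodes_of_int cvs.scale_minus_left)
qed

text \<open>A commutative multiplication that is associative at a single pair of points, with a vector \<open>one\<close> that creates
  \<open>e^(x L(-1)) w\<close> from \<open>w\<close>.\<close>

locale associative_mode_algebra = mode_algebra V A y
  for V :: "'u::complex_vector voa" and A :: "'u vmod" and y :: "'u \<Rightarrow> int \<Rightarrow> 'u \<Rightarrow> 'u" +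
  fixes one :: 'u and z1 z2 :: real
  assumes z: "z1 > z2" "z2 > z1 - z2" "z1 - z2 > 0"
    and one: "one \<in> W 0"
    and creation_neg: "w \<in> mcar A \<Longrightarrow> y w (- int r - 1) one = dexp V A 1 r w"
    and skew: "u \<in> mcar A \<Longrightarrow> v \<in> mcar A \<Longrightarrow> cmodes y u n v = skew_op V A (cmodes y) u n v"
    and assoc: "u \<in> mcar A \<Longrightarrow> v \<in> mcar A \<Longrightarrow> w \<in> mcar A \<Longrightarrow>
      \<exists>f. has_weak_sum V A (\<lambda>n. I (complex_of_real z1) u (I (complex_of_real z2) v w n)) UNIV f \<and>
          has_weak_sum V A (\<lambda>n. I (complex_of_real z2) (I (complex_of_real z1 - complex_of_real z2) u v n) w) UNIV f"
begin

lemma skew_modes: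
  assumes u: "u \<in> mcar A" and v: "v \<in> mcar A"
  shows "y v j u = - ((-1) powi j *\<^sub>C Sum_any (\<lambda>i::nat. dx (-1) i (y u (j + int i) v)))"
  using skew[OF v u, of "of_int j"] unfolding skew_op_cmodes cmodes_of_int .

context
  fixes p :: "'u \<Rightarrow> complex" and a b c e K :: int and u v w
  assumes p: "clinear_on (mcar A) p" and u: "u \<in> W a" and v: "v \<in> W b" and w: "w \<in> W c"
    and K: "K = a + b + c - 2 - e"
begin

lemma D_iter: "(D ^^ n) u \<in> W (a + int n)"
proof (induction n)
  case (Suc n)
  have "of_int (a + int n) + 1 = (of_int (a + int (Suc n)) :: complex)" by simp
  then show ?case using Lop_weight[OF mA Suc] by (simp only: funpow.simps o_apply)
qed (simp add: u)

text \<open>Associativity is applied to all \<open>L(-1)^n u\<close>; the \<open>L(-1)\<close>-derivative property makes the corresponding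
  sequences those of the derivatives.\<close>

lemma product_eq_iterate_half_disc:
  assumes t: "Re t > 1" "norm (t - 1) < 1"
  shows "lsum (inf_coeffs (aseq p K u v w)) (1 / t) = lsum (zero_coeffs (bseq p K u v w)) (t - 1)"
proof -
  let ?x = "complex_of_real z1" and ?y = "complex_of_real z2"
  let ?u = "\<lambda>n. (D ^^ n) u"
  have zn: "?y \<noteq> 0" "?x - ?y \<noteq> 0" "cmod ?x > cmod ?y" "cmod ?y > cmod (?x - ?y)"
    using z by (auto simp del: of_real_diff simp add: of_real_diff[symmetric])
  have Kn: "K + int n = (a + int n) + b + c - 2 - e" for n by (simp add: K)
  have um: "?u n \<in> mcar A" for n by (rule W_mcar[OF D_iter])
  note vm = W_mcar[OF v] and wm = W_mcar[OF w]
  have q: "?x / ?y - 1 = (?x - ?y) / ?y" using zn(1) by (simp add: diff_divide_distrib)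
  have "lsum (inf_coeffs ((\<lambda>n. aseq p (K + int n) (?u n) v w) 0)) (1 / t) = lsum (zero_coeffs ((\<lambda>n. bseq p (K + int n) (?u n) v w) 0)) (t - 1)"
  proof (rule associativity_propagates[where ?t0.0 = "?x / ?y", OF _ _ _ _ _ _ _ t])
    fix n
    show "lconv (inf_coeffs (aseq p (K + int n) (?u n) v w)) 1" by (rule aseq_lconv[OF p D_iter v w Kn])
    show "lconv (zero_coeffs (bseq p (K + int n) (?u n) v w)) 1" by (rule bseq_lconv[OF p D_iter v w Kn])
    show "aseq p (K + int (Suc n)) (?u (Suc n)) v w m = - of_int m * aseq p (K + int n) (?u n) v w (m - 1)" for m
    proof -
      have i: "K + int (Suc n) - m = K + int n - (m - 1)" by simp
      have x: "y v (K + int n - (m - 1)) w \<in> mcar A" by (rule y_closed[OF vm wm])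
      have yx: "y (?u n) (m - 1) (y v (K + int n - (m - 1)) w) \<in> mcar A" by (rule y_closed[OF um x])
      show ?thesis unfolding aseq_def i funpow.simps o_apply y_D_left[OF um x]
        using clinear_on_minus[OF p cvs.subspace_scale[OF sub yx]] clinear_on_scale[OF p yx] by (simp add: scaleC_complex_def)
    qed
    show "bseq p (K + int (Suc n)) (?u (Suc n)) v w m = - of_int m * bseq p (K + int n) (?u n) v w (m - 1)" for m
    proof -
      have i: "K + int (Suc n) - m = K + int n - (m - 1)" by simp
      have x: "y (?u n) (m - 1) v \<in> mcar A" by (rule y_closed[OF um vm])
      have sx: "of_int m *\<^sub>C y (?u n) (m - 1) v \<in> mcar A" by (rule cvs.subspace_scale[OF sub x])
      have yx: "y (y (?u n) (m - 1) v) (K + int n - (m - 1)) w \<in> mcar A" by (rule y_closed[OF x wm])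
      have "y (- (of_int m *\<^sub>C y (?u n) (m - 1) v)) (K + int n - (m - 1)) w = - (of_int m *\<^sub>C y (y (?u n) (m - 1) v) (K + int n - (m - 1)) w)"
        using clinear_on_minus[OF y_lin1[OF wm] sx] clinear_on_scale[OF y_lin1[OF wm] x] by simp
      then show ?thesis unfolding bseq_def i funpow.simps o_apply y_D_left[OF um vm]
        using clinear_on_minus[OF p cvs.subspace_scale[OF sub yx]] clinear_on_scale[OF p yx] by (simp add: scaleC_complex_def)
    qed
    show "lsum (inf_coeffs (aseq p (K + int n) (?u n) v w)) (1 / (?x / ?y)) = lsum (zero_coeffs (bseq p (K + int n) (?u n) v w)) (?x / ?y - 1)"
    proof -
      obtain f where f: "has_weak_sum V A (\<lambda>k. I ?x (?u n) (I ?y v w k)) UNIV f"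
        "has_weak_sum V A (\<lambda>k. I ?y (I (?x - ?y) (?u n) v k) w) UNIV f"
        using assoc[OF um vm wm] by blast
      have "?y powi (- (K + int n) - 2) * lsum (inf_coeffs (aseq p (K + int n) (?u n) v w)) (1 / (?x / ?y)) =
        ?y powi (- (K + int n) - 2) * lsum (zero_coeffs (bseq p (K + int n) (?u n) v w)) ((?x - ?y) / ?y)"
        by (rule trans[OF product_value[OF p D_iter v w Kn f(1) zn(1,3), symmetric] iterate_value[OF p D_iter v w Kn f(2) zn(2,4)]])
      then show ?thesis unfolding q using zn(1) by (metis mult_left_cancel power_int_not_zero)
    qed
  next
    show "Re (?x / ?y) > 1" using z by (simp flip: of_real_divide)
    show "norm (?x / ?y - 1) < 1" unfolding q using zn by (simp add: norm_divide divide_less_eq)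
  qed
  then show ?thesis by simp
qed

lemma bseq_skew:
  "bseq p K v u w j = - ((-1) powi j * Sum_any (\<lambda>i::nat. (of_int (K - j) gchoose i) * bseq p K u v w (j + int i)))"
proof -
  note um = W_mcar[OF u] and vm = W_mcar[OF v] and wm = W_mcar[OF w]
  let ?x = "\<lambda>i::nat. dx (-1) i (y u (j + int i) v)"
  have xm: "?x i \<in> mcar A" for i by (intro dexp_closed[OF mA] y_closed um vm)
  obtain N where N: "\<forall>n\<ge>N. y u n v = 0" using y_trunc[OF um vm] by blast
  have xf: "finite {i. ?x i \<noteq> 0}"
    by (rule finite_nat_support[of "nat (N - j)"]) (use N in \<open>auto simp: dexp_zero[OF mA]\<close>)
  have sm: "Sum_any ?x \<in> mcar A" by (rule subspace_Sum_any[OF sub xm])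
  let ?q = "\<lambda>x. p (y x (K - j) w)"
  have ql: "clinear_on (mcar A) ?q"
    by (rule clinear_on_compose[OF y_lin1[OF wm] p]) (auto intro: y_closed wm)
  have "bseq p K v u w j = - ((-1) powi j * ?q (Sum_any ?x))"
    unfolding bseq_def skew_modes[OF um vm]
    using clinear_on_minus[OF ql cvs.subspace_scale[OF sub sm]] clinear_on_scale[OF ql sm] by (simp add: scaleC_complex_def)
  also have "?q (Sum_any ?x) = Sum_any (\<lambda>i. ?q (?x i))" by (rule clinear_on_Sum_any[OF ql sub xm xf])
  also have "(\<lambda>i. ?q (?x i)) = (\<lambda>i. (of_int (K - j) gchoose i) * bseq p K u v w (j + int i))"
  proof
    fix i
    have "y (?x i) (K - j) w = (of_int (K - j) gchoose i) *\<^sub>C y (y u (j + int i) v) (K - j - int i) w"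
      using y_dexp_left[OF y_closed[OF um vm] wm, of "-1" i "j + int i" "K - j"] by simp
    moreover have "K - j - int i = K - (j + int i)" by simp
    ultimately show "?q (?x i) = (of_int (K - j) gchoose i) * bseq p K u v w (j + int i)"
      using clinear_on_scale[OF p y_closed[OF y_closed[OF um vm] wm]] by (simp add: bseq_def scaleC_complex_def)
  qed
  finally show ?thesis .
qed

lemma cseq_lconv: "lconv (zero_coeffs (cseq p K u v w)) 1"
proof -
  have K': "K = b + a + c - 2 - e" by (simp add: K)
  have "zero_coeffs (cseq p K u v w) = (\<lambda>k. inf_coeffs (aseq p K v u w) (k + (K + 2)))"
    unfolding cseq_aseq by (simp add: algebra_simps)
  then show ?thesis using lsum_shift(1)[OF aseq_lconv[OF p v u w K'], of "K + 2"] by simp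
qed

end

text \<open>From here on the third vector is moved from \<open>0\<close> to \<open>-d\<close>. The condition \<open>|d| < |1 - d|\<close> is the ordering of the last two
  points \<open>1 - d\<close> and \<open>-d\<close>.\<close>

context
  fixes p :: "'u \<Rightarrow> complex" and a b c e K :: int and u v w and d :: complex
  assumes p: "clinear_on (mcar A) p" and u: "u \<in> W a" and v: "v \<in> W b" and w: "w \<in> W c"
    and K: "K = a + b + c - 2 - e"
    and d: "d \<noteq> 0" "norm d < norm (1 - d)"
begin

text \<open>The weight \<open>n\<close> component of \<open>e^(-d L(-1)) Y(v, 1) w\<close>. It equals that of \<open>Y(v, 1 - d) e^(-d L(-1)) w\<close>, but is a finite
  sum.\<close>

definition shifted :: "int \<Rightarrow> 'u" where
  "shifted n = Sum_any (\<lambda>r::nat. dx (- d) r (y v (b + c - 1 - n + int r) w))"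

lemma mem: "u \<in> mcar A" "v \<in> mcar A" "w \<in> mcar A" using u v w W_mcar by auto

lemma shifted_support: "\<exists>N::nat. \<forall>r\<ge>N. y v (k + int r) w = 0"
proof -
  obtain N where "\<forall>n\<ge>N. y v n w = 0" using y_trunc[OF mem(2,3)] by blast
  then show ?thesis by (intro exI[of _ "nat (N - k)"]) auto
qed

lemma shifted_mem: "shifted n \<in> mcar A"
  unfolding shifted_def by (intro subspace_Sum_any[OF sub] dexp_closed[OF mA] y_closed mem)

lemma shifted_W: "shifted n \<in> W n"
  unfolding shifted_def
proof (rule subspace_Sum_any[OF wspace_subspace])
  fix r
  have "of_int (b + c - (b + c - 1 - n + int r) - 1) + of_nat r = (of_int n :: complex)" by simp
  then show "dx (- d) r (y v (b + c - 1 - n + int r) w) \<in> W n"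
    using dexp_weight[OF mA y_weight[OF v w, of "b + c - 1 - n + int r"], of "- d" r] by (simp only:)
qed

text \<open>The formal identity \<open>Y(v, 1 - d) e^(-d L(-1)) = e^(-d L(-1)) Y(v, 1)\<close> becomes convergent: after commuting,
  each power of \<open>L(-1)\<close> collects a binomial series in \<open>d / (1 - d)\<close> that sums to \<open>1\<close>.\<close>

lemma translated_mode_has_sum:
  assumes \<phi>: "clinear_on (mcar A) \<phi>"
  shows "((\<lambda>r::nat. (1 - d) powi (n - b - c - int r) * \<phi> (y v (b + c - 1 - n + int r) (dx (- d) r w))) has_sum \<phi> (shifted n)) UNIV"
proof -
  define j where "j = b + c - 1 - n"
  have d1: "1 - d \<noteq> 0" using d by auto
  obtain S :: nat where S: "\<And>s. s \<ge> S \<Longrightarrow> y v (j + int s) w = 0" using shifted_support[of j] by blast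
  define H where "H = (\<lambda>s. dx (- d) s (y v (j + int s) w))"
  define co where "co = (\<lambda>s q::nat. (1 - d) powi (- (j + int s + int q) - 1) * ((- d) ^ q * (of_int (j + int s + int q) gchoose q)))"
  have Hm: "H s \<in> mcar A" for s unfolding H_def by (intro dexp_closed[OF mA] y_closed mem)
  have H0: "H s = 0" if "s \<ge> S" for s unfolding H_def using S[OF that] by (simp add: dexp_zero[OF mA])
  have sh: "\<phi> (shifted n) = (\<Sum>s<S. \<phi> (H s))"
  proof -
    have "shifted n = (\<Sum>s<S. H s)" unfolding shifted_def H_def j_def[symmetric]
      by (rule Sum_any_nat) (simp add: S dexp_zero[OF mA])
    then show ?thesis using clinear_on_sum[OF \<phi> sub Hm] by simp
  qed
  have term_eq: "(1 - d) powi (n - b - c - int r) * \<phi> (y v (b + c - 1 - n + int r) (dx (- d) r w)) =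
      (\<Sum>s<S. (if s \<le> r then co s (r - s) else 0) * \<phi> (H s))" for r
  proof -
    have i: "n - b - c - int r = - (j + int r) - 1" "b + c - 1 - n + int r = j + int r" by (simp_all add: j_def)
    have cm: "dx (- d) (r - q) (y v (j + int r - int q) w) \<in> mcar A" for q by (intro dexp_closed[OF mA] y_closed mem)
    have "\<phi> (y v (j + int r) (dx (- d) r w)) = (\<Sum>q\<le>r. ((- d) ^ q * (of_int (j + int r) gchoose q)) * \<phi> (dx (- d) (r - q) (y v (j + int r - int q) w)))"
      unfolding y_dexp_right[OF mem(2,3)]
      by (subst clinear_on_sum[OF \<phi> sub]) (auto intro: cvs.subspace_scale[OF sub cm] simp: clinear_on_scale[OF \<phi> cm] scaleC_complex_def)
    also have "\<dots> = (\<Sum>s\<le>r. ((- d) ^ (r - s) * (of_int (j + int r) gchoose (r - s))) * \<phi> (H s))"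
    proof (rule sum.reindex_bij_witness[of _ "\<lambda>s. r - s" "\<lambda>q. r - q"])
      fix q assume q: "q \<in> {..r}"
      have "j + int (r - q) = j + int r - int q" using q by (simp add: of_nat_diff)
      then show "((- d) ^ (r - (r - q)) * (of_int (j + int r) gchoose (r - (r - q)))) * \<phi> (H (r - q)) =
          ((- d) ^ q * (of_int (j + int r) gchoose q)) * \<phi> (dx (- d) (r - q) (y v (j + int r - int q) w))"
        using q unfolding H_def by (simp only: atMost_iff diff_diff_cancel)
    qed auto
    finally have "(1 - d) powi (n - b - c - int r) * \<phi> (y v (b + c - 1 - n + int r) (dx (- d) r w)) =
        (\<Sum>s\<le>r. ((1 - d) powi (- (j + int r) - 1) * ((- d) ^ (r - s) * (of_int (j + int r) gchoose (r - s)))) * \<phi> (H s))"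
      unfolding i by (simp only: sum_distrib_left mult.assoc)
    also have "\<dots> = (\<Sum>s\<le>r. co s (r - s) * \<phi> (H s))"
    proof (rule sum.cong)
      fix s assume "s \<in> {..r}"
      then have "j + int s + int (r - s) = j + int r" by (simp add: of_nat_diff)
      then show "((1 - d) powi (- (j + int r) - 1) * ((- d) ^ (r - s) * (of_int (j + int r) gchoose (r - s)))) * \<phi> (H s) = co s (r - s) * \<phi> (H s)"
        unfolding co_def by simp
    qed simp
    also have "\<dots> = (\<Sum>s<S + Suc r. (if s \<le> r then co s (r - s) else 0) * \<phi> (H s))"
      by (rule sum.mono_neutral_cong_left) auto
    also have "\<dots> = (\<Sum>s<S. (if s \<le> r then co s (r - s) else 0) * \<phi> (H s))"
      by (rule sum.mono_neutral_right) (auto simp: H0 clinear_on_0[OF \<phi> sub])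
    finally show ?thesis .
  qed
  have one_sum: "(co s has_sum 1) UNIV" for s
  proof -
    define M where "M = j + int s"
    define \<zeta> where "\<zeta> = d / (1 - d)"
    have nz: "norm \<zeta> < 1" unfolding \<zeta>_def using d by (simp add: norm_divide divide_less_eq)
    have z1: "1 + \<zeta> = 1 / (1 - d)" unfolding \<zeta>_def using d1 by (simp add: field_simps)
    have "((\<lambda>q. (of_int (- M - 1) gchoose q) * \<zeta> ^ q) has_sum (1 + \<zeta>) powi (- M - 1)) UNIV"
      by (rule binomial_series_has_sum[OF nz])
    from has_sum_cmult_right[OF this, of "(1 - d) powi (- M - 1)"]
    have "((\<lambda>q. (1 - d) powi (- M - 1) * ((of_int (- M - 1) gchoose q) * \<zeta> ^ q)) has_sum (1 - d) powi (- M - 1) * (1 + \<zeta>) powi (- M - 1)) UNIV" .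
    moreover have "(1 - d) powi (- M - 1) * (1 + \<zeta>) powi (- M - 1) = 1"
      unfolding z1 using d1 by (simp flip: power_int_mult_distrib)
    moreover have "(1 - d) powi (- M - 1) * ((of_int (- M - 1) gchoose q) * \<zeta> ^ q) = co s q" for q
    proof -
      have g: "(of_int (- M - 1) gchoose q) = (-1) ^ q * ((of_int (M + int q) :: complex) gchoose q)"
        using gbinomial_shift_negate[of q "M + int q + 1"] by simp
      have "(1 - d) powi (- (M + int q) - 1) = (1 - d) powi (- M - 1) * (1 / (1 - d)) ^ q"
      proof -
        have "- (M + int q) - 1 = (- M - 1) + (- int q)" by simp
        then have "(1 - d) powi (- (M + int q) - 1) = (1 - d) powi (- M - 1) * (1 - d) powi (- int q)"
          using power_int_add[of "1 - d" "- M - 1" "- int q"] d1 by (simp only: not_False_eq_True simp_thms)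
        then show ?thesis by (simp only: power_int_minus power_int_of_nat power_one_over divide_inverse mult_1_left power_inverse)
      qed
      then show ?thesis unfolding co_def M_def[symmetric] g \<zeta>_def
        by (simp add: power_mult_distrib power_one_over divide_inverse power_minus[of d] mult_ac)
    qed
    ultimately show ?thesis by simp
  qed
  have "((\<lambda>r. \<Sum>s<S. (if s \<le> r then co s (r - s) else 0) * \<phi> (H s)) has_sum (\<Sum>s<S. 1 * \<phi> (H s))) UNIV"
    by (intro has_sum_finite_sum finite_lessThan has_sum_cmult_left has_sum_nat_shift one_sum)
  then show ?thesis unfolding term_eq sh by simp
qed

text \<open>The modes of the product expanded in powers of \<open>t - d\<close>, on the right, are matrix coefficients of \<open>u\<close> acting on
  shifted vectors, followed by \<open>e^(d L(-1))\<close> that undoes the shift.\<close>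

lemma translated_expansion:
  "Sum_any (\<lambda>k::nat. dx d k (y u j (shifted (e - int k - a + j + 1)))) =
   Sum_any (\<lambda>q::nat. ((- d) ^ q * (of_int j gchoose q)) *\<^sub>C y u (j - int q) (y v (K - (j - int q)) w))"
proof -
  obtain N :: nat where N: "\<And>r. r \<ge> N \<Longrightarrow> y v (K - j + int r) w = 0" using shifted_support[of "K - j"] by blast
  let ?c = "\<lambda>q. (- d) ^ q * (of_int j gchoose q)"
  define X where "X = (\<lambda>q m::nat. y u (j - int q) (y v (K - j + int (q + m)) w))"
  have Xm: "X q m \<in> mcar A" for q m unfolding X_def by (intro y_closed mem)
  have X0: "X q m = 0" if "q + m \<ge> N" for q m unfolding X_def using N[OF that] by (simp add: y_02[OF mem(1)])
  have dz: "dx s k 0 = 0" for s k by (rule dexp_zero[OF mA])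
  have sh: "shifted (e - int k - a + j + 1) = (\<Sum>r<N. dx (- d) r (y v (K - j + int (k + r)) w))" for k
  proof -
    have "b + c - 1 - (e - int k - a + j + 1) + int r = K - j + int (k + r)" for r by (simp add: K)
    then show ?thesis unfolding shifted_def by (simp only:) (rule Sum_any_nat, simp only: N trans_le_add2 dz)
  qed
  have inner: "y u j (shifted (e - int k - a + j + 1)) = (\<Sum>q<N. \<Sum>s<N. ?c q *\<^sub>C dx (- d) s (X q (k + s)))" for k
  proof -
    have "y u j (shifted (e - int k - a + j + 1)) = (\<Sum>r<N. y u j (dx (- d) r (y v (K - j + int (k + r)) w)))"
      unfolding sh by (rule clinear_on_sum[OF y_lin2[OF mem(1)] sub]) (intro dexp_closed[OF mA] y_closed mem)
    also have "\<dots> = (\<Sum>r<N. \<Sum>q\<le>r. ?c q *\<^sub>C dx (- d) (r - q) (X q (k + (r - q))))"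
    proof (rule sum.cong)
      fix r
      have "y u j (dx (- d) r (y v (K - j + int (k + r)) w)) = (\<Sum>q\<le>r. ?c q *\<^sub>C dx (- d) (r - q) (y u (j - int q) (y v (K - j + int (k + r)) w)))"
        by (rule y_dexp_right[OF mem(1) y_closed[OF mem(2,3)]])
      also have "\<dots> = (\<Sum>q\<le>r. ?c q *\<^sub>C dx (- d) (r - q) (X q (k + (r - q))))"
      proof (rule sum.cong)
        fix q assume "q \<in> {..r}"
        then have "q + (k + (r - q)) = k + r" by simp
        then show "?c q *\<^sub>C dx (- d) (r - q) (y u (j - int q) (y v (K - j + int (k + r)) w)) = ?c q *\<^sub>C dx (- d) (r - q) (X q (k + (r - q)))"
          unfolding X_def by (simp only:)
      qed simp
      finally show "y u j (dx (- d) r (y v (K - j + int (k + r)) w)) = (\<Sum>q\<le>r. ?c q *\<^sub>C dx (- d) (r - q) (X q (k + (r - q))))" .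
    qed simp
    also have "\<dots> = (\<Sum>q<N. \<Sum>s<N. ?c q *\<^sub>C dx (- d) s (X q (k + s)))"
      by (rule sum_square_triangle[symmetric]) (simp add: X0 dz)
    finally show ?thesis .
  qed
  have cm: "dx (- d) s (X q m) \<in> mcar A" for s q m by (rule dexp_closed[OF mA Xm])
  have outer: "dx d k (y u j (shifted (e - int k - a + j + 1))) = (\<Sum>q<N. \<Sum>s<N. ?c q *\<^sub>C dx d k (dx (- d) s (X q (k + s))))" for k
  proof -
    have "dx d k (y u j (shifted (e - int k - a + j + 1))) = (\<Sum>q<N. dx d k (\<Sum>s<N. ?c q *\<^sub>C dx (- d) s (X q (k + s))))"
      unfolding inner
      by (rule clinear_on_sum[OF dexp_lin[OF mA] sub]) (intro cvs.subspace_sum[OF sub] cvs.subspace_scale[OF sub] cm)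
    also have "\<dots> = (\<Sum>q<N. \<Sum>s<N. dx d k (?c q *\<^sub>C dx (- d) s (X q (k + s))))"
      by (intro sum.cong refl clinear_on_sum[OF dexp_lin[OF mA] sub] cvs.subspace_scale[OF sub] cm)
    also have "\<dots> = (\<Sum>q<N. \<Sum>s<N. ?c q *\<^sub>C dx d k (dx (- d) s (X q (k + s))))"
      by (intro sum.cong refl clinear_on_scale[OF dexp_lin[OF mA] cm])
    finally show ?thesis .
  qed
  have "Sum_any (\<lambda>k::nat. dx d k (y u j (shifted (e - int k - a + j + 1)))) = (\<Sum>k<N. \<Sum>q<N. \<Sum>s<N. ?c q *\<^sub>C dx d k (dx (- d) s (X q (k + s))))"
    unfolding outer by (rule Sum_any_nat) (simp add: X0 dz)
  also have "\<dots> = (\<Sum>q<N. \<Sum>k<N. \<Sum>s<N. ?c q *\<^sub>C dx d k (dx (- d) s (X q (k + s))))" by (rule sum.swap)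
  also have "\<dots> = (\<Sum>q<N. ?c q *\<^sub>C X q 0)"
  proof (rule sum.cong)
    fix q assume q: "q \<in> {..<N}"
    have "(\<Sum>k<N. \<Sum>s<N. ?c q *\<^sub>C dx d k (dx (- d) s (X q (k + s)))) = (\<Sum>m<N. \<Sum>k\<le>m. ?c q *\<^sub>C dx d k (dx (- d) (m - k) (X q (k + (m - k)))))"
      by (rule sum_square_triangle) (simp add: X0 dz)
    also have "\<dots> = (\<Sum>m<N. ?c q *\<^sub>C ((if m = 0 then 1 else 0) *\<^sub>C (D ^^ m) (X q m)))"
    proof (rule sum.cong)
      fix m
      have "dx d k (dx (- d) (m - k) (X q (k + (m - k)))) = ((d ^ k / fact k) * ((- d) ^ (m - k) / fact (m - k))) *\<^sub>C (D ^^ m) (X q m)" if "k \<le> m" for k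
      proof -
        have "(D ^^ k) ((D ^^ (m - k)) (X q m)) = (D ^^ m) (X q m)"
          using that by (metis funpow_add comp_apply le_add_diff_inverse)
        then show ?thesis unfolding dexp_def
          using clinear_on_scale[OF Dpow_lin[OF mA] Dpow_closed[OF mA Xm]] that by simp
      qed
      then have "(\<Sum>k\<le>m. ?c q *\<^sub>C dx d k (dx (- d) (m - k) (X q (k + (m - k))))) =
          (\<Sum>k\<le>m. ?c q *\<^sub>C (((d ^ k / fact k) * ((- d) ^ (m - k) / fact (m - k))) *\<^sub>C (D ^^ m) (X q m)))"
        by (intro sum.cong) auto
      also have "\<dots> = ?c q *\<^sub>C ((\<Sum>k\<le>m. (d ^ k / fact k) * ((- d) ^ (m - k) / fact (m - k))) *\<^sub>C (D ^^ m) (X q m))"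
        by (simp only: cvs.scale_sum_left cvs.scale_sum_right)
      finally show "(\<Sum>k\<le>m. ?c q *\<^sub>C dx d k (dx (- d) (m - k) (X q (k + (m - k))))) = ?c q *\<^sub>C ((if m = 0 then 1 else 0) *\<^sub>C (D ^^ m) (X q m))"
        unfolding exp_product_zero .
    qed simp
    also have "\<dots> = (\<Sum>m\<in>{0}. ?c q *\<^sub>C ((if m = 0 then 1 else 0) *\<^sub>C (D ^^ m) (X q m)))"
      using q by (intro sum.mono_neutral_right) auto
    finally show "(\<Sum>k<N. \<Sum>s<N. ?c q *\<^sub>C dx d k (dx (- d) s (X q (k + s)))) = ?c q *\<^sub>C X q 0" by simp
  qed simp
  also have "\<dots> = Sum_any (\<lambda>q::nat. ?c q *\<^sub>C X q 0)"
    by (rule Sum_any_nat[symmetric]) (simp add: X0)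
  also have "(\<lambda>q::nat. ?c q *\<^sub>C X q 0) = (\<lambda>q. ?c q *\<^sub>C y u (j - int q) (y v (K - (j - int q)) w))"
    unfolding X_def by (simp add: algebra_simps)
  finally show ?thesis .
qed

text \<open>The fourfold product with \<open>one\<close> as last vector converges absolutely as a double series over the two
  intermediate weights. Summing over the inner weight first leaves the series in question.\<close>

lemma translated_summable:
  fixes Y :: complex
  assumes q: "clinear_on (mcar A) q" and Y: "norm Y > norm (1 - d)"
  shows "(\<lambda>j. q (y u j (shifted (e' - a + j + 1))) * Y powi (- j - 1)) summable_on UNIV"
proof -
  have Y0: "Y \<noteq> 0" using Y norm_ge_zero[of "1 - d"] by (auto simp del: norm_ge_zero)
  have d1: "1 - d \<noteq> 0" using d by auto
  have om: "one \<in> mcar A" using one W_mcar by blast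
  obtain f where f: "has_weak_sum V A (\<lambda>(m, n). I Y u (I (1 - d) v (I (- d) w one n) m)) UNIV f"
    using triple_product_converges[OF mem om Y, of "- d"] d by auto
  let ?P = "wfunctional (of_int e') q"
  have "(\<lambda>s. norm (pairing ?P (case s of (m, n) \<Rightarrow> I Y u (I (1 - d) v (I (- d) w one n) m)))) summable_on UNIV"
    using f wfunctional_contragredient[OF q] unfolding has_weak_sum_def by blast
  then have "(\<lambda>s. pairing ?P (case s of (m, n) \<Rightarrow> I Y u (I (1 - d) v (I (- d) w one n) m))) summable_on UNIV"
    by (simp only: summable_on_iff_abs_summable_on_complex)
  note all = this
  define h where "h = (\<lambda>(n, r). (complex_of_int n, complex_of_int (c + int r)))"
  have rh: "(\<lambda>s. pairing ?P (case s of (m, n) \<Rightarrow> I Y u (I (1 - d) v (I (- d) w one n) m))) summable_on (range h)"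
    by (rule summable_on_subset_banach[OF all subset_UNIV])
  have ih: "inj h" unfolding h_def by (auto simp: inj_on_def)
  have s: "(\<lambda>s. pairing ?P (case h s of (m, n) \<Rightarrow> I Y u (I (1 - d) v (I (- d) w one n) m))) summable_on UNIV"
    using rh unfolding summable_on_reindex[OF ih] o_def .
  let ?\<phi> = "\<lambda>n x. q (y u (a + n - e' - 1) x)"
  have \<phi>l: "clinear_on (mcar A) (?\<phi> n)" for n
    by (rule clinear_on_compose[OF y_lin2[OF mem(1)] q]) (auto intro: y_closed mem)
  have val: "pairing ?P (case h (n, r) of (m, n) \<Rightarrow> I Y u (I (1 - d) v (I (- d) w one n) m)) =
      Y powi (e' - a - n) * ((1 - d) powi (n - b - c - int r) * ?\<phi> n (y v (b + c - 1 - n + int r) (dx (- d) r w)))" for n r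
  proof -
    let ?w = "dx (- d) r w"
    have wW: "?w \<in> W (c + int r)"
      using dexp_weight[OF mA w, of "- d" r] by simp
    have 1: "I (- d) w one (of_int (c + int r)) = ?w"
    proof -
      have "c + int r - c - 0 = int r" "c + 0 - (c + int r) - 1 = - int r - 1" by simp_all
      then have "I (- d) w one (of_int (c + int r)) = (- d) powi int r *\<^sub>C y w (- int r - 1) one"
        using I_int[OF w one, of "- d" "c + int r"] d by (simp only: neg_equal_0_iff_equal not_False_eq_True)
      also have "\<dots> = ?w" unfolding creation_neg[OF mem(3)] dexp_def by simp
      finally show ?thesis .
    qed
    have 2: "I (1 - d) v ?w (of_int n) = (1 - d) powi (n - b - c - int r) *\<^sub>C y v (b + c - 1 - n + int r) ?w"
    proof -
      have "n - b - (c + int r) = n - b - c - int r" "b + (c + int r) - n - 1 = b + c - 1 - n + int r" by simp_all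
      then show ?thesis using I_int[OF v wW d1, of n] by (simp only:)
    qed
    let ?x = "y v (b + c - 1 - n + int r) ?w"
    have "b + (c + int r) - (b + c - 1 - n + int r) - 1 = n" by simp
    then have xW: "?x \<in> W n" using y_weight[OF v wW, of "b + c - 1 - n + int r"] by (simp only:)
    have 3: "I Y u ?x (of_int e') = Y powi (e' - a - n) *\<^sub>C y u (a + n - e' - 1) ?x"
      by (rule I_int[OF u xW Y0])
    have cl: "I Y u (I (1 - d) v ?w (of_int n)) (of_int e') = (1 - d) powi (n - b - c - int r) *\<^sub>C I Y u ?x (of_int e')"
      unfolding 2 by (rule clinear_on_scale[OF I_lin2[OF mem(1)] W_mcar[OF xW]])
    have ym: "y u (a + n - e' - 1) ?x \<in> mcar A" by (rule y_closed[OF mem(1) W_mcar[OF xW]])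
    have "pairing ?P (I Y u (I (1 - d) v ?w (of_int n))) = q (I Y u (I (1 - d) v ?w (of_int n)) (of_int e'))"
      by (rule pairing_wfunctional[OF q I_completion[OF mem(1) I_mcar[OF mem(2) W_mcar[OF wW]]]])
    also have "\<dots> = Y powi (e' - a - n) * ((1 - d) powi (n - b - c - int r) * ?\<phi> n ?x)"
      unfolding cl 3 using clinear_on_scale[OF q ym] by (simp add: scaleC_complex_def)
    finally show ?thesis unfolding h_def using 1 by simp
  qed
  have "(\<lambda>(n, r). Y powi (e' - a - n) * ((1 - d) powi (n - b - c - int r) * ?\<phi> n (y v (b + c - 1 - n + int r) (dx (- d) r w)))) summable_on (UNIV \<times> UNIV)"
  proof -
    have "(\<lambda>(n, r). pairing ?P (case h (n, r) of (m, n) \<Rightarrow> I Y u (I (1 - d) v (I (- d) w one n) m))) summable_on (UNIV \<times> UNIV)"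
      using s by (simp add: case_prod_unfold)
    then show ?thesis unfolding val .
  qed
  then have "(\<lambda>n. \<Sum>\<^sub>\<infinity>r. Y powi (e' - a - n) * ((1 - d) powi (n - b - c - int r) * ?\<phi> n (y v (b + c - 1 - n + int r) (dx (- d) r w)))) summable_on UNIV"
    by (rule summable_on_Sigma_banach)
  moreover have "(\<Sum>\<^sub>\<infinity>r. Y powi (e' - a - n) * ((1 - d) powi (n - b - c - int r) * ?\<phi> n (y v (b + c - 1 - n + int r) (dx (- d) r w)))) =
      Y powi (e' - a - n) * ?\<phi> n (shifted n)" for n
    by (rule infsumI, rule has_sum_cmult_right, rule translated_mode_has_sum[OF \<phi>l])
  ultimately have "(\<lambda>n. Y powi (e' - a - n) * ?\<phi> n (shifted n)) summable_on UNIV" by simp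
  then have "(\<lambda>j. (\<lambda>n. Y powi (e' - a - n) * ?\<phi> n (shifted n)) (j + (e' - a + 1))) summable_on UNIV"
    unfolding summable_on_def has_sum_int_shift[of "\<lambda>n. Y powi (e' - a - n) * ?\<phi> n (shifted n)" "e' - a + 1"] .
  then show ?thesis by (simp add: algebra_simps)
qed

lemma translated_lconv:
  "lconv (inf_coeffs (\<lambda>j. Sum_any (\<lambda>i::nat. (- d) ^ i * (of_int j gchoose i) * aseq p K u v w (j - int i)))) (1 / norm (1 - d))"
proof -
  let ?s = "\<lambda>k::nat. \<lambda>j. y u j (shifted (e - int k - a + j + 1))"
  let ?a2 = "\<lambda>j. Sum_any (\<lambda>i::nat. (- d) ^ i * (of_int j gchoose i) * aseq p K u v w (j - int i))"
  obtain R :: real where R: "\<And>n. Re n < R \<Longrightarrow> wspace V A n = {0}" using weights_bounded_below[OF mA] by blast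
  obtain M :: nat where M: "real_of_int e - R < real M" using reals_Archimedean2 by blast
  have a2: "?a2 j = (\<Sum>k<M. p (dx d k (?s k j)))" for j
  proof -
    let ?X = "\<lambda>q::nat. y u (j - int q) (y v (K - (j - int q)) w)"
    have Xm: "?X q \<in> mcar A" for q by (intro y_closed mem)
    obtain N :: nat where N: "\<And>r. r \<ge> N \<Longrightarrow> y v (K - j + int r) w = 0" using shifted_support[of "K - j"] by blast
    have X0: "?X q = 0" if "q \<ge> N" for q
    proof -
      have "K - (j - int q) = K - j + int q" by simp
      then show ?thesis using N[OF that] by (simp only: y_02[OF mem(1)])
    qed
    have fin: "finite {q. ((- d) ^ q * (of_int j gchoose q)) *\<^sub>C ?X q \<noteq> 0}"
      by (rule finite_nat_support[of N]) (simp only: X0 cvs.scale_zero_right)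
    have "?a2 j = Sum_any (\<lambda>q. p (((- d) ^ q * (of_int j gchoose q)) *\<^sub>C ?X q))"
      unfolding aseq_def using clinear_on_scale[OF p Xm] by (simp add: scaleC_complex_def)
    also have "\<dots> = p (Sum_any (\<lambda>q. ((- d) ^ q * (of_int j gchoose q)) *\<^sub>C ?X q))"
      by (rule clinear_on_Sum_any[OF p sub cvs.subspace_scale[OF sub Xm] fin, symmetric])
    also have "\<dots> = p (Sum_any (\<lambda>k::nat. dx d k (?s k j)))"
      by (simp only: translated_expansion)
    also have "Sum_any (\<lambda>k::nat. dx d k (?s k j)) = (\<Sum>k<M. dx d k (?s k j))"
    proof (rule Sum_any_nat)
      fix k assume k: "k \<ge> M"
      have "a + (e - int k - a + j + 1) - j - 1 = e - int k" by simp
      then have "y u j (shifted (e - int k - a + j + 1)) \<in> W (e - int k)"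
        using y_weight[OF u shifted_W, of j "e - int k - a + j + 1"] by (simp only:)
      moreover have "W (e - int k) = {0}"
      proof (rule R)
        have "real M \<le> real k" using k by simp
        then show "Re (complex_of_int (e - int k)) < R" using M by simp
      qed
      ultimately show "dx d k (?s k j) = 0" by (simp add: dexp_zero[OF mA])
    qed
    also have "p \<dots> = (\<Sum>k<M. p (dx d k (?s k j)))"
      by (rule clinear_on_sum[OF p sub]) (intro dexp_closed[OF mA] y_closed mem shifted_mem)
    finally show ?thesis .
  qed
  show ?thesis unfolding lconv_def
  proof (intro conjI allI impI)
    obtain N where N: "\<And>m. m < N \<Longrightarrow> aseq p K u v w m = 0" using aseq_bdd[OF p u v w K] by auto
    show "\<exists>k0. \<forall>k<k0. inf_coeffs ?a2 k = 0"
    proof (intro exI[of _ N] allI impI)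
      fix k assume "k < N"
      then have "aseq p K u v w (k - 1 - int i) = 0" for i using N by simp
      then show "?a2 (k - 1) = 0" by simp
    qed
    fix x :: complex assume x: "0 < norm x \<and> norm x < 1 / norm (1 - d)"
    then have x0: "x \<noteq> 0" by auto
    have d1: "norm (1 - d) > 0" using d by auto
    have Y: "norm (1 / x) > norm (1 - d)" using x d1 by (auto simp: norm_divide field_simps)
    have "(\<lambda>j. \<Sum>k<M. p (dx d k (?s k j)) * (1 / x) powi (- j - 1)) summable_on UNIV"
    proof (rule has_sum_imp_summable[OF has_sum_finite_sum[OF finite_lessThan has_sum_infsum]])
      fix k
      have ql: "clinear_on (mcar A) (\<lambda>x. p (dx d k x))"
        by (rule clinear_on_compose[OF dexp_lin[OF mA] p]) (auto intro: dexp_closed[OF mA])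
      show "(\<lambda>j. p (dx d k (?s k j)) * (1 / x) powi (- j - 1)) summable_on UNIV"
        using translated_summable[OF ql Y, of "e - int k"] by simp
    qed
    then have "(\<lambda>j. ?a2 j * (1 / x) powi (- j - 1)) summable_on UNIV"
      unfolding a2 sum_distrib_right .
    moreover have "(1 / x) powi (- j - 1) = x powi (j + 1)" for j
    proof -
      have "- j - 1 = - (j + 1)" by simp
      then show ?thesis using one_div_powi[of x "j + 1"] by (simp only: minus_minus)
    qed
    ultimately have "(\<lambda>j. ?a2 j * x powi (j + 1)) summable_on UNIV" by simp
    then have "(\<lambda>k. (\<lambda>j. ?a2 j * x powi (j + 1)) (k + (- 1))) summable_on UNIV"
      unfolding summable_on_def has_sum_int_shift[of "\<lambda>j. ?a2 j * x powi (j + 1)" "- 1"] .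
    then show "(\<lambda>k. inf_coeffs ?a2 k * x powi k) summable_on UNIV" by simp
  qed
qed

end

text \<open>For \<open>d = 2/5\<close> the translated expansion converges for \<open>|t - 2/5| > |1 - d| = 3/5\<close>, as \<open>three_point_jacobi\<close> requires.\<close>

theorem jacobi_homogeneous:
  assumes u: "u \<in> W a" and v: "v \<in> W b" and w: "w \<in> W c"
  shows "jacobi_at u v w l m n"
  unfolding jacobi_at_iff[OF u v w]
proof (intro allI impI)
  fix p :: "'u \<Rightarrow> complex" assume p: "clinear_on (mcar A) p"
  define K where "K = l + m + n"
  define e where "e = a + b + c - 2 - K"
  have K: "K = a + b + c - 2 - e" and K': "K = b + a + c - 2 - e" by (simp_all add: e_def)
  have d: "(2/5::complex) \<noteq> 0" "norm (2/5 :: complex) < norm (1 - 2/5 :: complex)" "norm (1 - 2/5 :: complex) = 3/5"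
  proof -
    have "(1 - 2/5 :: complex) = of_real (3/5)" by simp
    then show h: "norm (1 - 2/5 :: complex) = 3/5" by (simp only: norm_of_real)
    show "(2/5::complex) \<noteq> 0" by simp
    show "norm (2/5 :: complex) < norm (1 - 2/5 :: complex)" unfolding h by simp
  qed
  have "jacobi_coeffs (aseq p K u v w) (bseq p K u v w) (cseq p K u v w) l m"
  proof (rule three_point_jacobi[OF aseq_lconv[OF p u v w K] bseq_lconv[OF p u v w K] cseq_lconv[OF p u v w K]])
    show "lconv (inf_coeffs (\<lambda>j. Sum_any (\<lambda>i::nat. (- (2/5)) ^ i * (of_int j gchoose i) * aseq p K u v w (j - int i)))) (5/3)"
      using translated_lconv[OF p u v w K d(1,2)] unfolding d(3) by simp
    show "Sum_any (\<lambda>i::nat. (- (2/5)) ^ i * (of_int j gchoose i) * aseq p K u v w (j - int i)) =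
        Sum_any (\<lambda>i::nat. (- (2/5)) ^ i * (of_int j gchoose i) * aseq p K u v w (j - int i))" for j ..
    show "lsum (inf_coeffs (aseq p K u v w)) (1 / t) = lsum (zero_coeffs (bseq p K u v w)) (t - 1)"
      if "Re t > 1" "norm (t - 1) < 1" for t
      by (rule product_eq_iterate_half_disc[OF p u v w K that])
    show "lsum (zero_coeffs (bseq p K u v w)) (t - 1) = lsum (zero_coeffs (cseq p K u v w)) t" if "norm (t - 4/5) < 1/10" for t
      by (rule skew_symmetric_continuation[OF bseq_lconv[OF p u v w K] bseq_skew[OF p u v w K] aseq_lconv[OF p v u w K']
            product_eq_iterate_half_disc[OF p v u w K'] cseq_aseq that])
  qed
  then show "jacobi_coeffs (aseq p (l + m + n) u v w) (bseq p (l + m + n) u v w) (cseq p (l + m + n) u v w) l m"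
    unfolding K_def .
qed

end

section \<open>Extensions give algebras\<close>

lemma dim_one_span:
  fixes x :: "'a::complex_vector"
  assumes "cvs.dim S = 1" "x \<in> S" "x \<noteq> 0"
  shows "S \<subseteq> cvs.span {x}"
proof -
  obtain B where B: "B \<subseteq> S" "S \<subseteq> cvs.span B" "card B = cvs.dim S"
    by (rule cvs.basis_exists[of S])
  then obtain b where b: "B = {b}" using assms(1) by (auto simp: card_1_singleton_iff)
  then obtain k where k: "x = k *\<^sub>C b" using B(2) assms(2) by (auto simp: cvs.span_singleton)
  have "b \<in> cvs.span {x}"
    unfolding cvs.span_singleton using k assms(3)
    by (intro image_eqI[of _ _ "inverse k"]) auto
  then show ?thesis using B(2) b cvs.span_minimal[of "{b}" "cvs.span {x}"] cvs.subspace_span by blast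
qed

lemma dim_span_single:
  fixes x :: "'a::complex_vector"
  assumes "x \<noteq> 0"
  shows "cvs.dim (cvs.span {x}) = 1"
  using cvs.dim_span_eq_card_independent[of "{x}"] assms by simp

lemma cmodes_skew_opI:
  fixes V :: "'u::complex_vector voa"
  assumes d0: "\<And>i. dexp V A (-1) i 0 = 0"
    and eq: "\<And>j. y u j v = - ((-1) powi j *\<^sub>C Sum_any (\<lambda>i::nat. dexp V A (-1) i (y v (j + int i) u)))"
  shows "cmodes y u n v = skew_op V A (cmodes y) u n v"
proof (cases "n \<in> \<int>")
  case True
  then obtain j where n: "n = of_int j" by (auto elim: Ints_cases)
  show ?thesis unfolding n skew_op_cmodes cmodes_of_int by (rule eq)
next
  case False
  have "n + of_nat k \<notin> \<int>" for k
  proof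
    assume "n + of_nat k \<in> \<int>"
    then have "(n + of_nat k) - of_nat k \<in> \<int>" by (intro Ints_diff) auto
    then show False using False by simp
  qed
  then show ?thesis unfolding skew_op_def using False by (simp add: cmodes_not_int d0)
qed

context fixed_voa
begin

text \<open>\<open>Y(x, z) 1 = e^(z L(-1)) x\<close>, since the derivative property lowers the mode of \<open>L(-1)^k x\<close> to \<open>-1\<close>.\<close>

lemma creation_modes:
  assumes x: "x \<in> vcar V"
  shows "vY V x (- int k - 1) (vac V) = dexp V (adj V) 1 k x"
proof -
  let ?d = "dexp V (adj V) 1 k x"
  have d: "?d \<in> vcar V" using dexp_closed[OF adj_module, of x 1 k] x by simp
  have g: "(- 1) ^ k * ((- 1 :: complex) gchoose k) = 1"
    by (simp add: gbinomial_minus[of 1] binomial_gbinomial[of k k, symmetric] flip: power_mult_distrib)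
  have i: "(- 1 :: complex) = of_int (- 1)" "(of_int (- 1) :: complex) - of_nat k = of_int (- int k - 1)" by simp_all
  have "?d = vY V ?d (-1) (vac V)" using creation[OF d] by simp
  also have "\<dots> = cmodes (vY V) ?d (of_int (- 1)) (vac V)" by (simp only: cmodes_of_int)
  also have "\<dots> = ((- 1) ^ k * (of_int (- 1) gchoose k)) *\<^sub>C cmodes (vY V) x (of_int (- 1) - of_nat k) (vac V)"
    using it_dexp1[OF adj_module adj_module adj_module action_intertwining[OF adj_module], of x "vac V" 1 k "of_int (- 1)"] x vac_in
    by simp
  also have "\<dots> = cmodes (vY V) x (of_int (- int k - 1)) (vac V)" unfolding i(2) using g by simp
  finally show ?thesis by (simp only: cmodes_of_int)
qed

text \<open>Apply the Jacobi identity for \<open>m = -1\<close>, \<open>n = 0\<close> to the vacuum: the product \<open>u v 1\<close> drops out by creation.\<close>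

lemma skew_symmetry:
  assumes u: "u \<in> vcar V" and v: "v \<in> vcar V"
  shows "vY V v l u = - ((-1) powi l *\<^sub>C Sum_any (\<lambda>i::nat. dexp V (adj V) (-1) i (vY V u (l + int i) v)))"
proof -
  have cl: "vY V u n v \<in> vcar V" for n using act_closed[OF adj_module, of u v n] u v by simp
  have a0: "vY V w n 0 = 0" for w n using act_0[OF adj_module, of w n] by simp
  have "binomial_sum (-1) (\<lambda>i. vY V (vY V u (l + int i) v) (of_int (-1) + (0::int) - of_nat i) (vac V)) =
      alternating_sum l (\<lambda>i. vY V u (-1 + l - int i) (vY V v (0 + of_nat i) (vac V)))
      - signed_sum l (\<lambda>i. vY V v (0 + of_int l - of_nat i) (vY V u (-1 + int i) (vac V)))"
    using act_jac[OF adj_module] u v vac_in unfolding jacobi_def adj_car adj_act by blast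
  note c1 = this
  have c2: "(of_int (-1) gchoose i) *\<^sub>C vY V (vY V u (l + int i) v) (of_int (-1) + (0::int) - of_nat i) (vac V) = dexp V (adj V) (-1) i (vY V u (l + int i) v)" for i
  proof -
    have g: "(of_int (-1) :: complex) gchoose i = (-1) ^ i" by (simp add: gbinomial_minus[of 1] binomial_gbinomial[of i i, symmetric])
    have "of_int (-1) + (0::int) - of_nat i = - int i - 1" by simp
    then have "vY V (vY V u (l + int i) v) (of_int (-1) + (0::int) - of_nat i) (vac V) = dexp V (adj V) 1 i (vY V u (l + int i) v)"
      using creation_modes[OF cl] by (simp only:)
    then show ?thesis unfolding g by (simp add: dexp_def)
  qed
  have c3: "((-1) ^ i * (of_int l gchoose i)) *\<^sub>C vY V u (-1 + l - int i) (vY V v (0 + of_nat i) (vac V)) = 0" for i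
    using creation_nonneg[OF v, of "int i"] a0 by simp
  have c4: "signed_sum l (\<lambda>i. vY V v (0 + of_int l - of_nat i) (vY V u (-1 + int i) (vac V))) = (-1) powi l *\<^sub>C vY V v l u"
    by (subst Sum_any_single[of 0]) (use creation_nonneg[OF u] creation[OF u] a0 in auto)
  have "Sum_any (\<lambda>i::nat. dexp V (adj V) (-1) i (vY V u (l + int i) v)) = - ((-1) powi l *\<^sub>C vY V v l u)"
    using c1 unfolding c2 c3 c4 by simp
  then show ?thesis by (simp flip: power_int_mult_distrib)
qed

end

context vtc
begin

lemma eta_cong:
  assumes "\<And>w1 n w2. w1 \<in> mcar W1 \<Longrightarrow> w2 \<in> mcar W2 \<Longrightarrow> Y w1 n w2 = Y' w1 n w2"
  shows "eta z W1 W2 W3 Y = eta z W1 W2 W3 Y'"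
proof -
  have "subst_at V W3 Y (logz z) w1 w2 = subst_at V W3 Y' (logz z) w1 w2" if "w1 \<in> mcar W1" "w2 \<in> mcar W2" for w1 w2
    by (rule subst_at_cong) (rule assms[OF that])
  then show ?thesis unfolding eta_def by (simp cong: ball_cong)
qed

end

locale voa_extension = vtc V D for V :: "'u::complex_vector voa" and D +
  fixes E :: "'u voa" and i :: "'u \<Rightarrow> 'u"
  assumes extension: "is_extension V E i"
begin

abbreviation M :: "'u vmod" where "M \<equiv> restrict_module V E i"

sublocale E: fixed_voa E
  using extension by unfold_locales (simp add: is_extension_def)

lemma i_lin: "clinear_on (vcar V) i" and i_inj: "inj_on i (vcar V)"
  and i_in: "v \<in> vcar V \<Longrightarrow> i v \<in> vcar E" and i_out: "v \<notin> vcar V \<Longrightarrow> i v = 0"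
  and i_vac: "i (vac V) = vac E" and i_omega: "i (omega V) = omega E"
  and i_hom: "u \<in> vcar V \<Longrightarrow> v \<in> vcar V \<Longrightarrow> i (vY V u n v) = vY E (i u) n (i v)"
  using extension by (auto simp: is_extension_def)

lemma M_car [simp]: "mcar M = vcar E" by (simp add: restrict_module_def)

lemma M_act: "v \<in> vcar V \<Longrightarrow> mact M v n w = vY E (i v) n w" by (simp add: restrict_module_def)

lemma M_Lop: "Lop V M = Lop E (adj E)"
  by (intro ext) (simp add: Lop_def M_act omega_in i_omega)

lemma M_wspace: "wspace V M = wspace E (adj E)"
  by (intro ext) (simp add: wspace_def M_Lop)

lemma M_dexp: "dexp V M = dexp E (adj E)"
  by (intro ext) (simp add: dexp_def M_Lop)

lemma E_closed: "u \<in> vcar E \<Longrightarrow> v \<in> vcar E \<Longrightarrow> vY E u n v \<in> vcar E"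
  using E.act_closed[OF E.adj_module, of u v n] by simp

lemma E_jacobi:
  assumes "u \<in> vcar E" "v \<in> vcar E" "w \<in> vcar E"
  shows "binomial_sum m (\<lambda>k. vY E (vY E u (l + int k) v) (of_int m + n - of_nat k) w) =
      alternating_sum l (\<lambda>k. vY E u (m + l - int k) (vY E v (n + of_nat k) w))
      - signed_sum l (\<lambda>k. vY E v (n + of_int l - of_nat k) (vY E u (m + int k) w))"
  using E.act_jac[OF E.adj_module] assms unfolding jacobi_def E.adj_car E.adj_act by blast

lemma i_Lop: "v \<in> vcar V \<Longrightarrow> i (Lop V (adj V) n v) = Lop E (adj E) n (i v)"
  by (simp add: Lop_def i_hom omega_in i_omega)

lemma M_vertex_action: "vertex_action V M"
  unfolding vertex_action_def
proof (intro conjI)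
  show "cvs.subspace (mcar M)" by (simp add: E.V_sub)
  show "\<forall>n. cbilinear_on (vcar V) (mcar M) (\<lambda>v w. mact M v n w)"
  proof (intro allI cbilinear_onI)
    fix n w assume "w \<in> mcar M"
    then have "clinear_on (vcar V) (\<lambda>v. vY E (i v) n w)"
      using clinear_on_compose[OF i_lin E.act_linv[OF E.adj_module, of w n]] i_in by auto
    then show "clinear_on (vcar V) (\<lambda>v. mact M v n w)"
      unfolding clinear_on_def using V_sub by (auto simp: M_act cvs.subspace_add cvs.subspace_scale)
  next
    fix n v assume "v \<in> vcar V"
    then show "clinear_on (mcar M) (mact M v n)"
      using E.act_lin[OF E.adj_module i_in, of v n] by (simp add: M_act clinear_on_def)
  qed
  show "\<forall>v\<in>vcar V. \<forall>n. \<forall>w\<in>mcar M. mact M v n w \<in> mcar M" by (simp add: M_act E_closed i_in)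
  show "\<forall>v\<in>vcar V. \<forall>w\<in>mcar M. \<exists>N. \<forall>n\<ge>N. mact M v n w = 0"
    using E.act_trunc[OF E.adj_module] i_in by (simp add: M_act)
  show "\<forall>w\<in>mcar M. \<forall>n. mact M (vac V) n w = (if n = -1 then w else 0)"
    using E.act_vac[OF E.adj_module] by (simp add: M_act vac_in i_vac)
  show "jacobi V (adj V) M M (mact M)"
    unfolding jacobi_def
  proof (intro ballI allI, goal_cases)
    case (1 u v w l m n)
    note u = 1(1)
    have v: "v \<in> vcar V" using 1(2) by simp
    have uv: "vY V u k v \<in> vcar V" for k using act_closed[OF adj_module u 1(2), of k] by simp
    show ?case
      using E_jacobi[OF i_in[OF u] i_in[OF v], of w m l n] 1(3)
      unfolding adj_act by (simp only: M_act[OF u] M_act[OF v] M_act[OF uv] i_hom[OF u v] M_car)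
  qed
  show "\<forall>v\<in>vcar V. \<forall>n. \<forall>w\<in>mcar M. mact M (Lop V (adj V) (-1) v) n w = - (of_int n *\<^sub>C mact M v (n - 1) w)"
  proof (intro ballI allI)
    fix v n w assume v: "v \<in> vcar V" and w: "w \<in> mcar M"
    have "Lop V (adj V) (-1) v \<in> vcar V" using Lop_closed[OF adj_module, of v "-1"] v by simp
    then show "mact M (Lop V (adj V) (-1) v) n w = - (of_int n *\<^sub>C mact M v (n - 1) w)"
      using E.act_deriv[OF E.adj_module i_in[OF v], of w n] w v by (simp add: M_act i_Lop)
  qed
  show "\<forall>v n w. v \<notin> vcar V \<or> w \<notin> mcar M \<longrightarrow> mact M v n w = 0"
    using E.act_out[OF E.adj_module] by (auto simp: restrict_module_def)
qed

lemma M_module: "is_module V M"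
  using E.adj_module M_vertex_action unfolding is_module_def M_wspace by simp

lemma M_integral: "wspace V M n \<noteq> {0} \<Longrightarrow> n \<in> \<int>"
  unfolding M_wspace by (rule is_module_adj(2)[OF E.voa])

lemma E_intertwining: "intertwining_operator V M M M (cmodes (vY E))"
proof (rule cmodes_intertwining[OF M_module])
  show "cbilinear_on (mcar M) (mcar M) (\<lambda>w1 w2. vY E w1 n w2)" for n
    using E.act_lin[OF E.adj_module] E.act_linv[OF E.adj_module] by (auto intro!: cbilinear_onI)
  show "w1 \<in> mcar M \<Longrightarrow> w2 \<in> mcar M \<Longrightarrow> vY E w1 n w2 \<in> mcar M" for w1 w2 n by (simp add: E_closed)
  show "w1 \<in> mcar M \<Longrightarrow> w2 \<in> mcar M \<Longrightarrow> \<exists>N. \<forall>n\<ge>N. vY E w1 n w2 = 0" for w1 w2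
    using E.act_trunc[OF E.adj_module, of w1 w2] by simp
  show "jacobi V M M M (vY E)"
    unfolding jacobi_def
  proof (intro ballI allI, goal_cases)
    case (1 u v w l m n)
    then show ?case
      using E_jacobi[OF i_in[OF 1(1)], of v w m l n] by (simp only: M_act[OF 1(1)] M_car)
  qed
  show "w1 \<in> mcar M \<Longrightarrow> w2 \<in> mcar M \<Longrightarrow> vY E (Lop V M (-1) w1) n w2 = - (of_int n *\<^sub>C vY E w1 (n - 1) w2)" for w1 w2 n
    unfolding M_Lop using E.act_deriv[OF E.adj_module, of w1 w2 n] by simp
qed

sublocale M: mode_algebra V M "vY E"
  using M_module E_intertwining M_integral vtc
  by unfold_locales (auto simp: vertex_tensor_category_def)

lemma E_skew:
  assumes u: "u \<in> mcar M" and v: "v \<in> mcar M"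
  shows "skew_op V M (cmodes (vY E)) u n v = cmodes (vY E) u n v"
proof (rule cmodes_skew_opI[symmetric])
  show "dexp V M (-1) k 0 = 0" for k by (rule dexp_zero[OF M_module])
  show "vY E u j v = - ((-1) powi j *\<^sub>C Sum_any (\<lambda>k::nat. dexp V M (-1) k (vY E v (j + int k) u)))" for j
    unfolding M_dexp by (rule E.skew_symmetry) (use u v in simp_all)
qed

text \<open>The multiplication of the algebra of an extension is defined by an integral sum at \<open>z = 1\<close>; as \<open>log 1 = 0\<close> this is
  evaluation of the vertex operator, regarded as an intertwining operator.\<close>

lemma amult_eq: "amult (algebra_of_extension V D (E, i)) = eta 1 M M M (cmodes (vY E))"
proof -
  have "(\<lambda>m. Sum_any (\<lambda>n::int. wproj V M m (vY E u n v))) = subst_at V M (cmodes (vY E)) (logz 1) u v" for u v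
  proof
    fix m
    have "subst_at V M (cmodes (vY E)) (logz 1) u v m = Sum_any (\<lambda>n. wproj V M m (cmodes (vY E) u n v))"
      by (simp add: subst_at_def logz_1)
    also have "\<dots> = Sum_any (\<lambda>n::int. wproj V M m (cmodes (vY E) u (of_int n) v))"
    proof (rule Sum_any_reindex_inj)
      show "inj (of_int :: int \<Rightarrow> complex)" by (simp add: inj_on_def)
      show "wproj V M m (cmodes (vY E) u y v) = 0" if "y \<notin> range of_int" for y
        using that by (simp add: cmodes_not_int Ints_def)
    qed
    finally show "Sum_any (\<lambda>n::int. wproj V M m (vY E u n v)) = subst_at V M (cmodes (vY E)) (logz 1) u v m" by simp
  qed
  then show ?thesis unfolding algebra_of_extension_def eta_def by (simp add: Let_def)
qed

lemma aobj_eq: "aobj (algebra_of_extension V D (E, i)) = M"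
  and aunit_eq: "aunit (algebra_of_extension V D (E, i)) = i"
  by (simp_all add: algebra_of_extension_def Let_def)

lemma i_Hom: "i \<in> Hom V (adj V) M"
  using i_lin i_in i_out i_hom by (auto simp: Hom_def M_act)

lemmas M3 = M_module M_module M_module E_intertwining

theorem C_algebra_of_extension:
  assumes z: "z1 > z2" "z2 > z1 - z2" "z1 - z2 > 0"
  shows "C_algebra V D z1 z2 (algebra_of_extension V D (E, i))"
  unfolding C_algebra_def Let_def aobj_eq aunit_eq amult_eq
proof (intro conjI)
  let ?\<mu> = "eta 1 M M M (cmodes (vY E))"
  show "is_module V M" by (rule M_module)
  show "?\<mu> \<in> Hom V (tprod D 1 M M) M"
    by (rule eta_Hom[OF one_neq_zero M3])
  show "i \<in> Hom V (adj V) M" by (rule i_Hom)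
  show "inj_on i (vcar V)" by (rule i_inj)
  have "\<exists>f. has_weak_sum V M (\<lambda>n. M.I (complex_of_real z1) u (M.I (complex_of_real z2) v w n)) UNIV f \<and>
             has_weak_sum V M (\<lambda>n. M.I (complex_of_real z2) (M.I (complex_of_real z1 - complex_of_real z2) u v n) w) UNIV f"
    if m: "u \<in> mcar M" "v \<in> mcar M" "w \<in> mcar M" for u v w
  proof (rule M.product_eq_iterate_of_jacobi[OF _ z m])
    fix u v w a b c l m n assume "u \<in> M.W a" "v \<in> M.W b" "w \<in> M.W c"
    then have "u \<in> vcar E" "v \<in> vcar E" "w \<in> vcar E" using M.W_mcar by auto
    from E_jacobi[OF this, of m l n] show "M.jacobi_at u v w l m n"
      unfolding M.jacobi_at_def by simp
  qed
  then show "\<forall>x\<in>mcar (tprod D 1 M (tprod D 1 M M)).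
      ?\<mu> (tmap V D 1 (tprod D 1 M M) M M M (?\<mu>) (idm M) (assoc_iso V D z1 z2 M M M x))
      = ?\<mu> (tmap V D 1 M (tprod D 1 M M) M M (idm M) (?\<mu>) x)"
    unfolding associativity_axiom_iff[OF M_module E_intertwining z] by (intro ballI)
  show "\<forall>x\<in>mcar (tprod D 1 M M). ?\<mu> (braiding V D M M x) = ?\<mu> x"
  proof
    fix x
    have "?\<mu> (braiding V D M M x) = eta 1 M M M (skew_op V M (cmodes (vY E))) x"
      using fun_cong[OF eta_braiding[OF M3], of x] by simp
    also have "eta 1 M M M (skew_op V M (cmodes (vY E))) = ?\<mu>"
      by (rule eta_cong) (rule E_skew)
    finally show "?\<mu> (braiding V D M M x) = ?\<mu> x" .
  qed
  show "\<forall>a\<in>mcar M. ?\<mu> (tmap V D 1 (adj V) M M M i (idm M)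
              (inv_into (mcar (tprod D 1 (adj V) M)) (left_unit V D M) a)) = a"
  proof
    fix a assume a: "a \<in> mcar M"
    have "cmodes (vY E) (i (vac V)) (of_int (-1)) a = a"
      using E.act_vac[OF E.adj_module, of a "-1"] a unfolding cmodes_of_int i_vac by simp
    then show "?\<mu> (tmap V D 1 (adj V) M M M i (idm M)
              (inv_into (mcar (tprod D 1 (adj V) M)) (left_unit V D M) a)) = a"
      unfolding unit_axiom[OF M_module E_intertwining i_Hom a] by simp
  qed
qed

lemma twist_of_extension: "w \<in> mcar M \<Longrightarrow> twist V M w = w"
proof -
  assume w: "w \<in> mcar M"
  have "exp (2 * pi * \<i> * n) *\<^sub>C wproj V M n w = wproj V M n w" for n
  proof (cases "n \<in> \<int>")
    case True
    then obtain k where k: "n = of_int k" by (auto elim: Ints_cases)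
    have "exp (2 * pi * \<i> * n) = 1" unfolding exp_eq_1 k by (auto intro!: exI[of _ k])
    then show ?thesis by simp
  next
    case False
    then have "wspace V M n = {0}" using M_integral by blast
    then show ?thesis using M.wproj_in[OF w, of n] by simp
  qed
  then show ?thesis unfolding twist_def using M.wproj_Sum_any[OF w] by simp
qed

lemma haploid_of_extension:
  assumes d: "cvs.dim (wspace E (adj E) 0) = 1" and v0: "vac V \<noteq> 0"
  shows "haploid V (algebra_of_extension V D (E, i))"
proof -
  have e0: "vac E \<noteq> 0"
  proof
    assume "vac E = 0"
    then have "i (vac V) = i 0" using clinear_on_0[OF i_lin V_sub] i_vac by simp
    then show False using inj_onD[OF i_inj] vac_in cvs.subspace_0[OF V_sub] v0 by blast
  qed
  have "Hom V (adj V) M = cvs.span {i}"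
  proof
    show "cvs.span {i} \<subseteq> Hom V (adj V) M"
    proof
      fix f assume "f \<in> cvs.span {i}"
      then obtain c where f: "f = (\<lambda>x. c *\<^sub>C i x)" by (auto simp: cvs.span_singleton scaleC_fun_def)
      have "vY E (i v) n (c *\<^sub>C i w) = c *\<^sub>C vY E (i v) n (i w)" if "v \<in> vcar V" "w \<in> vcar V" for v w n
        using clinear_on_scale[OF E.act_lin[OF E.adj_module i_in[OF that(1)]], of "i w" n c] i_in[OF that(2)] by simp
      then show "f \<in> Hom V (adj V) M"
        using i_lin i_in i_out i_hom E.V_sub
        by (auto simp: f Hom_def M_act clinear_on_def scaleC_add_right scaleC_scaleC mult.commute intro: cvs.subspace_scale)
    qed
    show "Hom V (adj V) M \<subseteq> cvs.span {i}"
    proof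
      fix f assume f: "f \<in> Hom V (adj V) M"
      have "f (vac V) \<in> wspace E (adj E) 0" using Hom_wspace[OF f vac_weight] by (simp add: M_wspace)
      moreover have "vac E \<in> wspace E (adj E) 0" by (rule E.vac_weight)
      ultimately obtain c where c: "f (vac V) = c *\<^sub>C vac E"
        using dim_one_span[OF d _ e0] by (auto simp: cvs.span_singleton)
      have "f v = c *\<^sub>C i v" for v
      proof (cases "v \<in> vcar V")
        case True
        have "f v = f (mact (adj V) v (-1) (vac V))" using creation[OF True] by simp
        also have "\<dots> = vY E (i v) (-1) (c *\<^sub>C vac E)"
          using Hom_act[OF f True, of "vac V" "-1"] vac_in c by (simp add: M_act True)
        also have "\<dots> = c *\<^sub>C i v"
          using clinear_on_scale[OF E.act_lin[OF E.adj_module i_in[OF True]], of "vac E" "-1" c] E.vac_in E.creation[OF i_in[OF True]] by simp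
        finally show ?thesis .
      next
        case False
        then show ?thesis using Hom_out[OF f, of v] i_out by simp
      qed
      then have "f = c *\<^sub>C i" by (simp add: scaleC_fun_def fun_eq_iff)
      then show "f \<in> cvs.span {i}" unfolding cvs.span_singleton by (rule range_eqI)
    qed
  qed
  moreover have "i \<noteq> 0" using e0 i_vac by auto
  ultimately show ?thesis unfolding haploid_def aobj_eq by (simp only: dim_span_single not_False_eq_True simp_thms)
qed

end

context vtc
begin

text \<open>The algebra remembers the vertex operator since modes are determined by the value at \<open>1\<close>, and the inclusion remembers
  vacuum and conformal vector.\<close>

lemma algebra_of_extension_inj:
  assumes "is_extension V E i" "is_extension V E' i'"
    and eq: "algebra_of_extension V D (E, i) = algebra_of_extension V D (E', i')"
  shows "E = E' \<and> i = i'"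
proof -
  interpret X: voa_extension V D E i by unfold_locales (rule assms(1))
  interpret X': voa_extension V D E' i' by unfold_locales (rule assms(2))
  have i: "i = i'" using arg_cong[OF eq, of aunit] unfolding X.aunit_eq X'.aunit_eq .
  have M: "X.M = X'.M" using arg_cong[OF eq, of aobj] unfolding X.aobj_eq X'.aobj_eq .
  have car: "vcar E = vcar E'" using arg_cong[OF M, of mcar] by simp
  note it = X.E_intertwining and it' = X'.E_intertwining[folded M]
  have \<mu>: "eta 1 X.M X.M X.M (cmodes (vY E)) = eta 1 X.M X.M X.M (cmodes (vY E'))"
    using arg_cong[OF eq, of amult] unfolding X.amult_eq X'.amult_eq M[symmetric] .
  have "vY E u n v = vY E' u n v" for u n v
  proof (cases "u \<in> vcar E \<and> v \<in> vcar E")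
    case True
    have "cmodes (vY E) u (of_int n) v = cmodes (vY E') u (of_int n) v"
    proof (rule intertwining_determined[OF X.M_module X.M_module X.M_module it it'])
      show "subst_at V X.M (cmodes (vY E)) (logz 1) w1 w2 = subst_at V X.M (cmodes (vY E')) (logz 1) w1 w2"
        if "w1 \<in> mcar X.M" "w2 \<in> mcar X.M" for w1 w2
        using eta_telem[OF one_neq_zero X.M_module X.M_module X.M_module it that]
          eta_telem[OF one_neq_zero X.M_module X.M_module X.M_module it' that] unfolding \<mu> by simp
    qed (use True in simp_all)
    then show ?thesis unfolding cmodes_of_int .
  next
    case False
    then show ?thesis using X.E.act_out[OF X.E.adj_module, of u v n] X'.E.act_out[OF X'.E.adj_module, of u v n] car by auto
  qed
  then have "vY E = vY E'" by (intro ext)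
  then have "E = E'" using car i X.i_vac X'.i_vac X.i_omega X'.i_omega by (intro voa.equality) auto
  then show ?thesis using i by simp
qed

end

section \<open>The Virasoro relations on modules\<close>

definition virasoro :: "'u::complex_vector voa \<Rightarrow> 'u vmod \<Rightarrow> complex \<Rightarrow> bool" where
  "virasoro V W c \<longleftrightarrow> (\<forall>m n. \<forall>w\<in>mcar W.
     Lop V W m (Lop V W n w) - Lop V W n (Lop V W m w)
     = of_int (m - n) *\<^sub>C Lop V W (m + n) w + (if m + n = 0 then (of_int (m ^ 3 - m) / 12 * c) *\<^sub>C w else 0))"

context fixed_voa
begin

lemma Lop_commutator_vac:
  assumes V: "virasoro V (adj V) c"
    and k: "k \<ge> -1"
  shows "Lop V (adj V) k (omega V) = of_int (k + 2) *\<^sub>C Lop V (adj V) (k - 2) (vac V) + (if k = 2 then (c / 2) *\<^sub>C vac V else 0)"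
proof -
  have "Lop V (adj V) (-2) (vac V) = omega V" unfolding Lop_def using creation[OF omega_in] by simp
  moreover have "Lop V (adj V) (-2) (Lop V (adj V) k (vac V)) = 0"
    using Lop_vac[OF k] clinear_on_0[OF Lop_lin[OF adj_module] mod_sub[OF adj_module]] by simp
  ultimately show ?thesis using V[unfolded virasoro_def, rule_format, of "vac V" k "-2"] vac_in by auto
qed

text \<open>Apply the Virasoro relations of \<open>V\<close> to \<open>\<omega> = L(-2) 1\<close>.\<close>

lemma omega_modes:
  assumes V: "virasoro V (adj V) c"
  shows "vY V (omega V) 0 (omega V) = Lop V (adj V) (-1) (omega V)"
    and "vY V (omega V) 1 (omega V) = 2 *\<^sub>C omega V"
    and "vY V (omega V) 2 (omega V) = 0"
    and "vY V (omega V) 3 (omega V) = (c / 2) *\<^sub>C vac V"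
    and "i \<ge> 4 \<Longrightarrow> vY V (omega V) (int i) (omega V) = 0"
proof -
  have w: "Lop V (adj V) (-2) (vac V) = omega V" unfolding Lop_def using creation[OF omega_in] by simp
  show "vY V (omega V) 0 (omega V) = Lop V (adj V) (-1) (omega V)" by (simp add: Lop_def)
  have L': "vY V (omega V) (k + 1) (omega V) = of_int (k + 2) *\<^sub>C Lop V (adj V) (k - 2) (vac V) + (if k = 2 then (c / 2) *\<^sub>C vac V else 0)"
    if "k \<ge> -1" for k
    using Lop_commutator_vac[OF V that] by (simp only: Lop_def adj_act)
  show "vY V (omega V) 1 (omega V) = 2 *\<^sub>C omega V" using L'[of 0] by (simp add: w)
  show "vY V (omega V) 2 (omega V) = 0" using L'[of 1] by (simp add: Lop_vac)
  show "vY V (omega V) 3 (omega V) = (c / 2) *\<^sub>C vac V" using L'[of 2] by (simp add: Lop_vac)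
  show "vY V (omega V) (int i) (omega V) = 0" if "i \<ge> 4"
  proof -
    have "Lop V (adj V) (int i - 1 - 2) (vac V) = 0" by (rule Lop_vac) (use that in simp)
    moreover have "int i - 1 \<noteq> 2" "int i - 1 \<ge> -1" "int i - 1 + 1 = int i" using that by simp_all
    ultimately show ?thesis using L'[of "int i - 1"] by (simp only: if_False cvs.scale_zero_right add_0_right)
  qed
qed

text \<open>The commutator formula expresses \<open>[L(m), L(n)]\<close> through the modes \<open>\<omega>_i \<omega>\<close>, which were computed in \<open>V\<close>. Hence the
  relations hold on every module, with the central charge of \<open>V\<close>.\<close>

theorem virasoro_module:
  "\<exists>c. \<forall>W. is_module V W \<longrightarrow> virasoro V W c"
proof -
  obtain c where c: "virasoro V (adj V) c"
    using voa unfolding is_voa_def virasoro_def adj_car by blast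
  note om = omega_modes[OF c]
  have "Lop V W m (Lop V W n w) - Lop V W n (Lop V W m w)
     = of_int (m - n) *\<^sub>C Lop V W (m + n) w + (if m + n = 0 then (of_int (m ^ 3 - m) / 12 * c) *\<^sub>C w else 0)"
    if mW: "is_module V W" and w: "w \<in> mcar W" for W m n w
  proof -
    let ?m = "of_int (m + 1) :: complex"
    let ?F = "\<lambda>i::nat. (?m gchoose i) *\<^sub>C mact W (vY V (omega V) (int i) (omega V)) ((m + 1) + (n + 1) - int i) w"
    have z0: "mact W 0 k w = 0" for k by (rule clinear_on_0[OF act_linv[OF mW w] V_sub])
    have "Lop V W m (Lop V W n w) - Lop V W n (Lop V W m w) = Sum_any ?F"
      unfolding Lop_def by (rule act_commutator[OF mW omega_in omega_in w, symmetric])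
    also have "\<dots> = (\<Sum>i<4. ?F i)" by (rule Sum_any_nat) (simp add: om(5) z0)
    also have "\<dots> = ?F 0 + ?F 1 + ?F 2 + ?F 3"
    proof -
      have "(\<Sum>i<4. G i) = G 0 + G 1 + G 2 + G 3" for G :: "nat \<Rightarrow> 'u" by (simp add: eval_nat_numeral)
      then show ?thesis .
    qed
    also have "?F 0 = (- of_int (m + n + 2)) *\<^sub>C Lop V W (m + n) w"
    proof -
      have i: "(m + 1) + (n + 1) - int 0 = m + n + 2" "m + n + 2 - 1 = m + n + 1" by simp_all
      have "mact W (vY V (omega V) (int 0) (omega V)) (m + n + 2) w = - (of_int (m + n + 2) *\<^sub>C Lop V W (m + n) w)"
        using act_deriv[OF mW omega_in w, of "m + n + 2"] unfolding om(1)[symmetric] i(2) Lop_def by simp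
      then show ?thesis unfolding i(1) by (simp only: gbinomial_0 cvs.scale_one cvs.scale_minus_left)
    qed
    also have "?F 1 = (2 * ?m) *\<^sub>C Lop V W (m + n) w"
    proof -
      have i: "(m + 1) + (n + 1) - int 1 = m + n + 1" by simp
      have "mact W (vY V (omega V) (int 1) (omega V)) (m + n + 1) w = 2 *\<^sub>C Lop V W (m + n) w"
        using clinear_on_scale[OF act_linv[OF mW w] omega_in, of 2 "m + n + 1"] om(2) by (simp add: Lop_def)
      then show ?thesis unfolding i by (simp add: mult.commute)
    qed
    also have "?F 2 = 0" using om(3) z0 by simp
    also have "?F 3 = (if m + n = 0 then (of_int (m ^ 3 - m) / 12 * c) *\<^sub>C w else 0)"
    proof -
      have g: "?m gchoose 3 = of_int (m ^ 3 - m) / 6"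
      proof -
        have "?m gchoose 3 = ?m * (?m - 1) * (?m - 2) / 6"
          by (simp add: gbinomial_prod_rev eval_nat_numeral)
        also have "?m * (?m - 1) * (?m - 2) = of_int (m ^ 3 - m)"
          by (simp add: algebra_simps power3_eq_cube)
        finally show ?thesis .
      qed
      have i: "(m + 1) + (n + 1) - int 3 = m + n - 1" by simp
      have v: "mact W ((c / 2) *\<^sub>C vac V) (m + n - 1) w = (if m + n = 0 then (c / 2) *\<^sub>C w else 0)"
        using clinear_on_scale[OF act_linv[OF mW w] vac_in, of "c / 2" "m + n - 1"] act_vac[OF mW w, of "m + n - 1"] by simp
      have o3: "vY V (omega V) (int 3) (omega V) = (c / 2) *\<^sub>C vac V" using om(4) by simp
      show ?thesis unfolding i o3 v g by simp
    qed
    also have "(- of_int (m + n + 2)) *\<^sub>C Lop V W (m + n) w + (2 * ?m) *\<^sub>C Lop V W (m + n) w = of_int (m - n) *\<^sub>C Lop V W (m + n) w"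
    proof -
      have "- of_int (m + n + 2) + 2 * ?m = of_int (m - n)" by simp
      then show ?thesis unfolding cvs.scale_left_distrib[symmetric] by (simp only:)
    qed
    finally show ?thesis by (simp only: add_0_right)
  qed
  then show ?thesis unfolding virasoro_def by (intro exI[of _ c] allI impI ballI)
qed

end

section \<open>Submodules and the weight zero space\<close>

text \<open>Besides the carrier, the action is changed to \<open>0\<close> outside the submodule, as the normalisation of modules demands.\<close>

definition restrict_to :: "'u::complex_vector vmod \<Rightarrow> 'u set \<Rightarrow> 'u vmod" where
  "restrict_to W U = \<lparr>mcar = U, mact = (\<lambda>v n w. if w \<in> U then mact W v n w else 0)\<rparr>"

lemma restrict_to_car [simp]: "mcar (restrict_to W U) = U" by (simp add: restrict_to_def)

context fixed_voa
begin

text \<open>A submodule is stable under \<open>L(0)\<close>; subtracting \<open>k0\<close> from \<open>L(0)\<close> removes one component at a time.\<close>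

lemma submodule_wproj:
  assumes mW: "is_module V W" and U: "submodule V W U" and w: "w \<in> U"
  shows "wproj V W n w \<in> U"
proof -
  interpret graded_space V W by (rule gs[OF mW])
  have US: "cvs.subspace U" and UW: "U \<subseteq> mcar W" using U by (auto simp: submodule_def)
  have UL: "Lop V W 0 x \<in> U" if "x \<in> U" for x using U that omega_in by (auto simp: submodule_def Lop_def)
  have *: "\<forall>k\<in>F. x k \<in> U" if "finite F" "\<forall>k\<in>F. x k \<in> wspace V W k" "(\<Sum>k\<in>F. x k) \<in> U" for F and x :: "complex \<Rightarrow> 'u"
    using that
  proof (induction F arbitrary: x rule: finite_induct)
    case (insert k0 F)
    have xm: "x k \<in> mcar W" if "k \<in> insert k0 F" for k using insert.prems(1) that wspace_mcar by blast
    let ?s = "x k0 + (\<Sum>k\<in>F. x k)"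
    have s: "?s \<in> U" using insert by simp
    have sm: "(\<Sum>k\<in>F. x k) \<in> mcar W" by (intro cvs.subspace_sum[OF sub] xm) simp
    have "Lop V W 0 ?s = k0 *\<^sub>C x k0 + (\<Sum>k\<in>F. k *\<^sub>C x k)"
    proof -
      have "Lop V W 0 (\<Sum>k\<in>F. x k) = (\<Sum>k\<in>F. Lop V W 0 (x k))"
        by (rule clinear_on_sum[OF L0_lin sub]) (simp add: xm)
      also have "\<dots> = (\<Sum>k\<in>F. k *\<^sub>C x k)" using insert.prems(1) by (intro sum.cong) (simp_all add: wspaceD)
      finally show ?thesis
        using clinear_on_add[OF L0_lin xm sm, of k0] wspaceD[of "x k0" k0] insert.prems(1) by simp
    qed
    then have "Lop V W 0 ?s - k0 *\<^sub>C ?s = (\<Sum>k\<in>F. (k - k0) *\<^sub>C x k)"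
      by (simp add: cvs.scale_right_distrib cvs.scale_sum_right cvs.scale_left_diff_distrib sum_subtractf)
    moreover have "Lop V W 0 ?s - k0 *\<^sub>C ?s \<in> U"
      by (intro cvs.subspace_diff[OF US] UL cvs.subspace_scale[OF US] s)
    moreover have "\<forall>k\<in>F. (k - k0) *\<^sub>C x k \<in> wspace V W k"
      using insert.prems(1) cvs.subspace_scale[OF wspace_subspace] by simp
    ultimately have "\<forall>k\<in>F. (k - k0) *\<^sub>C x k \<in> U" using insert.IH[of "\<lambda>k. (k - k0) *\<^sub>C x k"] by simp
    then have F: "x k \<in> U" if "k \<in> F" for k
    proof -
      have "k - k0 \<noteq> 0" using insert.hyps that by auto
      then have "x k = inverse (k - k0) *\<^sub>C ((k - k0) *\<^sub>C x k)" by simp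
      also have "\<dots> \<in> U" using cvs.subspace_scale[OF US] \<open>\<forall>k\<in>F. (k - k0) *\<^sub>C x k \<in> U\<close> that by blast
      finally show ?thesis .
    qed
    have "x k0 = ?s - (\<Sum>k\<in>F. x k)" by simp
    also have "\<dots> \<in> U" by (intro cvs.subspace_diff[OF US] s cvs.subspace_sum[OF US] F)
    finally show ?case using F by blast
  qed simp
  have wm: "w \<in> mcar W" using w UW by blast
  have "(\<Sum>k\<in>{k. wproj V W k w \<noteq> 0}. wproj V W k w) \<in> U"
    using wproj_Sum_any[OF wm] w by (simp add: Sum_any.expand_set)
  then have "\<forall>k\<in>{k. wproj V W k w \<noteq> 0}. wproj V W k w \<in> U"
    using *[OF wproj_finite[OF wm], of "\<lambda>k. wproj V W k w"] wproj_in[OF wm] by simp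
  then show ?thesis using cvs.subspace_0[OF US] by (cases "wproj V W n w = 0") auto
qed

context
  fixes W U
  assumes mW: "is_module V W" and U: "submodule V W U"
begin

lemma restrict_to_act: "w \<in> U \<Longrightarrow> mact (restrict_to W U) v n w = mact W v n w" by (simp add: restrict_to_def)

lemma submodule_mcar: "w \<in> U \<Longrightarrow> w \<in> mcar W" using U by (auto simp: submodule_def)

lemma submodule_act: "v \<in> vcar V \<Longrightarrow> w \<in> U \<Longrightarrow> mact W v n w \<in> U" using U by (auto simp: submodule_def)

lemma restrict_to_wspace: "wspace V (restrict_to W U) n = wspace V W n \<inter> U"
  using submodule_mcar by (auto simp: wspace_def Lop_def restrict_to_act)

lemma restrict_to_module: "is_module V (restrict_to W U)"
proof -
  let ?R = "restrict_to W U"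
  interpret graded_space V W by (rule gs[OF mW])
  have US: "cvs.subspace U" using U by (auto simp: submodule_def)
  have "vertex_action V ?R"
    unfolding vertex_action_def
  proof (intro conjI)
    show "cvs.subspace (mcar ?R)" using US by simp
    show "\<forall>n. cbilinear_on (vcar V) (mcar ?R) (\<lambda>v w. mact ?R v n w)"
    proof (intro allI cbilinear_onI)
      show "clinear_on (vcar V) (\<lambda>v. mact ?R v n w)" if "w \<in> mcar ?R" for n w
        using act_linv[OF mW submodule_mcar, of w n] that by (simp add: restrict_to_act)
      show "clinear_on (mcar ?R) (mact ?R v n)" if "v \<in> vcar V" for n v
        using act_lin[OF mW that, of n] submodule_mcar US
        by (simp add: clinear_on_def restrict_to_act cvs.subspace_add cvs.subspace_scale)
    qed
    show "\<forall>v\<in>vcar V. \<forall>n. \<forall>w\<in>mcar ?R. mact ?R v n w \<in> mcar ?R" by (simp add: restrict_to_act submodule_act)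
    show "\<forall>v\<in>vcar V. \<forall>w\<in>mcar ?R. \<exists>N. \<forall>n\<ge>N. mact ?R v n w = 0"
      using act_trunc[OF mW] submodule_mcar by (simp add: restrict_to_act)
    show "\<forall>w\<in>mcar ?R. \<forall>n. mact ?R (vac V) n w = (if n = -1 then w else 0)"
      using act_vac[OF mW] submodule_mcar by (simp add: restrict_to_act)
    show "jacobi V (adj V) ?R ?R (mact ?R)"
      unfolding jacobi_def
    proof (intro ballI allI, goal_cases)
      case (1 u v w l m n)
      have v: "v \<in> vcar V" and w: "w \<in> U" using 1 by simp_all
      show ?case
        unfolding restrict_to_act[OF w] restrict_to_act[OF submodule_act[OF 1(1) w]] restrict_to_act[OF submodule_act[OF v w]]
        using act_jac[OF mW] 1(1,2) submodule_mcar[OF w] unfolding jacobi_def by blast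
    qed
    show "\<forall>v\<in>vcar V. \<forall>n. \<forall>w\<in>mcar ?R. mact ?R (Lop V (adj V) (-1) v) n w = - (of_int n *\<^sub>C mact ?R v (n - 1) w)"
      using act_deriv[OF mW] submodule_mcar by (simp add: restrict_to_act)
    show "\<forall>v n w. v \<notin> vcar V \<or> w \<notin> mcar ?R \<longrightarrow> mact ?R v n w = 0"
      using act_out[OF mW] by (auto simp: restrict_to_def)
  qed
  moreover have "cvs.span (\<Union>n. wspace V ?R n) = mcar ?R"
  proof
    show "cvs.span (\<Union>n. wspace V ?R n) \<subseteq> mcar ?R"
      by (rule cvs.span_minimal) (auto simp: restrict_to_wspace US)
    show "mcar ?R \<subseteq> cvs.span (\<Union>n. wspace V ?R n)"
    proof
      fix w assume "w \<in> mcar ?R"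
      then have w: "w \<in> U" by simp
      have "Sum_any (\<lambda>n. wproj V W n w) \<in> cvs.span (\<Union>n. wspace V ?R n)"
        using submodule_wproj[OF mW U w] wproj_in[OF submodule_mcar[OF w]]
        by (intro subspace_Sum_any[OF cvs.subspace_span] cvs.span_base) (auto simp: restrict_to_wspace)
      then show "w \<in> cvs.span (\<Union>n. wspace V ?R n)" using wproj_Sum_any[OF submodule_mcar[OF w]] by simp
    qed
  qed
  moreover have "\<forall>n. finite_dimensional (wspace V ?R n)"
  proof
    fix n
    obtain B where "finite B" "wspace V W n \<subseteq> cvs.span B"
      using mW unfolding is_module_def finite_dimensional_def by blast
    then show "finite_dimensional (wspace V ?R n)" unfolding finite_dimensional_def restrict_to_wspace
      by (intro exI[of _ B]) auto
  qed
  moreover have "\<exists>N::real. \<forall>n. Re n < N \<longrightarrow> wspace V ?R n = {0}"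
  proof -
    obtain N :: real where "\<And>n. Re n < N \<Longrightarrow> wspace V W n = {0}" using weights_bounded_below[OF mW] by blast
    then show ?thesis using cvs.subspace_0[OF US] by (intro exI[of _ N]) (auto simp: restrict_to_wspace)
  qed
  ultimately show ?thesis by (simp add: is_module_def)
qed

lemma restrict_to_irreducible:
  assumes "irreducible_module V (W\<lparr>mcar := U\<rparr>)"
  shows "irreducible_module V (restrict_to W U)"
proof -
  have "submodule V (W\<lparr>mcar := U\<rparr>) U'" if "submodule V (restrict_to W U) U'" for U'
    unfolding submodule_def
  proof (intro conjI ballI allI)
    show "cvs.subspace U'" "U' \<subseteq> mcar (W\<lparr>mcar := U\<rparr>)" using that by (auto simp: submodule_def)
    fix v n w assume v: "v \<in> vcar V" and w: "w \<in> U'"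
    then have "mact (restrict_to W U) v n w \<in> U'" "w \<in> U" using that by (auto simp: submodule_def)
    then show "mact (W\<lparr>mcar := U\<rparr>) v n w \<in> U'" by (simp add: restrict_to_def)
  qed
  then show ?thesis using assms by (simp add: irreducible_module_def)
qed

end

end

context vtc
begin

text \<open>A vector of weight \<open>0\<close> in an irreducible summand makes the summand isomorphic to \<open>V\<close>. The inverse isomorphism is a
  module map from \<open>V\<close>, hence a multiple of \<open>\<iota>\<close>, and the vector is the image of a multiple of the vacuum.\<close>

lemma weight_zero_spanned_by_unit:
  assumes mA: "is_module V A" and cr: "completely_reducible V A"
    and irr: "\<And>W. is_module V W \<Longrightarrow> irreducible_module V W \<Longrightarrow> wspace V W 0 \<noteq> {0} \<Longrightarrow> Iso V W (adj V) \<noteq> {}"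
    and dV: "cvs.dim (wspace V (adj V) 0) = 1" and v0: "vac V \<noteq> 0"
    and \<iota>: "\<iota> \<in> Hom V (adj V) A" and \<iota>0: "\<iota> \<noteq> 0" and hap: "cvs.dim (Hom V (adj V) A) = 1"
  shows "wspace V A 0 \<subseteq> cvs.span {\<iota> (vac V)}"
proof -
  let ?L = "cvs.span {\<iota> (vac V)}"
  interpret graded_space V A by (rule gs[OF mA])
  obtain S where S: "\<And>U. U \<in> S \<Longrightarrow> submodule V A U" "\<And>U. U \<in> S \<Longrightarrow> irreducible_module V (A\<lparr>mcar := U\<rparr>)"
    and spanS: "cvs.span (\<Union>S) = mcar A"
    using cr unfolding completely_reducible_def by blast
  have comp: "x \<in> ?L" if US: "U \<in> S" and x: "x \<in> U" "x \<in> wspace V A 0" for U x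
  proof (cases "x = 0")
    case True
    then show ?thesis by (simp add: cvs.span_zero)
  next
    case False
    let ?R = "restrict_to A U"
    note mR = restrict_to_module[OF mA S(1)[OF US]] and car = restrict_to_car
    have "wspace V ?R 0 \<noteq> {0}" using restrict_to_wspace[OF mA S(1)[OF US], of 0] x False by auto
    then obtain g where g: "g \<in> Hom V ?R (adj V)" "bij_betw g U (vcar V)"
      using irr[OF mR restrict_to_irreducible[OF mA S(1)[OF US] S(2)[OF US]]] by (auto simp: Iso_def)
    define h where "h v = (if v \<in> vcar V then inv_into U g v else 0)" for v
    have hU: "h v \<in> U" and gh: "g (h v) = v" if "v \<in> vcar V" for v
      using that g(2) by (auto simp: h_def bij_betw_def inv_into_into f_inv_into_f)
    have hg: "h (g u) = u" if "u \<in> U" for u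
      using that g(2) by (auto simp: h_def bij_betw_def)
    have UA: "U \<subseteq> mcar A" and USub: "cvs.subspace U" and Uact: "\<And>v n w. v \<in> vcar V \<Longrightarrow> w \<in> U \<Longrightarrow> mact A v n w \<in> U"
      using S(1)[OF US] by (auto simp: submodule_def)
    have gl: "clinear_on U g" using Hom_lin[OF g(1)] by simp
    have "h \<in> Hom V (adj V) A"
      unfolding Hom_def
    proof (intro CollectI conjI)
      have "h (v + v') = h v + h v'" if "v \<in> vcar V" "v' \<in> vcar V" for v v'
      proof -
        have "v + v' = g (h v + h v')" using clinear_on_add[OF gl hU hU] that gh by simp
        then show ?thesis using hg cvs.subspace_add[OF USub hU hU] that by simp
      qed
      moreover have "h (k *\<^sub>C v) = k *\<^sub>C h v" if "v \<in> vcar V" for k v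
      proof -
        have "k *\<^sub>C v = g (k *\<^sub>C h v)" using clinear_on_scale[OF gl hU] that gh by simp
        then show ?thesis using hg cvs.subspace_scale[OF USub hU] that by simp
      qed
      ultimately show "clinear_on (mcar (adj V)) h" by (simp add: clinear_on_def)
      show "h ` mcar (adj V) \<subseteq> mcar A" using hU UA by auto
      show "\<forall>v\<in>vcar V. \<forall>n. \<forall>w\<in>mcar (adj V). h (mact (adj V) v n w) = mact A v n (h w)"
      proof (intro ballI allI)
        fix v n w assume v: "v \<in> vcar V" and "w \<in> mcar (adj V)"
        then have w: "w \<in> vcar V" by simp
        have "g (mact ?R v n (h w)) = mact (adj V) v n (g (h w))"
          using Hom_act[OF g(1) v, of "h w" n] hU[OF w] by simp
        then have "mact (adj V) v n w = g (mact A v n (h w))"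
          using gh[OF w] restrict_to_act[OF mA S(1)[OF US] hU[OF w]] by simp
        then show "h (mact (adj V) v n w) = mact A v n (h w)" using hg Uact[OF v hU[OF w]] by simp
      qed
      show "\<forall>w. w \<notin> mcar (adj V) \<longrightarrow> h w = 0" by (simp add: h_def)
    qed
    then obtain c where c: "h = c *\<^sub>C \<iota>"
      using dim_one_span[OF hap \<iota> \<iota>0] by (auto simp: cvs.span_singleton)
    have "g x \<in> wspace V (adj V) 0"
      by (rule Hom_wspace[OF g(1)]) (use restrict_to_wspace[OF mA S(1)[OF US], of 0] x in simp)
    then obtain k where k: "g x = k *\<^sub>C vac V"
      using dim_one_span[OF dV vac_weight v0] by (auto simp: cvs.span_singleton)
    have "x = c *\<^sub>C \<iota> (k *\<^sub>C vac V)" using hg[OF x(1)] unfolding k c scaleC_fun_def by simp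
    also have "\<iota> (k *\<^sub>C vac V) = k *\<^sub>C \<iota> (vac V)"
      using clinear_on_scale[OF Hom_lin[OF \<iota>], of "vac V"] vac_in by simp
    finally have "x = (c * k) *\<^sub>C \<iota> (vac V)" by simp
    then show ?thesis unfolding cvs.span_singleton by (rule range_eqI)
  qed
  let ?T = "{x \<in> mcar A. wproj V A 0 x \<in> ?L}"
  have "\<Union>S \<subseteq> ?T"
  proof
    fix x assume "x \<in> \<Union>S"
    then obtain U where U: "U \<in> S" "x \<in> U" by blast
    have xm: "x \<in> mcar A" using U S(1)[OF U(1)] by (auto simp: submodule_def)
    have "wproj V A 0 x \<in> ?L"
      by (rule comp[OF U(1) submodule_wproj[OF mA S(1)[OF U(1)] U(2)] wproj_in[OF xm]])
    then show "x \<in> ?T" using xm by simp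
  qed
  moreover have "cvs.subspace ?T"
  proof (rule cvs.subspaceI)
    show "0 \<in> ?T" by (simp add: cvs.span_zero cvs.subspace_0[OF sub])
    show "x + w \<in> ?T" if "x \<in> ?T" "w \<in> ?T" for x w
      using that clinear_on_add[OF wproj_linear, of x w 0] cvs.subspace_add[OF sub] by (simp add: cvs.span_add)
    show "c *\<^sub>C x \<in> ?T" if "x \<in> ?T" for c x
      using that clinear_on_scale[OF wproj_linear, of x 0 c] cvs.subspace_scale[OF sub] by (simp add: cvs.span_scale)
  qed
  ultimately have "cvs.span (\<Union>S) \<subseteq> ?T" by (rule cvs.span_minimal)
  then have proj: "wproj V A 0 x \<in> ?L" if "x \<in> mcar A" for x
    using that unfolding spanS by auto
  show ?thesis
  proof
    fix x assume x: "x \<in> wspace V A 0"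
    then show "x \<in> ?L" using proj[OF wspace_mcar[OF x]] wproj_hom[OF x, of 0] by simp
  qed
qed

end

section \<open>Algebras give extensions\<close>

context mode_algebra
begin

text \<open>Trilinear in the vectors, so its vanishing can be tested on homogeneous ones.\<close>

definition jacobi_defect :: "'u \<Rightarrow> 'u \<Rightarrow> 'u \<Rightarrow> int \<Rightarrow> int \<Rightarrow> int \<Rightarrow> 'u" where
  "jacobi_defect u v w l m n =
     binomial_sum m (\<lambda>i. y (y u (l + int i) v) (m + n - int i) w)
      - (alternating_sum l (\<lambda>i. y u (m + l - int i) (y v (n + int i) w))
      - signed_sum l (\<lambda>i. y v (n + l - int i) (y u (m + int i) w)))"

lemma jacobi_at_defect: "jacobi_at u v w l m n \<longleftrightarrow> jacobi_defect u v w l m n = 0"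
  by (simp add: jacobi_at_def jacobi_defect_def)

lemma jacobi_finite:
  assumes "u \<in> mcar A" "v \<in> mcar A" "w \<in> mcar A"
  shows "finite {i::nat. c i *\<^sub>C y (y u (l + int i) v) (m + n - int i) w \<noteq> 0}"
    and "finite {i::nat. c i *\<^sub>C y u (m + l - int i) (y v (n + int i) w) \<noteq> 0}"
    and "finite {i::nat. c i *\<^sub>C y v (n + l - int i) (y u (m + int i) w) \<noteq> 0}"
proof -
  obtain N :: nat where "\<And>i. i \<ge> N \<Longrightarrow> y (y u (l + int i) v) (m + n - int i) w = 0" using jacobi_terms(1)[OF assms] by blast
  then show "finite {i::nat. c i *\<^sub>C y (y u (l + int i) v) (m + n - int i) w \<noteq> 0}" by (intro finite_nat_support[of N]) simp
  obtain N :: nat where "\<And>i. i \<ge> N \<Longrightarrow> y u (m + l - int i) (y v (n + int i) w) = 0" using jacobi_terms(2)[OF assms] by blast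
  then show "finite {i::nat. c i *\<^sub>C y u (m + l - int i) (y v (n + int i) w) \<noteq> 0}" by (intro finite_nat_support[of N]) simp
  obtain N :: nat where "\<And>i. i \<ge> N \<Longrightarrow> y v (n + l - int i) (y u (m + int i) w) = 0" using jacobi_terms(3)[OF assms] by blast
  then show "finite {i::nat. c i *\<^sub>C y v (n + l - int i) (y u (m + int i) w) \<noteq> 0}" by (intro finite_nat_support[of N]) simp
qed

lemma y_compose:
  assumes "u \<in> mcar A" "v \<in> mcar A"
  shows "clinear_on (mcar A) (\<lambda>x. y (y x j v) k u)" "clinear_on (mcar A) (\<lambda>x. y (y v j x) k u)"
    and "clinear_on (mcar A) (\<lambda>x. y u k (y x j v))" "clinear_on (mcar A) (\<lambda>x. y u k (y v j x))"
  by (rule clinear_on_compose[OF y_lin1[OF assms(2)] y_lin1[OF assms(1)]] clinear_on_compose[OF y_lin2[OF assms(2)] y_lin1[OF assms(1)]]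
      clinear_on_compose[OF y_lin1[OF assms(2)] y_lin2[OF assms(1)]] clinear_on_compose[OF y_lin2[OF assms(2)] y_lin2[OF assms(1)]],
      use assms y_closed in blast)+

lemma jacobi_defect_linear:
  shows "v \<in> mcar A \<Longrightarrow> w \<in> mcar A \<Longrightarrow> clinear_on (mcar A) (\<lambda>u. jacobi_defect u v w l m n)"
    and "u \<in> mcar A \<Longrightarrow> w \<in> mcar A \<Longrightarrow> clinear_on (mcar A) (\<lambda>v. jacobi_defect u v w l m n)"
    and "u \<in> mcar A \<Longrightarrow> v \<in> mcar A \<Longrightarrow> clinear_on (mcar A) (\<lambda>w. jacobi_defect u v w l m n)"
  unfolding jacobi_defect_def
  by (intro clinear_on_diff_fun clinear_on_Sum_any_fun[OF sub] clinear_on_scaleC jacobi_finite y_compose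
      clinear_on_compose[OF y_lin1 y_lin1] y_lin1 y_lin2 y_closed; assumption)+

lemma jacobi_at_of_homogeneous:
  assumes hom: "\<And>a b c u v w. u \<in> W a \<Longrightarrow> v \<in> W b \<Longrightarrow> w \<in> W c \<Longrightarrow> jacobi_at u v w l m n"
    and uvw: "u \<in> mcar A" "v \<in> mcar A" "w \<in> mcar A"
  shows "jacobi_at u v w l m n"
  unfolding jacobi_at_defect
proof -
  let ?J = "\<lambda>u v w. jacobi_defect u v w l m n"
  have hw: "?J u v w = 0" if u: "u \<in> W a" and v: "v \<in> W b" and w: "w \<in> mcar A" for u v w a b
    using w
  proof (induction rule: homogeneous_int_induct)
    case (hom k x)
    then show ?case using assms(1)[OF u v] by (simp add: jacobi_at_defect)
  next
    case (add x y)
    then show ?case using clinear_on_add[OF jacobi_defect_linear(3)[OF W_mcar[OF u] W_mcar[OF v]]] by simp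
  qed
  have hv: "?J u v w = 0" if u: "u \<in> W a" and v: "v \<in> mcar A" and w: "w \<in> mcar A" for u v w a
    using v
  proof (induction rule: homogeneous_int_induct)
    case (hom k x)
    show ?case by (rule hw[OF u hom w])
  next
    case (add x y)
    then show ?case using clinear_on_add[OF jacobi_defect_linear(2)[OF W_mcar[OF u] w]] by simp
  qed
  show "?J u v w = 0"
    using uvw(1)
  proof (induction rule: homogeneous_int_induct)
    case (hom k x)
    show ?case by (rule hv[OF hom uvw(2,3)])
  next
    case (add x y)
    then show ?case using clinear_on_add[OF jacobi_defect_linear(1)[OF uvw(2,3)]] by simp
  qed
qed

end

locale module_algebra = vtc V D for V :: "'u::complex_vector voa" and D +
  fixes z1 z2 :: real and X :: "'u C_alg"
  assumes z: "z1 > z2" "z2 > z1 - z2" "z1 - z2 > 0"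
    and algebra: "C_algebra V D z1 z2 X"
    and twist_free: "w \<in> mcar (aobj X) \<Longrightarrow> twist V (aobj X) w = w"
begin

abbreviation A :: "'u vmod" where "A \<equiv> aobj X"
abbreviation \<mu> :: "'u \<Rightarrow> 'u" where "\<mu> \<equiv> amult X"
abbreviation \<iota> :: "'u \<Rightarrow> 'u" where "\<iota> \<equiv> aunit X"

lemma A_module: "is_module V A" and \<mu>_Hom: "\<mu> \<in> Hom V (tprod D 1 A A) A"
  and \<iota>_Hom: "\<iota> \<in> Hom V (adj V) A" and \<iota>_inj: "inj_on \<iota> (vcar V)"
  and associative: "\<forall>x\<in>mcar (tprod D 1 A (tprod D 1 A A)).
         \<mu> (tmap V D 1 (tprod D 1 A A) A A A \<mu> (idm A) (assoc_iso V D z1 z2 A A A x))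
         = \<mu> (tmap V D 1 A (tprod D 1 A A) A A (idm A) \<mu> x)"
  and commutative: "x \<in> mcar (tprod D 1 A A) \<Longrightarrow> \<mu> (braiding V D A A x) = \<mu> x"
  and unital: "a \<in> mcar A \<Longrightarrow> \<mu> (tmap V D 1 (adj V) A A A \<iota> (idm A)
              (inv_into (mcar (tprod D 1 (adj V) A)) (left_unit V D A) a)) = a"
  using algebra by (auto simp: C_algebra_def Let_def)

lemmas AA = A_module A_module and AAA = A_module A_module A_module
lemmas AA_mod = tprod_module[OF one_neq_zero AA] and AA_it = tY_it[OF one_neq_zero AA]

text \<open>The twist acts on weight \<open>n\<close> by \<open>e^(2 \<pi> \<i> n)\<close>.\<close>

lemma weights_integral:
  assumes "wspace V A n \<noteq> {0}"
  shows "n \<in> \<int>"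
proof -
  interpret graded_space V A by (rule gs[OF A_module])
  obtain x where x: "x \<in> wspace V A n" "x \<noteq> 0" using assms zero_wspace[of n] by blast
  have "twist V A x = exp (2 * pi * \<i> * n) *\<^sub>C x"
    unfolding twist_def by (subst Sum_any_single[of n]) (simp_all add: wproj_hom[OF x(1)])
  then have "exp (2 * pi * \<i> * n) *\<^sub>C x = 1 *\<^sub>C x" using twist_free[OF wspace_mcar[OF x(1)]] by simp
  then have "exp (2 * pi * \<i> * n) = 1" using x(2) by (simp only: cvs.scale_right_imp_eq)
  then obtain k :: int where "Re (2 * pi * \<i> * n) = 0" "Im (2 * pi * \<i> * n) = of_int (2 * k) * pi"
    unfolding exp_eq_1 by blast
  then have "n = of_int k" by (simp add: complex_eq_iff)
  then show ?thesis by simp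
qed

text \<open>The integral modes of the operator represented by \<open>\<mu>\<close>; \<open>idm\<close> makes them vanish outside the carrier.\<close>

definition y :: "'u \<Rightarrow> int \<Rightarrow> 'u \<Rightarrow> 'u" where
  "y u k v = \<mu> (tY 1 A A (idm A u) (of_int k) (idm A v))"

lemma \<mu>_intertwining: "intertwining_operator V A A A (\<lambda>u n v. \<mu> (tY 1 A A u n v))"
  by (rule intertwining_compose[OF \<mu>_Hom AA AA_mod A_module
        AA_it])

lemma idm_mem: "idm A u \<in> mcar A" using mod_0[OF A_module] by (simp add: idm_def)

lemma non_integral_mode:
  assumes "u \<in> mcar A" "v \<in> mcar A" "n \<notin> \<int>"
  shows "\<mu> (tY 1 A A u n v) = 0"
proof (rule bilinear_eqI[OF AA _ _ _ assms(1,2), where g = "\<lambda>u v. 0" and f = "\<lambda>u v. \<mu> (tY 1 A A u n v)"])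
  note it = AAA \<mu>_intertwining
  show "cbilinear_on (mcar A) (mcar A) (\<lambda>u v. \<mu> (tY 1 A A u n v))"
    by (rule cbilinear_onI[OF it_lin1[OF it] it_lin2[OF it]])
  show "cbilinear_on (mcar A) (mcar A) (\<lambda>u v. 0 :: 'u)" by (simp add: cbilinear_on_def clinear_on_def)
  fix a b u v assume u: "u \<in> wspace V A a" and v: "v \<in> wspace V A b"
  interpret graded_space V A by (rule gs[OF A_module])
  show "\<mu> (tY 1 A A u n v) = 0"
  proof (cases "u = 0 \<or> v = 0")
    case True
    then show ?thesis
      using it_01[OF it wspace_mcar[OF v], of n] it_02[OF it wspace_mcar[OF u], of n] by auto
  next
    case False
    then have ab: "a \<in> \<int>" "b \<in> \<int>" using u v by (auto intro: weights_integral)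
    have "a + b - n - 1 \<notin> \<int>"
    proof
      assume "a + b - n - 1 \<in> \<int>"
      then have "(a + b - 1) - (a + b - n - 1) \<in> \<int>" using ab by (intro Ints_diff Ints_add) auto
      then show False using assms(3) by simp
    qed
    then have "wspace V A (a + b - n - 1) = {0}" using weights_integral by blast
    then show ?thesis using it_weight[OF it u v, of n] by simp
  qed
qed

lemma cmodes_y: "cmodes y = (\<lambda>u n v. \<mu> (tY 1 A A (idm A u) n (idm A v)))"
proof (intro ext)
  fix u n v
  show "cmodes y u n v = \<mu> (tY 1 A A (idm A u) n (idm A v))"
  proof (cases "n \<in> \<int>")
    case True
    then obtain k where "n = of_int k" by (auto elim: Ints_cases)
    then show ?thesis by (simp add: y_def)
  next
    case False
    then show ?thesis using non_integral_mode[OF idm_mem idm_mem False] by (simp add: cmodes_not_int)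
  qed
qed

lemma y_intertwining: "intertwining_operator V A A A (cmodes y)"
  unfolding cmodes_y by (rule intertwining_precompose[OF idm_Hom[OF A_module] idm_Hom[OF A_module] \<mu>_intertwining])

sublocale M: mode_algebra V A y
  using A_module y_intertwining weights_integral vtc
  by unfold_locales (auto simp: vertex_tensor_category_def)

lemma \<mu>_eta: "\<mu> = eta 1 A A A (cmodes y)"
proof (rule eta_unique[OF one_neq_zero AAA y_intertwining \<mu>_Hom])
  fix u v assume u: "u \<in> mcar A" and v: "v \<in> mcar A"
  have "cext \<mu> (telem D 1 A A u v) = subst_at V A (\<lambda>u n v. \<mu> (tY 1 A A u n v)) (logz 1) u v"
    unfolding telem_tY[OF one_neq_zero AA u v]
    by (rule subst_at_cext[OF \<mu>_Hom AA AA_mod A_module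
          AA_it u v])
  also have "\<dots> = subst_at V A (cmodes y) (logz 1) u v"
    by (rule subst_at_cong) (simp add: cmodes_y u v)
  finally show "cext \<mu> (telem D 1 A A u v) = subst_at V A (cmodes y) (logz 1) u v" .
qed

text \<open>Commutativity and \<open>eta_braiding\<close>: the operator and its opposite are represented by the same map.\<close>

lemma y_skew:
  assumes u: "u \<in> mcar A" and v: "v \<in> mcar A"
  shows "cmodes y u n v = skew_op V A (cmodes y) u n v"
proof (rule intertwining_determined[OF AAA y_intertwining
      skew_op_intertwining[OF AAA y_intertwining] _ u v])
  fix u v assume u: "u \<in> mcar A" and v: "v \<in> mcar A"
  have "cext \<mu> (telem D 1 A A u v) = cext (eta 1 A A A (skew_op V A (cmodes y))) (telem D 1 A A u v)"
  proof
    fix n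
    have "eta 1 A A A (skew_op V A (cmodes y)) x = \<mu> (braiding V D A A x)" for x
      using fun_cong[OF eta_braiding[OF AAA y_intertwining], of x] by (simp add: \<mu>_eta)
    then show "cext \<mu> (telem D 1 A A u v) n = cext (eta 1 A A A (skew_op V A (cmodes y))) (telem D 1 A A u v) n"
      using commutative[OF telem_in[OF one_neq_zero AA u v]] by (simp add: cext_def)
  qed
  then show "subst_at V A (cmodes y) (logz 1) u v = subst_at V A (skew_op V A (cmodes y)) (logz 1) u v"
    using eta_telem[OF one_neq_zero AAA y_intertwining u v]
      eta_telem[OF one_neq_zero AAA skew_op_intertwining[OF AAA y_intertwining] u v]
    by (simp add: \<mu>_eta)
qed

lemma \<iota>_mem: "v \<in> vcar V \<Longrightarrow> \<iota> v \<in> mcar A" using Hom_closed[OF \<iota>_Hom] by simp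

lemma y_unit_left:
  assumes a: "a \<in> mcar A"
  shows "y (\<iota> (vac V)) (-1) a = a"
proof -
  have "cmodes y (\<iota> (vac V)) (-1) a = a"
    using unital[OF a] unit_axiom[OF A_module y_intertwining \<iota>_Hom a] unfolding \<mu>_eta by simp
  moreover have "(-1 :: complex) = of_int (-1)" by simp
  ultimately show ?thesis by (simp only: cmodes_of_int)
qed

text \<open>Both sides are intertwining operators out of \<open>V\<close> whose vacuum mode \<open>1_(-1)\<close> is the identity, on the left by the unit
  axiom.\<close>

lemma y_\<iota>:
  assumes v: "v \<in> vcar V" and a: "a \<in> mcar A"
  shows "y (\<iota> v) k a = mact A v k a"
proof -
  let ?Y = "\<lambda>v n a. cmodes y (\<iota> v) n (idm A a)"
  have it: "intertwining_operator V (adj V) A A ?Y"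
    by (rule intertwining_precompose[OF \<iota>_Hom idm_Hom[OF A_module] y_intertwining])
  have "?Y (vac V) (-1) a = a"
  proof -
    have "(-1 :: complex) = of_int (-1)" by simp
    then show ?thesis using y_unit_left[OF a] a by (simp only: cmodes_of_int idm_in)
  qed
  then have "?Y v (of_int k) a = cmodes (mact A) v (of_int k) a"
    using unit_intertwiner[OF AA it v a] by (simp only:)
  then show ?thesis using a by (simp only: cmodes_of_int idm_in)
qed

abbreviation one :: 'u where "one \<equiv> \<iota> (vac V)"

lemma one_mem: "one \<in> mcar A" by (rule \<iota>_mem[OF vac_in])

lemma y_one: "a \<in> mcar A \<Longrightarrow> y one k a = (if k = -1 then a else 0)"
  using y_\<iota>[OF vac_in] act_vac[OF A_module] by simp

text \<open>Skew-symmetry reduces multiplication by the unit from the right to multiplication from the left.\<close>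

lemma y_creation:
  assumes a: "a \<in> mcar A"
  shows "y a j one = (if j < 0 then dexp V A 1 (nat (- j - 1)) a else 0)"
proof -
  have m: "y a j one = - ((-1) powi j *\<^sub>C Sum_any (\<lambda>i::nat. dexp V A (-1) i (y one (j + int i) a)))"
    using y_skew[OF a one_mem, of "of_int j"] unfolding skew_op_cmodes cmodes_of_int .
  have z0: "dexp V A (-1) i 0 = 0" for i by (rule dexp_zero[OF A_module])
  show ?thesis
  proof (cases "j < 0")
    case True
    define r where "r = nat (- j - 1)"
    have j: "j = - int r - 1" using True by (simp add: r_def)
    have "Sum_any (\<lambda>i::nat. dexp V A (-1) i (y one (j + int i) a)) = dexp V A (-1) r (y one (j + int r) a)"
      by (rule Sum_any_single) (simp add: y_one[OF a] z0 j)
    also have "\<dots> = dexp V A (-1) r a" by (simp add: y_one[OF a] j)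
    finally have "y a j one = (- ((-1) powi j) * (-1) ^ r) *\<^sub>C dexp V A 1 r a"
      unfolding m by (simp add: dexp_def)
    moreover have "- ((-1 :: complex) powi j) * (-1) ^ r = 1"
    proof -
      have "(-1 :: complex) powi (- int r - 1) = (-1) powi (- int r) * (-1) powi (- 1)"
        using power_int_add[of "-1 :: complex" "- int r" "- 1"] by simp
      then show ?thesis unfolding j by (simp add: power_int_minus flip: power_mult_distrib)
    qed
    ultimately have "y a j one = dexp V A 1 r a" by (simp only: cvs.scale_one)
    then show ?thesis using True by (simp add: r_def)
  next
    case False
    then have "y one (j + int i) a = 0" for i using y_one[OF a, of "j + int i"] by simp
    then show ?thesis unfolding m using False by (simp add: z0)
  qed
qed

sublocale M: associative_mode_algebra V A y one z1 z2
proof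
  show "z1 > z2" "z2 > z1 - z2" "z1 - z2 > 0" by (rule z)+
  show "one \<in> M.W 0" using Hom_wspace[OF \<iota>_Hom vac_weight] by simp
  show "y w (- int r - 1) one = dexp V A 1 r w" if "w \<in> mcar A" for w r
    using y_creation[OF that, of "- int r - 1"] by simp
  show "cmodes y u n v = skew_op V A (cmodes y) u n v" if "u \<in> mcar A" "v \<in> mcar A" for u v n by (rule y_skew[OF that])
  show "\<exists>f. has_weak_sum V A (\<lambda>n. M.I (complex_of_real z1) u (M.I (complex_of_real z2) v w n)) UNIV f \<and>
          has_weak_sum V A (\<lambda>n. M.I (complex_of_real z2) (M.I (complex_of_real z1 - complex_of_real z2) u v n) w) UNIV f"
    if "u \<in> mcar A" "v \<in> mcar A" "w \<in> mcar A" for u v w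
    using associativity_axiom_iff[OF A_module y_intertwining z] associative that unfolding \<mu>_eta by blast
qed

lemma y_jacobi: "u \<in> mcar A \<Longrightarrow> v \<in> mcar A \<Longrightarrow> w \<in> mcar A \<Longrightarrow> M.jacobi_at u v w l m n"
  by (rule M.jacobi_at_of_homogeneous[OF M.jacobi_homogeneous])

definition E :: "'u voa" where
  "E = \<lparr>vcar = mcar A, vY = y, vac = one, omega = \<iota> (omega V)\<rparr>"

lemma E_sel [simp]: "vcar E = mcar A" "vY E = y" "vac E = one" "omega E = \<iota> (omega V)"
  by (simp_all add: E_def)

lemma E_adj [simp]: "mcar (adj E) = mcar A" "mact (adj E) = y"
  by (simp_all add: adj_def)

lemma E_Lop: "w \<in> mcar A \<Longrightarrow> Lop E (adj E) n w = Lop V A n w"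
  by (simp add: Lop_def y_\<iota> omega_in)

lemma E_wspace: "wspace E (adj E) n = wspace V A n"
  by (auto simp: wspace_def E_Lop)

lemma y_outside: "u \<notin> mcar A \<or> v \<notin> mcar A \<Longrightarrow> y u k v = 0"
  using it_01[OF AAA \<mu>_intertwining idm_mem, of "of_int k" v]
    it_02[OF AAA \<mu>_intertwining idm_mem, of u "of_int k"]
  unfolding y_def by (auto simp: idm_def)

theorem E_voa: "is_voa E"
  unfolding is_voa_def
proof (intro conjI)
  let ?U = "\<Union>n::int. wspace E (adj E) (of_int n)"
  show "vac E \<in> vcar E" "omega E \<in> vcar E" by (simp_all add: \<iota>_mem vac_in omega_in)
  show "vertex_action E (adj E)"
    unfolding vertex_action_def E_adj E_sel
  proof (intro conjI)
    show "cvs.subspace (mcar A)" by (rule M.sub)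
    show "\<forall>n. cbilinear_on (mcar A) (mcar A) (\<lambda>v w. y v n w)"
      by (intro allI cbilinear_onI M.y_lin1 M.y_lin2)
    show "\<forall>v\<in>mcar A. \<forall>n. \<forall>w\<in>mcar A. y v n w \<in> mcar A" by (simp add: M.y_closed)
    show "\<forall>v\<in>mcar A. \<forall>w\<in>mcar A. \<exists>N. \<forall>n\<ge>N. y v n w = 0" by (simp add: M.y_trunc)
    show "\<forall>w\<in>mcar A. \<forall>n. y one n w = (if n = -1 then w else 0)" by (simp add: y_one)
    show "jacobi E (adj E) (adj E) (adj E) y"
      unfolding jacobi_def E_adj E_sel
    proof (intro ballI allI, goal_cases)
      case (1 u v w l m n)
      then show ?case using y_jacobi[of u v w l m n] by (simp add: M.jacobi_at_def)
    qed
    show "\<forall>v\<in>mcar A. \<forall>n. \<forall>w\<in>mcar A. y (Lop E (adj E) (-1) v) n w = - (of_int n *\<^sub>C y v (n - 1) w)"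
      by (simp add: E_Lop M.y_D_left)
    show "\<forall>v n w. v \<notin> mcar A \<or> w \<notin> mcar A \<longrightarrow> y v n w = 0" using y_outside by blast
  qed
  show "\<forall>v\<in>vcar E. vY E v (-1) (vac E) = v \<and> (\<forall>n\<ge>0. vY E v n (vac E) = 0)"
    by (simp add: y_creation dexp_def)
  obtain c where c: "\<And>W. is_module V W \<Longrightarrow> virasoro V W c" using virasoro_module by blast
  show "\<exists>c::complex. \<forall>m n. \<forall>v\<in>vcar E.
        Lop E (adj E) m (Lop E (adj E) n v) - Lop E (adj E) n (Lop E (adj E) m v)
        = of_int (m - n) *\<^sub>C Lop E (adj E) (m + n) v
          + (if m + n = 0 then (of_int (m ^ 3 - m) / 12 * c) *\<^sub>C v else 0)"
  proof (intro exI[of _ c] allI ballI, goal_cases)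
    case (1 m n v)
    then have v: "v \<in> mcar A" by simp
    show ?case
      using c[OF A_module] v unfolding virasoro_def E_Lop[OF v] E_Lop[OF Lop_closed[OF A_module v]] by blast
  qed
  show "cvs.span ?U = vcar E"
  proof
    show "cvs.span ?U \<subseteq> vcar E"
      by (rule cvs.span_minimal) (auto simp: E_wspace M.wspace_mcar M.sub)
    have "(\<Union>n. wspace V A n) \<subseteq> cvs.span ?U"
    proof
      fix x assume "x \<in> (\<Union>n. wspace V A n)"
      then obtain n where x: "x \<in> wspace V A n" by blast
      show "x \<in> cvs.span ?U"
      proof (cases "x = 0")
        case False
        then have "n \<in> \<int>" using x by (intro weights_integral) auto
        then show ?thesis using x by (intro cvs.span_base) (auto simp: E_wspace elim: Ints_cases)
      qed (simp add: cvs.span_zero)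
    qed
    then show "vcar E \<subseteq> cvs.span ?U"
      unfolding E_sel M.span[symmetric] by (rule cvs.span_minimal[OF _ cvs.subspace_span])
  qed
  show "\<forall>n::int. finite_dimensional (wspace E (adj E) (of_int n))"
    using A_module unfolding E_wspace is_module_def by blast
  obtain R :: real where R: "\<And>n. Re n < R \<Longrightarrow> wspace V A n = {0}" using weights_bounded_below[OF A_module] by blast
  have "Re (of_int n) < R" if "n < \<lfloor>R\<rfloor>" for n using that by simp linarith
  then show "\<exists>N::int. \<forall>n<N. wspace E (adj E) (of_int n) = {0}"
    unfolding E_wspace using R by (intro exI[of _ "\<lfloor>R\<rfloor>"]) auto
qed

lemma E_extension: "is_extension V E \<iota>"
  unfolding is_extension_def
proof (intro conjI)
  show "is_voa E" by (rule E_voa)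
  show "clinear_on (vcar V) \<iota>" using Hom_lin[OF \<iota>_Hom] by simp
  show "inj_on \<iota> (vcar V)" by (rule \<iota>_inj)
  show "\<iota> ` vcar V \<subseteq> vcar E" using \<iota>_mem by auto
  show "\<forall>v. v \<notin> vcar V \<longrightarrow> \<iota> v = 0" using Hom_out[OF \<iota>_Hom] by simp
  show "\<forall>u\<in>vcar V. \<forall>v\<in>vcar V. \<forall>n. \<iota> (vY V u n v) = vY E (\<iota> u) n (\<iota> v)"
    using Hom_act[OF \<iota>_Hom] by (simp add: y_\<iota> \<iota>_mem)
qed simp_all

lemma algebra_of_E: "algebra_of_extension V D (E, \<iota>) = X"
proof -
  interpret X: voa_extension V D E \<iota> by unfold_locales (rule E_extension)
  have "mact X.M v n w = mact A v n w" for v n w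
  proof (cases "v \<in> vcar V \<and> w \<in> mcar A")
    case True
    then show ?thesis using y_\<iota>[of v w n] by (simp add: restrict_module_def)
  next
    case False
    then show ?thesis using act_out[OF A_module, of v w n] y_outside[of "\<iota> v" w n] by (auto simp: restrict_module_def)
  qed
  then have "mact X.M = mact A" by (intro ext)
  then have M: "X.M = A" by (intro vmod.equality) simp_all
  show ?thesis
    using X.aobj_eq X.aunit_eq X.amult_eq \<mu>_eta unfolding M E_sel by (intro C_alg.equality) simp_all
qed

end

section \<open>The equivalence\<close>

theorem theorem3p2:
  fixes V :: "'u::complex_vector voa" and D :: "'u vertex_tensor" and z1 z2 :: real
  assumes "universe TYPE('u)"
    and "is_voa V"
    and "vertex_tensor_category V D"
    and "z1 > z2" and "z2 > z1 - z2" and "z1 - z2 > 0"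
    and "simple_voa V"
    and "\<And>W. is_module V W \<Longrightarrow> completely_reducible V W"
    and "\<And>W n. is_module V W \<Longrightarrow> irreducible_module V W \<Longrightarrow> wspace V W n \<noteq> {0} \<Longrightarrow>
           n \<in> \<real> \<and> Re n \<ge> 0"
    and "\<And>W. is_module V W \<Longrightarrow> irreducible_module V W \<Longrightarrow>
           wspace V W 0 \<noteq> {0} \<longleftrightarrow> Iso V W (adj V) \<noteq> {}"
    and "cvs.dim (wspace V (adj V) 0) = 1"
  shows "bij_betw (algebra_of_extension V D)
     {(E, i). is_extension V E i \<and> cvs.dim (wspace E (adj E) 0) = 1}
     {X. C_algebra V D z1 z2 X \<and> haploid V X \<and>
         (\<forall>w\<in>mcar (aobj X). twist V (aobj X) w = w)}"
proof -
  interpret vtc V D by unfold_locales (fact assms(2), fact assms(3))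
  note z = assms(4-6)
  have V0: "vcar V \<noteq> {0}" using assms(7) by (simp add: simple_voa_def irreducible_module_def)
  have v0: "vac V \<noteq> 0"
  proof
    assume v: "vac V = 0"
    have "x = 0" if "x \<in> vcar V" for x
      using creation[OF that] act_0[OF adj_module, of x "-1"] unfolding v by simp
    then show False using V0 cvs.subspace_0[OF V_sub] by blast
  qed
  let ?S = "{(E, i). is_extension V E i \<and> cvs.dim (wspace E (adj E) 0) = 1}"
  let ?T = "{X. C_algebra V D z1 z2 X \<and> haploid V X \<and> (\<forall>w\<in>mcar (aobj X). twist V (aobj X) w = w)}"
  have inj: "inj_on (algebra_of_extension V D) ?S"
  proof (rule inj_onI)
    fix x x' assume "x \<in> ?S" "x' \<in> ?S" "algebra_of_extension V D x = algebra_of_extension V D x'"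
    then show "x = x'" using algebra_of_extension_inj[of "fst x" "snd x" "fst x'" "snd x'"] by (cases x; cases x') simp
  qed
  have into: "algebra_of_extension V D x \<in> ?T" if x: "x \<in> ?S" for x
  proof -
    obtain E i where xe: "x = (E, i)" by (cases x)
    interpret X: voa_extension V D E i by unfold_locales (use x xe in simp)
    have "cvs.dim (wspace E (adj E) 0) = 1" using x xe by simp
    from X.haploid_of_extension[OF this v0] X.C_algebra_of_extension[OF z] X.twist_of_extension
    show ?thesis unfolding xe by (simp add: X.aobj_eq)
  qed
  have onto: "X \<in> algebra_of_extension V D ` ?S" if X: "X \<in> ?T" for X
  proof -
    interpret X: module_algebra V D z1 z2 X by unfold_locales (use X z in auto)
    have \<iota>0: "aunit X (vac V) \<noteq> 0"
    proof
      assume "aunit X (vac V) = 0"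
      then have "aunit X (vac V) = aunit X 0" using clinear_on_0[OF Hom_lin[OF X.\<iota>_Hom]] V_sub by simp
      then show False using inj_onD[OF X.\<iota>_inj] vac_in cvs.subspace_0[OF V_sub] v0 by blast
    qed
    then have \<iota>ne: "aunit X \<noteq> 0" by auto
    have hap: "cvs.dim (Hom V (adj V) (aobj X)) = 1" using X by (simp add: haploid_def)
    have irr: "Iso V W (adj V) \<noteq> {}" if "is_module V W" "irreducible_module V W" "wspace V W 0 \<noteq> {0}" for W
      using assms(10)[OF that(1,2)] that(3) by (rule iffD1)
    have "wspace V (aobj X) 0 = cvs.span {aunit X (vac V)}"
    proof
      show "wspace V (aobj X) 0 \<subseteq> cvs.span {aunit X (vac V)}"
        by (rule weight_zero_spanned_by_unit[OF X.A_module assms(8)[OF X.A_module] irr assms(11) v0 X.\<iota>_Hom \<iota>ne hap])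
      have "aunit X (vac V) \<in> wspace V (aobj X) 0" by (rule Hom_wspace[OF X.\<iota>_Hom vac_weight])
      then show "cvs.span {aunit X (vac V)} \<subseteq> wspace V (aobj X) 0"
        using cvs.span_minimal[OF _ X.M.wspace_subspace] by simp
    qed
    then have "cvs.dim (wspace X.E (adj X.E) 0) = 1"
      unfolding X.E_wspace using dim_span_single[OF \<iota>0] by (simp only:)
    then have "(X.E, aunit X) \<in> ?S" using X.E_extension by simp
    then have "algebra_of_extension V D (X.E, aunit X) \<in> algebra_of_extension V D ` ?S" by (rule imageI)
    then show ?thesis unfolding X.algebra_of_E .
  qed
  show ?thesis unfolding bij_betw_def
  proof (intro conjI inj equalityI subsetI)
    fix X assume "X \<in> algebra_of_extension V D ` ?S"
    then show "X \<in> ?T" using into by (elim imageE) (simp only:)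
  next
    fix X assume "X \<in> ?T"
    then show "X \<in> algebra_of_extension V D ` ?S" by (rule onto)
  qed
qed

end
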